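(* Let $X,X_1,X_2,\dots$ be i.i.d. real random variables with common Lebesgue density $f$, and assume $f$ is bounded. Let $\phi$ be a scaling function that is bounded, compactly supported and of finite total variation, $\|\phi\|_v<\infty$. Let $\{j_n\}_{n\ge1}$ be a sequence of integers such that: (i) $j_n\to\infty$ and $2^{-j_n}\asymp n^{-\delta}$ for some $\delta\in(0,1/3)$; (ii) there exists an increasing sequence of positive constants $\{\lambda_k\}_{k\ge1}$ satisfying $\lambda_{k+1}/\lambda_k\to1$, $\log\log\lambda_k/\log k\to1$ and $\lambda_{k+1}-\lambda_k\to\infty$ as $k\to\infty$, such that $2^{-j_n}$ is constant for $n\in[\lambda_k,\lambda_{k+1})$, for every $k\in\mathbb N$. Let $f_{n,K}$ be the linear wavelet density estimator of $f$ based on $X_1,\dots,X_n$, put $$J_n:=\|f_{n,K}-f\|_2^2-\mathbb E\|f_{n,K}-f\|_2^2,\qquad \sigma^2:=2\int_{\mathbb R}f^2(x)\,dx ,\quad \sigma>0.$$ Then, for each of the two choices of sign, $$\limsup_{n\to\infty}\ \pm\frac{n2^{-j_n/2}}{\sigma\sqrt{2\log\log n}}\,J_n=1\quad\text{almost surely.}$$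
   Context: Notation: $a_n\asymp b_n$ means $0<\liminf a_n/b_n<\limsup a_n/b_n<\infty$; $\|\cdot\|_2$ is the $L_2(\mathbb R)$ norm; $\|\phi\|_v$ is the total variation norm of $\phi$. A scaling function $\phi\in L_2(\mathbb R)$ is the (father) scaling function of an orthonormal wavelet multiresolution analysis, with corresponding wavelet function $\psi$: writing $\phi_{0k}(x)=\phi(x-k)$ and $\psi_{jk}(x)=2^{j/2}\psi(2^jx-k)$, the family $\{\phi_{0k},\psi_{jk}: j\ge0,k\in\mathbb Z\}$ is an orthonormal wavelet basis of $L_2(\mathbb R)$. The linear wavelet density estimator is $$f_{n,K}(x)=\sum_k\hat\alpha_{0k}\phi_{0k}(x)+\sum_{j=0}^{j_n-1}\sum_k\hat\beta_{jk}\psi_{jk}(x),\quad \hat\alpha_{0k}=\frac1n\sum_{i=1}^n\phi_{0k}(X_i),\quad \hat\beta_{jk}=\frac1n\sum_{i=1}^n\psi_{jk}(X_i),$$ which, for bounded compactly supported $\phi$, is equivalently written $$f_{n,K}(x)=\frac{2^{j_n}}{n}\sum_{i=1}^nK(2^{j_n}x,2^{j_n}X_i),\qquad K(x,y)=\sum_{k\in\mathbb Z}\phi(x-k)\phi(y-k).$$ *)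

theory Defs
  imports "HOL-Probability.Probability"
begin

section \<open>Real-valued functions in \<open>L\<^sub>2(\<real>)\<close>\<close>

text \<open>
  Elements of \<open>L\<^sub>2(\<real>)\<close> are represented by Borel functions rather than by
  classes modulo almost everywhere equality.
\<close>

definition L2 :: "(real \<Rightarrow> real) set" where
  "L2 = {g. g \<in> borel_measurable lborel \<and> integrable lborel (\<lambda>x. (g x)\<^sup>2)}"

definition L2_inner :: "(real \<Rightarrow> real) \<Rightarrow> (real \<Rightarrow> real) \<Rightarrow> real" where
  "L2_inner g h = (\<integral>x. g x * h x \<partial>lborel)"

definition L2_norm :: "(real \<Rightarrow> real) \<Rightarrow> real" where
  "L2_norm g = sqrt (\<integral>x. (g x)\<^sup>2 \<partial>lborel)"

text \<open>
  The last condition makes the set closed under almost everywhere equality as well.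
\<close>

definition closed_L2_subspace :: "(real \<Rightarrow> real) set \<Rightarrow> bool" where
  "closed_L2_subspace V \<longleftrightarrow>
     V \<subseteq> L2 \<and> (\<lambda>x. 0) \<in> V \<and>
     (\<forall>g\<in>V. \<forall>h\<in>V. \<forall>a b. (\<lambda>x. a * g x + b * h x) \<in> V) \<and>
     (\<forall>g\<in>L2. (\<forall>e>0. \<exists>h\<in>V. L2_norm (\<lambda>x. g x - h x) < e) \<longrightarrow> g \<in> V)"

definition orthonormal_basis_of :: "('i \<Rightarrow> real \<Rightarrow> real) \<Rightarrow> (real \<Rightarrow> real) set \<Rightarrow> bool" where
  "orthonormal_basis_of u V \<longleftrightarrow>
     (\<forall>i. u i \<in> V) \<and>
     (\<forall>i i'. L2_inner (u i) (u i') = (if i = i' then 1 else 0)) \<and>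
     (\<forall>g\<in>V. \<forall>e>0. \<exists>I c. finite I \<and> L2_norm (\<lambda>x. g x - (\<Sum>i\<in>I. c i * u i x)) < e)"

section \<open>Multiresolution analyses and wavelets\<close>

definition dilate :: "(real \<Rightarrow> real) \<Rightarrow> int \<Rightarrow> int \<Rightarrow> real \<Rightarrow> real" where
  "dilate g j k x = 2 powr (real_of_int j / 2) * g (2 powi j * x - real_of_int k)"

definition multiresolution_analysis :: "(int \<Rightarrow> (real \<Rightarrow> real) set) \<Rightarrow> (real \<Rightarrow> real) \<Rightarrow> bool" where
  "multiresolution_analysis V \<phi> \<longleftrightarrow>
     (\<forall>j. closed_L2_subspace (V j)) \<and>
     (\<forall>j. V j \<subseteq> V (j + 1)) \<and>
     (\<forall>g. (\<forall>j. g \<in> V j) \<longrightarrow> (AE x in lborel. g x = 0)) \<and>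
     (\<forall>g\<in>L2. \<forall>e>0. \<exists>j. \<exists>h\<in>V j. L2_norm (\<lambda>x. g x - h x) < e) \<and>
     (\<forall>j g. g \<in> V j \<longleftrightarrow> (\<lambda>x. g (2 * x)) \<in> V (j + 1)) \<and>
     orthonormal_basis_of (\<lambda>k. dilate \<phi> 0 k) (V 0)"

fun wavelet_family ::
  "(real \<Rightarrow> real) \<Rightarrow> (real \<Rightarrow> real) \<Rightarrow> int + nat \<times> int \<Rightarrow> real \<Rightarrow> real" where
  "wavelet_family \<phi> \<psi> (Inl k) = dilate \<phi> 0 k"
| "wavelet_family \<phi> \<psi> (Inr (j, k)) = dilate \<psi> (int j) k"

text \<open>
  Dilating the second condition by a factor of two shows that \<open>V 1\<close> is the orthogonal
  sum of \<open>V 0\<close> and the closed span of the translates of \<open>\<psi>\<close>, so \<open>\<psi>\<close> is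
  a wavelet of the given multiresolution analysis and not of some other one.
\<close>

definition scaling_function_with_wavelet :: "(real \<Rightarrow> real) \<Rightarrow> (real \<Rightarrow> real) \<Rightarrow> bool" where
  "scaling_function_with_wavelet \<phi> \<psi> \<longleftrightarrow>
     (\<exists>V. multiresolution_analysis V \<phi>) \<and> orthonormal_basis_of (wavelet_family \<phi> \<psi>) L2"

definition total_variation :: "(real \<Rightarrow> real) \<Rightarrow> ennreal" where
  "total_variation g =
     (SUP xs\<in>{xs. sorted xs}. \<Sum>i<length xs - 1. ennreal \<bar>g (xs ! Suc i) - g (xs ! i)\<bar>)"

section \<open>The linear wavelet density estimator\<close>

definition empirical_coeff ::
  "(real \<Rightarrow> real) \<Rightarrow> (nat \<Rightarrow> 'a \<Rightarrow> real) \<Rightarrow> nat \<Rightarrow> 'a \<Rightarrow> real" where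
  "empirical_coeff g X n \<omega> = (\<Sum>i=1..n. g (X i \<omega>)) / real n"

text \<open>
  The series over \<open>k\<close> are finite for compactly supported \<open>\<phi>\<close> and \<open>\<psi>\<close>.  For an
  arbitrary \<open>\<psi>\<close> they still converge absolutely for almost all values of
  \<open>x\<close> and of the observations, since the integral over \<open>[0,1]\<close> of
  the sum of the \<open>(\<psi>(y - k))\<^sup>2\<close> is the squared norm of \<open>\<psi>\<close>.
\<close>

definition wavelet_density_estimator ::
  "(real \<Rightarrow> real) \<Rightarrow> (real \<Rightarrow> real) \<Rightarrow> int \<Rightarrow> (nat \<Rightarrow> 'a \<Rightarrow> real) \<Rightarrow> nat \<Rightarrow> 'a \<Rightarrow> real \<Rightarrow> real" where
  "wavelet_density_estimator \<phi> \<psi> J X n \<omega> x =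
     (\<Sum>\<^sub>\<infinity>k. empirical_coeff (dilate \<phi> 0 k) X n \<omega> * dilate \<phi> 0 k x) +
     (\<Sum>j\<in>{0..<J}. \<Sum>\<^sub>\<infinity>k. empirical_coeff (dilate \<psi> j k) X n \<omega> * dilate \<psi> j k x)"

definition integrated_squared_error ::
  "(real \<Rightarrow> real) \<Rightarrow> (real \<Rightarrow> real) \<Rightarrow> (nat \<Rightarrow> int) \<Rightarrow> (nat \<Rightarrow> 'a \<Rightarrow> real) \<Rightarrow> (real \<Rightarrow> real) \<Rightarrow>
   nat \<Rightarrow> 'a \<Rightarrow> real" where
  "integrated_squared_error \<phi> \<psi> j X f n \<omega> =
     (L2_norm (\<lambda>x. wavelet_density_estimator \<phi> \<psi> (j n) X n \<omega> x - f x))\<^sup>2"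

definition centered_ISE ::
  "'a measure \<Rightarrow> (real \<Rightarrow> real) \<Rightarrow> (real \<Rightarrow> real) \<Rightarrow> (nat \<Rightarrow> int) \<Rightarrow> (nat \<Rightarrow> 'a \<Rightarrow> real) \<Rightarrow>
   (real \<Rightarrow> real) \<Rightarrow> nat \<Rightarrow> 'a \<Rightarrow> real" where
  "centered_ISE M \<phi> \<psi> j X f n \<omega> =
     integrated_squared_error \<phi> \<psi> j X f n \<omega> -
     prob_space.expectation M (integrated_squared_error \<phi> \<psi> j X f n)"

section \<open>Sequences of the same order\<close>

text \<open>
  The strict inequality between the lower and the upper limit is part of the convention
  used here; for instance, a sequence is not of the same order as itself.  It costs nothing for
  \<open>2\<^sup>-\<^sup>j\<close> against a power of \<open>n\<close> with \<open>j\<close> an integer sequence tending to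
  infinity: the quotient changes by a factor of about two or more, in one direction
  or the other, infinitely often.
\<close>

definition same_order :: "(nat \<Rightarrow> real) \<Rightarrow> (nat \<Rightarrow> real) \<Rightarrow> bool" where
  "same_order a b \<longleftrightarrow>
     0 < liminf (\<lambda>n. ereal (a n / b n)) \<and>
     liminf (\<lambda>n. ereal (a n / b n)) < limsup (\<lambda>n. ereal (a n / b n)) \<and>
     limsup (\<lambda>n. ereal (a n / b n)) < \<infinity>"

end

theory Submission
  imports Defs "HOL-Real_Asymp.Real_Asymp"
begin

text \<open>
  Write \<open>L\<close> for \<open>2 powi j n\<close> and \<open>K\<^sub>L (x, y) = L K (L x, L y)\<close> for the kernel of the orthogonal projection onto
  the approximation space at that scale. The estimator is \<open>(1 / n) \<Sum>\<^sub>i K\<^sub>L (X\<^sub>i, x)\<close>, and since \<open>K\<^sub>L\<close> reproduces itself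
  under integration, expanding the square gives for the integrated squared error
  \<open>(1 / n\<^sup>2) \<Sum>\<^sub>i \<Sum>\<^sub>l K\<^sub>L (X\<^sub>i, X\<^sub>l) - (2 / n) \<Sum>\<^sub>i P f (X\<^sub>i) + \<parallel>f\<parallel>\<^sup>2\<close> with \<open>P\<close> the projection. Completing
  \<open>K\<^sub>L\<close> to the kernel \<open>H (x, y) = K\<^sub>L (x, y) - P f x - P f y + \<integral> f P f\<close>, which integrates to zero in each variable,
  the linear terms cancel except for \<open>-(2 / n\<^sup>2) \<Sum>\<^sub>i P f (X\<^sub>i)\<close>. So \<open>n\<^sup>2\<close> times the centered error is the degenerate
  U-statistic \<open>\<Sum>\<^sub>i\<^sub>\<noteq>\<^sub>l H (X\<^sub>i, X\<^sub>l)\<close> plus the centered sum of the diagonal terms \<open>K\<^sub>L (X\<^sub>i, X\<^sub>i) - 2 P f (X\<^sub>i)\<close> of size \<open>O(L)\<close>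
  (\<open>squared_error_expansion\<close>, \<open>centered_ISE_eq\<close>). The diagonal sum is negligible against \<open>n \<surd>L\<close> by a fourth
  moment bound, because \<open>L\<^sup>2 / n\<^sup>2\<close> is summable for \<open>\<delta> < 1 / 2\<close> (\<open>diag_negligible\<close>).

  It remains to prove a law of the iterated logarithm for the U-statistic. Its partial sums in \<open>n\<close> form a martingale
  whose increment at time \<open>k\<close> is \<open>2 \<Sum>\<^sub>i\<^sub><\<^sub>k H (X\<^sub>i, X\<^sub>k)\<close>. The conditional variance of that increment
  is itself a diagonal sum plus a degenerate U-statistic, for the composed kernel \<open>\<integral> H (x, z) H (y, z)\<close>, and hence is
  nearly constant (\<open>cond_variance_deviation\<close>). Replacing the increments one at a time by Gaussian ones
  (\<open>martingale_lindeberg\<close>) gives a central limit theorem for smooth test functions with an error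
  \<open>O(n\<^sup>-\<^sup>1\<^sup>/\<^sup>2 + L\<^sup>-\<^sup>1\<^sup>/\<^sup>2)\<close> (\<open>ustat_clt\<close>). Moderate deviation probabilities at the iterated logarithm scale are only
  powers of \<open>log n\<close>, whereas this error is a power of \<open>n\<close>, so these crude estimates are sharp enough.

  For the upper half (\<open>ustat_lil_upper\<close>), the kernel is the same for all \<open>n\<close> in a block \<open>[\<lambda>\<^sub>k, \<lambda>\<^sub>k\<^sub>+\<^sub>1)\<close>, so
  the maximum over a block is controlled by a maximal inequality for a martingale (\<open>ustat_maximal\<close>);
  \<open>log log \<lambda>\<^sub>k\<close> is asymptotic to \<open>log k\<close>, which makes the block probabilities of order \<open>k\<^sup>-\<^sup>1\<^sup>-\<^sup>\<epsilon>\<close> and summable, and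
  \<open>\<lambda>\<^sub>k\<^sub>+\<^sub>1 / \<lambda>\<^sub>k \<longlonglongrightarrow> 1\<close> makes the normalization constant on a block up to a factor near one.
  For the lower half (\<open>ustat_lil_lower\<close>), along \<open>n\<^sub>k = ((k + 1)!)\<^sup>2\<close> the pairs within consecutive stretches of the sample
  give independent U-statistics which carry almost all of the variance, and the second Borel-Cantelli lemma applies.

  The constant comes from \<open>kernel_var_limit\<close>: the second moment of \<open>H\<close> divided by \<open>L\<close> tends to \<open>\<integral> f\<^sup>2\<close>. Indeed
  \<open>\<integral> L K (L x, L y)\<^sup>2 dy = K (L x, L x)\<close>, this mass sits within distance \<open>O(1 / L)\<close> of \<open>x\<close>, and
  \<open>K (L x, L x)\<close> converges weakly to one: over an interval of length \<open>T\<close> the integral of \<open>K (x, x) = \<Sum>\<^sub>k \<phi> (x - k)\<^sup>2\<close> is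
  \<open>T + O(1)\<close>, because \<open>\<phi>\<^sup>2\<close> has integral one. Finally, \<open>\<psi>\<close> enters only through the series defining the estimator,
  and is eliminated by telescoping Parseval identities over the scales (\<open>kernel_identity\<close>).
\<close>

section \<open>Gaussian smoothing and the Lindeberg replacement method\<close>

definition stdN :: "real measure" where "stdN = density lborel std_normal_density"

lemma space_stdN [simp]: "space stdN = UNIV" and sets_stdN [simp, measurable_cong]: "sets stdN = sets borel"
  by (simp_all add: stdN_def)

lemma prob_space_stdN: "prob_space stdN"
  unfolding stdN_def by (rule prob_space_normal_density) simp

interpretation stdN: prob_space stdN by (rule prob_space_stdN)

lemma prob_UNIV_stdN [simp]: "measure stdN UNIV = 1"
  using stdN.prob_space by simp

lemma integrable_stdN_abs_power: "integrable stdN (\<lambda>z. \<bar>z\<bar> ^ k)"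
  unfolding stdN_def by (subst integrable_density) (auto simp: integrable_std_normal_moment_abs normal_density_nonneg)

lemma stdN_first: "(\<integral>z. z \<partial>stdN) = 0" "integrable stdN (\<lambda>z. z)"
  using integral_std_normal_distribution_moment_odd[of 1] integrable_std_normal_distribution_moment[of 1] by (simp_all add: stdN_def)

lemma stdN_second: "(\<integral>z. z\<^sup>2 \<partial>stdN) = 1" "integrable stdN (\<lambda>z. z\<^sup>2)"
  using std_normal_distribution_even_moments(1)[of 1] integrable_std_normal_distribution_moment[of 2]
  by (simp_all add: stdN_def)

lemma stdN_third_abs: "(\<integral>z. \<bar>z\<bar>^3 \<partial>stdN) \<le> 2"
proof -
  have "(\<integral>z. \<bar>z\<bar>^3 \<partial>stdN) = (\<integral>x. std_normal_density x * \<bar>x\<bar>^(2*1+1) \<partial>lborel)"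
    unfolding stdN_def by (subst integral_density) (auto simp: normal_density_nonneg eval_nat_numeral)
  also have "\<dots> = sqrt (2/pi) * 2"
    by (subst integral_std_normal_moment_abs_odd) simp
  also have "\<dots> \<le> 1 * 2"
    using pi_gt3 by (intro mult_right_mono) auto
  finally show ?thesis by simp
qed

text \<open>
  The operator of the heat semigroup: the expectation of \<open>g\<close> at \<open>x\<close> plus a centered Gaussian of variance \<open>t\<close>.
\<close>

definition gauss_smooth :: "real \<Rightarrow> (real \<Rightarrow> real) \<Rightarrow> real \<Rightarrow> real" where
  "gauss_smooth t g x = (\<integral>z. g (x + sqrt t * z) \<partial>stdN)"

text \<open>
  A third order Taylor bound, stated for given functions in place of the derivatives. Unlike three times continuous
  differentiability it is visibly stable under averaging, and it admits piecewise cubic test functions.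
\<close>

definition taylor3 :: "real \<Rightarrow> real \<Rightarrow> (real \<Rightarrow> real) \<Rightarrow> (real \<Rightarrow> real) \<Rightarrow> (real \<Rightarrow> real) \<Rightarrow> bool" where
  "taylor3 C B g g1 g2 \<longleftrightarrow>
     g \<in> borel_measurable borel \<and> g1 \<in> borel_measurable borel \<and> g2 \<in> borel_measurable borel \<and>
     (\<forall>x y. \<bar>g (x + y) - g x - g1 x * y - g2 x * y\<^sup>2 / 2\<bar> \<le> C * \<bar>y\<bar>^3) \<and> (\<forall>x. \<bar>g2 x\<bar> \<le> B)"

lemma taylor3D:
  assumes "taylor3 C B g g1 g2"
  shows "g \<in> borel_measurable borel" "g1 \<in> borel_measurable borel" "g2 \<in> borel_measurable borel"
    "\<bar>g (x + y) - g x - g1 x * y - g2 x * y\<^sup>2 / 2\<bar> \<le> C * \<bar>y\<bar>^3" "\<bar>g2 x\<bar> \<le> B"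
  using assms unfolding taylor3_def by auto

lemma taylor3_nonneg: assumes "taylor3 C B g g1 g2" shows "0 \<le> C" "0 \<le> B"
  using taylor3D(4)[OF assms, of 0 1] taylor3D(5)[OF assms, of 0] by auto

lemma taylor3_growth:
  assumes "taylor3 C B g g1 g2"
  shows "\<bar>g (x + y)\<bar> \<le> \<bar>g x\<bar> + \<bar>g1 x\<bar> * \<bar>y\<bar> + B * y\<^sup>2 / 2 + C * \<bar>y\<bar>^3"
proof -
  have "\<bar>g2 x * y\<^sup>2 / 2\<bar> \<le> B * y\<^sup>2 / 2"
    using taylor3D(5)[OF assms, of x] by (simp add: abs_mult mult_right_mono)
  moreover have "\<bar>g1 x * y\<bar> = \<bar>g1 x\<bar> * \<bar>y\<bar>" by (simp add: abs_mult)
  ultimately show ?thesis using taylor3D(4)[OF assms, of x y] by linarith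
qed

text \<open>
  Taking the increment to be one recovers the first derivative from values of the function, so bounds and integrability of
  \<open>g1\<close> follow from those of \<open>g\<close>.
\<close>

lemma taylor3_growth1:
  assumes "taylor3 C B g g1 g2"
  shows "\<bar>g1 x\<bar> \<le> \<bar>g (x + 1)\<bar> + \<bar>g x\<bar> + (B / 2 + C)"
  using taylor3D(4)[OF assms, of x 1] taylor3D(5)[OF assms, of x] by simp

lemma taylor3_bounded_on:
  assumes t: "taylor3 C B g g1 g2"
  shows "\<exists>c. \<forall>x. \<bar>x\<bar> \<le> K \<longrightarrow> \<bar>g x\<bar> \<le> c" "\<exists>c. \<forall>x. \<bar>x\<bar> \<le> K \<longrightarrow> \<bar>g1 x\<bar> \<le> c"
proof -
  note nn = taylor3_nonneg[OF t]
  have *: "\<exists>c. \<forall>x. \<bar>x\<bar> \<le> K \<longrightarrow> \<bar>g x\<bar> \<le> c" for K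
  proof (intro exI allI impI)
    fix x assume "\<bar>x\<bar> \<le> K"
    then have "\<bar>g1 0\<bar> * \<bar>x\<bar> \<le> \<bar>g1 0\<bar> * K" "B * \<bar>x\<bar>\<^sup>2 / 2 \<le> B * K\<^sup>2 / 2" "C * \<bar>x\<bar>^3 \<le> C * K^3"
      using nn by (intro mult_left_mono divide_right_mono power_mono; simp)+
    then show "\<bar>g x\<bar> \<le> \<bar>g 0\<bar> + \<bar>g1 0\<bar> * K + B * K\<^sup>2 / 2 + C * K^3"
      using taylor3_growth[OF t, of 0 x] by simp
  qed
  show "\<exists>c. \<forall>x. \<bar>x\<bar> \<le> K \<longrightarrow> \<bar>g x\<bar> \<le> c" by (rule *)
  from *[of "K + 1"] obtain c where c: "\<And>x. \<bar>x\<bar> \<le> K + 1 \<Longrightarrow> \<bar>g x\<bar> \<le> c" by blast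
  from *[of K] obtain c' where c': "\<And>x. \<bar>x\<bar> \<le> K \<Longrightarrow> \<bar>g x\<bar> \<le> c'" by blast
  have "\<bar>g1 x\<bar> \<le> c + c' + (B / 2 + C)" if "\<bar>x\<bar> \<le> K" for x
    using taylor3_growth1[OF t, of x] c[of "x + 1"] c'[of x] that by linarith
  then show "\<exists>c. \<forall>x. \<bar>x\<bar> \<le> K \<longrightarrow> \<bar>g1 x\<bar> \<le> c" by blast
qed

lemma taylor3_integrable:
  assumes t: "taylor3 C B g g1 g2"
  shows "integrable stdN (\<lambda>z. g (x + s * z))" "integrable stdN (\<lambda>z. g1 (x + s * z))"
    "integrable stdN (\<lambda>z. g2 (x + s * z))"
proof -
  note [measurable] = taylor3D(1-3)[OF t]
  have *: "integrable stdN (\<lambda>z. g (x + s * z))" for x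
  proof (rule Bochner_Integration.integrable_bound)
    show "integrable stdN (\<lambda>z. \<bar>g x\<bar> + (\<bar>g1 x\<bar> * \<bar>s\<bar>) * \<bar>z\<bar>^1 + (B * s\<^sup>2 / 2) * \<bar>z\<bar>^2 + (C * \<bar>s\<bar>^3) * \<bar>z\<bar>^3)"
      by (intro Bochner_Integration.integrable_add integrable_mult_right integrable_stdN_abs_power) auto
    show "AE z in stdN. norm (g (x + s * z)) \<le> norm (\<bar>g x\<bar> + (\<bar>g1 x\<bar> * \<bar>s\<bar>) * \<bar>z\<bar>^1 + (B * s\<^sup>2 / 2) * \<bar>z\<bar>^2 + (C * \<bar>s\<bar>^3) * \<bar>z\<bar>^3)"
    proof (rule AE_I2)
      fix z
      show "norm (g (x + s * z)) \<le> norm (\<bar>g x\<bar> + (\<bar>g1 x\<bar> * \<bar>s\<bar>) * \<bar>z\<bar>^1 + (B * s\<^sup>2 / 2) * \<bar>z\<bar>^2 + (C * \<bar>s\<bar>^3) * \<bar>z\<bar>^3)"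
        using taylor3_growth[OF t, of x "s * z"] unfolding real_norm_def
        by (intro order_trans[OF _ abs_ge_self]) (simp add: abs_mult power_mult_distrib algebra_simps)
    qed
  qed simp
  show "integrable stdN (\<lambda>z. g (x + s * z))" by (rule *)
  show "integrable stdN (\<lambda>z. g1 (x + s * z))"
  proof (rule Bochner_Integration.integrable_bound)
    show "integrable stdN (\<lambda>z. \<bar>g ((x + 1) + s * z)\<bar> + \<bar>g (x + s * z)\<bar> + (B / 2 + C))"
      using *[of "x+1"] *[of x] by (intro Bochner_Integration.integrable_add integrable_abs) auto
    show "AE z in stdN. norm (g1 (x + s * z)) \<le> norm (\<bar>g ((x + 1) + s * z)\<bar> + \<bar>g (x + s * z)\<bar> + (B / 2 + C))"
    proof (rule AE_I2)
      fix z
      have "x + s * z + 1 = (x + 1) + s * z" by simp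
      then show "norm (g1 (x + s * z)) \<le> norm (\<bar>g ((x + 1) + s * z)\<bar> + \<bar>g (x + s * z)\<bar> + (B / 2 + C))"
        using taylor3_growth1[OF t, of "x + s * z"] by (metis abs_ge_self order_trans real_norm_def)
    qed
  qed simp
  show "integrable stdN (\<lambda>z. g2 (x + s * z))"
    by (rule stdN.integrable_const_bound[where B=B]) (use taylor3D(5)[OF t] in auto)
qed

lemma gauss_smooth_measurable:
  assumes [measurable]: "g \<in> borel_measurable borel"
  shows "gauss_smooth t g \<in> borel_measurable borel"
  unfolding gauss_smooth_def by measurable

text \<open>
  The bound is uniform in \<open>x\<close> and therefore survives averaging over translates, with the same constants. This keeps the
  replacement error from growing with the number of steps.
\<close>

lemma taylor3_gauss_smooth:
  assumes t: "taylor3 C B g g1 g2"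
  shows "taylor3 C B (gauss_smooth t g) (gauss_smooth t g1) (gauss_smooth t g2)"
  unfolding taylor3_def
proof (intro conjI allI)
  note [measurable] = taylor3D(1-3)[OF t]
  note I = taylor3_integrable[OF t]
  fix x y :: real
  let ?s = "sqrt t"
  have "\<bar>gauss_smooth t g (x + y) - gauss_smooth t g x - gauss_smooth t g1 x * y - gauss_smooth t g2 x * y\<^sup>2 / 2\<bar>
    = \<bar>\<integral>z. g ((x + y) + ?s * z) - g (x + ?s * z) - g1 (x + ?s * z) * y - g2 (x + ?s * z) * y\<^sup>2 / 2 \<partial>stdN\<bar>"
    unfolding gauss_smooth_def using I
    by (simp add: Bochner_Integration.integral_diff Bochner_Integration.integrable_diff)
  also have "\<dots> \<le> (\<integral>z. C * \<bar>y\<bar>^3 \<partial>stdN)"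
  proof (rule order_trans[OF integral_abs_bound], rule integral_mono)
    show "integrable stdN (\<lambda>z. \<bar>g ((x + y) + ?s * z) - g (x + ?s * z) - g1 (x + ?s * z) * y - g2 (x + ?s * z) * y\<^sup>2 / 2\<bar>)"
      by (intro integrable_abs Bochner_Integration.integrable_diff I integrable_mult_left integrable_divide)
    show "\<bar>g ((x + y) + ?s * z) - g (x + ?s * z) - g1 (x + ?s * z) * y - g2 (x + ?s * z) * y\<^sup>2 / 2\<bar> \<le> C * \<bar>y\<bar>^3" for z
    proof -
      have "(x + y) + ?s * z = (x + ?s * z) + y" by simp
      then show ?thesis using taylor3D(4)[OF t, of "x + ?s * z" y] by (simp only:)
    qed
  qed (rule stdN.integrable_const)
  also have "\<dots> = C * \<bar>y\<bar>^3" by simp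
  finally show "\<bar>gauss_smooth t g (x + y) - gauss_smooth t g x - gauss_smooth t g1 x * y - gauss_smooth t g2 x * y\<^sup>2 / 2\<bar> \<le> C * \<bar>y\<bar>^3" .
next
  note [measurable] = taylor3D(1-3)[OF t]
  fix x
  have "\<bar>gauss_smooth t g2 x\<bar> \<le> (\<integral>z. \<bar>g2 (x + sqrt t * z)\<bar> \<partial>stdN)"
    unfolding gauss_smooth_def by (rule integral_abs_bound)
  also have "\<dots> \<le> (\<integral>z. B \<partial>stdN)"
    by (intro integral_mono integrable_abs taylor3_integrable(3)[OF t] taylor3D(5)[OF t] stdN.integrable_const)
  finally show "\<bar>gauss_smooth t g2 x\<bar> \<le> B" by simp
qed (use taylor3D(1-3)[OF t] gauss_smooth_measurable in auto)

text \<open>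
  The first moment of a standard Gaussian vanishes, the second is one, and the third absolute moment is at most two.
\<close>

lemma gauss_smooth_expansion:
  assumes t: "taylor3 C B g g1 g2" and "0 \<le> D"
  shows "\<bar>gauss_smooth D g x - g x - g2 x * D / 2\<bar> \<le> 2 * C * sqrt D ^ 3"
proof -
  let ?s = "sqrt D"
  note I = taylor3_integrable[OF t]
  have "\<bar>gauss_smooth D g x - g x - g2 x * D / 2\<bar>
    = \<bar>\<integral>z. g (x + ?s * z) - g x - g1 x * ?s * z - (g2 x * D / 2) * z\<^sup>2 \<partial>stdN\<bar>"
    unfolding gauss_smooth_def using I stdN_first stdN_second
    by (simp add: Bochner_Integration.integral_diff stdN.prob_space)
  also have "\<dots> \<le> (\<integral>z. (C * ?s^3) * \<bar>z\<bar>^3 \<partial>stdN)"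
  proof (rule order_trans[OF integral_abs_bound], rule integral_mono)
    show "integrable stdN (\<lambda>z. \<bar>g (x + ?s * z) - g x - g1 x * ?s * z - (g2 x * D / 2) * z\<^sup>2\<bar>)"
      by (intro integrable_abs Bochner_Integration.integrable_diff I integrable_mult_right stdN_first stdN_second) auto
    show "integrable stdN (\<lambda>z. C * ?s^3 * \<bar>z\<bar>^3)"
      by (intro integrable_mult_right integrable_stdN_abs_power)
    fix z
    show "\<bar>g (x + ?s * z) - g x - g1 x * ?s * z - (g2 x * D / 2) * z\<^sup>2\<bar> \<le> C * ?s^3 * \<bar>z\<bar>^3"
      using taylor3D(4)[OF t, of x "?s * z"] assms(2)
      by (simp add: power_mult_distrib abs_mult mult.assoc)
  qed
  also have "\<dots> = (C * ?s^3) * (\<integral>z. \<bar>z\<bar>^3 \<partial>stdN)" by simp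
  also have "\<dots> \<le> (C * ?s^3) * 2"
    using taylor3_nonneg[OF t] assms(2) by (intro mult_left_mono stdN_third_abs) auto
  finally show ?thesis by (simp add: mult_ac)
qed

lemma gauss_smooth_0: "gauss_smooth 0 g = g"
  by (simp add: gauss_smooth_def fun_eq_iff stdN.prob_space)

text \<open>
  The sum of independent centered Gaussians is Gaussian, and variances add.
\<close>

lemma gauss_smooth_semigroup:
  assumes t: "taylor3 C B g g1 g2" and ab: "0 \<le> a" "0 \<le> b"
  shows "gauss_smooth (a + b) g x = gauss_smooth a (gauss_smooth b g) x"
proof (cases "a = 0 \<or> b = 0")
  case True then show ?thesis by (auto simp: gauss_smooth_0)
next
  case False
  with ab have p: "0 < a" "0 < b" by auto
  note [measurable] = taylor3D(1-3)[OF t]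
  interpret P: pair_prob_space stdN stdN ..
  have fst_d: "distr (stdN \<Otimes>\<^sub>M stdN) stdN fst = stdN"
    by (rule stdN.distr_pair_fst)
  have snd_d: "distr (stdN \<Otimes>\<^sub>M stdN) stdN snd = stdN"
  proof -
    have "distr (stdN \<Otimes>\<^sub>M stdN) stdN snd = distr (distr (stdN \<Otimes>\<^sub>M stdN) (stdN \<Otimes>\<^sub>M stdN) (\<lambda>(x, y). (y, x))) stdN snd"
      by (rule arg_cong[where f="\<lambda>m. distr m stdN snd", OF P.distr_pair_swap])
    also have "\<dots> = distr (stdN \<Otimes>\<^sub>M stdN) stdN fst"
      by (subst distr_distr) (auto simp: o_def split_beta)
    finally show ?thesis using fst_d by simp
  qed
  have d1: "distributed (stdN \<Otimes>\<^sub>M stdN) lborel (\<lambda>p. sqrt c * fst p) (normal_density 0 (sqrt c))"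
    and d2: "distributed (stdN \<Otimes>\<^sub>M stdN) lborel (\<lambda>p. sqrt c * snd p) (normal_density 0 (sqrt c))" if "0 < c" for c
  proof -
    have "distr (stdN \<Otimes>\<^sub>M stdN) lborel fst = density lborel std_normal_density"
      unfolding stdN_def[symmetric]
      using fst_d by (subst distr_cong[where g=fst and L=stdN and K="stdN \<Otimes>\<^sub>M stdN"]) auto
    then have A: "distributed (stdN \<Otimes>\<^sub>M stdN) lborel fst std_normal_density"
      unfolding distributed_def by simp
    have "distr (stdN \<Otimes>\<^sub>M stdN) lborel snd = density lborel std_normal_density"
      unfolding stdN_def[symmetric]
      using snd_d by (subst distr_cong[where g=snd and L=stdN and K="stdN \<Otimes>\<^sub>M stdN"]) auto
    then have B: "distributed (stdN \<Otimes>\<^sub>M stdN) lborel snd std_normal_density"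
      unfolding distributed_def by simp
    show "distributed (stdN \<Otimes>\<^sub>M stdN) lborel (\<lambda>p. sqrt c * fst p) (normal_density 0 (sqrt c))"
      using P.normal_density_affine[OF A, of "sqrt c" 0] that by simp
    show "distributed (stdN \<Otimes>\<^sub>M stdN) lborel (\<lambda>p. sqrt c * snd p) (normal_density 0 (sqrt c))"
      using P.normal_density_affine[OF B, of "sqrt c" 0] that by simp
  qed
  have "P.indep_var stdN fst stdN snd"
    unfolding P.indep_var_distribution_eq fst_d snd_d by (simp add: distr_id2)
  then have "P.indep_var borel ((\<lambda>z. sqrt a * z) \<circ> fst) borel ((\<lambda>z. sqrt b * z) \<circ> snd)"
    by (rule P.indep_var_compose) auto
  then have "P.indep_var borel (\<lambda>p. sqrt a * fst p) borel (\<lambda>p. sqrt b * snd p)"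
    by (simp add: o_def)
  from P.add_indep_normal[OF this _ _ d1[OF p(1)] d2[OF p(2)]] p
  have d3: "distributed (stdN \<Otimes>\<^sub>M stdN) lborel (\<lambda>p. sqrt a * fst p + sqrt b * snd p) (normal_density 0 (sqrt (a + b)))"
    by simp
  have c: "0 < a + b" using p by simp
  have m[measurable]: "(\<lambda>u. g (x + u)) \<in> borel_measurable lborel" by measurable
  have fst_int: "integrable (stdN \<Otimes>\<^sub>M stdN) (\<lambda>p. f (fst p)) \<longleftrightarrow> integrable stdN f"
    "(\<integral>p. f (fst p) \<partial>(stdN \<Otimes>\<^sub>M stdN)) = (\<integral>z. f z \<partial>stdN)" if [measurable]: "f \<in> borel_measurable borel" for f :: "real \<Rightarrow> real"
    using integrable_distr_eq[of fst "stdN \<Otimes>\<^sub>M stdN" stdN f] integral_distr[of fst "stdN \<Otimes>\<^sub>M stdN" stdN f] fst_d by auto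
  have "integrable (stdN \<Otimes>\<^sub>M stdN) (\<lambda>p. g (x + sqrt (a + b) * fst p))"
    using taylor3_integrable(1)[OF t, of x "sqrt (a + b)"] by (subst fst_int(1)) auto
  then have I: "integrable (stdN \<Otimes>\<^sub>M stdN) (\<lambda>p. g (x + (sqrt a * fst p + sqrt b * snd p)))"
    using distributed_integrable[OF d1[OF c] m] distributed_integrable[OF d3 m] by simp
  have "gauss_smooth (a + b) g x = (\<integral>p. g (x + sqrt (a + b) * fst p) \<partial>(stdN \<Otimes>\<^sub>M stdN))"
    unfolding gauss_smooth_def by (subst fst_int(2)[symmetric]) auto
  also have "\<dots> = (\<integral>p. g (x + (sqrt a * fst p + sqrt b * snd p)) \<partial>(stdN \<Otimes>\<^sub>M stdN))"
    using distributed_integral[OF d1[OF c] m] distributed_integral[OF d3 m] by simp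
  also have "\<dots> = (\<integral>z. (\<integral>w. g (x + (sqrt a * z + sqrt b * w)) \<partial>stdN) \<partial>stdN)"
    using P.integral_fst'[OF I] by simp
  also have "\<dots> = gauss_smooth a (gauss_smooth b g) x"
    unfolding gauss_smooth_def by (simp add: add_ac)
  finally show ?thesis .
qed

text \<open>
  One step of the replacement: the Taylor expansions of \<open>h (S + d)\<close> and of the smoothed \<open>h\<close> at \<open>S\<close> agree in order zero, in
  order one because \<open>d\<close> is orthogonal to functions of \<open>S\<close>, and in order two up to the error \<open>e\<close>.
\<close>

lemma (in prob_space) lindeberg_step:
  fixes S d :: "'a \<Rightarrow> real"
  assumes t: "taylor3 C B h h1 h2"
    and [measurable]: "S \<in> borel_measurable M" "d \<in> borel_measurable M"
    and bd: "\<And>\<omega>. \<omega> \<in> space M \<Longrightarrow> \<bar>S \<omega>\<bar> \<le> c" "\<And>\<omega>. \<omega> \<in> space M \<Longrightarrow> \<bar>d \<omega>\<bar> \<le> c"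
    and zero: "expectation (\<lambda>\<omega>. h1 (S \<omega>) * d \<omega>) = 0"
    and var: "\<bar>expectation (\<lambda>\<omega>. h2 (S \<omega>) * ((d \<omega>)\<^sup>2 - D))\<bar> \<le> e"
    and third: "expectation (\<lambda>\<omega>. \<bar>d \<omega>\<bar>^3) \<le> r"
    and D: "0 \<le> D"
  shows "\<bar>expectation (\<lambda>\<omega>. h (S \<omega> + d \<omega>)) - expectation (\<lambda>\<omega>. gauss_smooth D h (S \<omega>))\<bar>
     \<le> e / 2 + C * r + 2 * C * sqrt D ^ 3"
proof -
  note [measurable] = taylor3D(1-3)[OF t] gauss_smooth_measurable
  note nn = taylor3_nonneg[OF t]
  obtain a1 where a1: "\<And>x. \<bar>x\<bar> \<le> 2 * c \<Longrightarrow> \<bar>h x\<bar> \<le> a1" using taylor3_bounded_on(1)[OF t, of "2*c"] by blast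
  obtain a2 where a2: "\<And>x. \<bar>x\<bar> \<le> c \<Longrightarrow> \<bar>h1 x\<bar> \<le> a2" using taylor3_bounded_on(2)[OF t, of "c"] by blast
  obtain a3 where a3: "\<And>x. \<bar>x\<bar> \<le> c \<Longrightarrow> \<bar>gauss_smooth D h x\<bar> \<le> a3"
    using taylor3_bounded_on(1)[OF taylor3_gauss_smooth[OF t], of c] by blast
  have c0: "0 \<le> c" using bd(1) not_empty abs_ge_zero order_trans by blast
  have I0: "integrable M (\<lambda>\<omega>. h (S \<omega> + d \<omega>))"
  proof (rule integrable_const_bound[where B=a1])
    show "AE \<omega> in M. norm (h (S \<omega> + d \<omega>)) \<le> a1"
    proof (rule AE_I2)
      fix \<omega> assume w: "\<omega> \<in> space M"
      show "norm (h (S \<omega> + d \<omega>)) \<le> a1"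
        unfolding real_norm_def by (rule a1) (use bd[OF w] in linarith)
    qed
  qed simp
  have I1: "integrable M (\<lambda>\<omega>. h (S \<omega>))"
    by (rule integrable_const_bound[where B=a1]) (auto intro!: AE_I2 a1 order_trans[OF bd(1)] simp: c0)
  have I2: "integrable M (\<lambda>\<omega>. h1 (S \<omega>) * d \<omega>)"
  proof (rule integrable_const_bound[where B="a2 * c"])
    show "AE \<omega> in M. norm (h1 (S \<omega>) * d \<omega>) \<le> a2 * c"
    proof (rule AE_I2)
      fix \<omega> assume w: "\<omega> \<in> space M"
      show "norm (h1 (S \<omega>) * d \<omega>) \<le> a2 * c"
        using a2[OF bd(1)[OF w]] bd(2)[OF w] by (auto simp: abs_mult intro!: mult_mono)
    qed
  qed simp
  have I3: "integrable M (\<lambda>\<omega>. h2 (S \<omega>) * (d \<omega>)\<^sup>2)"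
  proof (rule integrable_const_bound[where B="B * c\<^sup>2"])
    show "AE \<omega> in M. norm (h2 (S \<omega>) * (d \<omega>)\<^sup>2) \<le> B * c\<^sup>2"
    proof (rule AE_I2)
      fix \<omega> assume w: "\<omega> \<in> space M"
      have "\<bar>d \<omega>\<bar>\<^sup>2 \<le> c\<^sup>2" using bd(2)[OF w] by (intro power_mono) auto
      then show "norm (h2 (S \<omega>) * (d \<omega>)\<^sup>2) \<le> B * c\<^sup>2"
        using taylor3D(5)[OF t] nn by (auto simp: abs_mult intro!: mult_mono)
    qed
  qed simp
  have I4: "integrable M (\<lambda>\<omega>. h2 (S \<omega>))"
    by (rule integrable_const_bound[where B=B]) (use taylor3D(5)[OF t] in auto)
  have I5: "integrable M (\<lambda>\<omega>. \<bar>d \<omega>\<bar>^3)"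
    by (rule integrable_const_bound[where B="c^3"]) (auto intro!: AE_I2 power_mono bd)
  have I6: "integrable M (\<lambda>\<omega>. gauss_smooth D h (S \<omega>))"
    by (rule integrable_const_bound[where B=a3]) (auto intro!: AE_I2 a3 bd)
  have A: "\<bar>expectation (\<lambda>\<omega>. h (S \<omega> + d \<omega>) - h (S \<omega>) - h1 (S \<omega>) * d \<omega> - h2 (S \<omega>) * (d \<omega>)\<^sup>2 / 2)\<bar> \<le> C * r"
  proof -
    have "\<bar>expectation (\<lambda>\<omega>. h (S \<omega> + d \<omega>) - h (S \<omega>) - h1 (S \<omega>) * d \<omega> - h2 (S \<omega>) * (d \<omega>)\<^sup>2 / 2)\<bar>
       \<le> expectation (\<lambda>\<omega>. C * \<bar>d \<omega>\<bar>^3)"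
      by (rule order_trans[OF integral_abs_bound], rule integral_mono)
         (use I0 I1 I2 I3 I5 taylor3D(4)[OF t] in auto)
    also have "\<dots> \<le> C * r" using third nn by (simp add: mult_left_mono)
    finally show ?thesis .
  qed
  have E: "\<bar>expectation (\<lambda>\<omega>. gauss_smooth D h (S \<omega>) - h (S \<omega>) - h2 (S \<omega>) * D / 2)\<bar> \<le> 2 * C * sqrt D ^ 3"
  proof -
    have "\<bar>expectation (\<lambda>\<omega>. gauss_smooth D h (S \<omega>) - h (S \<omega>) - h2 (S \<omega>) * D / 2)\<bar>
       \<le> expectation (\<lambda>\<omega>. 2 * C * sqrt D ^ 3)"
      by (rule order_trans[OF integral_abs_bound], rule integral_mono)
         (use I1 I4 I6 gauss_smooth_expansion[OF t D] in auto)
    also have "\<dots> = 2 * C * sqrt D ^ 3" by (simp add: prob_space)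
    finally show ?thesis .
  qed
  have "expectation (\<lambda>\<omega>. h2 (S \<omega>) * ((d \<omega>)\<^sup>2 - D)) = expectation (\<lambda>\<omega>. h2 (S \<omega>) * (d \<omega>)\<^sup>2) - expectation (\<lambda>\<omega>. h2 (S \<omega>)) * D"
    using I3 I4 by (simp add: right_diff_distrib)
  moreover have "expectation (\<lambda>\<omega>. h (S \<omega> + d \<omega>) - h (S \<omega>) - h1 (S \<omega>) * d \<omega> - h2 (S \<omega>) * (d \<omega>)\<^sup>2 / 2)
     = expectation (\<lambda>\<omega>. h (S \<omega> + d \<omega>)) - expectation (\<lambda>\<omega>. h (S \<omega>)) - expectation (\<lambda>\<omega>. h2 (S \<omega>) * (d \<omega>)\<^sup>2) / 2"
    using I0 I1 I2 I3 zero by (simp add: Bochner_Integration.integral_diff)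
  moreover have "expectation (\<lambda>\<omega>. gauss_smooth D h (S \<omega>) - h (S \<omega>) - h2 (S \<omega>) * D / 2)
     = expectation (\<lambda>\<omega>. gauss_smooth D h (S \<omega>)) - expectation (\<lambda>\<omega>. h (S \<omega>)) - expectation (\<lambda>\<omega>. h2 (S \<omega>)) * D / 2"
    using I1 I4 I6 by (simp add: Bochner_Integration.integral_diff)
  ultimately show ?thesis using A E var by linarith
qed

text \<open>
  Lindeberg's method for martingales. After \<open>k\<close> steps the test function is smoothed by the variance still to come; by the
  semigroup property consecutive stages differ by a single replacement. Conditional expectations are avoided: it is enough
  that the increments are orthogonal to bounded functions of the preceding sum, and that their squares are close to
  \<open>D k\<close> when tested against such functions.
\<close>

theorem (in prob_space) martingale_lindeberg:
  fixes d :: "nat \<Rightarrow> 'a \<Rightarrow> real"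
  defines "S \<equiv> \<lambda>k \<omega>. \<Sum>i<k. d i \<omega>"
  assumes t: "taylor3 C B g g1 g2"
    and meas: "\<And>k. k < n \<Longrightarrow> d k \<in> borel_measurable M"
    and bd: "\<And>k \<omega>. k < n \<Longrightarrow> \<omega> \<in> space M \<Longrightarrow> \<bar>d k \<omega>\<bar> \<le> c"
    and zero: "\<And>k \<zeta> b. k < n \<Longrightarrow> \<zeta> \<in> borel_measurable borel \<Longrightarrow>
       (\<And>x. \<bar>\<zeta> x\<bar> \<le> b) \<Longrightarrow> expectation (\<lambda>\<omega>. \<zeta> (S k \<omega>) * d k \<omega>) = 0"
    and var: "\<And>k \<zeta> b. k < n \<Longrightarrow> \<zeta> \<in> borel_measurable borel \<Longrightarrow> (\<And>x. \<bar>\<zeta> x\<bar> \<le> b) \<Longrightarrow>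
       \<bar>expectation (\<lambda>\<omega>. \<zeta> (S k \<omega>) * ((d k \<omega>)\<^sup>2 - D k))\<bar> \<le> b * e k"
    and third: "\<And>k. k < n \<Longrightarrow> expectation (\<lambda>\<omega>. \<bar>d k \<omega>\<bar>^3) \<le> r k"
    and D: "\<And>k. k < n \<Longrightarrow> 0 \<le> D k"
  shows "\<bar>expectation (\<lambda>\<omega>. g (S n \<omega>)) - gauss_smooth (\<Sum>k<n. D k) g 0\<bar>
     \<le> (\<Sum>k<n. B * e k / 2 + C * r k + 2 * C * sqrt (D k) ^ 3)"
proof -
  define Q where "Q k = gauss_smooth (\<Sum>i\<in>{k..<n}. D i)" for k
  have Smeas: "S k \<in> borel_measurable M" if "k \<le> n" for k
    unfolding S_def using meas that by (intro borel_measurable_sum) auto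
  have c0: "0 \<le> c" if "0 < n" using bd[OF that] not_empty abs_ge_zero order_trans by blast
  have Sbd: "\<bar>S k \<omega>\<bar> \<le> real n * c" if "k \<le> n" "\<omega> \<in> space M" for k \<omega>
  proof (cases "n = 0")
    case True then show ?thesis using that by (simp add: S_def)
  next
    case False
    have "\<bar>S k \<omega>\<bar> \<le> (\<Sum>i<k. c)"
      unfolding S_def by (rule order_trans[OF sum_abs sum_mono]) (use bd that in auto)
    also have "\<dots> \<le> real n * c" using that False c0 by (auto intro!: mult_right_mono)
    finally show ?thesis .
  qed
  have step: "\<bar>expectation (\<lambda>\<omega>. Q (Suc k) g (S (Suc k) \<omega>)) - expectation (\<lambda>\<omega>. Q k g (S k \<omega>))\<bar>
      \<le> B * e k / 2 + C * r k + 2 * C * sqrt (D k) ^ 3" if k: "k < n" for k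
  proof -
    have tt: "taylor3 C B (Q (Suc k) g) (Q (Suc k) g1) (Q (Suc k) g2)"
      unfolding Q_def by (rule taylor3_gauss_smooth[OF t])
    obtain b where b: "\<And>x. \<bar>x\<bar> \<le> real n * c \<Longrightarrow> \<bar>Q (Suc k) g1 x\<bar> \<le> b"
      using taylor3_bounded_on(2)[OF tt, of "real n * c"] by blast
    have "{k..<n} = insert k {Suc k..<n}" using k by auto
    moreover have "0 \<le> sum D {Suc k..<n}" by (rule sum_nonneg) (use D in auto)
    ultimately have "Q k g x = gauss_smooth (D k) (Q (Suc k) g) x" for x
      unfolding Q_def using gauss_smooth_semigroup[OF t, of "D k" "sum D {Suc k..<n}" x] D[OF k]
      by simp
    moreover have "S (Suc k) \<omega> = S k \<omega> + d k \<omega>" for \<omega> by (simp add: S_def)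
    moreover have "\<bar>expectation (\<lambda>\<omega>. Q (Suc k) g (S k \<omega> + d k \<omega>)) - expectation (\<lambda>\<omega>. gauss_smooth (D k) (Q (Suc k) g) (S k \<omega>))\<bar>
      \<le> B * e k / 2 + C * r k + 2 * C * sqrt (D k) ^ 3"
    proof (rule lindeberg_step[OF tt])
      show "S k \<in> borel_measurable M" "d k \<in> borel_measurable M" using Smeas meas k by auto
      show "\<bar>S k \<omega>\<bar> \<le> real n * c" if "\<omega> \<in> space M" for \<omega> using Sbd that k by simp
      show "\<bar>d k \<omega>\<bar> \<le> real n * c" if "\<omega> \<in> space M" for \<omega>
      proof -
        have "1 * c \<le> real n * c" using k c0 by (intro mult_right_mono) auto
        then show ?thesis using bd[OF k that] by simp
      qed
      \<comment> \<open>The derivative is unbounded, but only its values on the range of the partial sum matter.\<close>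
      let ?\<zeta> = "\<lambda>x. if \<bar>x\<bar> \<le> real n * c then Q (Suc k) g1 x else 0"
      have "expectation (\<lambda>\<omega>. Q (Suc k) g1 (S k \<omega>) * d k \<omega>) = expectation (\<lambda>\<omega>. ?\<zeta> (S k \<omega>) * d k \<omega>)"
        by (rule Bochner_Integration.integral_cong) (use Sbd k in auto)
      also have "\<dots> = 0"
      proof (rule zero[OF k])
        have [measurable]: "Q (Suc k) g1 \<in> borel_measurable borel" by (rule taylor3D(2)[OF tt])
        show "?\<zeta> \<in> borel_measurable borel" by measurable
        show "\<bar>?\<zeta> x\<bar> \<le> max b 0" for x using b[of x] by auto
      qed
      finally show "expectation (\<lambda>\<omega>. Q (Suc k) g1 (S k \<omega>) * d k \<omega>) = 0" .
      show "\<bar>expectation (\<lambda>\<omega>. Q (Suc k) g2 (S k \<omega>) * ((d k \<omega>)\<^sup>2 - D k))\<bar> \<le> B * e k"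
        by (intro var k taylor3D(3,5)[OF tt])
    qed (use third D k in auto)
    ultimately show ?thesis by simp
  qed
  have "\<bar>expectation (\<lambda>\<omega>. Q n g (S n \<omega>)) - expectation (\<lambda>\<omega>. Q 0 g (S 0 \<omega>))\<bar>
     = \<bar>\<Sum>k<n. expectation (\<lambda>\<omega>. Q (Suc k) g (S (Suc k) \<omega>)) - expectation (\<lambda>\<omega>. Q k g (S k \<omega>))\<bar>"
    by (subst sum_lessThan_telescope) simp
  also have "\<dots> \<le> (\<Sum>k<n. B * e k / 2 + C * r k + 2 * C * sqrt (D k) ^ 3)"
    by (rule order_trans[OF sum_abs sum_mono]) (use step in auto)
  finally show ?thesis
    by (simp add: Q_def gauss_smooth_0 S_def prob_space atLeast0LessThan)
qed

section \<open>Samples of independent observations\<close>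

lemma norm_sq_le: "\<bar>x :: real\<bar> \<le> c \<Longrightarrow> norm (x\<^sup>2) \<le> c\<^sup>2"
  using power_mono[of "\<bar>x\<bar>" c 2] by simp

text \<open>
  The common law \<open>D\<close> is a parameter, so that the same kernel estimates serve the sample and its shifts.
\<close>

locale iid_sample = prob_space M for M :: "'a measure" +
  fixes X :: "nat \<Rightarrow> 'a \<Rightarrow> real" and D :: "real measure"
  assumes indep: "indep_vars (\<lambda>_. borel) X UNIV"
    and law: "distr M borel (X i) = D"
begin

lemma X_measurable [measurable]: "X i \<in> borel_measurable M"
  using indep by (auto simp: indep_vars_def)

lemma sets_D [simp, measurable_cong]: "sets D = sets borel"
  using law[of 0] by auto

lemma space_D [simp]: "space D = UNIV"
  using law[of 0] by auto

sublocale D: prob_space D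
  using prob_space_distr[OF X_measurable, of 0] law by simp

lemma prob_UNIV_D [simp]: "measure D UNIV = 1"
  using D.prob_space by simp

definition past :: "nat \<Rightarrow> 'a \<Rightarrow> nat \<Rightarrow> real" where
  "past l \<omega> = restrict (\<lambda>i. X i \<omega>) {..<l}"

lemma past_measurable [measurable]: "past l \<in> measurable M (PiM {..<l} (\<lambda>_. borel))"
  unfolding past_def by measurable

lemma past_apply: "i < l \<Longrightarrow> past l \<omega> i = X i \<omega>"
  by (simp add: past_def)

lemma indep_past:
  "indep_var (PiM {..<l} (\<lambda>_. borel)) (past l) (PiM {l} (\<lambda>_. borel)) (\<lambda>\<omega>. restrict (\<lambda>i. X i \<omega>) {l})"
  unfolding past_def[abs_def] by (rule indep_var_restrict[OF indep]) auto

text \<open>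
  Fubini's theorem for the product of the law of the first \<open>l\<close> observations with the law of the next one, which replaces
  conditioning on the past throughout. Both orders of integration are used: the past fixed for orthogonality, the new observation
  fixed for moments.
\<close>

lemma expectation_fresh:
  assumes m: "(\<lambda>p. \<Phi> (fst p) (snd p)) \<in> borel_measurable (PiM {..<l} (\<lambda>_. borel) \<Otimes>\<^sub>M borel)"
    and b: "\<And>x y. \<bar>\<Phi> x y :: real\<bar> \<le> c"
  shows "expectation (\<lambda>\<omega>. \<Phi> (past l \<omega>) (X l \<omega>)) = expectation (\<lambda>\<omega>. \<integral>y. \<Phi> (past l \<omega>) y \<partial>D)"
    and "expectation (\<lambda>\<omega>. \<Phi> (past l \<omega>) (X l \<omega>)) = (\<integral>y. expectation (\<lambda>\<omega>. \<Phi> (past l \<omega>) y) \<partial>D)"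
proof -
  let ?S = "PiM {..<l} (\<lambda>_. borel :: real measure)"
  define P where "P = distr M ?S (past l)"
  have sP[simp, measurable_cong]: "sets P = sets ?S" by (simp add: P_def)
  let ?T = "PiM {l} (\<lambda>_. borel :: real measure)"
  define R where "R = distr M ?T (\<lambda>\<omega>. restrict (\<lambda>i. X i \<omega>) {l})"
  have sR[simp, measurable_cong]: "sets R = sets ?T" by (simp add: R_def)
  have RD: "distr R borel (\<lambda>y. y l) = D"
    unfolding R_def by (subst distr_distr) (auto simp: o_def law)
  interpret P: prob_space P unfolding P_def by (rule prob_space_distr) simp
  interpret R: prob_space R unfolding R_def by (rule prob_space_distr) measurable
  interpret PR: pair_prob_space P R ..
  have m'[measurable]: "case_prod \<Phi> \<in> borel_measurable (?S \<Otimes>\<^sub>M borel)" using m by (simp add: split_beta')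
  have [measurable]: "\<Phi> x \<in> borel_measurable borel" if "x \<in> space ?S" for x
    using measurable_Pair2[OF m' that] by simp
  have [measurable]: "(\<lambda>x. \<Phi> x y) \<in> borel_measurable ?S" for y
    using measurable_Pair1[OF m', of y] by simp
  have m2[measurable]: "(\<lambda>(x, y). \<Phi> x (y l)) \<in> borel_measurable (?S \<Otimes>\<^sub>M ?T)" by measurable
  have inner: "(\<integral>y. \<Phi> x (y l) \<partial>R) = (\<integral>y. \<Phi> x y \<partial>D)" if "x \<in> space ?S" for x
    using that unfolding RD[symmetric] by (subst integral_distr) auto
  have eq: "P \<Otimes>\<^sub>M R = distr M (?S \<Otimes>\<^sub>M ?T) (\<lambda>\<omega>. (past l \<omega>, restrict (\<lambda>i. X i \<omega>) {l}))"
    using indep_past[of l] unfolding indep_var_distribution_eq P_def R_def by simp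
  have I: "integrable (P \<Otimes>\<^sub>M R) (\<lambda>(x, y). \<Phi> x (y l))"
    by (rule PR.integrable_const_bound[where B=c]) (use b in auto)
  have e: "expectation (\<lambda>\<omega>. \<Phi> (past l \<omega>) (X l \<omega>)) = integral\<^sup>L (P \<Otimes>\<^sub>M R) (\<lambda>(x, y). \<Phi> x (y l))"
    unfolding eq by (subst integral_distr) auto
  have "integral\<^sup>L (P \<Otimes>\<^sub>M R) (\<lambda>(x, y). \<Phi> x (y l)) = (\<integral>x. (\<integral>y. \<Phi> x (y l) \<partial>R) \<partial>P)"
    using PR.integral_fst'[OF I] by simp
  also have "\<dots> = (\<integral>x. (\<integral>y. \<Phi> x y \<partial>D) \<partial>P)"
    by (rule Bochner_Integration.integral_cong) (use inner in \<open>auto simp: P_def\<close>)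
  also have "\<dots> = expectation (\<lambda>\<omega>. \<integral>y. \<Phi> (past l \<omega>) y \<partial>D)"
    unfolding P_def by (subst integral_distr) auto
  finally show "expectation (\<lambda>\<omega>. \<Phi> (past l \<omega>) (X l \<omega>)) = expectation (\<lambda>\<omega>. \<integral>y. \<Phi> (past l \<omega>) y \<partial>D)"
    using e by simp
  have "integral\<^sup>L (P \<Otimes>\<^sub>M R) (\<lambda>(x, y). \<Phi> x (y l)) = (\<integral>y. (\<integral>x. \<Phi> x (y l) \<partial>P) \<partial>R)"
    using PR.integral_snd[OF I] by simp
  also have "\<dots> = (\<integral>y. (\<integral>x. \<Phi> x y \<partial>P) \<partial>distr R borel (\<lambda>y. y l))"
    by (subst integral_distr) auto
  also have "\<dots> = (\<integral>y. expectation (\<lambda>\<omega>. \<Phi> (past l \<omega>) y) \<partial>D)"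
    unfolding P_def RD by (subst integral_distr) auto
  finally show "expectation (\<lambda>\<omega>. \<Phi> (past l \<omega>) (X l \<omega>)) = (\<integral>y. expectation (\<lambda>\<omega>. \<Phi> (past l \<omega>) y) \<partial>D)"
    using e by simp
qed

lemma expectation_X:
  fixes q :: "real \<Rightarrow> real"
  assumes "q \<in> borel_measurable borel"
  shows "expectation (\<lambda>\<omega>. q (X i \<omega>)) = (\<integral>y. q y \<partial>D :: real)"
  using integral_distr[OF X_measurable, of q i] assms law by simp

text \<open>
  Centered independent variables are orthogonal.
\<close>

lemma weighted_sum_second_moment:
  fixes q :: "real \<Rightarrow> real"
  assumes [measurable]: "q \<in> borel_measurable borel" and b: "\<And>y. \<bar>q y\<bar> \<le> c" and z: "(\<integral>y. q y \<partial>D) = 0"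
  shows "expectation (\<lambda>\<omega>. (\<Sum>i<n. a i * q (X i \<omega>))\<^sup>2) = (\<Sum>i<n. (a i)\<^sup>2) * (\<integral>y. (q y)\<^sup>2 \<partial>D)"
proof (induction n)
  case (Suc n)
  define V where "V = (\<lambda>x :: nat \<Rightarrow> real. \<Sum>i<n. a i * q (x i))"
  define K where "K = (\<Sum>i<n. \<bar>a i\<bar> * c)"
  have Vb: "\<bar>V x\<bar> \<le> K" for x
  proof -
    have "\<bar>V x\<bar> \<le> (\<Sum>i<n. \<bar>a i * q (x i)\<bar>)" unfolding V_def by (rule sum_abs)
    also have "\<dots> \<le> K" unfolding K_def abs_mult by (intro sum_mono mult_left_mono b) auto
    finally show ?thesis .
  qed
  have [measurable]: "V \<in> borel_measurable (PiM {..<n} (\<lambda>_. borel))"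
    unfolding V_def by measurable
  have Vp: "V (past n \<omega>) = (\<Sum>i<n. a i * q (X i \<omega>))" for \<omega>
    unfolding V_def by (intro sum.cong) (auto simp: past_apply)
  have bq: "integrable D q" "integrable D (\<lambda>y. (q y)\<^sup>2)"
  proof -
    show "integrable D q" by (rule D.integrable_const_bound[where B=c]) (use b in auto)
    show "integrable D (\<lambda>y. (q y)\<^sup>2)"
      by (rule D.integrable_const_bound[where B="c\<^sup>2"]) (auto intro!: AE_I2 norm_sq_le simp del: real_norm_def intro: b)
  qed
  have "expectation (\<lambda>\<omega>. (V (past n \<omega>) + a n * q (X n \<omega>))\<^sup>2) = expectation (\<lambda>\<omega>. \<integral>y. (V (past n \<omega>) + a n * q y)\<^sup>2 \<partial>D)"
  proof (rule expectation_fresh(1)[where c="(K + \<bar>a n\<bar> * c)\<^sup>2"])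
    show "\<bar>(V x + a n * q y)\<^sup>2\<bar> \<le> (K + \<bar>a n\<bar> * c)\<^sup>2" for x y
    proof -
      have "\<bar>V x + a n * q y\<bar> \<le> K + \<bar>a n\<bar> * c"
        by (rule order_trans[OF abs_triangle_ineq add_mono[OF Vb]]) (auto simp: abs_mult intro!: mult_left_mono b)
      then show ?thesis using norm_sq_le by auto
    qed
  qed measurable
  also have "\<dots> = expectation (\<lambda>\<omega>. (V (past n \<omega>))\<^sup>2 + (a n)\<^sup>2 * (\<integral>y. (q y)\<^sup>2 \<partial>D))"
  proof (rule Bochner_Integration.integral_cong[OF refl])
    fix \<omega>
    have "(V (past n \<omega>) + a n * q y)\<^sup>2 = (V (past n \<omega>))\<^sup>2 + 2 * V (past n \<omega>) * a n * q y + (a n)\<^sup>2 * (q y)\<^sup>2" for y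
      by (simp add: power2_eq_square algebra_simps)
    then show "(\<integral>y. (V (past n \<omega>) + a n * q y)\<^sup>2 \<partial>D) = (V (past n \<omega>))\<^sup>2 + (a n)\<^sup>2 * (\<integral>y. (q y)\<^sup>2 \<partial>D)"
      using bq z by (simp add: D.prob_space)
  qed
  also have "\<dots> = expectation (\<lambda>\<omega>. (V (past n \<omega>))\<^sup>2) + (a n)\<^sup>2 * (\<integral>y. (q y)\<^sup>2 \<partial>D)"
  proof (subst Bochner_Integration.integral_add)
    show "integrable M (\<lambda>\<omega>. (V (past n \<omega>))\<^sup>2)"
      by (rule integrable_const_bound[where B="K\<^sup>2"]) (auto intro!: AE_I2 norm_sq_le simp del: real_norm_def intro: Vb)
  qed (auto simp: prob_space)
  finally show ?case using Suc by (simp add: Vp distrib_right)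
qed simp

text \<open>
  In the expansion of \<open>(V + q)\<^sup>4\<close> with \<open>q\<close> independent of the preceding sum \<open>V\<close> and centered, the terms with \<open>q\<close> to the
  first power vanish, and so does the one linear in \<open>V\<close>; the rest grows by \<open>6 n q\<^sub>2\<^sup>2 + q\<^sub>4\<close> per step.
\<close>

lemma sum_fourth_moment:
  fixes q :: "real \<Rightarrow> real"
  assumes [measurable]: "q \<in> borel_measurable borel" and b: "\<And>y. \<bar>q y\<bar> \<le> c" and z: "(\<integral>y. q y \<partial>D) = 0"
  shows "expectation (\<lambda>\<omega>. (\<Sum>i<n. q (X i \<omega>))^4) \<le> n * (\<integral>y. (q y)^4 \<partial>D) + 3 * (real n)\<^sup>2 * (\<integral>y. (q y)\<^sup>2 \<partial>D)\<^sup>2"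
proof (induction n)
  case (Suc n)
  define V where "V = (\<lambda>x :: nat \<Rightarrow> real. \<Sum>i<n. q (x i))"
  define K where "K = real n * c"
  define q2 q3 q4 where "q2 = (\<integral>y. (q y)\<^sup>2 \<partial>D)" and "q3 = (\<integral>y. (q y)^3 \<partial>D)" and "q4 = (\<integral>y. (q y)^4 \<partial>D)"
  have Vb: "\<bar>V x\<bar> \<le> K" for x
    unfolding V_def K_def
    by (rule order_trans[OF sum_abs order_trans[OF sum_mono[where g="\<lambda>_. c"]]]) (auto intro!: b)
  have [measurable]: "V \<in> borel_measurable (PiM {..<n} (\<lambda>_. borel))"
    unfolding V_def by measurable
  have Vp: "V (past n \<omega>) = (\<Sum>i<n. q (X i \<omega>))" for \<omega>
    unfolding V_def by (intro sum.cong) (auto simp: past_apply)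
  have bq: "integrable D (\<lambda>y. (q y)^k)" for k
    by (rule D.integrable_const_bound[where B="c^k"]) (auto simp: power_abs intro!: power_mono b)
  have VI: "integrable M (\<lambda>\<omega>. (V (past n \<omega>))^k)" for k
    by (rule integrable_const_bound[where B="K^k"]) (auto simp: power_abs intro!: power_mono Vb)
  have EV1: "expectation (\<lambda>\<omega>. V (past n \<omega>)) = 0"
    unfolding Vp using b z
    by (subst Bochner_Integration.integral_sum)
       (auto simp: expectation_X intro!: integrable_const_bound[where B=c])
  have EV2: "expectation (\<lambda>\<omega>. (V (past n \<omega>))\<^sup>2) = n * q2"
    unfolding Vp q2_def using weighted_sum_second_moment[OF assms, of "\<lambda>_. 1" n] by simp
  have "expectation (\<lambda>\<omega>. (V (past n \<omega>) + q (X n \<omega>))^4) = expectation (\<lambda>\<omega>. \<integral>y. (V (past n \<omega>) + q y)^4 \<partial>D)"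
  proof (rule expectation_fresh(1)[where c="(K + c)^4"])
    show "\<bar>(V x + q y)^4\<bar> \<le> (K + c)^4" for x y
      unfolding power_abs
      by (rule power_mono, rule order_trans[OF abs_triangle_ineq add_mono[OF Vb b]]) simp
  qed measurable
  also have "\<dots> = expectation (\<lambda>\<omega>. (V (past n \<omega>))^4 + 6 * (V (past n \<omega>))\<^sup>2 * q2 + 4 * V (past n \<omega>) * q3 + q4)"
  proof (rule Bochner_Integration.integral_cong[OF refl])
    fix \<omega>
    let ?v = "V (past n \<omega>)"
    have "(?v + q y)^4 = ?v^4 + 4 * ?v^3 * (q y)^1 + 6 * ?v\<^sup>2 * (q y)\<^sup>2 + 4 * ?v * (q y)^3 + (q y)^4" for y
      by (simp add: power2_eq_square eval_nat_numeral algebra_simps)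
    then show "(\<integral>y. (?v + q y)^4 \<partial>D) = ?v^4 + 6 * ?v\<^sup>2 * q2 + 4 * ?v * q3 + q4"
      unfolding q2_def q3_def q4_def
      using bq bq[of 1] z by (simp add: D.prob_space)
  qed
  also have "\<dots> = expectation (\<lambda>\<omega>. (V (past n \<omega>))^4) + 6 * (n * q2) * q2 + q4"
    using VI VI[of 1] EV1 EV2 by (simp add: prob_space)
  also have "\<dots> \<le> (n * q4 + 3 * (real n)\<^sup>2 * q2\<^sup>2) + 6 * (n * q2) * q2 + q4"
    using Suc unfolding Vp q2_def q4_def by simp
  also have "\<dots> \<le> (Suc n) * q4 + 3 * (real (Suc n))\<^sup>2 * q2\<^sup>2"
    by (simp add: power2_eq_square algebra_simps)
  finally show ?case by (simp add: Vp q2_def q4_def)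
qed simp

end

section \<open>Degenerate U-statistics and their moments\<close>

text \<open>
  The sum of \<open>H\<close> over ordered pairs of distinct indices, for symmetric \<open>H\<close>, grouped by the larger index. In this order it is
  a martingale in \<open>n\<close> when \<open>H\<close> is degenerate.
\<close>

definition ustat :: "(real \<Rightarrow> real \<Rightarrow> real) \<Rightarrow> nat \<Rightarrow> (nat \<Rightarrow> real) \<Rightarrow> real" where
  "ustat H n x = (\<Sum>l<n. 2 * (\<Sum>i<l. H (x i) (x l)))"

text \<open>
  Weights single out the pairs within a block or those reaching back before it.
\<close>

definition wsum :: "(nat \<Rightarrow> nat \<Rightarrow> real) \<Rightarrow> (real \<Rightarrow> real \<Rightarrow> real) \<Rightarrow> nat \<Rightarrow> (nat \<Rightarrow> real) \<Rightarrow> real" where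
  "wsum a H n x = (\<Sum>l<n. \<Sum>i<l. a i l * H (x i) (x l))"

lemma ustat_wsum: "ustat H n x = wsum (\<lambda>_ _. 2) H n x"
  by (simp add: ustat_def wsum_def sum_distrib_left)

lemma wsum_cong: "(\<And>i. i < n \<Longrightarrow> x i = y i) \<Longrightarrow> wsum a H n x = wsum a H n y"
  unfolding wsum_def by (intro sum.cong) auto

lemma ustat_cong: "(\<And>i. i < n \<Longrightarrow> x i = y i) \<Longrightarrow> ustat H n x = ustat H n y"
  unfolding ustat_def by (intro sum.cong arg_cong[where f="\<lambda>z. 2 * z"]) auto

lemma double_sum_ustat:
  fixes G :: "real \<Rightarrow> real \<Rightarrow> real"
  assumes "\<And>x y. G x y = G y x"
  shows "(\<Sum>i<n. \<Sum>i'<n. G (x i) (x i')) = (\<Sum>i<n. G (x i) (x i)) + ustat G n (x :: nat \<Rightarrow> real)"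
proof (induction n)
  case (Suc n)
  have "(\<Sum>i<Suc n. \<Sum>i'<Suc n. G (x i) (x i')) = (\<Sum>i<n. \<Sum>i'<n. G (x i) (x i')) + (\<Sum>i<n. G (x i) (x n)) + (\<Sum>i<n. G (x n) (x i)) + G (x n) (x n)"
    by (simp add: sum.distrib)
  also have "(\<Sum>i<n. G (x n) (x i)) = (\<Sum>i<n. G (x i) (x n))" using assms by metis
  finally show ?case using Suc by (simp add: ustat_def)
qed (simp add: ustat_def)

definition kernel_var :: "real measure \<Rightarrow> (real \<Rightarrow> real \<Rightarrow> real) \<Rightarrow> real" where
  "kernel_var D H = (\<integral>y. (\<integral>x. (H x y)\<^sup>2 \<partial>D) \<partial>D)"

text \<open>
  A kernel with the shape of a projection kernel at scale \<open>L\<close>: height of order \<open>L\<close> but mass of order one in each row. Both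
  bounds together give second moments of order \<open>L\<close>, and not of order \<open>L\<^sup>2\<close>.
\<close>

definition deg_kernel :: "real measure \<Rightarrow> real \<Rightarrow> real \<Rightarrow> (real \<Rightarrow> real \<Rightarrow> real) \<Rightarrow> bool" where
  "deg_kernel D A L H \<longleftrightarrow>
     (\<lambda>p. H (fst p) (snd p)) \<in> borel_measurable (borel \<Otimes>\<^sub>M borel) \<and>
     (\<forall>x y. H x y = H y x) \<and> (\<forall>x. (\<integral>y. H x y \<partial>D) = 0) \<and>
     (\<forall>x y. \<bar>H x y\<bar> \<le> A * L) \<and> (\<forall>x. (\<integral>y. \<bar>H x y\<bar> \<partial>D) \<le> A)"

lemma deg_kernelD:
  assumes "deg_kernel D A L H"
  shows "(\<lambda>p. H (fst p) (snd p)) \<in> borel_measurable (borel \<Otimes>\<^sub>M borel)"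
    "H x y = H y x" "(\<integral>y. H x y \<partial>D) = 0" "\<bar>H x y\<bar> \<le> A * L" "(\<integral>y. \<bar>H x y\<bar> \<partial>D) \<le> A"
  using assms unfolding deg_kernel_def by blast+

lemma kernel_measurable_comp:
  fixes H :: "real \<Rightarrow> real \<Rightarrow> real"
  assumes "(\<lambda>p. H (fst p) (snd p)) \<in> borel_measurable (borel \<Otimes>\<^sub>M borel)"
    and "u \<in> borel_measurable N" "v \<in> borel_measurable N"
  shows "(\<lambda>z. H (u z) (v z)) \<in> borel_measurable N"
  using measurable_compose[OF measurable_Pair[OF assms(2,3)] assms(1)] by simp

lemma wsum_measurable:
  assumes m: "(\<lambda>p. H (fst p) (snd p)) \<in> borel_measurable (borel \<Otimes>\<^sub>M borel)"
    and u: "\<And>i. i < n \<Longrightarrow> (\<lambda>z. u z i) \<in> borel_measurable N"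
  shows "(\<lambda>z. wsum a H n (u z)) \<in> borel_measurable N"
  unfolding wsum_def
  by (intro borel_measurable_sum borel_measurable_times borel_measurable_const kernel_measurable_comp[OF m] u) auto

lemma wsum_bound:
  assumes "\<And>x y. \<bar>H x y\<bar> \<le> c"
  shows "\<bar>wsum a H n x\<bar> \<le> (\<Sum>l<n. \<Sum>i<l. \<bar>a i l\<bar> * c)"
proof -
  have "\<bar>wsum a H n x\<bar> \<le> (\<Sum>l<n. \<bar>\<Sum>i<l. a i l * H (x i) (x l)\<bar>)"
    unfolding wsum_def by (rule sum_abs)
  also have "\<dots> \<le> (\<Sum>l<n. \<Sum>i<l. \<bar>a i l * H (x i) (x l)\<bar>)"
    by (rule sum_mono) (rule sum_abs)
  also have "\<dots> \<le> (\<Sum>l<n. \<Sum>i<l. \<bar>a i l\<bar> * c)"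
    unfolding abs_mult by (intro sum_mono mult_left_mono assms) auto
  finally show ?thesis .
qed

lemma row_bound:
  fixes H :: "real \<Rightarrow> real \<Rightarrow> real"
  assumes "\<And>x y. \<bar>H x y\<bar> \<le> c"
  shows "\<bar>\<Sum>i<k. a i * H (x i) y\<bar> \<le> (\<Sum>i<k. \<bar>a i\<bar> * c)"
proof -
  have "\<bar>\<Sum>i<k. a i * H (x i) y\<bar> \<le> (\<Sum>i<k. \<bar>a i * H (x i) y\<bar>)" by (rule sum_abs)
  also have "\<dots> \<le> (\<Sum>i<k. \<bar>a i\<bar> * c)" unfolding abs_mult by (intro sum_mono mult_left_mono assms) auto
  finally show ?thesis .
qed

context iid_sample
begin

lemma deg_kernel_nonneg: assumes "deg_kernel D A L H" shows "0 \<le> A" "0 \<le> A * L"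
proof -
  have "0 \<le> (\<integral>y. \<bar>H 0 y\<bar> \<partial>D)" by simp
  then show "0 \<le> A" using deg_kernelD(5)[OF assms, of 0] by linarith
  show "0 \<le> A * L" using deg_kernelD(4)[OF assms, of 0 0] by linarith
qed

lemma kernel_section_measurable:
  fixes H :: "real \<Rightarrow> real \<Rightarrow> real"
  assumes m: "(\<lambda>p. H (fst p) (snd p)) \<in> borel_measurable (borel \<Otimes>\<^sub>M borel)"
  shows "(\<lambda>y. H x y) \<in> borel_measurable borel" "(\<lambda>x. H x y) \<in> borel_measurable borel"
  by (intro kernel_measurable_comp[OF m] borel_measurable_const; simp)+

lemma deg_kernel_integrable:
  assumes k: "deg_kernel D A L H"
  shows "integrable D (\<lambda>y. H x y)" "integrable D (\<lambda>x. H x y)" "integrable D (\<lambda>y. (H x y)^p)" "integrable D (\<lambda>x. (H x y)^p)"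
proof -
  note [measurable] = kernel_section_measurable[OF deg_kernelD(1)[OF k]]
  show "integrable D (\<lambda>y. H x y)"
    by (rule D.integrable_const_bound[where B="A*L"]) (use deg_kernelD(4)[OF k] in auto)
  show "integrable D (\<lambda>x. H x y)"
    by (rule D.integrable_const_bound[where B="A*L"]) (use deg_kernelD(4)[OF k] in auto)
  show "integrable D (\<lambda>y. (H x y)^p)"
    by (rule D.integrable_const_bound[where B="(A*L)^p"]) (auto simp: power_abs intro!: power_mono deg_kernelD(4)[OF k])
  show "integrable D (\<lambda>x. (H x y)^p)"
    by (rule D.integrable_const_bound[where B="(A*L)^p"]) (auto simp: power_abs intro!: power_mono deg_kernelD(4)[OF k])
qed

text \<open>
  Bound one factor by the supremum and integrate the other.
\<close>

lemma deg_kernel_second_moment: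
  assumes k: "deg_kernel D A L H"
  shows "(\<integral>x. (H x y)\<^sup>2 \<partial>D) \<le> A\<^sup>2 * L"
proof -
  have "(\<integral>x. (H x y)\<^sup>2 \<partial>D) \<le> (\<integral>x. A * L * \<bar>H y x\<bar> \<partial>D)"
  proof (rule integral_mono)
    show "integrable D (\<lambda>x. A * L * \<bar>H y x\<bar>)"
      by (intro integrable_mult_right integrable_abs deg_kernel_integrable[OF k])
    show "(H x y)\<^sup>2 \<le> A * L * \<bar>H y x\<bar>" for x
      using mult_right_mono[OF deg_kernelD(4)[OF k, of y x], of "\<bar>H y x\<bar>"] deg_kernelD(2)[OF k, of x y]
      by (simp add: power2_eq_square abs_mult[symmetric])
  qed (rule deg_kernel_integrable[OF k])
  also have "\<dots> = A * L * (\<integral>x. \<bar>H y x\<bar> \<partial>D)" by simp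
  also have "\<dots> \<le> A * L * A"
    by (rule mult_left_mono[OF deg_kernelD(5)[OF k] deg_kernel_nonneg(2)[OF k]])
  finally show ?thesis by (simp add: power2_eq_square mult_ac)
qed

lemma deg_kernel_fourth_moment:
  assumes k: "deg_kernel D A L H"
  shows "(\<integral>x. (H x y)^4 \<partial>D) \<le> A^4 * L^3"
proof -
  have "(\<integral>x. (H x y)^4 \<partial>D) \<le> (\<integral>x. (A * L)\<^sup>2 * (H x y)\<^sup>2 \<partial>D)"
  proof (rule integral_mono)
    show "(H x y)^4 \<le> (A * L)\<^sup>2 * (H x y)\<^sup>2" for x
    proof -
      have "\<bar>H x y\<bar>\<^sup>2 \<le> (A*L)\<^sup>2" by (intro power_mono deg_kernelD(4)[OF k]) auto
      then have "(H x y)\<^sup>2 * (H x y)\<^sup>2 \<le> (A*L)\<^sup>2 * (H x y)\<^sup>2" by (intro mult_right_mono) auto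
      then show ?thesis by (simp add: power2_eq_square eval_nat_numeral mult_ac)
    qed
  qed (intro integrable_mult_right deg_kernel_integrable[OF k])+
  also have "\<dots> = (A * L)\<^sup>2 * (\<integral>x. (H x y)\<^sup>2 \<partial>D)" by simp
  also have "\<dots> \<le> (A * L)\<^sup>2 * (A\<^sup>2 * L)"
    by (rule mult_left_mono[OF deg_kernel_second_moment[OF k]]) simp
  finally show ?thesis by (simp add: power_mult_distrib eval_nat_numeral mult_ac)
qed

lemma kernel_var_bounds:
  assumes k: "deg_kernel D A L H"
  shows "0 \<le> kernel_var D H" "kernel_var D H \<le> A\<^sup>2 * L"
proof -
  show "0 \<le> kernel_var D H" unfolding kernel_var_def by (intro integral_nonneg_AE AE_I2) auto
  note [measurable] = deg_kernelD(1)[OF k]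
  have [measurable]: "(\<lambda>(y, x). (H x y)\<^sup>2) \<in> borel_measurable (borel \<Otimes>\<^sub>M borel)"
    unfolding split_beta' by (intro borel_measurable_power kernel_measurable_comp[OF deg_kernelD(1)[OF k]]) auto
  have "0 \<le> (\<integral>x. (H x y)\<^sup>2 \<partial>D)" for y by (intro integral_nonneg_AE AE_I2) auto
  then have "kernel_var D H \<le> (\<integral>y. A\<^sup>2 * L \<partial>D)" unfolding kernel_var_def
    by (intro integral_mono D.integrable_const deg_kernel_second_moment[OF k] D.integrable_const_bound[where B="A\<^sup>2 * L"])
       (use deg_kernel_second_moment[OF k] in auto)
  then show "kernel_var D H \<le> A\<^sup>2 * L" by simp
qed

lemma row_measurable:
  assumes k: "deg_kernel D A L H"
  shows "(\<lambda>p. \<Sum>i<l. a i * H (fst p i) (snd p)) \<in> borel_measurable (PiM {..<l} (\<lambda>_. borel) \<Otimes>\<^sub>M borel)"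
  by (intro borel_measurable_sum borel_measurable_times borel_measurable_const kernel_measurable_comp[OF deg_kernelD(1)[OF k]])
     (auto intro!: measurable_compose[OF measurable_fst])

text \<open>
  Integrating out the newest observation annihilates every \<open>H (X i) (X l)\<close>: this is the martingale property.
\<close>

lemma row_orthogonal:
  assumes k: "deg_kernel D A L H"
    and z: "z \<in> borel_measurable (PiM {..<l} (\<lambda>_. borel))" "\<And>x. \<bar>z x\<bar> \<le> b"
  shows "expectation (\<lambda>\<omega>. z (past l \<omega>) * (\<Sum>i<l. a i * H (X i \<omega>) (X l \<omega>))) = 0"
proof -
  define c where "c = (\<Sum>i<l. \<bar>a i\<bar> * (A * L))"
  have "expectation (\<lambda>\<omega>. z (past l \<omega>) * (\<Sum>i<l. a i * H (past l \<omega> i) (X l \<omega>)))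
      = expectation (\<lambda>\<omega>. \<integral>y. z (past l \<omega>) * (\<Sum>i<l. a i * H (past l \<omega> i) y) \<partial>D)"
  proof (rule expectation_fresh(1)[where c="b * c"])
    show "(\<lambda>p. z (fst p) * (\<Sum>i<l. a i * H (fst p i) (snd p))) \<in> borel_measurable (PiM {..<l} (\<lambda>_. borel) \<Otimes>\<^sub>M borel)"
      by (intro borel_measurable_times row_measurable[OF k] measurable_compose[OF measurable_fst z(1)])
    show "\<bar>z x * (\<Sum>i<l. a i * H (x i) y)\<bar> \<le> b * c" for x y
    proof -
      have "0 \<le> b" using z(2)[of x] by linarith
      then show ?thesis
        unfolding abs_mult c_def by (intro mult_mono z(2) row_bound deg_kernelD(4)[OF k]) auto
    qed
  qed
  also have "\<dots> = expectation (\<lambda>\<omega>. 0)"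
  proof (rule Bochner_Integration.integral_cong[OF refl])
    fix \<omega>
    show "(\<integral>y. z (past l \<omega>) * (\<Sum>i<l. a i * H (past l \<omega> i) y) \<partial>D) = 0"
      using deg_kernelD(3)[OF k] deg_kernel_integrable(1)[OF k]
      by (simp add: Bochner_Integration.integral_sum)
  qed
  also have "(\<lambda>\<omega>. z (past l \<omega>) * (\<Sum>i<l. a i * H (past l \<omega> i) (X l \<omega>))) = (\<lambda>\<omega>. z (past l \<omega>) * (\<Sum>i<l. a i * H (X i \<omega>) (X l \<omega>)))"
    by (intro ext arg_cong2[where f="(*)"] refl sum.cong) (auto simp: past_apply)
  finally show ?thesis by simp
qed

text \<open>
  With the newest observation held fixed, the row is a sum of centered independent variables.
\<close>

lemma row_second_moment:
  assumes k: "deg_kernel D A L H"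
  shows "expectation (\<lambda>\<omega>. (\<Sum>i<l. a i * H (X i \<omega>) (X l \<omega>))\<^sup>2) = (\<Sum>i<l. (a i)\<^sup>2) * kernel_var D H"
proof -
  define c where "c = (\<Sum>i<l. \<bar>a i\<bar> * (A * L))"
  have p: "(\<Sum>i<l. a i * H (past l \<omega> i) y) = (\<Sum>i<l. a i * H (X i \<omega>) y)" for \<omega> y
    by (intro sum.cong) (auto simp: past_apply)
  have "expectation (\<lambda>\<omega>. (\<Sum>i<l. a i * H (past l \<omega> i) (X l \<omega>))\<^sup>2)
      = (\<integral>y. expectation (\<lambda>\<omega>. (\<Sum>i<l. a i * H (past l \<omega> i) y)\<^sup>2) \<partial>D)"
  proof (rule expectation_fresh(2)[where c="c\<^sup>2"])
    show "\<bar>(\<Sum>i<l. a i * H (x i) y)\<^sup>2\<bar> \<le> c\<^sup>2" for x y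
      unfolding power_abs c_def by (intro power_mono row_bound deg_kernelD(4)[OF k]) auto
  qed (intro borel_measurable_power row_measurable[OF k])
  also have "\<dots> = (\<integral>y. (\<Sum>i<l. (a i)\<^sup>2) * (\<integral>x. (H x y)\<^sup>2 \<partial>D) \<partial>D)"
    unfolding p
  proof (rule Bochner_Integration.integral_cong[OF refl])
    fix y
    have zz: "(\<integral>x. H x y \<partial>D) = 0" by (subst deg_kernelD(2)[OF k]) (rule deg_kernelD(3)[OF k])
    show "expectation (\<lambda>\<omega>. (\<Sum>i<l. a i * H (X i \<omega>) y)\<^sup>2) = (\<Sum>i<l. (a i)\<^sup>2) * (\<integral>x. (H x y)\<^sup>2 \<partial>D)"
      by (rule weighted_sum_second_moment[where c="A*L"]) (rule kernel_section_measurable[OF deg_kernelD(1)[OF k]] deg_kernelD(4)[OF k] zz)+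
  qed
  finally show ?thesis unfolding p kernel_var_def by simp
qed

text \<open>
  The bound is the fourth moment bound for independent sums, with the newest observation held fixed. It replaces a
  third moment condition in the central limit theorem.
\<close>

lemma row_fourth_moment:
  assumes k: "deg_kernel D A L H"
  shows "expectation (\<lambda>\<omega>. (\<Sum>i<l. H (X i \<omega>) (X l \<omega>))^4) \<le> l * (A^4 * L^3) + 3 * (real l)\<^sup>2 * (A\<^sup>2 * L)\<^sup>2"
proof -
  define c where "c = (\<Sum>i<l. \<bar>1\<bar> * (A * L))"
  have p: "(\<Sum>i<l. 1 * H (past l \<omega> i) y) = (\<Sum>i<l. H (X i \<omega>) y)" for \<omega> y
    by (intro sum.cong) (auto simp: past_apply)
  have zz: "(\<integral>x. H x y \<partial>D) = 0" for y by (subst deg_kernelD(2)[OF k]) (rule deg_kernelD(3)[OF k])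
  have b: "\<bar>(\<Sum>i<l. 1 * H (x i) y)^4\<bar> \<le> c^4" for x y
    unfolding power_abs c_def by (intro power_mono row_bound deg_kernelD(4)[OF k]) auto
  have "expectation (\<lambda>\<omega>. (\<Sum>i<l. 1 * H (past l \<omega> i) (X l \<omega>))^4)
      = (\<integral>y. expectation (\<lambda>\<omega>. (\<Sum>i<l. 1 * H (past l \<omega> i) y)^4) \<partial>D)"
    by (rule expectation_fresh(2)[where c="c^4"]) (intro b borel_measurable_power row_measurable[OF k])+
  also have "\<dots> \<le> (\<integral>y. l * (A^4 * L^3) + 3 * (real l)\<^sup>2 * (A\<^sup>2 * L)\<^sup>2 \<partial>D)"
  proof (rule integral_mono')
    fix y
    have "expectation (\<lambda>\<omega>. (\<Sum>i<l. H (X i \<omega>) y)^4) \<le> l * (\<integral>x. (H x y)^4 \<partial>D) + 3 * (real l)\<^sup>2 * (\<integral>x. (H x y)\<^sup>2 \<partial>D)\<^sup>2"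
      by (rule sum_fourth_moment[where c="A*L"]) (rule zz kernel_section_measurable[OF deg_kernelD(1)[OF k]] deg_kernelD(4)[OF k])+
    also have "\<dots> \<le> l * (A^4 * L^3) + 3 * (real l)\<^sup>2 * (A\<^sup>2 * L)\<^sup>2"
      by (intro add_mono mult_left_mono deg_kernel_fourth_moment[OF k] power_mono deg_kernel_second_moment[OF k] integral_nonneg_AE AE_I2) auto
    finally have le: "expectation (\<lambda>\<omega>. (\<Sum>i<l. H (X i \<omega>) y)^4) \<le> l * (A^4 * L^3) + 3 * (real l)\<^sup>2 * (A\<^sup>2 * L)\<^sup>2" .
    then show "expectation (\<lambda>\<omega>. (\<Sum>i<l. 1 * H (past l \<omega> i) y)^4) \<le> l * (A^4 * L^3) + 3 * (real l)\<^sup>2 * (A\<^sup>2 * L)\<^sup>2"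
      unfolding p .
    have "0 \<le> expectation (\<lambda>\<omega>. (\<Sum>i<l. H (X i \<omega>) y)^4)"
      by (intro integral_nonneg_AE AE_I2) auto
    then show "0 \<le> l * (A^4 * L^3) + 3 * (real l)\<^sup>2 * (A\<^sup>2 * L)\<^sup>2"
      using le by linarith
  qed (rule D.integrable_const)
  finally show ?thesis unfolding p by simp
qed

text \<open>
  Rows are orthogonal to everything before them.
\<close>

lemma wsum_second_moment:
  assumes k: "deg_kernel D A L H"
  shows "expectation (\<lambda>\<omega>. (wsum a H n (\<lambda>i. X i \<omega>))\<^sup>2) = (\<Sum>l<n. \<Sum>i<l. (a i l)\<^sup>2) * kernel_var D H"
proof (induction n)
  case 0 then show ?case by (simp add: wsum_def)
next
  case (Suc n)
  note b = deg_kernelD(4)[OF k]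
  define c c' where "c = (\<Sum>l<n. \<Sum>i<l. \<bar>a i l\<bar> * (A * L))" and "c' = (\<Sum>i<n. \<bar>a i n\<bar> * (A * L))"
  let ?W = "\<lambda>\<omega>. wsum a H n (\<lambda>i. X i \<omega>)" and ?R = "\<lambda>\<omega>. \<Sum>i<n. a i n * H (X i \<omega>) (X n \<omega>)"
  have Wp: "wsum a H n (past n \<omega>) = ?W \<omega>" for \<omega> by (rule wsum_cong) (simp add: past_apply)
  have "expectation (\<lambda>\<omega>. wsum a H n (past n \<omega>) * ?R \<omega>) = 0"
    by (rule row_orthogonal[OF k wsum_measurable[OF deg_kernelD(1)[OF k]] wsum_bound[OF b]]) measurable
  then have o: "expectation (\<lambda>\<omega>. ?W \<omega> * ?R \<omega>) = 0" by (simp add: Wp)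
  have [measurable]: "?W \<in> borel_measurable M" by (rule wsum_measurable[OF deg_kernelD(1)[OF k]]) simp
  have [measurable]: "?R \<in> borel_measurable M"
    by (intro borel_measurable_sum borel_measurable_times borel_measurable_const kernel_measurable_comp[OF deg_kernelD(1)[OF k]]) auto
  have Wb: "\<bar>?W \<omega>\<bar> \<le> c" for \<omega> unfolding c_def by (rule wsum_bound[OF b])
  have Rb: "\<bar>?R \<omega>\<bar> \<le> c'" for \<omega> unfolding c'_def by (rule row_bound[OF b])
  have I1: "integrable M (\<lambda>\<omega>. (?W \<omega>)\<^sup>2)"
    by (rule integrable_const_bound[where B="c\<^sup>2"]) (auto intro!: AE_I2 norm_sq_le simp del: real_norm_def intro: Wb)
  have I2: "integrable M (\<lambda>\<omega>. (?R \<omega>)\<^sup>2)"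
    by (rule integrable_const_bound[where B="c'\<^sup>2"]) (auto intro!: AE_I2 norm_sq_le simp del: real_norm_def intro: Rb)
  have c0: "0 \<le> c" using Wb[of undefined] by linarith
  have I3: "integrable M (\<lambda>\<omega>. ?W \<omega> * ?R \<omega>)"
    by (rule integrable_const_bound[where B="c*c'"]) (auto simp: abs_mult intro!: mult_mono Wb Rb c0)
  have "(wsum a H (Suc n) (\<lambda>i. X i \<omega>))\<^sup>2 = (?W \<omega>)\<^sup>2 + 2 * (?W \<omega> * ?R \<omega>) + (?R \<omega>)\<^sup>2" for \<omega>
    by (simp add: wsum_def power2_eq_square algebra_simps)
  then have "expectation (\<lambda>\<omega>. (wsum a H (Suc n) (\<lambda>i. X i \<omega>))\<^sup>2) = expectation (\<lambda>\<omega>. (?W \<omega>)\<^sup>2) + expectation (\<lambda>\<omega>. (?R \<omega>)\<^sup>2)"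
    using I1 I2 I3 o by simp
  then show ?case using Suc row_second_moment[OF k, of "\<lambda>i. a i n" n] by (simp add: distrib_right)
qed

lemma sum_lt_const: "(\<Sum>l<n. \<Sum>i<l. c) = real n * (real n - 1) / 2 * (c::real)"
  by (induction n) (auto simp: field_simps)

lemma ustat_second_moment:
  assumes k: "deg_kernel D A L H"
  shows "expectation (\<lambda>\<omega>. (ustat H n (\<lambda>i. X i \<omega>))\<^sup>2) = 2 * real n * (real n - 1) * kernel_var D H"
  unfolding ustat_wsum wsum_second_moment[OF k] sum_lt_const by simp

lemma past_restrict: "m \<le> l \<Longrightarrow> restrict (past l \<omega>) {..<m} = past m \<omega>"
  by (auto simp: past_def restrict_def)

text \<open>
  The martingale property over several steps, in the form needed for a stopping argument.
\<close>

lemma ustat_orthogonal: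
  assumes k: "deg_kernel D A L H" and "m \<le> n"
    and z: "z \<in> borel_measurable (PiM {..<m} (\<lambda>_. borel))" "\<And>x. \<bar>z x\<bar> \<le> b"
  shows "expectation (\<lambda>\<omega>. z (past m \<omega>) * (ustat H n (\<lambda>i. X i \<omega>) - ustat H m (\<lambda>i. X i \<omega>))) = 0"
proof -
  have b0: "0 \<le> b" using z(2)[of undefined] by linarith
  have "ustat H n x - ustat H m x = (\<Sum>l\<in>{m..<n}. \<Sum>i<l. 2 * H (x i) (x l))" for x :: "nat \<Rightarrow> real"
    using sum.atLeastLessThan_concat[of 0 m n "\<lambda>l. \<Sum>i<l. 2 * H (x i) (x l)"] \<open>m \<le> n\<close>
    by (simp add: ustat_def atLeast0LessThan sum_distrib_left)
  then have "expectation (\<lambda>\<omega>. z (past m \<omega>) * (ustat H n (\<lambda>i. X i \<omega>) - ustat H m (\<lambda>i. X i \<omega>)))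
    = expectation (\<lambda>\<omega>. \<Sum>l\<in>{m..<n}. z (past m \<omega>) * (\<Sum>i<l. 2 * H (X i \<omega>) (X l \<omega>)))"
    by (simp add: sum_distrib_left)
  also have "\<dots> = (\<Sum>l\<in>{m..<n}. expectation (\<lambda>\<omega>. z (past m \<omega>) * (\<Sum>i<l. 2 * H (X i \<omega>) (X l \<omega>))))"
  proof (rule Bochner_Integration.integral_sum)
    fix l assume "l \<in> {m..<n}"
    show "integrable M (\<lambda>\<omega>. z (past m \<omega>) * (\<Sum>i<l. 2 * H (X i \<omega>) (X l \<omega>)))"
    proof (rule integrable_const_bound[where B="b * (\<Sum>i<l. \<bar>2\<bar> * (A * L))"])
      show "AE \<omega> in M. norm (z (past m \<omega>) * (\<Sum>i<l. 2 * H (X i \<omega>) (X l \<omega>))) \<le> b * (\<Sum>i<l. \<bar>2\<bar> * (A * L))"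
        unfolding real_norm_def abs_mult
        by (intro AE_I2 mult_mono z(2) b0 row_bound deg_kernelD(4)[OF k] abs_ge_zero)
      show "(\<lambda>\<omega>. z (past m \<omega>) * (\<Sum>i<l. 2 * H (X i \<omega>) (X l \<omega>))) \<in> borel_measurable M"
        by (intro borel_measurable_sum borel_measurable_times borel_measurable_const measurable_compose[OF past_measurable z(1)]
          kernel_measurable_comp[OF deg_kernelD(1)[OF k]]) auto
    qed
  qed
  also have "\<dots> = 0"
  proof (rule sum.neutral, rule ballI)
    fix l assume l: "l \<in> {m..<n}"
    have "expectation (\<lambda>\<omega>. z (restrict (past l \<omega>) {..<m}) * (\<Sum>i<l. 2 * H (X i \<omega>) (X l \<omega>))) = 0"
    proof (rule row_orthogonal[OF k])
      show "(\<lambda>x. z (restrict x {..<m})) \<in> borel_measurable (PiM {..<l} (\<lambda>_. borel))"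
        by (rule measurable_compose[OF _ z(1)], rule measurable_restrict_subset) (use l in auto)
    qed (rule z(2))
    then show "expectation (\<lambda>\<omega>. z (past m \<omega>) * (\<Sum>i<l. 2 * H (X i \<omega>) (X l \<omega>))) = 0"
      using l by (simp add: past_restrict)
  qed
  finally show ?thesis .
qed

end

section \<open>Concentration of the conditional variance\<close>

text \<open>
  The three terms bound, in units of \<open>1 / \<surd>n + 1 / \<surd>L\<close>, the deviation of the conditional variances, the third absolute
  moments of the increments, and the remaining numerical constants including the Gaussian third moments; \<open>b\<close> is a lower
  bound for the second moment of the kernel relative to \<open>L\<close>.
\<close>

definition clt_const :: "real \<Rightarrow> real \<Rightarrow> real" where
  "clt_const A b = 4 * A\<^sup>2 / b + 32 * A^4 / b\<^sup>2 + 8"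

context iid_sample
begin

text \<open>
  The kernel of the square of the integral operator with kernel \<open>H\<close>.
\<close>

definition compose_kernel :: "(real \<Rightarrow> real \<Rightarrow> real) \<Rightarrow> real \<Rightarrow> real \<Rightarrow> real" where
  "compose_kernel H x y = (\<integral>z. H x z * H y z \<partial>D)"

lemma compose_integrable:
  assumes k: "deg_kernel D A L H"
  shows "integrable D (\<lambda>z. H x z * H y z)"
proof (rule D.integrable_const_bound[where B="(A*L)*(A*L)"])
  show "AE z in D. norm (H x z * H y z) \<le> A * L * (A * L)"
    unfolding real_norm_def abs_mult
    by (intro AE_I2 mult_mono deg_kernelD(4)[OF k] deg_kernel_nonneg[OF k] abs_ge_zero)
  note [measurable] = kernel_section_measurable[OF deg_kernelD(1)[OF k]]
  show "(\<lambda>z. H x z * H y z) \<in> borel_measurable D" by measurable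
qed

text \<open>
  Convolving preserves the shape, with \<open>A\<close> squared but with the same \<open>L\<close>. This makes the conditional variances concentrate:
  their fluctuation is a U-statistic with second moment of order \<open>n\<^sup>2 L\<close>, against a mean square of order \<open>n\<^sup>2 L\<^sup>2\<close>.
\<close>

lemma deg_kernel_compose:
  assumes k: "deg_kernel D A L H"
  shows "deg_kernel D (A\<^sup>2) L (compose_kernel H)"
proof -
  note b = deg_kernelD(4)[OF k] and nn = deg_kernel_nonneg[OF k]
  note m = kernel_measurable_comp[OF deg_kernelD(1)[OF k]]
  interpret DD: pair_prob_space D D ..
  have m1: "(\<lambda>p. \<integral>z. H (fst p) z * H (snd p) z \<partial>D) \<in> borel_measurable (borel \<Otimes>\<^sub>M borel)"
  proof (rule D.borel_measurable_lebesgue_integral)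
    show "(\<lambda>(p, z). H (fst p) z * H (snd p) z) \<in> borel_measurable ((borel \<Otimes>\<^sub>M borel) \<Otimes>\<^sub>M D)"
      unfolding split_beta' by (intro borel_measurable_times m) auto
  qed
  have m1': "(\<lambda>p. compose_kernel H (fst p) (snd p)) \<in> borel_measurable (borel \<Otimes>\<^sub>M borel)"
    using m1 by (simp add: compose_kernel_def)
  have abs: "\<bar>compose_kernel H x y\<bar> \<le> (\<integral>z. \<bar>H x z\<bar> * \<bar>H y z\<bar> \<partial>D)" for x y
    unfolding compose_kernel_def abs_mult[symmetric] by (rule integral_abs_bound)
  have absI: "integrable D (\<lambda>z. \<bar>H x z\<bar> * \<bar>H y z\<bar>)" for x y
    unfolding abs_mult[symmetric] by (rule integrable_abs[OF compose_integrable[OF k]])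
  have sup: "\<bar>compose_kernel H x y\<bar> \<le> A\<^sup>2 * L" for x y
  proof -
    have "(\<integral>z. \<bar>H x z\<bar> * \<bar>H y z\<bar> \<partial>D) \<le> (\<integral>z. \<bar>H x z\<bar> * (A * L) \<partial>D)"
      by (intro integral_mono absI integrable_mult_left integrable_abs deg_kernel_integrable[OF k] mult_left_mono b abs_ge_zero)
    also have "\<dots> = (\<integral>z. \<bar>H x z\<bar> \<partial>D) * (A * L)" by simp
    also have "\<dots> \<le> A * (A * L)" by (intro mult_right_mono deg_kernelD(5)[OF k] nn)
    finally show ?thesis using abs[of x y] by (simp add: power2_eq_square mult_ac)
  qed
  have zero: "(\<integral>y. compose_kernel H x y \<partial>D) = 0" for x
  proof -
    have I: "integrable (D \<Otimes>\<^sub>M D) (\<lambda>(z, y). H x z * H y z)"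
    proof (rule DD.integrable_const_bound[where B="(A*L)*(A*L)"])
      show "AE p in D \<Otimes>\<^sub>M D. norm (case p of (z, y) \<Rightarrow> H x z * H y z) \<le> A * L * (A * L)"
        unfolding real_norm_def split_beta' abs_mult by (intro AE_I2 mult_mono b nn abs_ge_zero)
      show "(\<lambda>(z, y). H x z * H y z) \<in> borel_measurable (D \<Otimes>\<^sub>M D)"
        unfolding split_beta' by (intro borel_measurable_times m) auto
    qed
    have "(\<integral>y. compose_kernel H x y \<partial>D) = (\<integral>y. (\<integral>z. H x z * H y z \<partial>D) \<partial>D)"
      by (simp add: compose_kernel_def)
    also have "\<dots> = (\<integral>z. (\<integral>y. H x z * H y z \<partial>D) \<partial>D)"
      by (rule DD.Fubini_integral[OF I])
    also have "\<dots> = (\<integral>z. H x z * (\<integral>y. H z y \<partial>D) \<partial>D)"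
      by (subst deg_kernelD(2)[OF k, where y = _]) simp
    also have "\<dots> = 0" using deg_kernelD(3)[OF k] by simp
    finally show ?thesis .
  qed
  have L1: "(\<integral>y. \<bar>compose_kernel H x y\<bar> \<partial>D) \<le> A\<^sup>2" for x
  proof -
    have I: "integrable (D \<Otimes>\<^sub>M D) (\<lambda>(z, y). \<bar>H x z\<bar> * \<bar>H y z\<bar>)"
    proof (rule DD.integrable_const_bound[where B="(A*L)*(A*L)"])
      show "AE p in D \<Otimes>\<^sub>M D. norm (case p of (z, y) \<Rightarrow> \<bar>H x z\<bar> * \<bar>H y z\<bar>) \<le> A * L * (A * L)"
        unfolding real_norm_def split_beta' abs_mult abs_abs by (intro AE_I2 mult_mono b nn abs_ge_zero)
      show "(\<lambda>(z, y). \<bar>H x z\<bar> * \<bar>H y z\<bar>) \<in> borel_measurable (D \<Otimes>\<^sub>M D)"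
        unfolding split_beta' by (intro borel_measurable_times borel_measurable_abs m) auto
    qed
    have "(\<integral>y. \<bar>compose_kernel H x y\<bar> \<partial>D) \<le> (\<integral>y. (\<integral>z. \<bar>H x z\<bar> * \<bar>H y z\<bar> \<partial>D) \<partial>D)"
    proof (rule integral_mono)
      show "integrable D (\<lambda>y. \<bar>compose_kernel H x y\<bar>)"
        by (rule integrable_abs, rule D.integrable_const_bound[where B="A\<^sup>2*L"])
           (use sup kernel_section_measurable(1)[OF m1'] in auto)
      show "integrable D (\<lambda>y. \<integral>z. \<bar>H x z\<bar> * \<bar>H y z\<bar> \<partial>D)"
        using DD.integrable_snd[OF I] by simp
    qed (rule abs)
    also have "\<dots> = (\<integral>z. (\<integral>y. \<bar>H x z\<bar> * \<bar>H y z\<bar> \<partial>D) \<partial>D)"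
      by (rule DD.Fubini_integral[OF I])
    also have "\<dots> = (\<integral>z. \<bar>H x z\<bar> * (\<integral>y. \<bar>H z y\<bar> \<partial>D) \<partial>D)"
      using deg_kernelD(2)[OF k] by (intro Bochner_Integration.integral_cong refl) simp
    also have "\<dots> \<le> (\<integral>z. \<bar>H x z\<bar> * A \<partial>D)"
      by (rule integral_mono') (auto intro!: integrable_mult_left integrable_abs deg_kernel_integrable[OF k] mult_left_mono deg_kernelD(5)[OF k] mult_nonneg_nonneg nn)
    also have "\<dots> = (\<integral>z. \<bar>H x z\<bar> \<partial>D) * A" by simp
    also have "\<dots> \<le> A * A" by (intro mult_right_mono deg_kernelD(5)[OF k] nn)
    finally show ?thesis by (simp add: power2_eq_square)
  qed
  show ?thesis
    unfolding deg_kernel_def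
  proof (intro conjI allI)
    show "(\<lambda>p. compose_kernel H (fst p) (snd p)) \<in> borel_measurable (borel \<Otimes>\<^sub>M borel)" by (rule m1')
    show "compose_kernel H x y = compose_kernel H y x" for x y by (simp add: compose_kernel_def mult.commute)
  qed (rule zero sup L1)+
qed

lemma compose_kernel_diag:
  assumes k: "deg_kernel D A L H"
  shows "(\<integral>y. compose_kernel H y y \<partial>D) = kernel_var D H"
  unfolding compose_kernel_def kernel_var_def using deg_kernelD(2)[OF k]
  by (intro Bochner_Integration.integral_cong refl) (simp add: power2_eq_square)

text \<open>
  The left-hand side is, up to a factor, the conditional variance of an increment. It is a quadratic form in the past, and thus
  again a diagonal sum plus a U-statistic.
\<close>

lemma row_inner_sq:
  assumes k: "deg_kernel D A L H"
  shows "(\<integral>y. (\<Sum>i<l. H (x i) y)\<^sup>2 \<partial>D) = (\<Sum>i<l. compose_kernel H (x i) (x i)) + ustat (compose_kernel H) l x"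
proof -
  have "(\<integral>y. (\<Sum>i<l. H (x i) y)\<^sup>2 \<partial>D) = (\<integral>y. (\<Sum>i<l. \<Sum>i'<l. H (x i) y * H (x i') y) \<partial>D)"
    by (simp add: power2_eq_square sum_product)
  also have "\<dots> = (\<Sum>i<l. \<Sum>i'<l. compose_kernel H (x i) (x i'))"
    unfolding compose_kernel_def
    by (simp add: Bochner_Integration.integral_sum Bochner_Integration.integrable_sum compose_integrable[OF k])
  also have "\<dots> = (\<Sum>i<l. compose_kernel H (x i) (x i)) + ustat (compose_kernel H) l x"
    by (rule double_sum_ustat) (rule deg_kernelD(2)[OF deg_kernel_compose[OF k]])
  finally show ?thesis .
qed

lemma abs_le_sqrt_second_moment:
  assumes [measurable]: "Z \<in> borel_measurable M" and b: "\<And>\<omega>. \<bar>Z \<omega> :: real\<bar> \<le> c"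
  shows "expectation (\<lambda>\<omega>. \<bar>Z \<omega>\<bar>) \<le> sqrt (expectation (\<lambda>\<omega>. (Z \<omega>)\<^sup>2))"
proof -
  have I: "integrable M (\<lambda>\<omega>. \<bar>Z \<omega>\<bar>)" by (rule integrable_const_bound[where B=c]) (use b in auto)
  have I2: "integrable M (\<lambda>\<omega>. \<bar>Z \<omega>\<bar>\<^sup>2)" by (rule integrable_const_bound[where B="c\<^sup>2"]) (use norm_sq_le[OF b] in auto)
  have "0 \<le> variance (\<lambda>\<omega>. \<bar>Z \<omega>\<bar>)" by (rule variance_positive)
  then have "(expectation (\<lambda>\<omega>. \<bar>Z \<omega>\<bar>))\<^sup>2 \<le> expectation (\<lambda>\<omega>. \<bar>Z \<omega>\<bar>\<^sup>2)"
    using variance_eq[OF I I2] by simp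
  then show ?thesis by (simp add: real_le_rsqrt)
qed

text \<open>
  The diagonal sum has \<open>l\<close> centered independent terms of size \<open>A\<^sup>2 L\<close>, and the U-statistic has second moment at most
  \<open>2 l\<^sup>2 A\<^sup>4 L\<close>. Relative to the mean \<open>l L\<close> these are of order \<open>l\<^sup>-\<^sup>1\<^sup>/\<^sup>2\<close> and \<open>L\<^sup>-\<^sup>1\<^sup>/\<^sup>2\<close>.
\<close>

lemma cond_variance_deviation:
  assumes k: "deg_kernel D A L H" and L: "0 \<le> L"
  shows "expectation (\<lambda>\<omega>. \<bar>(\<Sum>i<l. compose_kernel H (X i \<omega>) (X i \<omega>) - kernel_var D H) + ustat (compose_kernel H) l (\<lambda>i. X i \<omega>)\<bar>)
     \<le> sqrt l * (2 * A\<^sup>2 * L) + 2 * real l * A\<^sup>2 * sqrt L"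
proof -
  let ?G = "compose_kernel H" and ?w = "kernel_var D H"
  note kG = deg_kernel_compose[OF k]
  let ?P = "\<lambda>\<omega>. \<Sum>i<l. ?G (X i \<omega>) (X i \<omega>) - ?w" and ?U = "\<lambda>\<omega>. ustat ?G l (\<lambda>i. X i \<omega>)"
  have qm: "(\<lambda>y. ?G y y - ?w) \<in> borel_measurable borel"
    by (intro borel_measurable_diff borel_measurable_const kernel_measurable_comp[OF deg_kernelD(1)[OF kG]]) auto
  have dm: "(\<lambda>y. ?G y y) \<in> borel_measurable borel"
    by (intro kernel_measurable_comp[OF deg_kernelD(1)[OF kG]]) auto
  have w: "0 \<le> ?w" "?w \<le> A\<^sup>2 * L" by (rule kernel_var_bounds[OF k])+
  have qb: "\<bar>?G y y - ?w\<bar> \<le> 2 * A\<^sup>2 * L" for y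
    using deg_kernelD(4)[OF kG, of y y] w by linarith
  have dI: "integrable D (\<lambda>y. ?G y y)"
    by (rule D.integrable_const_bound[where B="A\<^sup>2*L"]) (use deg_kernelD(4)[OF kG] dm in auto)
  have qz: "(\<integral>y. ?G y y - ?w \<partial>D) = 0"
    using dI compose_kernel_diag[OF k] by simp
  have Pm: "?P \<in> borel_measurable M"
    by (intro borel_measurable_sum measurable_compose[OF X_measurable qm])
  have Um: "?U \<in> borel_measurable M"
    unfolding ustat_wsum by (rule wsum_measurable[OF deg_kernelD(1)[OF kG]]) simp
  define cP where "cP = real l * (2 * A\<^sup>2 * L)"
  define cU where "cU = (\<Sum>j<l. \<Sum>i<j. \<bar>2\<bar> * (A\<^sup>2 * L))"
  have Pb: "\<bar>?P \<omega>\<bar> \<le> cP" for \<omega>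
  proof -
    have "\<bar>?P \<omega>\<bar> \<le> (\<Sum>i<l. \<bar>?G (X i \<omega>) (X i \<omega>) - ?w\<bar>)" by (rule sum_abs)
    also have "\<dots> \<le> (\<Sum>i<l. 2 * A\<^sup>2 * L)" by (intro sum_mono qb)
    finally show ?thesis by (simp add: cP_def)
  qed
  have Ub: "\<bar>?U \<omega>\<bar> \<le> cU" for \<omega>
    unfolding ustat_wsum cU_def by (rule wsum_bound[OF deg_kernelD(4)[OF kG]])
  have "expectation (\<lambda>\<omega>. \<bar>?P \<omega> + ?U \<omega>\<bar>) \<le> expectation (\<lambda>\<omega>. \<bar>?P \<omega>\<bar> + \<bar>?U \<omega>\<bar>)"
    by (intro integral_mono Bochner_Integration.integrable_add integrable_abs integrable_const_bound[OF _ Pm] integrable_const_bound[OF _ Um] abs_triangle_ineq)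
       (use Pb Ub in \<open>auto intro!: AE_I2\<close>)
  also have "\<dots> = expectation (\<lambda>\<omega>. \<bar>?P \<omega>\<bar>) + expectation (\<lambda>\<omega>. \<bar>?U \<omega>\<bar>)"
    by (intro Bochner_Integration.integral_add integrable_abs integrable_const_bound[OF _ Pm] integrable_const_bound[OF _ Um])
       (use Pb Ub in \<open>auto intro!: AE_I2\<close>)
  also have "\<dots> \<le> sqrt (expectation (\<lambda>\<omega>. (?P \<omega>)\<^sup>2)) + sqrt (expectation (\<lambda>\<omega>. (?U \<omega>)\<^sup>2))"
    by (intro add_mono abs_le_sqrt_second_moment[OF Pm Pb] abs_le_sqrt_second_moment[OF Um Ub])
  also have "\<dots> \<le> sqrt (real l * (2 * A\<^sup>2 * L)\<^sup>2) + sqrt ((2 * real l * A\<^sup>2 * sqrt L)\<^sup>2)"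
  proof (intro add_mono real_sqrt_le_mono)
    have "expectation (\<lambda>\<omega>. (\<Sum>i<l. 1 * (?G (X i \<omega>) (X i \<omega>) - ?w))\<^sup>2) = (\<Sum>i<l. (1::real)\<^sup>2) * (\<integral>y. (?G y y - ?w)\<^sup>2 \<partial>D)"
      by (rule weighted_sum_second_moment[OF qm qb qz])
    moreover have "(\<integral>y. (?G y y - ?w)\<^sup>2 \<partial>D) \<le> (\<integral>y. (2 * A\<^sup>2 * L)\<^sup>2 \<partial>D)"
      by (rule integral_mono') (use qb norm_sq_le in auto)
    ultimately show "expectation (\<lambda>\<omega>. (?P \<omega>)\<^sup>2) \<le> real l * (2 * A\<^sup>2 * L)\<^sup>2"
      by (simp add: mult_left_mono)
    have "expectation (\<lambda>\<omega>. (?U \<omega>)\<^sup>2) = 2 * real l * (real l - 1) * kernel_var D ?G"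
      by (rule ustat_second_moment[OF kG])
    also have "\<dots> \<le> 2 * real l * real l * ((A\<^sup>2)\<^sup>2 * L)"
    proof (cases "l = 0")
      case False
      then show ?thesis by (intro mult_mono kernel_var_bounds[OF kG] mult_nonneg_nonneg) auto
    qed simp
    also have "\<dots> \<le> (2 * real l * A\<^sup>2 * sqrt L)\<^sup>2"
      using L by (simp add: power_mult_distrib) (simp add: power2_eq_square mult_ac mult_left_mono)
    finally show "expectation (\<lambda>\<omega>. (?U \<omega>)\<^sup>2) \<le> (2 * real l * A\<^sup>2 * sqrt L)\<^sup>2" .
  qed
  also have "\<dots> = sqrt l * (2 * A\<^sup>2 * L) + 2 * real l * A\<^sup>2 * sqrt L"
    using L by (simp add: real_sqrt_mult)
  finally show ?thesis .
qed

end

section \<open>A quantitative central limit theorem and a maximal inequality\<close>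

context iid_sample
begin

text \<open>
  The replacement method applied to the normalized rows. As \<open>L \<le> n\<close>, their third absolute moments are of order
  \<open>n\<^sup>-\<^sup>3\<^sup>/\<^sup>2\<close>; their conditional variances concentrate by the preceding bound.
\<close>

theorem ustat_clt:
  assumes k: "deg_kernel D A L H" and n: "2 \<le> n" and b: "0 < b" and L: "0 < L" "L \<le> real n"
    and w: "b * L \<le> kernel_var D H" and t: "taylor3 C B g g1 g2"
  shows "\<bar>expectation (\<lambda>\<omega>. g (ustat H n (\<lambda>i. X i \<omega>) / sqrt (2 * real n * (real n - 1) * kernel_var D H))) - gauss_smooth 1 g 0\<bar>
    \<le> (B + C) * clt_const A b * (1 / sqrt n + 1 / sqrt L)"
proof -
  define w where "w = kernel_var D H"
  define s where "s = sqrt (2 * real n * (real n - 1) * w)"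
  define u v where "u = sqrt n" and "v = sqrt L"
  have uv: "0 < u" "0 < v" "real n = u\<^sup>2" "L = v\<^sup>2" "v \<le> u" using n L by (auto simp: u_def v_def)
  have w0: "0 < w" using w b L unfolding w_def by (smt (verit) mult_pos_pos)
  have s2: "s\<^sup>2 = 2 * real n * (real n - 1) * w" unfolding s_def using n w0 by simp
  have "real n \<le> 2 * (real n - 1)" using n by simp
  then have "real n * real n \<le> real n * (2 * (real n - 1))" using n by (intro mult_left_mono) auto
  then have "real n * real n * (b * L) \<le> real n * (2 * (real n - 1)) * w"
    using w b L n by (intro mult_mono) (auto simp: w_def)
  \<comment> \<open>In terms of \<open>u = \<surd>n\<close> and \<open>v = \<surd>L\<close> every estimate below is a rational inequality.\<close>
  then have s2_ge: "u^4 * b * v\<^sup>2 \<le> s\<^sup>2"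
    unfolding s2 uv by (simp add: power2_eq_square eval_nat_numeral mult_ac)
  have s_pos: "0 < s" unfolding s_def using n w0 by simp
  note CB = taylor3_nonneg[OF t] and A0 = deg_kernel_nonneg(1)[OF k]
  note bH = deg_kernelD(4)[OF k] and mH = deg_kernelD(1)[OF k]
  define dd where "dd = (\<lambda>k \<omega>. 2 * (\<Sum>i<k. H (X i \<omega>) (X k \<omega>)) / s)"
  \<comment> \<open>The expected squares of the normalized rows \<open>dd k\<close>; they add up to one.\<close>
  define Del where "Del = (\<lambda>k::nat. 4 * real k * w / s\<^sup>2)"
  define e where "e = (8 * A\<^sup>2 / b) * (1 / u^3 + 1 / (u\<^sup>2 * v))"
  define r where "r = (1 + 32 * A^4 / b\<^sup>2) / u^3"
  have S: "(\<Sum>i<k. dd i \<omega>) = ustat H k (\<lambda>i. X i \<omega>) / s" for k \<omega>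
    unfolding dd_def ustat_def by (simp add: sum_divide_distrib)
  have Sp: "ustat H k (past k \<omega>) = ustat H k (\<lambda>i. X i \<omega>)" for k \<omega>
    by (rule ustat_cong) (simp add: past_apply)
  have rowp: "(\<Sum>i<k. H (past k \<omega> i) y) = (\<Sum>i<k. H (X i \<omega>) y)" for k \<omega> y
    by (intro sum.cong) (auto simp: past_apply)
  have rb: "\<bar>\<Sum>i<k. H (x i) y\<bar> \<le> real k * (A * L)" for k x y
    using row_bound[OF bH, where a="\<lambda>_. 1" and x=x and y=y and k=k] by simp
  have um: "(\<lambda>x. ustat H k x) \<in> borel_measurable (PiM {..<k} (\<lambda>_. borel))" for k
    unfolding ustat_wsum by (rule wsum_measurable[OF mH]) measurable
  have rm: "(\<lambda>p. \<Sum>i<k. H (fst p i) (snd p)) \<in> borel_measurable (PiM {..<k} (\<lambda>_. borel) \<Otimes>\<^sub>M borel)" for k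
    using row_measurable[OF k, of "\<lambda>_. 1" k] by simp
  have rmX: "(\<lambda>\<omega>. \<Sum>i<k. H (X i \<omega>) (X k \<omega>)) \<in> borel_measurable M" for k
    by (intro borel_measurable_sum kernel_measurable_comp[OF mH]) auto
  have Del_le: "0 \<le> Del k" "Del k \<le> 2 / u\<^sup>2" if "k < n" for k
  proof -
    show "0 \<le> Del k" unfolding Del_def using w0 by simp
    have "Del k = 2 * real k / (real n * (real n - 1))"
      unfolding Del_def s2 using w0 n by (simp add: field_simps)
    also have "\<dots> \<le> 2 * (real n - 1) / (real n * (real n - 1))"
      using that n by (intro divide_right_mono) auto
    also have "\<dots> = 2 / u\<^sup>2" unfolding uv(3)[symmetric] using n by (simp add: nonzero_divide_eq_eq nonzero_eq_divide_eq)
    finally show "Del k \<le> 2 / u\<^sup>2" .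
  qed
  have sumDel: "(\<Sum>k<n. Del k) = 1"
  proof -
    have "(\<Sum>k<n. real k) = real n * (real n - 1) / 2"
      by (induction n) (auto simp: field_simps)
    moreover have "(\<Sum>k<n. Del k) = (\<Sum>k<n. real k) * (4 * w / s\<^sup>2)"
      unfolding Del_def sum_distrib_right by (intro sum.cong) auto
    ultimately have "(\<Sum>k<n. Del k) = (real n * (real n - 1) / 2) * (4 * w / s\<^sup>2)"
      by simp
    then show ?thesis unfolding s2 using n w0 by (simp add: field_simps)
  qed
  have main: "\<bar>expectation (\<lambda>\<omega>. g (\<Sum>i<n. dd i \<omega>)) - gauss_smooth (\<Sum>k<n. Del k) g 0\<bar>
     \<le> (\<Sum>k<n. B * e / 2 + C * r + 2 * C * sqrt (Del k) ^ 3)"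
  proof (rule martingale_lindeberg[OF t, where c="2 * (real n * (A * L)) / s"])
    fix k assume kn: "k < n"
    show "dd k \<in> borel_measurable M" unfolding dd_def using rmX[of k] by measurable
    show "\<bar>dd k \<omega>\<bar> \<le> 2 * (real n * (A * L)) / s" for \<omega>
    proof -
      have "\<bar>dd k \<omega>\<bar> = 2 * \<bar>\<Sum>i<k. H (X i \<omega>) (X k \<omega>)\<bar> / s"
        unfolding dd_def using s_pos by (simp add: abs_mult)
      also have "\<dots> \<le> 2 * (real n * (A * L)) / s"
        using order_trans[OF rb[of "\<lambda>i. X i \<omega>" "X k \<omega>" k] mult_right_mono[of "real k" "real n", OF _ deg_kernel_nonneg(2)[OF k]]] kn s_pos
        by (intro divide_right_mono mult_left_mono) auto
      finally show ?thesis .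
    qed
    show "0 \<le> Del k" by (rule Del_le(1)[OF kn])
    have d2I: "integrable M (\<lambda>\<omega>. (dd k \<omega>)\<^sup>2)" and d4I: "integrable M (\<lambda>\<omega>. (dd k \<omega>)^4)"
    proof -
      have [measurable]: "dd k \<in> borel_measurable M" by fact
      have bb: "\<bar>dd k \<omega>\<bar> \<le> 2 * (real n * (A * L)) / s" for \<omega> by fact
      show "integrable M (\<lambda>\<omega>. (dd k \<omega>)\<^sup>2)"
        by (rule integrable_const_bound[where B="(2 * (real n * (A * L)) / s)\<^sup>2"]) (use norm_sq_le[OF bb] in auto)
      have "norm ((dd k \<omega>)^4) \<le> (2 * (real n * (A * L)) / s)^4" for \<omega>
        unfolding real_norm_def power_abs by (rule power_mono[OF bb]) simp
      then show "integrable M (\<lambda>\<omega>. (dd k \<omega>)^4)"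
        by (intro integrable_const_bound[where B="(2 * (real n * (A * L)) / s)^4"] AE_I2) auto
    qed
    show "expectation (\<lambda>\<omega>. \<bar>dd k \<omega>\<bar>^3) \<le> r"
    proof -
      have E2: "expectation (\<lambda>\<omega>. (dd k \<omega>)\<^sup>2) \<le> 2 / u\<^sup>2"
      proof -
        have "expectation (\<lambda>\<omega>. (dd k \<omega>)\<^sup>2) = 4 / s\<^sup>2 * expectation (\<lambda>\<omega>. (\<Sum>i<k. 1 * H (X i \<omega>) (X k \<omega>))\<^sup>2)"
          unfolding dd_def by (simp add: power_divide power_mult_distrib)
        also have "\<dots> = Del k" unfolding row_second_moment[OF k] Del_def w_def by simp
        finally show ?thesis using Del_le(2)[OF kn] by simp
      qed
      have E4: "expectation (\<lambda>\<omega>. (dd k \<omega>)^4) \<le> 64 * A^4 / (b\<^sup>2 * u^4)"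
      proof -
        have "expectation (\<lambda>\<omega>. (dd k \<omega>)^4) = 16 / s^4 * expectation (\<lambda>\<omega>. (\<Sum>i<k. H (X i \<omega>) (X k \<omega>))^4)"
          unfolding dd_def by (simp add: power_divide power_mult_distrib)
        also have "\<dots> \<le> 16 / s^4 * (k * (A^4 * L^3) + 3 * (real k)\<^sup>2 * (A\<^sup>2 * L)\<^sup>2)"
          by (intro mult_left_mono row_fourth_moment[OF k]) auto
        also have "\<dots> \<le> 16 / s^4 * (real n * (A^4 * (L\<^sup>2 * real n)) + 3 * (real n)\<^sup>2 * (A\<^sup>2 * L)\<^sup>2)"
        proof (intro mult_left_mono add_mono mult_mono power_mono order_refl)
          show "L^3 \<le> L\<^sup>2 * real n" using L by (simp add: power3_eq_cube power2_eq_square mult_left_mono)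
        qed (use kn L A0 in auto)
        also have "\<dots> = 64 * A^4 * (u^4 * v^4) / s^4"
          unfolding uv by (simp add: power2_eq_square eval_nat_numeral field_simps)
        also have "\<dots> \<le> 64 * A^4 * (u^4 * v^4) / (u^4 * b * v\<^sup>2)\<^sup>2"
        proof (rule divide_left_mono)
          have "(u^4 * b * v\<^sup>2)\<^sup>2 \<le> (s\<^sup>2)\<^sup>2" using s2_ge uv b by (intro power_mono) auto
          then show "(u^4 * b * v\<^sup>2)\<^sup>2 \<le> s^4" by (simp add: power_mult[symmetric])
        qed (use uv b s_pos A0 in auto)
        also have "\<dots> = 64 * A^4 / (b\<^sup>2 * u^4)"
          using uv b by (simp add: field_simps power2_eq_square eval_nat_numeral)
        finally show ?thesis .
      qed
      \<comment> \<open>Interpolating the third moment between the second and the fourth, balanced for increments of size \<open>1 / u\<close>.\<close>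
      have "expectation (\<lambda>\<omega>. \<bar>dd k \<omega>\<bar>^3) \<le> expectation (\<lambda>\<omega>. (dd k \<omega>)\<^sup>2 / (2 * u) + u / 2 * (dd k \<omega>)^4)"
      proof (rule integral_mono')
        show "integrable M (\<lambda>\<omega>. (dd k \<omega>)\<^sup>2 / (2 * u) + u / 2 * (dd k \<omega>)^4)" using d2I d4I by simp
        fix \<omega>
        have "0 \<le> (1 - u * \<bar>dd k \<omega>\<bar>)\<^sup>2 * (\<bar>dd k \<omega>\<bar>\<^sup>2 / (2 * u))" using uv by simp
        also have "\<dots> = \<bar>dd k \<omega>\<bar>\<^sup>2 / (2 * u) + u / 2 * \<bar>dd k \<omega>\<bar>^4 - \<bar>dd k \<omega>\<bar>^3"
          using uv by (simp add: field_simps power2_eq_square eval_nat_numeral del: power2_abs abs_mult_self_eq)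
        finally show "\<bar>dd k \<omega>\<bar>^3 \<le> (dd k \<omega>)\<^sup>2 / (2 * u) + u / 2 * (dd k \<omega>)^4"
          by (simp add: power_even_abs)
        show "0 \<le> (dd k \<omega>)\<^sup>2 / (2 * u) + u / 2 * (dd k \<omega>)^4" using uv by simp
      qed
      also have "\<dots> = expectation (\<lambda>\<omega>. (dd k \<omega>)\<^sup>2) / (2 * u) + u / 2 * expectation (\<lambda>\<omega>. (dd k \<omega>)^4)"
        using d2I d4I by simp
      also have "\<dots> \<le> (2 / u\<^sup>2) / (2 * u) + u / 2 * (64 * A^4 / (b\<^sup>2 * u^4))"
        using E2 E4 uv by (intro add_mono divide_right_mono mult_left_mono) auto
      also have "\<dots> = r" unfolding r_def using uv b by (simp add: field_simps power2_eq_square eval_nat_numeral)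
      finally show ?thesis .
    qed
    fix \<zeta> :: "real \<Rightarrow> real" and b' :: real
    assume zm[measurable]: "\<zeta> \<in> borel_measurable borel" and zb: "\<And>x. \<bar>\<zeta> x\<bar> \<le> b'"
    have zm': "(\<lambda>x. \<zeta> (ustat H k x / s)) \<in> borel_measurable (PiM {..<k} (\<lambda>_. borel))"
      using um[of k] by measurable
    have b'0: "0 \<le> b'" using zb[of 0] by linarith
    have "expectation (\<lambda>\<omega>. \<zeta> (ustat H k (past k \<omega>) / s) * (\<Sum>i<k. (2 / s) * H (X i \<omega>) (X k \<omega>))) = 0"
      by (rule row_orthogonal[OF k zm' zb])
    moreover have "dd k \<omega> = (\<Sum>i<k. (2 / s) * H (X i \<omega>) (X k \<omega>))" for \<omega>
      by (simp add: dd_def sum_distrib_left sum_divide_distrib)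
    ultimately show "expectation (\<lambda>\<omega>. \<zeta> (\<Sum>i<k. dd i \<omega>) * dd k \<omega>) = 0"
      unfolding S Sp by simp
    have ddk: "dd k \<omega> = 2 * (\<Sum>i<k. H (X i \<omega>) (X k \<omega>)) / s" for \<omega>
      by (simp add: dd_def)
    define Z where "Z = (\<lambda>x :: nat \<Rightarrow> real. (\<Sum>i<k. compose_kernel H (x i) (x i) - w) + ustat (compose_kernel H) k x)"
    have Zp: "Z (past k \<omega>) = Z (\<lambda>i. X i \<omega>)" for \<omega>
      unfolding Z_def by (intro arg_cong2[where f="(+)"] sum.cong ustat_cong) (auto simp: past_apply)
    note kG = deg_kernel_compose[OF k]
    have "expectation (\<lambda>\<omega>. \<zeta> (ustat H k (past k \<omega>) / s) * ((2 * (\<Sum>i<k. H (past k \<omega> i) (X k \<omega>)) / s)\<^sup>2 - Del k))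
       = expectation (\<lambda>\<omega>. \<integral>y. \<zeta> (ustat H k (past k \<omega>) / s) * ((2 * (\<Sum>i<k. H (past k \<omega> i) y) / s)\<^sup>2 - Del k) \<partial>D)"
    proof (rule expectation_fresh(1)[where c="b' * ((2 * (real k * (A * L)) / s)\<^sup>2 + Del k)"])
      show "(\<lambda>p. \<zeta> (ustat H k (fst p) / s) * ((2 * (\<Sum>i<k. H (fst p i) (snd p)) / s)\<^sup>2 - Del k))
         \<in> borel_measurable (PiM {..<k} (\<lambda>_. borel) \<Otimes>\<^sub>M borel)"
        using rm[of k] measurable_compose[OF measurable_fst zm'] by measurable
      fix x y
      have "\<bar>2 * (\<Sum>i<k. H (x i) y) / s\<bar> \<le> 2 * (real k * (A * L)) / s"
        using rb[of x y k] s_pos by (simp add: abs_mult divide_right_mono)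
      from norm_sq_le[OF this]
      have "\<bar>(2 * (\<Sum>i<k. H (x i) y) / s)\<^sup>2 - Del k\<bar> \<le> (2 * (real k * (A * L)) / s)\<^sup>2 + Del k"
        using Del_le(1)[OF kn] unfolding real_norm_def by linarith
      then show "\<bar>\<zeta> (ustat H k x / s) * ((2 * (\<Sum>i<k. H (x i) y) / s)\<^sup>2 - Del k)\<bar> \<le> b' * ((2 * (real k * (A * L)) / s)\<^sup>2 + Del k)"
        unfolding abs_mult using zb b'0 by (intro mult_mono) auto
    qed
    also have "\<dots> = expectation (\<lambda>\<omega>. \<zeta> (ustat H k (past k \<omega>) / s) * (4 / s\<^sup>2 * Z (past k \<omega>)))"
    proof (rule Bochner_Integration.integral_cong[OF refl])
      fix \<omega>
      let ?x = "past k \<omega>"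
      have [measurable]: "(\<lambda>y. \<Sum>i<k. H (?x i) y) \<in> borel_measurable borel"
        by (intro borel_measurable_sum kernel_section_measurable[OF mH])
      have I: "integrable D (\<lambda>y. (\<Sum>i<k. H (?x i) y)\<^sup>2)"
        by (rule D.integrable_const_bound[where B="(real k * (A*L))\<^sup>2"]) (use norm_sq_le[OF rb] in auto)
      have "(\<integral>y. \<zeta> (ustat H k ?x / s) * ((2 * (\<Sum>i<k. H (?x i) y) / s)\<^sup>2 - Del k) \<partial>D)
        = (\<integral>y. \<zeta> (ustat H k ?x / s) * (4 / s\<^sup>2 * (\<Sum>i<k. H (?x i) y)\<^sup>2 - Del k) \<partial>D)"
        by (simp add: power_divide power_mult_distrib)
      also have "\<dots> = \<zeta> (ustat H k ?x / s) * (4 / s\<^sup>2 * (\<integral>y. (\<Sum>i<k. H (?x i) y)\<^sup>2 \<partial>D) - Del k)"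
        using I by simp
      also have "\<dots> = \<zeta> (ustat H k ?x / s) * (4 / s\<^sup>2 * Z ?x)"
        unfolding row_inner_sq[OF k] Z_def Del_def by (simp add: sum_subtractf right_diff_distrib distrib_left)
      finally show "(\<integral>y. \<zeta> (ustat H k ?x / s) * ((2 * (\<Sum>i<k. H (?x i) y) / s)\<^sup>2 - Del k) \<partial>D) = \<zeta> (ustat H k ?x / s) * (4 / s\<^sup>2 * Z ?x)" .
    qed
    finally have eq: "expectation (\<lambda>\<omega>. \<zeta> (\<Sum>i<k. dd i \<omega>) * ((dd k \<omega>)\<^sup>2 - Del k))
       = expectation (\<lambda>\<omega>. \<zeta> (ustat H k (\<lambda>i. X i \<omega>) / s) * (4 / s\<^sup>2 * Z (\<lambda>i. X i \<omega>)))"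
      unfolding S Sp Zp rowp ddk .
    have Zm: "(\<lambda>\<omega>. Z (\<lambda>i. X i \<omega>)) \<in> borel_measurable M"
      unfolding Z_def ustat_wsum
      by (intro borel_measurable_add borel_measurable_sum borel_measurable_diff borel_measurable_const
          wsum_measurable[OF deg_kernelD(1)[OF kG]] kernel_measurable_comp[OF deg_kernelD(1)[OF kG]]) auto
    define cZ where "cZ = (\<Sum>i<k. A\<^sup>2 * L + w) + (\<Sum>j<k. \<Sum>i<j. \<bar>2\<bar> * (A\<^sup>2 * L))"
    have Zb: "\<bar>Z x\<bar> \<le> cZ" for x
    proof -
      have "\<bar>\<Sum>i<k. compose_kernel H (x i) (x i) - w\<bar> \<le> (\<Sum>i<k. \<bar>compose_kernel H (x i) (x i) - w\<bar>)" by (rule sum_abs)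
      also have "\<dots> \<le> (\<Sum>i<k. A\<^sup>2 * L + w)"
      proof (rule sum_mono)
        fix i show "\<bar>compose_kernel H (x i) (x i) - w\<bar> \<le> A\<^sup>2 * L + w"
          using deg_kernelD(4)[OF kG, of "x i" "x i"] w0 by linarith
      qed
      finally show ?thesis
        using wsum_bound[where H="compose_kernel H" and a="\<lambda>_ _. 2" and n=k and x=x, OF deg_kernelD(4)[OF kG]]
        unfolding Z_def cZ_def ustat_wsum by linarith
    qed
    have ZI: "integrable M (\<lambda>\<omega>. \<bar>Z (\<lambda>i. X i \<omega>)\<bar>)"
      by (rule integrable_abs, rule integrable_const_bound[OF _ Zm]) (use Zb in auto)
    have "\<bar>expectation (\<lambda>\<omega>. \<zeta> (ustat H k (\<lambda>i. X i \<omega>) / s) * (4 / s\<^sup>2 * Z (\<lambda>i. X i \<omega>)))\<bar>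
       \<le> expectation (\<lambda>\<omega>. \<bar>\<zeta> (ustat H k (\<lambda>i. X i \<omega>) / s) * (4 / s\<^sup>2 * Z (\<lambda>i. X i \<omega>))\<bar>)"
      by (rule integral_abs_bound)
    also have "\<dots> \<le> expectation (\<lambda>\<omega>. b' * (4 / s\<^sup>2 * \<bar>Z (\<lambda>i. X i \<omega>)\<bar>))"
      by (rule integral_mono') (use ZI zb b'0 s_pos in \<open>auto simp: abs_mult intro!: mult_right_mono divide_right_mono\<close>)
    also have "\<dots> = b' * (4 / s\<^sup>2 * expectation (\<lambda>\<omega>. \<bar>Z (\<lambda>i. X i \<omega>)\<bar>))" by simp
    also have "\<dots> \<le> b' * e"
    proof (rule mult_left_mono[OF _ b'0])
      have "expectation (\<lambda>\<omega>. \<bar>Z (\<lambda>i. X i \<omega>)\<bar>) \<le> sqrt k * (2 * A\<^sup>2 * L) + 2 * real k * A\<^sup>2 * sqrt L"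
        unfolding Z_def w_def using cond_variance_deviation[OF k] L by simp
      also have "\<dots> \<le> u * (2 * A\<^sup>2 * v\<^sup>2) + 2 * u\<^sup>2 * A\<^sup>2 * v"
        unfolding v_def[symmetric] uv(4)[symmetric] using kn uv(2,3) L unfolding u_def
        by (intro add_mono mult_right_mono mult_left_mono) auto
      finally have "4 / s\<^sup>2 * expectation (\<lambda>\<omega>. \<bar>Z (\<lambda>i. X i \<omega>)\<bar>) \<le> 4 / (u^4 * b * v\<^sup>2) * (u * (2 * A\<^sup>2 * v\<^sup>2) + 2 * u\<^sup>2 * A\<^sup>2 * v)"
        using s2_ge uv b s_pos by (intro mult_mono divide_left_mono) auto
      also have "\<dots> = e" unfolding e_def using uv b by (simp add: field_simps power2_eq_square eval_nat_numeral)
      finally show "4 / s\<^sup>2 * expectation (\<lambda>\<omega>. \<bar>Z (\<lambda>i. X i \<omega>)\<bar>) \<le> e" .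
    qed
    finally show "\<bar>expectation (\<lambda>\<omega>. \<zeta> (\<Sum>i<k. dd i \<omega>) * ((dd k \<omega>)\<^sup>2 - Del k))\<bar> \<le> b' * e"
      unfolding eq .
  qed
  also have "\<dots> \<le> (\<Sum>k<n. B * e / 2 + C * r + 2 * C * (3 / u^3))"
  proof (intro sum_mono add_mono mult_left_mono order_refl)
    fix k assume "k \<in> {..<n}"
    then have "sqrt (Del k) ^ 3 \<le> (sqrt 2 / u) ^ 3"
      using Del_le[of k] uv by (intro power_mono real_le_lsqrt) (auto simp: power_divide)
    also have "\<dots> = 2 * sqrt 2 / u^3" by (simp add: power_divide power3_eq_cube)
    also have "\<dots> \<le> 3 / u^3"
    proof -
      have "sqrt 2 \<le> 3 / 2" by (rule real_le_lsqrt) (auto simp: power2_eq_square)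
      then show ?thesis using uv by (intro divide_right_mono) auto
    qed
    finally show "sqrt (Del k) ^ 3 \<le> 3 / u^3" .
  qed (use CB in auto)
  also have "\<dots> = u\<^sup>2 * (B * e / 2 + C * r + 2 * C * (3 / u^3))" by (simp add: uv(3)[symmetric])
  also have "\<dots> = B * (4 * A\<^sup>2 / b) * (1 / u + 1 / v) + C * (7 + 32 * A^4 / b\<^sup>2) * (1 / u)"
    unfolding e_def r_def using uv b by (simp add: field_simps power2_eq_square eval_nat_numeral)
  also have "\<dots> \<le> B * clt_const A b * (1 / u + 1 / v) + C * clt_const A b * (1 / u + 1 / v)"
  proof -
    have "0 \<le> 4 * A\<^sup>2 / b" "0 \<le> 32 * A^4 / b\<^sup>2" using b by auto
    then have c: "4 * A\<^sup>2 / b \<le> clt_const A b" "7 + 32 * A^4 / b\<^sup>2 \<le> clt_const A b" "0 \<le> clt_const A b"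
      unfolding clt_const_def by linarith+
    show ?thesis
      by (intro add_mono[of "B * (4 * A\<^sup>2 / b) * (1 / u + 1 / v)"] mult_mono mult_left_mono mult_nonneg_nonneg c CB)
         (use uv c(3) CB in auto)
  qed
  also have "\<dots> = (B + C) * clt_const A b * (1 / u + 1 / v)" by (simp add: algebra_simps)
  finally show ?thesis unfolding S sumDel unfolding s_def w_def u_def v_def .
qed

text \<open>
  Doob's inequality for the submartingale \<open>g (U / s - y)\<close>, by stopping at the first passage: convexity gives
  \<open>g (U\<^sub>m) + g1 (U\<^sub>m) (U\<^sub>N - U\<^sub>m) \<le> g (U\<^sub>N)\<close>, and the linear term has mean zero on the event that \<open>m\<close> is the first
  passage. The right-hand side has a smooth test function, so the central limit theorem applies to it directly.
\<close>

theorem ustat_maximal: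
  assumes k: "deg_kernel D A L H" and s: "0 < s" and t: "taylor3 C B g g1 g2"
    and g0: "\<And>u. 0 \<le> g u" and g1': "\<And>u. 1 \<le> u \<Longrightarrow> 1 \<le> g u"
    and convex: "\<And>a b. g a + g1 a * (b - a) \<le> g b"
  shows "prob {\<omega>\<in>space M. \<exists>m\<le>N. s * (y + 1) \<le> ustat H m (\<lambda>i. X i \<omega>)}
     \<le> expectation (\<lambda>\<omega>. g (ustat H N (\<lambda>i. X i \<omega>) / s - y))"
proof -
  let ?U = "\<lambda>m \<omega>. ustat H m (\<lambda>i. X i \<omega>)"
  let ?E = "{\<omega>\<in>space M. \<exists>m\<le>N. s * (y + 1) \<le> ?U m \<omega>}"
  note [measurable] = taylor3D(1-3)[OF t]
  note bH = deg_kernelD(4)[OF k] and mH = deg_kernelD(1)[OF k]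
  have Um[measurable]: "?U m \<in> borel_measurable M" for m
    unfolding ustat_wsum by (rule wsum_measurable[OF mH]) simp
  have um: "(\<lambda>x. ustat H m x) \<in> borel_measurable (PiM {..<k} (\<lambda>_. borel))" if "m \<le> k" for m k
    unfolding ustat_wsum by (rule wsum_measurable[OF mH], rule measurable_component_singleton) (use that in auto)
  define K where "K m = (\<Sum>l<m. \<Sum>i<l. \<bar>2\<bar> * (A * L))" for m :: nat
  have ub: "\<bar>ustat H m x\<bar> \<le> K m" for m x
    unfolding ustat_wsum K_def by (rule wsum_bound[OF bH])
  define K' where "K' m = K m / s + \<bar>y\<bar>" for m
  have ub': "\<bar>ustat H m x / s - y\<bar> \<le> K' m" for m x
  proof -
    have "\<bar>ustat H m x / s\<bar> \<le> K m / s" using ub[of m x] s by (simp add: divide_right_mono)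
    then show ?thesis unfolding K'_def by linarith
  qed
  \<comment> \<open>First passage over the level at time \<open>m\<close>, as a property of the first \<open>m\<close> observations.\<close>
  define hit where "hit m x \<longleftrightarrow> s * (y + 1) \<le> ustat H m x \<and> (\<forall>m'<m. \<not> s * (y + 1) \<le> ustat H m' x)" for m x
  define z where "z m x = (if hit m x then g1 (ustat H m x / s - y) / s else 0)" for m x
  have zm: "z m \<in> borel_measurable (PiM {..<m} (\<lambda>_. borel))" for m
  proof -
    \<comment> \<open>The minimum keeps earlier times measurable with respect to the first \<open>m\<close> coordinates.\<close>
    have [measurable]: "(\<lambda>x. ustat H (min m' m) x) \<in> borel_measurable (PiM {..<m} (\<lambda>_. borel))" for m'
      by (rule um) simp
    have [measurable]: "(\<lambda>x. ustat H m x) \<in> borel_measurable (PiM {..<m} (\<lambda>_. borel))"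
      by (rule um) simp
    have "hit m = (\<lambda>x. s * (y + 1) \<le> ustat H m x \<and> (\<forall>m'. m' < m \<longrightarrow> \<not> s * (y + 1) \<le> ustat H (min m' m) x))"
      unfolding hit_def by (auto simp: fun_eq_iff min_def)
    also have "Measurable.pred (PiM {..<m} (\<lambda>_. borel)) \<dots>" by measurable
    finally have [measurable]: "Measurable.pred (PiM {..<m} (\<lambda>_. borel)) (hit m)" .
    show ?thesis unfolding z_def by measurable
  qed
  have "\<exists>c. \<forall>x. \<bar>z m x\<bar> \<le> c" for m
  proof -
    obtain c where c: "\<And>x. \<bar>x\<bar> \<le> K' m \<Longrightarrow> \<bar>g1 x\<bar> \<le> c" using taylor3_bounded_on(2)[OF t, of "K' m"] by blast
    have "\<bar>z m x\<bar> \<le> \<bar>c\<bar> / s" for x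
      unfolding z_def using c[OF ub'[of m x]] s by (auto simp: divide_right_mono)
    then show ?thesis by blast
  qed
  then obtain c where c: "\<And>m x. \<bar>z m x\<bar> \<le> c m" by metis
  have zp: "z m (past m \<omega>) = z m (\<lambda>i. X i \<omega>)" for m \<omega>
  proof -
    have "ustat H m' (past m \<omega>) = ?U m' \<omega>" if "m' \<le> m" for m' by (rule ustat_cong) (use that in \<open>simp add: past_apply\<close>)
    then show ?thesis unfolding z_def hit_def by auto
  qed
  have orth: "expectation (\<lambda>\<omega>. z m (\<lambda>i. X i \<omega>) * (?U N \<omega> - ?U m \<omega>)) = 0" if "m \<le> N" for m
    using ustat_orthogonal[OF k that zm c] by (simp add: zp)
  have zX: "(\<lambda>\<omega>. z m (\<lambda>i. X i \<omega>)) \<in> borel_measurable M" for m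
    using measurable_compose[OF past_measurable zm[of m]] by (simp add: zp)
  have zI: "integrable M (\<lambda>\<omega>. z m (\<lambda>i. X i \<omega>) * (?U N \<omega> - ?U m \<omega>))" for m
  proof (rule integrable_const_bound[where B="c m * (K N + K m)"])
    show "AE \<omega> in M. norm (z m (\<lambda>i. X i \<omega>) * (?U N \<omega> - ?U m \<omega>)) \<le> c m * (K N + K m)"
    proof (rule AE_I2)
      fix \<omega>
      have "\<bar>?U N \<omega> - ?U m \<omega>\<bar> \<le> K N + K m" using ub[of N "\<lambda>i. X i \<omega>"] ub[of m "\<lambda>i. X i \<omega>"] by linarith
      then show "norm (z m (\<lambda>i. X i \<omega>) * (?U N \<omega> - ?U m \<omega>)) \<le> c m * (K N + K m)"
        unfolding real_norm_def abs_mult using c[of m "\<lambda>i. X i \<omega>"] by (intro mult_mono) auto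
    qed
  qed (use zX in measurable)
  obtain cg where cg: "\<And>x. \<bar>x\<bar> \<le> K' N \<Longrightarrow> \<bar>g x\<bar> \<le> cg" using taylor3_bounded_on(1)[OF t, of "K' N"] by blast
  have gI: "integrable M (\<lambda>\<omega>. g (?U N \<omega> / s - y))"
    by (rule integrable_const_bound[where B=cg]) (use cg[OF ub'] in auto)
  have E: "?E \<in> sets M" by measurable
  have EI: "integrable M (\<lambda>\<omega>. indicator ?E \<omega> :: real)"
    by (rule integrable_real_indicator[OF E]) (simp add: emeasure_eq_measure)
  have "prob ?E = expectation (\<lambda>\<omega>. indicator ?E \<omega>)" using E by simp
  also have "\<dots> \<le> expectation (\<lambda>\<omega>. g (?U N \<omega> / s - y) - (\<Sum>m\<le>N. z m (\<lambda>i. X i \<omega>) * (?U N \<omega> - ?U m \<omega>)))"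
  proof (rule integral_mono)
    fix \<omega> assume w: "\<omega> \<in> space M"
    let ?x = "\<lambda>i. X i \<omega>"
    show "indicator ?E \<omega> \<le> g (?U N \<omega> / s - y) - (\<Sum>m\<le>N. z m ?x * (?U N \<omega> - ?U m \<omega>))"
    proof (cases "\<exists>m\<le>N. s * (y + 1) \<le> ?U m \<omega>")
      case False
      then have "z m ?x = 0" if "m \<le> N" for m using that by (auto simp: z_def hit_def)
      then have "(\<Sum>m\<le>N. z m ?x * (?U N \<omega> - ?U m \<omega>)) = 0" by (intro sum.neutral) auto
      then show ?thesis using False g0 by auto
    next
      case True
      define m0 where "m0 = (LEAST m. s * (y + 1) \<le> ?U m \<omega>)"
      have m0: "s * (y + 1) \<le> ?U m0 \<omega>" "m0 \<le> N" "\<And>m'. m' < m0 \<Longrightarrow> \<not> s * (y + 1) \<le> ?U m' \<omega>"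
        unfolding m0_def using True
        by (auto intro: LeastI dest: not_less_Least) (meson Least_le order_trans)
      have h: "hit m ?x \<longleftrightarrow> m = m0" for m
      proof
        assume "hit m ?x" then show "m = m0"
          unfolding hit_def using m0 by (meson linorder_neqE_nat)
      qed (use m0 in \<open>auto simp: hit_def\<close>)
      have "(\<Sum>m\<le>N. z m ?x * (?U N \<omega> - ?U m \<omega>)) = (\<Sum>m\<in>{m0}. z m ?x * (?U N \<omega> - ?U m \<omega>))"
        by (rule sum.mono_neutral_right) (use m0(2) h in \<open>auto simp: z_def\<close>)
      also have "\<dots> = g1 (?U m0 \<omega> / s - y) * ((?U N \<omega> / s - y) - (?U m0 \<omega> / s - y))"
        using s h by (simp add: z_def field_simps)
      finally have "g (?U m0 \<omega> / s - y) \<le> g (?U N \<omega> / s - y) - (\<Sum>m\<le>N. z m ?x * (?U N \<omega> - ?U m \<omega>))"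
        using convex[of "?U m0 \<omega> / s - y" "?U N \<omega> / s - y"] by linarith
      moreover have "1 \<le> g (?U m0 \<omega> / s - y)"
        using m0(1) s by (intro g1') (simp add: field_simps)
      ultimately show ?thesis using True w by auto
    qed
  qed (use gI zI EI in \<open>auto intro!: Bochner_Integration.integrable_diff Bochner_Integration.integrable_sum\<close>)
  also have "\<dots> = expectation (\<lambda>\<omega>. g (?U N \<omega> / s - y)) - (\<Sum>m\<le>N. expectation (\<lambda>\<omega>. z m (\<lambda>i. X i \<omega>) * (?U N \<omega> - ?U m \<omega>)))"
    using gI zI by (simp add: Bochner_Integration.integral_sum Bochner_Integration.integrable_sum)
  also have "\<dots> = expectation (\<lambda>\<omega>. g (?U N \<omega> / s - y))" using orth by simp
  finally show ?thesis .
qed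

end

section \<open>Tail bounds for degenerate U-statistics\<close>

definition cube_plus :: "real \<Rightarrow> real" where "cube_plus u = (max 0 u)^3"

text \<open>
  The second derivative \<open>6 max 0 x\<close> is Lipschitz with constant six, so the remainder of order three has constant one.
  Differences of truncated cubes are the test functions.
\<close>

lemma cube_plus_taylor:
  "\<bar>cube_plus (x + y) - cube_plus x - 3 * (max 0 x)\<^sup>2 * y - 6 * max 0 x * y\<^sup>2 / 2\<bar> \<le> \<bar>y\<bar>^3"
proof -
  consider "0 \<le> x" "0 \<le> x + y" | "0 \<le> x" "x + y < 0" | "x < 0" "0 \<le> x + y" | "x < 0" "x + y < 0" by linarith
  then show ?thesis
  proof cases
    case 1
    have "(x + y)^3 - x^3 - 3 * x\<^sup>2 * y - 6 * x * y\<^sup>2 / 2 = y^3"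
      by (simp add: power2_eq_square power3_eq_cube algebra_simps)
    then show ?thesis using 1 by (simp add: cube_plus_def power_abs)
  next
    case 2
    define t where "t = - (x + y)"
    have t: "0 < t" "y = - (x + t)" using 2 by (auto simp: t_def)
    have "0 - x^3 - 3 * x\<^sup>2 * y - 6 * x * y\<^sup>2 / 2 = t^3 - (x + t)^3"
      unfolding t(2) by (simp add: power2_eq_square power3_eq_cube algebra_simps)
    moreover have "t^3 \<le> (x + t)^3" "0 \<le> t^3" using 2 t by (auto intro!: power_mono)
    moreover have "\<bar>y\<bar> = x + t" using 2 t by simp
    ultimately show ?thesis using 2 by (simp add: cube_plus_def)
  next
    case 3
    have "(x + y)^3 \<le> y^3" "0 \<le> (x+y)^3" using 3 by (auto intro!: power_mono)
    then show ?thesis using 3 by (simp add: cube_plus_def)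
  next
    case 4
    then show ?thesis by (simp add: cube_plus_def)
  qed
qed

text \<open>
  A convex function which vanishes on the negative half-line, is at least one from \<open>u = 1\<close> on, and has a second derivative bounded
  and Lipschitz; the second derivative is \<open>6 min (max 0 u) 1\<close>.
\<close>

definition convex_test :: "real \<Rightarrow> real" where
  "convex_test u = cube_plus u - cube_plus (u - 1)"
definition convex_test1 :: "real \<Rightarrow> real" where
  "convex_test1 u = 3 * (max 0 u)\<^sup>2 - 3 * (max 0 (u - 1))\<^sup>2"
definition convex_test2 :: "real \<Rightarrow> real" where
  "convex_test2 u = 6 * max 0 u - 6 * max 0 (u - 1)"

text \<open>
  Six times an integrated quadratic B-spline: it rises from zero to six between \<open>u = 0\<close> and \<open>u = 3\<close>, and is at least one
  from \<open>u = 1\<close> on. It bounds six times an indicator function from below.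
\<close>

definition step_test :: "real \<Rightarrow> real" where
  "step_test u = cube_plus u - 3 * cube_plus (u - 1) + 3 * cube_plus (u - 2) - cube_plus (u - 3)"
definition step_test1 :: "real \<Rightarrow> real" where
  "step_test1 u = 3 * (max 0 u)\<^sup>2 - 9 * (max 0 (u - 1))\<^sup>2 + 9 * (max 0 (u - 2))\<^sup>2 - 3 * (max 0 (u - 3))\<^sup>2"
definition step_test2 :: "real \<Rightarrow> real" where
  "step_test2 u = 6 * max 0 u - 18 * max 0 (u - 1) + 18 * max 0 (u - 2) - 6 * max 0 (u - 3)"

lemma taylor3_convex_test: "taylor3 2 6 (\<lambda>u. convex_test (u - a)) (\<lambda>u. convex_test1 (u - a)) (\<lambda>u. convex_test2 (u - a))"
  unfolding taylor3_def
proof (intro conjI allI)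
  fix x y :: real
  have "x + y - a = (x - a) + y" "x + y - a - 1 = (x - a - 1) + y" by auto
  then show "\<bar>convex_test (x + y - a) - convex_test (x - a) - convex_test1 (x - a) * y - convex_test2 (x - a) * y\<^sup>2 / 2\<bar> \<le> 2 * \<bar>y\<bar>^3"
    using cube_plus_taylor[of "x - a" y] cube_plus_taylor[of "x - a - 1" y]
    unfolding convex_test_def convex_test1_def convex_test2_def left_diff_distrib diff_divide_distrib
    by (smt (verit))
  show "\<bar>convex_test2 (x - a)\<bar> \<le> 6" unfolding convex_test2_def by (auto simp: max_def abs_le_iff)
qed (auto simp: convex_test_def convex_test1_def convex_test2_def cube_plus_def)

lemma taylor3_step_test: "taylor3 8 6 (\<lambda>u. step_test (u - a)) (\<lambda>u. step_test1 (u - a)) (\<lambda>u. step_test2 (u - a))"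
  unfolding taylor3_def
proof (intro conjI allI)
  fix x y :: real
  define T where "T x = cube_plus (x + y) - cube_plus x - 3 * (max 0 x)\<^sup>2 * y - 6 * max 0 x * y\<^sup>2 / 2" for x
  have "x + y - a = (x - a) + y" "x + y - a - 1 = (x - a - 1) + y" "x + y - a - 2 = (x - a - 2) + y" "x + y - a - 3 = (x - a - 3) + y" by auto
  then have "step_test (x + y - a) - step_test (x - a) - step_test1 (x - a) * y - step_test2 (x - a) * y\<^sup>2 / 2
      = T (x - a) - 3 * T (x - a - 1) + 3 * T (x - a - 2) - T (x - a - 3)"
    unfolding step_test_def step_test1_def step_test2_def T_def by (simp add: field_simps)
  moreover have "\<bar>T x\<bar> \<le> \<bar>y\<bar>^3" for x unfolding T_def by (rule cube_plus_taylor)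
  from this[of "x - a"] this[of "x - a - 1"] this[of "x - a - 2"] this[of "x - a - 3"]
  have "\<bar>T (x - a) - 3 * T (x - a - 1) + 3 * T (x - a - 2) - T (x - a - 3)\<bar> \<le> 8 * \<bar>y\<bar>^3" by linarith
  ultimately show "\<bar>step_test (x + y - a) - step_test (x - a) - step_test1 (x - a) * y - step_test2 (x - a) * y\<^sup>2 / 2\<bar> \<le> 8 * \<bar>y\<bar>^3"
    by simp
  show "\<bar>step_test2 (x - a)\<bar> \<le> 6" unfolding step_test2_def by (auto simp: max_def abs_le_iff)
qed (auto simp: step_test_def step_test1_def step_test2_def cube_plus_def)

lemma convex_test_cases:
  "u \<le> 0 \<Longrightarrow> convex_test u = 0" "0 \<le> u \<Longrightarrow> u \<le> 1 \<Longrightarrow> convex_test u = u^3"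
  "1 \<le> u \<Longrightarrow> convex_test u = 3 * u\<^sup>2 - 3 * u + 1"
  "u \<le> 0 \<Longrightarrow> convex_test1 u = 0" "0 \<le> u \<Longrightarrow> u \<le> 1 \<Longrightarrow> convex_test1 u = 3 * u\<^sup>2"
  "1 \<le> u \<Longrightarrow> convex_test1 u = 6 * u - 3"
  by (auto simp: convex_test_def convex_test1_def cube_plus_def max_def power2_eq_square power3_eq_cube algebra_simps)

lemma convex_test_nonneg: "0 \<le> convex_test u"
proof -
  have "cube_plus (u - 1) \<le> cube_plus u" unfolding cube_plus_def by (intro power_mono) auto
  then show ?thesis by (simp add: convex_test_def)
qed

lemma convex_test_ge_1: "1 \<le> u \<Longrightarrow> 1 \<le> convex_test u"
  using mult_mono[of 1 u 1 u] by (simp add: convex_test_cases power2_eq_square)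

lemma convex_test_supporting_line: "convex_test a + convex_test1 a * (b - a) \<le> convex_test b"
proof -
  consider "a \<le> 0" | "0 \<le> a" "a \<le> 1" "b \<le> 0" | "0 \<le> a" "a \<le> 1" "0 \<le> b" "b \<le> 1" | "0 \<le> a" "a \<le> 1" "1 \<le> b"
    | "1 \<le> a" "b \<le> 0" | "1 \<le> a" "0 \<le> b" "b \<le> 1" | "1 \<le> a" "1 \<le> b" by linarith
  then show ?thesis
  proof cases
    case 1 then show ?thesis using convex_test_nonneg[of b] by (simp add: convex_test_cases)
  next
    case 2
    have "a^3 + 3 * a\<^sup>2 * (b - a) = 3 * a\<^sup>2 * b - 2 * a^3" by (simp add: power2_eq_square power3_eq_cube algebra_simps)
    also have "\<dots> \<le> 0"
    proof -
      have "3 * a\<^sup>2 * b \<le> 0" by (rule mult_nonneg_nonpos) (use 2 in auto)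
      moreover have "0 \<le> 2 * a^3" using 2 by simp
      ultimately show ?thesis by linarith
    qed
    finally show ?thesis using 2 by (simp add: convex_test_cases)
  next
    case 3
    have "0 \<le> (b - a)\<^sup>2 * (b + 2 * a)" using 3 by simp
    also have "\<dots> = b^3 - (a^3 + 3 * a\<^sup>2 * (b - a))" by (simp add: power2_eq_square power3_eq_cube algebra_simps)
    finally show ?thesis using 3 by (simp add: convex_test_cases)
  next
    case 4
    have "(b - 1)\<^sup>2 * (b - 1) \<le> (b - a)\<^sup>2 * (b + 2 * a)" using 4 by (intro mult_mono power_mono) auto
    moreover have "(b - a)\<^sup>2 * (b + 2 * a) - (b - 1)\<^sup>2 * (b - 1) = 3 * b\<^sup>2 - 3 * b + 1 - (a^3 + 3 * a\<^sup>2 * (b - a))"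
      by (simp add: power2_eq_square power3_eq_cube algebra_simps)
    ultimately show ?thesis using 4 by (simp add: convex_test_cases)
  next
    case 5
    have "1 \<le> a\<^sup>2" using 5 by simp
    moreover have "0 \<le> (6 * a - 3) * (- b)" by (rule mult_nonneg_nonneg) (use 5 in auto)
    ultimately have "0 \<le> 3 * (a\<^sup>2 - 1) + 2 + (6 * a - 3) * (- b)"
      by (intro add_nonneg_nonneg) auto
    also have "\<dots> = 0 - (3 * a\<^sup>2 - 3 * a + 1 + (6 * a - 3) * (b - a))" by (simp add: power2_eq_square algebra_simps)
    finally show ?thesis using 5 by (simp add: convex_test_cases)
  next
    case 6
    have "0 \<le> (b - 1)\<^sup>2 * (b + 2) + 3 * ((a - 1) * (a + 1 - 2 * b))" using 6 by (intro add_nonneg_nonneg mult_nonneg_nonneg) auto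
    also have "\<dots> = b^3 - (3 * a\<^sup>2 - 3 * a + 1 + (6 * a - 3) * (b - a))" by (simp add: power2_eq_square power3_eq_cube algebra_simps)
    finally show ?thesis using 6 by (simp add: convex_test_cases)
  next
    case 7
    have "0 \<le> 3 * (b - a)\<^sup>2" by simp
    also have "\<dots> = 3 * b\<^sup>2 - 3 * b + 1 - (3 * a\<^sup>2 - 3 * a + 1 + (6 * a - 3) * (b - a))" by (simp add: power2_eq_square algebra_simps)
    finally show ?thesis using 7 by (simp add: convex_test_cases)
  qed
qed

lemma convex_test_le_exp: assumes "1 \<le> \<theta>" shows "convex_test u \<le> 27 * exp (\<theta> * u)"
proof (cases "u \<le> 0")
  case False
  have "convex_test u \<le> u^3" using False by (simp add: convex_test_def cube_plus_def)
  also have "\<dots> = 27 * (u / 3)^3" by (simp add: power_divide)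
  also have "\<dots> \<le> 27 * (exp (u / 3))^3"
  proof (intro mult_left_mono power_mono)
    show "u / 3 \<le> exp (u / 3)" using exp_ge_add_one_self[of "u / 3"] by linarith
  qed (use False in auto)
  also have "\<dots> = 27 * exp u" by (simp add: exp_of_nat_mult[symmetric])
  also have "\<dots> \<le> 27 * exp (\<theta> * u)" using False assms by simp
  finally show ?thesis .
qed (simp add: convex_test_cases)

lemma step_test_props: "u \<le> 0 \<Longrightarrow> step_test u = 0" "0 \<le> step_test u" "step_test u \<le> 6" "1 \<le> u \<Longrightarrow> 1 \<le> step_test u"
proof -
  show "u \<le> 0 \<Longrightarrow> step_test u = 0" by (simp add: step_test_def cube_plus_def)
  have c1: "step_test u = u^3" if "0 \<le> u" "u \<le> 1" using that by (simp add: step_test_def cube_plus_def)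
  have c2: "step_test u = 1 + 3 * (u - 1) + 3 * (u - 1)\<^sup>2 - 2 * (u - 1)^3" if "1 \<le> u" "u \<le> 2"
    using that by (simp add: step_test_def cube_plus_def power2_eq_square power3_eq_cube algebra_simps)
  have c3: "step_test u = 6 - (3 - u)^3" if "2 \<le> u" "u \<le> 3"
    using that by (simp add: step_test_def cube_plus_def power2_eq_square power3_eq_cube algebra_simps)
  have c4: "step_test u = 6" if "3 \<le> u"
    using that by (simp add: step_test_def cube_plus_def power2_eq_square power3_eq_cube algebra_simps)
  consider "u \<le> 0" | "0 \<le> u" "u \<le> 1" | "1 \<le> u" "u \<le> 2" | "2 \<le> u" "u \<le> 3" | "3 \<le> u" by linarith
  then have "0 \<le> step_test u \<and> step_test u \<le> 6 \<and> (1 \<le> u \<longrightarrow> 1 \<le> step_test u)"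
  proof cases
    case 1 then show ?thesis by (simp add: step_test_def cube_plus_def)
  next
    case 2 then show ?thesis using c1 power_le_one[of u 3] by (auto simp: le_less)
  next
    case 3
    define v where "v = u - 1"
    have v: "0 \<le> v" "v \<le> 1" using 3 by (auto simp: v_def)
    then have "0 \<le> v\<^sup>2" "v\<^sup>2 \<le> v" "0 \<le> v^3" "v^3 \<le> v"
      using power_decreasing[of 1 2 v] power_decreasing[of 1 3 v] by auto
    moreover have "0 \<le> (v - 1)\<^sup>2 * (v + 2)" using v by simp
    then have "3 * v - 2 \<le> v^3" by (simp add: power2_eq_square power3_eq_cube algebra_simps)
    ultimately show ?thesis using c2[OF 3] v unfolding v_def[symmetric] by linarith
  next
    case 4
    have "0 \<le> (3 - u)^3" "(3 - u)^3 \<le> 1" using 4 power_le_one[of "3 - u" 3] by auto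
    then show ?thesis using c3[OF 4] by linarith
  next
    case 5 then show ?thesis using c4 by simp
  qed
  then show "0 \<le> step_test u" "step_test u \<le> 6" "1 \<le> u \<Longrightarrow> 1 \<le> step_test u" by auto
qed

lemma stdN_exp: "integrable stdN (\<lambda>z. exp (\<theta> * z))" "(\<integral>z. exp (\<theta> * z) \<partial>stdN) = exp (\<theta>\<^sup>2 / 2)"
proof -
  have eq: "std_normal_density z * exp (\<theta> * z) = exp (\<theta>\<^sup>2 / 2) * normal_density \<theta> 1 z" for z
    unfolding normal_density_def by (simp add: mult_exp_exp power2_eq_square field_simps)
  have "integrable lborel (\<lambda>z. std_normal_density z * exp (\<theta> * z))" unfolding eq by simp
  then show "integrable stdN (\<lambda>z. exp (\<theta> * z))" unfolding stdN_def by (subst integrable_density) auto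
  have "(\<integral>z. exp (\<theta> * z) \<partial>stdN) = (\<integral>z. std_normal_density z * exp (\<theta> * z) \<partial>lborel)"
    unfolding stdN_def by (subst integral_density) auto
  also have "\<dots> = exp (\<theta>\<^sup>2 / 2)" unfolding eq by simp
  finally show "(\<integral>z. exp (\<theta> * z) \<partial>stdN) = exp (\<theta>\<^sup>2 / 2)" .
qed

text \<open>
  Exponential Chebyshev bound with the optimal exponent \<open>\<theta> = y\<close>.
\<close>

lemma gauss_convex_test: assumes "1 \<le> y"
  shows "gauss_smooth 1 (\<lambda>u. convex_test (u - y)) 0 \<le> 27 * exp (- y\<^sup>2 / 2)"
proof -
  have "gauss_smooth 1 (\<lambda>u. convex_test (u - y)) 0 = (\<integral>z. convex_test (z - y) \<partial>stdN)"
    by (simp add: gauss_smooth_def)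
  also have "\<dots> \<le> (\<integral>z. 27 * exp (- y\<^sup>2) * exp (y * z) \<partial>stdN)"
  proof (rule integral_mono')
    show "convex_test (z - y) \<le> 27 * exp (- y\<^sup>2) * exp (y * z)" for z
      using convex_test_le_exp[OF assms, of "z - y"]
      by (simp add: mult.assoc mult_exp_exp right_diff_distrib power2_eq_square)
  qed (auto intro!: stdN_exp)
  also have "\<dots> = 27 * exp (- y\<^sup>2) * exp (y\<^sup>2 / 2)" by (simp add: stdN_exp)
  also have "\<dots> = 27 * exp (- y\<^sup>2 / 2)" by (simp add: mult.assoc mult_exp_exp)
  finally show ?thesis .
qed

text \<open>
  Only the Gaussian mass of \<open>[x + 1, x + 2]\<close> is kept, where the density is at least its value at \<open>x + 2\<close>.
\<close>

lemma gauss_step_test: assumes "0 \<le> x"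
  shows "exp (- (x + 2)\<^sup>2 / 2) / sqrt (2 * pi) \<le> gauss_smooth 1 (\<lambda>u. step_test (u - x)) 0"
proof -
  have sm: "(\<lambda>z. step_test (z - x)) \<in> borel_measurable borel"
    using taylor3D(1)[OF taylor3_step_test] .
  let ?c = "exp (- (x + 2)\<^sup>2 / 2) / sqrt (2 * pi)"
  have "?c = (\<integral>z. ?c * indicator {x+1..x+2} z \<partial>lborel)" by simp
  also have "\<dots> \<le> (\<integral>z. std_normal_density z * step_test (z - x) \<partial>lborel)"
  proof (rule integral_mono)
    show "integrable lborel (\<lambda>z. ?c * indicator {x+1..x+2} z)" by simp
    show "integrable lborel (\<lambda>z. std_normal_density z * step_test (z - x))"
    proof (rule Bochner_Integration.integrable_bound)
      show "integrable lborel (\<lambda>z. std_normal_density z * 6)" by simp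
      show "AE z in lborel. norm (std_normal_density z * step_test (z - x)) \<le> norm (std_normal_density z * 6)"
        using step_test_props(2,3) by (auto simp: abs_mult intro!: AE_I2 mult_left_mono)
    qed (use sm in measurable)
    fix z
    show "?c * indicator {x+1..x+2} z \<le> std_normal_density z * step_test (z - x)"
    proof (cases "z \<in> {x+1..x+2}")
      case True
      have "z\<^sup>2 \<le> (x + 2)\<^sup>2" using True assms by (intro power_mono) auto
      then have "?c \<le> std_normal_density z" unfolding std_normal_density_def by (simp add: divide_right_mono)
      moreover have "1 \<le> step_test (z - x)" using True by (intro step_test_props(4)) auto
      ultimately have "?c * 1 \<le> std_normal_density z * step_test (z - x)" by (intro mult_mono) auto
      then show ?thesis using True by simp
    qed (use step_test_props(2) in auto)
  qed
  also have "\<dots> = gauss_smooth 1 (\<lambda>u. step_test (u - x)) 0"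
    unfolding gauss_smooth_def stdN_def using sm by (subst integral_density) auto
  finally show ?thesis .
qed

context iid_sample
begin

theorem ustat_max_tail:
  assumes k: "deg_kernel D A L H" and n: "2 \<le> n" and b: "0 < b" and L: "0 < L" "L \<le> real n"
    and w: "b * L \<le> kernel_var D H" and y: "1 \<le> y"
  shows "prob {\<omega>\<in>space M. \<exists>m\<le>n. sqrt (2 * real n * (real n - 1) * kernel_var D H) * (y + 1) \<le> ustat H m (\<lambda>i. X i \<omega>)}
    \<le> 27 * exp (- y\<^sup>2 / 2) + 8 * clt_const A b * (1 / sqrt n + 1 / sqrt L)"
proof -
  let ?s = "sqrt (2 * real n * (real n - 1) * kernel_var D H)"
  have "0 < kernel_var D H" using w b L by (smt (verit) mult_pos_pos)
  then have s: "0 < ?s" using n by simp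
  note t = taylor3_convex_test[of y] and t0 = taylor3_convex_test[of 0, simplified]
  have "prob {\<omega>\<in>space M. \<exists>m\<le>n. ?s * (y + 1) \<le> ustat H m (\<lambda>i. X i \<omega>)} \<le> expectation (\<lambda>\<omega>. convex_test (ustat H n (\<lambda>i. X i \<omega>) / ?s - y))"
    by (rule ustat_maximal[OF k s t0 convex_test_nonneg convex_test_ge_1 convex_test_supporting_line])
  also have "\<dots> \<le> gauss_smooth 1 (\<lambda>u. convex_test (u - y)) 0 + (6 + 2) * clt_const A b * (1 / sqrt n + 1 / sqrt L)"
    using ustat_clt[OF k n b L w t] by linarith
  finally show ?thesis using gauss_convex_test[OF y] by simp
qed

text \<open>
  The smoothed indicator costs a shift of \<open>x\<close> by two, which is harmless for \<open>x\<close> of order \<open>\<surd>(log log n)\<close>.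
\<close>

theorem ustat_lower_tail:
  assumes k: "deg_kernel D A L H" and n: "2 \<le> n" and b: "0 < b" and L: "0 < L" "L \<le> real n"
    and w: "b * L \<le> kernel_var D H" and x: "0 \<le> x"
  shows "exp (- (x + 2)\<^sup>2 / 2) / (6 * sqrt (2 * pi)) - 3 * clt_const A b * (1 / sqrt n + 1 / sqrt L)
    \<le> prob {\<omega>\<in>space M. sqrt (2 * real n * (real n - 1) * kernel_var D H) * x \<le> ustat H n (\<lambda>i. X i \<omega>)}"
proof -
  let ?s = "sqrt (2 * real n * (real n - 1) * kernel_var D H)"
  let ?U = "\<lambda>\<omega>. ustat H n (\<lambda>i. X i \<omega>)"
  let ?E = "{\<omega>\<in>space M. ?s * x \<le> ?U \<omega>}"
  have "0 < kernel_var D H" using w b L by (smt (verit) mult_pos_pos)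
  then have s: "0 < ?s" using n by simp
  have Um[measurable]: "?U \<in> borel_measurable M"
    unfolding ustat_wsum by (rule wsum_measurable[OF deg_kernelD(1)[OF k]]) simp
  have E: "?E \<in> sets M" by measurable
  have sm[measurable]: "step_test \<in> borel_measurable borel"
    using taylor3D(1)[OF taylor3_step_test[of 0]] by simp
  have "expectation (\<lambda>\<omega>. step_test (?U \<omega> / ?s - x)) \<le> expectation (\<lambda>\<omega>. 6 * indicator ?E \<omega> :: real)"
  proof (rule integral_mono)
    show "integrable M (\<lambda>\<omega>. step_test (?U \<omega> / ?s - x))"
      by (rule integrable_const_bound[where B=6]) (use step_test_props(2,3) in auto)
    show "integrable M (\<lambda>\<omega>. 6 * indicator ?E \<omega> :: real)"
      by (rule integrable_mult_right, rule integrable_real_indicator[OF E]) (simp add: emeasure_eq_measure)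
    fix \<omega> assume w: "\<omega> \<in> space M"
    show "step_test (?U \<omega> / ?s - x) \<le> 6 * indicator ?E \<omega>"
    proof (cases "\<omega> \<in> ?E")
      case False
      then have "?U \<omega> / ?s - x \<le> 0" using w s by (simp add: field_simps)
      then show ?thesis using step_test_props(1) by simp
    qed (use step_test_props(3) in auto)
  qed
  also have "\<dots> = 6 * prob ?E" using E by simp
  finally have "expectation (\<lambda>\<omega>. step_test (?U \<omega> / ?s - x)) \<le> 6 * prob ?E" .
  moreover define R where "R = clt_const A b * (1 / sqrt n + 1 / sqrt L)"
  have "\<bar>expectation (\<lambda>\<omega>. step_test (?U \<omega> / ?s - x)) - gauss_smooth 1 (\<lambda>u. step_test (u - x)) 0\<bar> \<le> 14 * R"
    using ustat_clt[OF k n b L w taylor3_step_test[of x]] by (simp add: R_def mult.assoc)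
  then have "gauss_smooth 1 (\<lambda>u. step_test (u - x)) 0 - 14 * R \<le> expectation (\<lambda>\<omega>. step_test (?U \<omega> / ?s - x))"
    by linarith
  moreover have "0 \<le> R"
    unfolding R_def clt_const_def using b L deg_kernel_nonneg(1)[OF k] by (intro mult_nonneg_nonneg add_nonneg_nonneg) auto
  moreover have "exp (- (x + 2)\<^sup>2 / 2) / (6 * sqrt (2 * pi)) = (exp (- (x + 2)\<^sup>2 / 2) / sqrt (2 * pi)) / 6" by simp
  ultimately have "exp (- (x + 2)\<^sup>2 / 2) / (6 * sqrt (2 * pi)) - 3 * R \<le> prob ?E" using gauss_step_test[OF x] by linarith
  then show ?thesis unfolding R_def by (simp add: mult.assoc)
qed

end

section \<open>The upper half of the iterated logarithm law\<close>

lemma filterlim_of_increments: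
  fixes lam :: "nat \<Rightarrow> real"
  assumes "filterlim (\<lambda>k. lam (Suc k) - lam k) at_top sequentially"
  shows "filterlim lam at_top sequentially"
proof -
  from assms have "\<forall>\<^sub>F k in sequentially. 1 \<le> lam (Suc k) - lam k"
    by (simp add: filterlim_at_top)
  then obtain K where K: "\<And>k. K \<le> k \<Longrightarrow> 1 \<le> lam (Suc k) - lam k" by (auto simp: eventually_sequentially)
  have "lam K + real m \<le> lam (K + m)" for m
  proof (induction m)
    case (Suc m) then show ?case using K[of "K + m"] by simp
  qed simp
  then have le: "lam K + (real k - real K) \<le> lam k" if "K \<le> k" for k
    using that by (metis le_add_diff_inverse of_nat_diff)
  show ?thesis
  proof (rule filterlim_at_top_mono)
    show "filterlim (\<lambda>k. lam K + (real k - real K)) at_top sequentially" by real_asymp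
    show "\<forall>\<^sub>F k in sequentially. lam K + (real k - real K) \<le> lam k"
      using le by (auto simp: eventually_sequentially)
  qed
qed

text \<open>
  The index is the last one at which \<open>lam\<close> has not passed \<open>x\<close>.
\<close>

lemma block_exists:
  fixes lam :: "nat \<Rightarrow> real"
  assumes mono: "mono_on {1..} lam" and top: "filterlim lam at_top sequentially"
    and K: "1 \<le> K" "lam K \<le> x"
  shows "\<exists>k\<ge>K. lam k \<le> x \<and> x < lam (Suc k)"
proof -
  from top have "\<forall>\<^sub>F k in sequentially. x < lam k" by (simp add: filterlim_at_top_dense)
  then obtain K1 where K1: "\<And>k. K1 \<le> k \<Longrightarrow> x < lam k" by (auto simp: eventually_sequentially)
  let ?S = "{k. K \<le> k \<and> lam k \<le> x}"
  have "?S \<subseteq> {..K1}"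
  proof
    fix k assume "k \<in> ?S"
    then have "\<not> K1 \<le> k" using K1[of k] by auto
    then show "k \<in> {..K1}" by simp
  qed
  then have fin: "finite ?S" by (rule finite_subset) simp
  have "K \<in> ?S" using K by simp
  then have "Max ?S \<in> ?S" using fin by (intro Max_in) auto
  moreover have "Suc (Max ?S) \<notin> ?S" using Max_ge[OF fin, of "Suc (Max ?S)"] by auto
  ultimately show ?thesis by (intro exI[of _ "Max ?S"]) auto
qed

context iid_sample
begin

lemma ustat_measurable:
  assumes "deg_kernel D A L H"
  shows "(\<lambda>\<omega>. ustat H n (\<lambda>i. X i \<omega>)) \<in> borel_measurable M"
  unfolding ustat_wsum by (rule wsum_measurable[OF deg_kernelD(1)[OF assms]]) simp

text \<open>
  All asymptotic hypotheses at a single \<open>n\<close>, with the variance limit made quantitative by \<open>\<eta>\<close>.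
\<close>

definition regular_at :: "real \<Rightarrow> real \<Rightarrow> real \<Rightarrow> real \<Rightarrow> real \<Rightarrow> (nat \<Rightarrow> real \<Rightarrow> real \<Rightarrow> real) \<Rightarrow> (nat \<Rightarrow> real) \<Rightarrow> nat \<Rightarrow> bool" where
  "regular_at A c \<delta> \<sigma> \<eta> H L n \<longleftrightarrow> 2 \<le> n \<and> deg_kernel D A (L n) (H n) \<and>
     c * real n powr \<delta> \<le> L n \<and> 2 * L n \<le> real n \<and> 0 < L n \<and>
     \<sigma>\<^sup>2 / 2 * (1 - \<eta>) * L n \<le> kernel_var D (H n) \<and> kernel_var D (H n) \<le> \<sigma>\<^sup>2 / 2 * (1 + \<eta>) * L n"

lemma eventually_regular:
  assumes k: "\<forall>\<^sub>F n in sequentially. deg_kernel D A (L n) (H n)"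
    and L: "\<forall>\<^sub>F n in sequentially. c * real n powr \<delta> \<le> L n \<and> 2 * L n \<le> real n" and c: "0 < c"
    and w: "(\<lambda>n. kernel_var D (H n) / L n) \<longlonglongrightarrow> \<sigma>\<^sup>2 / 2" and \<sigma>: "0 < \<sigma>" and \<eta>: "0 < \<eta>"
  shows "\<forall>\<^sub>F n in sequentially. regular_at A c \<delta> \<sigma> \<eta> H L n"
proof -
  have "\<sigma>\<^sup>2 / 2 * (1 - \<eta>) < \<sigma>\<^sup>2 / 2" "\<sigma>\<^sup>2 / 2 < \<sigma>\<^sup>2 / 2 * (1 + \<eta>)" using \<sigma> \<eta> by auto
  then have "\<forall>\<^sub>F n in sequentially. \<sigma>\<^sup>2 / 2 * (1 - \<eta>) < kernel_var D (H n) / L n"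
    "\<forall>\<^sub>F n in sequentially. kernel_var D (H n) / L n < \<sigma>\<^sup>2 / 2 * (1 + \<eta>)"
    using order_tendstoD[OF w] by blast+
  with k L eventually_ge_at_top[of 2] show ?thesis
  proof eventually_elim
    case (elim n)
    then have "0 < c * real n powr \<delta>" using c by simp
    then have "0 < L n" using elim by linarith
    then show ?case using elim by (auto simp: regular_at_def field_simps)
  qed
qed

text \<open>
  The kernel used at the end of a block is the kernel used throughout it, so one maximal inequality covers the block. It is
  applied at height \<open>(1 + \<epsilon> / 4) \<surd>(2 log log \<lambda>\<^sub>k)\<close>, where the Gaussian bound is about \<open>k\<close> to the power \<open>-(1 + \<epsilon> / 4)\<close>;
  the error of the central limit theorem is negligible because \<open>\<lambda>\<^sub>k\<close> grows faster than every power of \<open>k\<close>.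
\<close>

theorem ustat_lil_upper:
  fixes H :: "nat \<Rightarrow> real \<Rightarrow> real \<Rightarrow> real" and L lam :: "nat \<Rightarrow> real"
  assumes k: "\<forall>\<^sub>F n in sequentially. deg_kernel D A (L n) (H n)"
    and L: "\<forall>\<^sub>F n in sequentially. c * real n powr \<delta> \<le> L n \<and> 2 * L n \<le> real n" and c: "0 < c" and \<delta>: "0 < \<delta>"
    and w: "(\<lambda>n. kernel_var D (H n) / L n) \<longlonglongrightarrow> \<sigma>\<^sup>2 / 2" and \<sigma>: "0 < \<sigma>"
    and mono: "mono_on {1..} lam" and lam_log: "(\<lambda>k. ln (ln (lam k)) / ln (real k)) \<longlonglongrightarrow> 1"
    and ratio: "(\<lambda>k. lam (Suc k) / lam k) \<longlonglongrightarrow> 1"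
    and diff: "filterlim (\<lambda>k. lam (Suc k) - lam k) at_top sequentially"
    and blocks: "\<And>k n m. 1 \<le> k \<Longrightarrow> lam k \<le> real n \<Longrightarrow> real n < lam (Suc k) \<Longrightarrow> lam k \<le> real m \<Longrightarrow> real m < lam (Suc k) \<Longrightarrow> H n = H m \<and> L n = L m"
    and eps: "0 < \<epsilon>" "\<epsilon> \<le> 1"
  shows "AE \<omega> in M. \<forall>\<^sub>F n in sequentially.
    ustat (H n) n (\<lambda>i. X i \<omega>) \<le> (1 + \<epsilon>) * (\<sigma> * real n * sqrt (L n) * sqrt (2 * ln (ln (real n))))"
proof -
  define \<eta> where "\<eta> = \<epsilon> / 8"
  have \<eta>: "0 < \<eta>" "\<eta> \<le> 1 / 8" using eps by (auto simp: \<eta>_def)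
  obtain n0 where n0: "\<And>n. n0 \<le> n \<Longrightarrow> regular_at A c \<delta> \<sigma> \<eta> H L n"
    using eventually_regular[OF k L c w \<sigma> \<eta>(1)] by (auto simp: eventually_sequentially)
  have top: "filterlim lam at_top sequentially" by (rule filterlim_of_increments[OF diff])
  define LLn where "LLn k = ln (ln (lam k))" for k
  define \<theta> where "\<theta> k = sqrt (2 * LLn k)" for k
  define y where "y k = (1 + \<epsilon> / 4) * \<theta> k" for k
  \<comment> \<open>All that is needed of a block, collected so that it holds for all but finitely many \<open>k\<close>.\<close>
  define P where "P k \<longleftrightarrow> 2 \<le> k \<and> max (real n0) (exp 1) \<le> lam k \<and> exp (sqrt k) \<le> lam k \<and> ln k \<le> (1 + \<epsilon> / 4) * LLn k
     \<and> (1 - \<eta>) * lam (Suc k) \<le> lam k \<and> 4 / \<epsilon> \<le> \<theta> k \<and> exp (- (\<delta> / 2) * sqrt k) \<le> 1 / (real k)\<^sup>2" for k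
  have evP: "\<forall>\<^sub>F k in sequentially. P k"
  proof -
    have a: "\<forall>\<^sub>F k in sequentially. max (real n0) (exp 1) \<le> lam k" using top unfolding filterlim_at_top by blast
    have "1 / (1 + \<epsilon> / 4) < 1" using eps by simp
    with lam_log have b: "\<forall>\<^sub>F k in sequentially. 1 / (1 + \<epsilon> / 4) < LLn k / ln (real k)" unfolding LLn_def by (rule order_tendstoD)
    have b': "\<forall>\<^sub>F k in sequentially. 1 / 2 < LLn k / ln (real k)" unfolding LLn_def by (rule order_tendstoD[OF lam_log]) simp
    have "1 < 1 / (1 - \<eta>)" using \<eta> by simp
    with ratio have d: "\<forall>\<^sub>F k in sequentially. lam (Suc k) / lam k < 1 / (1 - \<eta>)" by (rule order_tendstoD)
    have f: "\<forall>\<^sub>F k in sequentially. exp (- (\<delta> / 2) * sqrt (real k)) \<le> 1 / (real k)\<^sup>2" using \<delta> by real_asymp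
    have g: "\<forall>\<^sub>F k in sequentially. (4 / \<epsilon>)\<^sup>2 \<le> ln (real k)" by real_asymp
    from a b b' d f g eventually_ge_at_top[of 2] show ?thesis
    proof eventually_elim
      case (elim k)
      have lnk: "0 < ln (real k)" using elim by simp
      have lamk: "0 < lam k" "1 \<le> ln (lam k)"
      proof -
        show "0 < lam k" using elim(1) exp_gt_zero[of "1::real"] by linarith
        then show "1 \<le> ln (lam k)" using elim(1) by (subst ln_ge_iff) auto
      qed
      have L2: "ln (real k) / 2 \<le> LLn k" using elim(3) lnk by (simp add: field_simps)
      have "sqrt (real k) = exp (ln (real k) / 2)" using elim by (simp add: powr_half_sqrt[symmetric] powr_def)
      also have "\<dots> \<le> exp (LLn k)" using L2 by simp
      also have "\<dots> = ln (lam k)" unfolding LLn_def by (rule exp_ln) (use lamk in linarith)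
      finally have "exp (sqrt k) \<le> lam k" using lamk by (metis exp_le_cancel_iff exp_ln)
      moreover have "ln k \<le> (1 + \<epsilon> / 4) * LLn k" using elim(2) lnk eps by (simp add: field_simps)
      moreover have "(1 - \<eta>) * lam (Suc k) \<le> lam k" using elim(4) lamk \<eta> by (simp add: field_simps)
      moreover have "4 / \<epsilon> \<le> \<theta> k" unfolding \<theta>_def by (rule real_le_rsqrt) (use L2 elim(6) in linarith)
      ultimately show ?case unfolding P_def using elim by auto
    qed
  qed
  then obtain K where K: "\<And>k. K \<le> k \<Longrightarrow> P k" by (auto simp: eventually_sequentially)
  define blk where "blk k = {n. lam k \<le> real n \<and> real n < lam (Suc k)}" for k
  have blk_fin: "finite (blk k)" for k
  proof -
    have "blk k \<subseteq> {..nat \<lceil>lam (Suc k)\<rceil>}" unfolding blk_def by auto linarith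
    then show ?thesis by (rule finite_subset) simp
  qed
  define N where "N k = Max (blk k)" for k
  have N: "N k \<in> blk k" "\<And>n. n \<in> blk k \<Longrightarrow> n \<le> N k" if "blk k \<noteq> {}" for k
    unfolding N_def using blk_fin that by (auto intro: Max_in)
  define s where "s k = sqrt (2 * real (N k) * (real (N k) - 1) * kernel_var D (H (N k)))" for k
  \<comment> \<open>A block may contain no integer, and early blocks need not be regular; the bad event is then set to be empty.\<close>
  define B where "B k = (if K \<le> k \<and> blk k \<noteq> {} then {\<omega>\<in>space M. \<exists>m\<le>N k. s k * (y k + 1) \<le> ustat (H (N k)) m (\<lambda>i. X i \<omega>)} else {})" for k
  have reg: "regular_at A c \<delta> \<sigma> \<eta> H L n" if "K \<le> k" "n \<in> blk k" for k n
  proof -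
    have "real n0 \<le> lam k" using K[OF that(1)] by (simp add: P_def)
    then have "real n0 \<le> real n" using that(2) by (simp add: blk_def)
    then show ?thesis by (intro n0) simp
  qed
  have Bs: "B k \<in> sets M" for k
  proof (cases "K \<le> k \<and> blk k \<noteq> {}")
    case True
    then have "deg_kernel D A (L (N k)) (H (N k))" using reg N(1) by (auto simp: regular_at_def)
    note [measurable] = ustat_measurable[OF this]
    have "{\<omega>\<in>space M. \<exists>m\<le>N k. s k * (y k + 1) \<le> ustat (H (N k)) m (\<lambda>i. X i \<omega>)} \<in> sets M" by measurable
    then show ?thesis unfolding B_def by (simp only: if_P[OF True])
  next
    case False
    have "B k = {}" unfolding B_def by (rule if_not_P[OF False])
    then show ?thesis by simp
  qed
  define b where "b = \<sigma>\<^sup>2 / 4"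
  have b: "0 < b" using \<sigma> by (simp add: b_def)
  define CC where "CC = 8 * clt_const A b * (2 / sqrt c)"
  have CC: "0 \<le> CC" unfolding CC_def clt_const_def using b c by simp
  have probB: "prob (B k) \<le> 27 * real k powr (- (1 + \<epsilon> / 4)) + CC * (1 / (real k)\<^sup>2)" if kK: "K \<le> k" for k
  proof (cases "blk k = {}")
    case True then show ?thesis using CC by (simp add: B_def)
  next
    case False
    note Pk = K[OF kK, unfolded P_def]
    let ?n = "N k"
    have nb: "?n \<in> blk k" by (rule N(1)[OF False])
    have r: "regular_at A c \<delta> \<sigma> \<eta> H L ?n" by (rule reg[OF kK nb])
    then have dk: "deg_kernel D A (L ?n) (H ?n)" and n2: "2 \<le> ?n" and L0: "0 < L ?n" and Ln: "2 * L ?n \<le> real ?n"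
      and Lc: "c * real ?n powr \<delta> \<le> L ?n" and w1: "\<sigma>\<^sup>2 / 2 * (1 - \<eta>) * L ?n \<le> kernel_var D (H ?n)" by (auto simp: regular_at_def)
    have "\<sigma>\<^sup>2 / 2 * (1 / 2) * L ?n \<le> \<sigma>\<^sup>2 / 2 * (1 - \<eta>) * L ?n" using \<eta> L0 by (intro mult_right_mono mult_left_mono) auto
    moreover have "b * L ?n = \<sigma>\<^sup>2 / 2 * (1 / 2) * L ?n" by (simp add: b_def)
    ultimately have bw: "b * L ?n \<le> kernel_var D (H ?n)" using w1 by (simp only:)
    have \<theta>4: "4 / \<epsilon> \<le> \<theta> k" using Pk by simp
    have "4 \<le> 4 / \<epsilon>" using eps by (simp add: field_simps)
    then have \<theta>1: "1 \<le> \<theta> k" using \<theta>4 by linarith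
    have y1: "1 \<le> y k" unfolding y_def using \<theta>1 eps mult_mono[of 1 "1 + \<epsilon> / 4" 1 "\<theta> k"] by simp
    have "prob (B k) \<le> 27 * exp (- (y k)\<^sup>2 / 2) + 8 * clt_const A b * (1 / sqrt ?n + 1 / sqrt (L ?n))"
      using ustat_max_tail[OF dk n2 b L0 _ bw y1] Ln L0 kK False unfolding B_def s_def by simp
    also have "\<dots> \<le> 27 * real k powr (- (1 + \<epsilon> / 4)) + 8 * clt_const A b * (2 / sqrt c * (1 / (real k)\<^sup>2))"
    proof (intro add_mono mult_left_mono)
      have LL0: "0 \<le> LLn k" using \<theta>1 unfolding \<theta>_def by (smt (verit) real_sqrt_le_0_iff)
      have "(1 + \<epsilon> / 4) * ln (real k) \<le> (1 + \<epsilon> / 4) * ((1 + \<epsilon> / 4) * LLn k)" using Pk eps by (intro mult_left_mono) auto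
      also have "\<dots> = (y k)\<^sup>2 / 2" using LL0 by (simp add: y_def \<theta>_def power_mult_distrib) (simp add: power2_eq_square)
      finally have "exp (- (y k)\<^sup>2 / 2) \<le> exp (- ((1 + \<epsilon> / 4) * ln (real k)))" by simp
      also have "\<dots> = real k powr (- (1 + \<epsilon> / 4))" using Pk by (simp add: powr_def algebra_simps)
      finally show "exp (- (y k)\<^sup>2 / 2) \<le> real k powr (- (1 + \<epsilon> / 4))" .
      have nk: "exp (sqrt k) \<le> real ?n" using Pk nb by (auto simp: blk_def)
      have "(exp (\<delta> / 2 * sqrt k))\<^sup>2 = exp (sqrt k) powr \<delta>"
        by (simp add: powr_def exp_of_nat_mult[symmetric])
      then have "sqrt c * exp (\<delta> / 2 * sqrt k) = sqrt (c * exp (sqrt k) powr \<delta>)"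
        by (metis real_sqrt_mult real_sqrt_unique exp_ge_zero)
      also have "\<dots> \<le> sqrt (L ?n)"
      proof (rule real_sqrt_le_mono)
        have "c * exp (sqrt k) powr \<delta> \<le> c * real ?n powr \<delta>" using c \<delta> nk by (intro mult_left_mono powr_mono2) auto
        then show "c * exp (sqrt k) powr \<delta> \<le> L ?n" using Lc by linarith
      qed
      finally have sL: "sqrt c * exp (\<delta> / 2 * sqrt k) \<le> sqrt (L ?n)" .
      have "1 / sqrt ?n \<le> 1 / sqrt (L ?n)" using L0 Ln by (intro divide_left_mono real_sqrt_le_mono) auto
      then have "1 / sqrt ?n + 1 / sqrt (L ?n) \<le> 2 / sqrt (L ?n)" by simp
      also have "\<dots> \<le> 2 / (sqrt c * exp (\<delta> / 2 * sqrt k))" using sL c L0 by (intro divide_left_mono) auto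
      also have "\<dots> = 2 / sqrt c * exp (- (\<delta> / 2) * sqrt k)" by (simp add: exp_minus field_simps)
      also have "\<dots> \<le> 2 / sqrt c * (1 / (real k)\<^sup>2)" using Pk c by (intro mult_left_mono) auto
      finally show "1 / sqrt ?n + 1 / sqrt (L ?n) \<le> 2 / sqrt c * (1 / (real k)\<^sup>2)" .
    qed (use b in \<open>auto simp: clt_const_def\<close>)
    finally show ?thesis unfolding CC_def by (simp add: mult_ac)
  qed
  have "AE \<omega> in M. \<forall>\<^sub>F k in sequentially. \<omega> \<in> space M - B k"
  proof (rule borel_cantelli_AE1[OF Bs])
    show "emeasure M (B k) < \<infinity>" for k by (simp add: emeasure_eq_measure)
    show "summable (\<lambda>k. measure M (B k))"
    proof (rule summable_comparison_test')
      have "summable (\<lambda>k. real k powr (- (1 + \<epsilon> / 4)))" using eps by (subst summable_real_powr_iff) auto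
      moreover have "summable (\<lambda>k. 1 / (real k)\<^sup>2)" using inverse_power_summable[of 2, where ?'a=real] by (simp add: inverse_eq_divide)
      ultimately show "summable (\<lambda>k. 27 * real k powr (- (1 + \<epsilon> / 4)) + CC * (1 / (real k)\<^sup>2))"
        by (intro summable_add summable_mult)
      show "norm (measure M (B k)) \<le> 27 * real k powr (- (1 + \<epsilon> / 4)) + CC * (1 / (real k)\<^sup>2)" if "K \<le> k" for k
        using probB[OF that] by simp
    qed
  qed
  then show ?thesis
  proof eventually_elim
    case (elim \<omega>)
    then obtain K1 where K1: "\<And>k. K1 \<le> k \<Longrightarrow> \<omega> \<in> space M - B k" by (auto simp: eventually_sequentially)
    define K2 where "K2 = max (max K K1) 1"
    show ?case
    proof (rule eventually_sequentiallyI[of "nat \<lceil>lam K2\<rceil>"])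
      fix n assume "nat \<lceil>lam K2\<rceil> \<le> n"
      then have "lam K2 \<le> real n" by linarith
      then obtain k where kk: "K2 \<le> k" "lam k \<le> real n" "real n < lam (Suc k)"
        using block_exists[OF mono top, of K2 "real n"] by (auto simp: K2_def)
      then have kK: "K \<le> k" "K1 \<le> k" "1 \<le> k" by (auto simp: K2_def)
      have nb: "n \<in> blk k" using kk by (simp add: blk_def)
      then have ne: "blk k \<noteq> {}" by auto
      let ?n = "N k"
      have Nb: "?n \<in> blk k" "n \<le> ?n" using N[OF ne] nb by auto
      have same: "H n = H ?n" "L n = L ?n" using blocks[OF kK(3), of n ?n] nb Nb by (auto simp: blk_def)
      note Pk = K[OF kK(1), unfolded P_def]
      have r: "regular_at A c \<delta> \<sigma> \<eta> H L ?n" by (rule reg[OF kK(1) Nb(1)])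
      then have n2: "2 \<le> ?n" and L0: "0 < L ?n" and w2: "kernel_var D (H ?n) \<le> \<sigma>\<^sup>2 / 2 * (1 + \<eta>) * L ?n"
        and dk: "deg_kernel D A (L ?n) (H ?n)" by (auto simp: regular_at_def)
      have "\<omega> \<notin> B k" "\<omega> \<in> space M" using K1[OF kK(2)] by auto
      then have lt: "ustat (H ?n) n (\<lambda>i. X i \<omega>) < s k * (y k + 1)"
        using kK(1) ne Nb(2) unfolding B_def by (auto simp: not_le) (use Nb(2) in \<open>metis not_le\<close>)
      have \<theta>4: "4 / \<epsilon> \<le> \<theta> k" using Pk by simp
      have "0 < 4 / \<epsilon>" using eps by simp
      then have \<theta>0: "0 \<le> \<theta> k" "1 \<le> \<epsilon> / 4 * \<theta> k" using \<theta>4 eps by (linarith, simp add: pos_divide_le_eq mult.commute)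
      have lam0: "0 < lam k" "exp 1 \<le> lam k" using Pk exp_gt_zero[of "1::real"] by linarith+
      have s_le: "s k \<le> lam k / (1 - \<eta>) * (\<sigma> * sqrt (L ?n) * (1 + \<eta>))"
      proof -
        have "s k \<le> sqrt ((real ?n)\<^sup>2 * (\<sigma>\<^sup>2 * L ?n * (1 + \<eta>)\<^sup>2))" unfolding s_def
        proof (rule real_sqrt_le_mono)
          have "2 * real ?n * (real ?n - 1) * kernel_var D (H ?n) \<le> 2 * real ?n * real ?n * (\<sigma>\<^sup>2 / 2 * (1 + \<eta>) * L ?n)"
            using w2 n2 kernel_var_bounds(1)[OF dk] by (intro mult_mono) auto
          also have "\<dots> = (real ?n)\<^sup>2 * (\<sigma>\<^sup>2 * L ?n * (1 + \<eta>))" by (simp add: power2_eq_square)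
          also have "\<dots> \<le> (real ?n)\<^sup>2 * (\<sigma>\<^sup>2 * L ?n * (1 + \<eta>)\<^sup>2)"
            using \<eta> L0 by (intro mult_left_mono) (auto simp: power2_eq_square)
          finally show "2 * real ?n * (real ?n - 1) * kernel_var D (H ?n) \<le> (real ?n)\<^sup>2 * (\<sigma>\<^sup>2 * L ?n * (1 + \<eta>)\<^sup>2)" .
        qed
        also have "\<dots> = real ?n * (\<sigma> * sqrt (L ?n) * (1 + \<eta>))"
          using \<sigma> \<eta> by (simp add: real_sqrt_mult)
        also have "\<dots> \<le> lam k / (1 - \<eta>) * (\<sigma> * sqrt (L ?n) * (1 + \<eta>))"
        proof (rule mult_right_mono)
          have "real ?n \<le> lam (Suc k)" using Nb(1) by (simp add: blk_def)
          also have "\<dots> \<le> lam k / (1 - \<eta>)" using Pk \<eta> by (simp add: field_simps)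
          finally show "real ?n \<le> lam k / (1 - \<eta>)" .
        qed (use \<sigma> L0 \<eta> in auto)
        finally show ?thesis .
      qed
      have y_le: "y k + 1 \<le> (1 + \<epsilon> / 2) * \<theta> k" unfolding y_def using \<theta>0 by (simp add: algebra_simps)
      \<comment> \<open>The choice \<open>\<eta> = \<epsilon> / 8\<close> pays for the variance error, for the change of \<open>\<lambda>\<close> over the block, and for smoothing.\<close>
      have key: "(1 + \<epsilon> / 2) * (1 + \<eta>) \<le> (1 + \<epsilon>) * (1 - \<eta>)"
      proof -
        have "0 \<le> \<epsilon> * (1 / 4 - 3 / 16 * \<epsilon>)" using eps by (intro mult_nonneg_nonneg) auto
        then show ?thesis unfolding \<eta>_def by (simp add: field_simps)
      qed
      have "s k * (y k + 1) \<le> (lam k / (1 - \<eta>) * (\<sigma> * sqrt (L ?n) * (1 + \<eta>))) * ((1 + \<epsilon> / 2) * \<theta> k)"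
      proof (rule mult_mono[OF s_le y_le])
        show "0 \<le> lam k / (1 - \<eta>) * (\<sigma> * sqrt (L ?n) * (1 + \<eta>))" using lam0 \<eta> \<sigma> L0 by simp
        show "0 \<le> y k + 1" unfolding y_def using \<theta>0 eps by simp
      qed
      also have "\<dots> = (\<sigma> * lam k * sqrt (L ?n) * \<theta> k / (1 - \<eta>)) * ((1 + \<epsilon> / 2) * (1 + \<eta>))"
        by (simp add: field_simps)
      also have "\<dots> \<le> (\<sigma> * lam k * sqrt (L ?n) * \<theta> k / (1 - \<eta>)) * ((1 + \<epsilon>) * (1 - \<eta>))"
        using key \<sigma> lam0 L0 \<theta>0 \<eta> by (intro mult_left_mono) auto
      also have "\<dots> = (1 + \<epsilon>) * (\<sigma> * lam k * sqrt (L ?n) * \<theta> k)" using \<eta> by (simp add: field_simps)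
      also have "\<dots> \<le> (1 + \<epsilon>) * (\<sigma> * real n * sqrt (L n) * sqrt (2 * ln (ln (real n))))"
      proof -
        have "1 \<le> ln (lam k)" using lam0 by (subst ln_ge_iff) auto
        moreover have "ln (lam k) \<le> ln (real n)" using lam0 kk by (subst ln_le_cancel_iff) auto
        ultimately have "LLn k \<le> ln (ln (real n))" unfolding LLn_def by (subst ln_le_cancel_iff) auto
        then have "\<theta> k \<le> sqrt (2 * ln (ln (real n)))" unfolding \<theta>_def by simp
        then show ?thesis unfolding same using eps kk(2) \<sigma> L0 \<theta>0 lam0 by (intro mult_mono mult_left_mono) auto
      qed
      finally show "ustat (H n) n (\<lambda>i. X i \<omega>) \<le> (1 + \<epsilon>) * (\<sigma> * real n * sqrt (L n) * sqrt (2 * ln (ln (real n))))"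
        using lt same by simp
    qed
  qed
qed

end

section \<open>The lower half of the iterated logarithm law\<close>

text \<open>
  The second Borel-Cantelli lemma: by independence the probability that all \<open>F k\<close> with \<open>k \<ge> n\<close> occur is at most the
  exponential of minus a divergent sum.
\<close>

lemma (in prob_space) indep_borel_cantelli:
  assumes F: "indep_events F (UNIV :: nat set)" and div: "\<not> summable (\<lambda>k. 1 - prob (F k))"
  shows "AE \<omega> in M. \<exists>\<^sub>F k in sequentially. \<omega> \<notin> F k"
proof -
  have Fm: "F k \<in> sets M" for k using F by (auto simp: indep_events_def)
  have null: "prob (\<Inter>k\<in>{n..}. F k) = 0" for n
  proof (rule ccontr)
    define p where "p = prob (\<Inter>k\<in>{n..}. F k)"
    assume "prob (\<Inter>k\<in>{n..}. F k) \<noteq> 0"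
    then have p: "0 < p" unfolding p_def by (simp add: zero_less_measure_iff)
    have bound: "(\<Sum>k\<in>{n..<m}. 1 - prob (F k)) \<le> - ln p" if "n < m" for m
    proof -
      have "p \<le> prob (\<Inter>k\<in>{n..<m}. F k)" unfolding p_def
        using that Fm by (intro finite_measure_mono sets.finite_INT) auto
      also have "\<dots> = (\<Prod>k\<in>{n..<m}. prob (F k))"
        using F that by (auto simp: indep_events_def)
      also have "\<dots> \<le> (\<Prod>k\<in>{n..<m}. exp (- (1 - prob (F k))))"
        by (rule prod_mono) (use exp_ge_add_one_self[of "prob (F _) - 1"] in auto)
      also have "\<dots> = exp (- (\<Sum>k\<in>{n..<m}. 1 - prob (F k)))"
        by (simp add: exp_sum sum_negf[symmetric])
      finally have "ln p \<le> ln (exp (- (\<Sum>k\<in>{n..<m}. 1 - prob (F k))))" using p by (subst ln_le_cancel_iff) auto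
      then show ?thesis by simp
    qed
    have "summable (\<lambda>k. 1 - prob (F k))"
    proof (rule bounded_imp_summable)
      show "0 \<le> 1 - prob (F k)" for k by simp
      show "(\<Sum>k\<le>m. 1 - prob (F k)) \<le> (\<Sum>k<n. 1 - prob (F k)) + - ln p" for m
      proof -
        have "(\<Sum>k\<le>m. 1 - prob (F k)) \<le> (\<Sum>k\<in>{0..<max (Suc m) (Suc n)}. 1 - prob (F k))"
          by (rule sum_mono2) auto
        also have "\<dots> = (\<Sum>k\<in>{0..<n}. 1 - prob (F k)) + (\<Sum>k\<in>{n..<max (Suc m) (Suc n)}. 1 - prob (F k))"
          by (rule sum.atLeastLessThan_concat[symmetric]) auto
        also have "\<dots> \<le> (\<Sum>k<n. 1 - prob (F k)) + - ln p"
          using bound[of "max (Suc m) (Suc n)"] by (simp add: atLeast0LessThan)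
        finally show ?thesis .
      qed
    qed
    with div show False by simp
  qed
  have "AE \<omega> in M. \<forall>n. \<omega> \<notin> (\<Inter>k\<in>{n..}. F k)"
    unfolding AE_all_countable
  proof
    fix n
    have "(\<Inter>k\<in>{n..}. F k) \<in> null_sets M"
      using null[of n] Fm by (intro null_setsI) (auto simp: emeasure_eq_measure)
    then show "AE \<omega> in M. \<omega> \<notin> (\<Inter>k\<in>{n..}. F k)" by (rule AE_not_in)
  qed
  then show ?thesis by eventually_elim (auto simp: frequently_sequentially)
qed

lemma sum_shift_split: "(\<Sum>i<a + l. f i) = (\<Sum>i<a. f i) + (\<Sum>i<l. f (a + i))" for f :: "nat \<Rightarrow> real"
  by (induction l) auto

lemma ustat_block:
  "wsum (\<lambda>i l. if a \<le> i then 2 else 0) H (a + m) x = ustat H m (\<lambda>i. x (a + i))"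
proof -
  have "(\<Sum>l<a. \<Sum>i<l. (if a \<le> i then 2 else 0) * H (x i) (x l)) = 0"
    by (intro sum.neutral ballI) auto
  moreover have "(\<Sum>i<a. (if a \<le> i then 2 else 0) * H (x i) z) = 0" for z
    by (intro sum.neutral ballI) auto
  ultimately show ?thesis
    unfolding wsum_def ustat_def sum_shift_split by (simp add: sum_distrib_left)
qed

text \<open>
  Pairs are sorted by whether the smaller index lies before \<open>a\<close>.
\<close>

lemma ustat_split:
  "ustat H n x = wsum (\<lambda>i l. if a \<le> i then 2 else 0) H n x + wsum (\<lambda>i l. if i < a then 2 else 0) H n x"
  unfolding ustat_wsum wsum_def sum.distrib[symmetric] by (intro sum.cong) auto

context iid_sample
begin

lemma iid_sample_shift: "iid_sample M (\<lambda>i. X (a + i)) D"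
proof
  have "indep_vars (\<lambda>j. PiM {a + j} (\<lambda>_. borel)) (\<lambda>j \<omega>. restrict (\<lambda>i. X i \<omega>) {a + j}) UNIV"
    by (rule indep_vars_restrict[OF indep]) (auto simp: disjoint_family_on_def)
  then have "indep_vars (\<lambda>_. borel) (\<lambda>j \<omega>. (\<lambda>x. x (a + j)) (restrict (\<lambda>i. X i \<omega>) {a + j})) UNIV"
    by (rule indep_vars_compose2) auto
  then show "indep_vars (\<lambda>_. borel) (\<lambda>i. X (a + i)) UNIV" by simp
qed (rule law)

text \<open>
  Each of the \<open>n\<close> rows contains at most \<open>a\<close> early indices.
\<close>

lemma early_pairs_second_moment:
  assumes k: "deg_kernel D A L H"
  shows "expectation (\<lambda>\<omega>. (wsum (\<lambda>i l. if i < a then 2 else 0) H n (\<lambda>i. X i \<omega>))\<^sup>2) \<le> 4 * real a * real n * kernel_var D H"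
  unfolding wsum_second_moment[OF k]
proof (rule mult_right_mono[OF _ kernel_var_bounds(1)[OF k]])
  have "(\<Sum>i<l. (if i < a then 2 else 0 :: real)\<^sup>2) \<le> 4 * real a" for l
  proof -
    have "(\<Sum>i<l. (if i < a then 2 else 0 :: real)\<^sup>2) = (\<Sum>i\<in>{..<l} \<inter> {..<a}. 4)"
      by (rule sum.mono_neutral_cong_right) auto
    also have "\<dots> = 4 * real (card ({..<l} \<inter> {..<a}))" by simp
    also have "\<dots> \<le> 4 * real a" using card_mono[of "{..<a}" "{..<l} \<inter> {..<a}"] by simp
    finally show ?thesis .
  qed
  then have "(\<Sum>l<n. \<Sum>i<l. (if i < a then 2 else 0 :: real)\<^sup>2) \<le> (\<Sum>l<n. 4 * real a)" by (intro sum_mono)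
  then show "(\<Sum>l<n. \<Sum>i<l. (if i < a then 2 else 0 :: real)\<^sup>2) \<le> 4 * real a * real n" by (simp add: mult.commute mult.left_commute)
qed

lemma second_moment_tail:
  assumes [measurable]: "Z \<in> borel_measurable M" and b: "\<And>\<omega>. \<bar>Z \<omega> :: real\<bar> \<le> c" and t: "0 < t"
  shows "prob {\<omega>\<in>space M. t \<le> \<bar>Z \<omega>\<bar>} \<le> expectation (\<lambda>\<omega>. (Z \<omega>)\<^sup>2) / t\<^sup>2"
proof -
  let ?E = "{\<omega>\<in>space M. t \<le> \<bar>Z \<omega>\<bar>}"
  have E: "?E \<in> sets M" by measurable
  have "prob ?E = expectation (\<lambda>\<omega>. indicator ?E \<omega>)" using E by simp
  also have "\<dots> \<le> expectation (\<lambda>\<omega>. (Z \<omega>)\<^sup>2 / t\<^sup>2)"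
  proof (rule integral_mono)
    show "integrable M (\<lambda>\<omega>. indicator ?E \<omega> :: real)"
      by (rule integrable_real_indicator[OF E]) (simp add: emeasure_eq_measure)
    show "integrable M (\<lambda>\<omega>. (Z \<omega>)\<^sup>2 / t\<^sup>2)"
      by (rule integrable_divide, rule integrable_const_bound[where B="c\<^sup>2"]) (use norm_sq_le[OF b] in auto)
    show "indicator ?E \<omega> \<le> (Z \<omega>)\<^sup>2 / t\<^sup>2" for \<omega>
    proof (cases "\<omega> \<in> ?E")
      case True
      then have "t\<^sup>2 \<le> \<bar>Z \<omega>\<bar>\<^sup>2" using t by (intro power_mono) auto
      then show ?thesis using True t by simp
    qed simp
  qed
  finally show ?thesis by simp
qed

text \<open>
  Along \<open>n\<^sub>k = ((k + 1)!)\<^sup>2\<close> with \<open>a\<^sub>k = (k!)\<^sup>2\<close>, the U-statistics of the observations between \<open>a\<^sub>k\<close> and \<open>n\<^sub>k\<close> are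
  independent. The ratio \<open>a\<^sub>k / n\<^sub>k = (k + 1)\<^sup>-\<^sup>2\<close> is small enough for the remaining pairs to be almost surely negligible by
  Chebyshev's inequality, while \<open>log log n\<^sub>k\<close> is still asymptotic to \<open>log k\<close>, so that the probabilities of large
  values have a divergent sum.
\<close>

theorem ustat_lil_lower:
  fixes H :: "nat \<Rightarrow> real \<Rightarrow> real \<Rightarrow> real" and L :: "nat \<Rightarrow> real"
  assumes k: "\<forall>\<^sub>F n in sequentially. deg_kernel D A (L n) (H n)"
    and L: "\<forall>\<^sub>F n in sequentially. c * real n powr \<delta> \<le> L n \<and> 2 * L n \<le> real n" and c: "0 < c" and \<delta>: "0 < \<delta>"
    and w: "(\<lambda>n. kernel_var D (H n) / L n) \<longlonglongrightarrow> \<sigma>\<^sup>2 / 2" and \<sigma>: "0 < \<sigma>"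
    and eps: "0 < \<epsilon>" "\<epsilon> \<le> 1"
  shows "AE \<omega> in M. \<exists>\<^sub>F n in sequentially.
    (1 - \<epsilon>) * (\<sigma> * real n * sqrt (L n) * sqrt (2 * ln (ln (real n)))) \<le> ustat (H n) n (\<lambda>i. X i \<omega>)"
proof -
  define \<eta> where "\<eta> = \<epsilon> / 8"
  have \<eta>: "0 < \<eta>" "\<eta> \<le> 1 / 8" using eps by (auto simp: \<eta>_def)
  obtain n0 where n0: "\<And>n. n0 \<le> n \<Longrightarrow> regular_at A c \<delta> \<sigma> \<eta> H L n"
    using eventually_regular[OF k L c w \<sigma> \<eta>(1)] by (auto simp: eventually_sequentially)
  \<comment> \<open>Squared factorials: the ratios grow like \<open>k\<^sup>2\<close>, whose reciprocals are summable, but the logarithms only like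
    \<open>k log k\<close>.\<close>
  define f :: "nat \<Rightarrow> nat" where "f k = (fact k)\<^sup>2" for k
  have fSuc: "f (Suc k) = (Suc k)\<^sup>2 * f k" for k unfolding f_def fact_Suc power_mult_distrib by simp
  have f1: "1 \<le> f k" for k by (simp add: f_def Suc_leI)
  have f_mono: "f k \<le> f k'" if "k \<le> k'" for k k' unfolding f_def using that by (intro power_mono fact_mono) auto
  have f_ge: "2 ^ k \<le> real (f (Suc k))" for k
  proof (induction k)
    case 0 show ?case by (simp add: f_def)
  next
    case (Suc k)
    have "2 * 1 \<le> (Suc (Suc k))\<^sup>2" by (simp add: power2_eq_square)
    then have "2 * f (Suc k) \<le> f (Suc (Suc k))" unfolding fSuc[of "Suc k"] by (intro mult_right_mono) auto
    then have "2 * real (f (Suc k)) \<le> real (f (Suc (Suc k)))" using of_nat_mono by fastforce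
    with Suc show ?case unfolding power_Suc by linarith
  qed
  \<comment> \<open>Up to time \<open>n k\<close> the observations split into \<open>a k\<close> early ones and a block of \<open>m k\<close> new ones.\<close>
  define n a m where "n k = f (Suc k)" and "a k = f k" and "m k = f (Suc k) - f k" for k
  have nma: "n k = a k + m k" for k unfolding n_def m_def a_def using f_mono[of k "Suc k"] by simp
  have na: "real (n k) = (real k + 1)\<^sup>2 * real (a k)" for k unfolding n_def a_def fSuc by (simp add: add.commute)
  define b where "b = \<sigma>\<^sup>2 / 4"
  have b: "0 < b" using \<sigma> by (simp add: b_def)
  \<comment> \<open>The summand one makes \<open>R\<close> positive.\<close>
  define R where "R = 6 * clt_const A b / sqrt c + 1"
  have clt0: "0 \<le> clt_const A b" using b by (simp add: clt_const_def)
  have R: "0 < R" unfolding R_def using clt0 c by (simp add: add_nonneg_pos)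
  define \<theta> where "\<theta> k = sqrt (2 * ln (ln (real (n k))))" for k
  define P where "P k \<longleftrightarrow> 2 \<le> k \<and> regular_at A c \<delta> \<sigma> \<eta> H L (n k) \<and> 16 / \<epsilon> \<le> \<theta> k \<and> (1 - \<epsilon> / 8) * ln (ln (real (n k))) \<le> ln (real k + 1)
    \<and> R * 2 powr (- (real k * \<delta> / 2)) \<le> 1 / (36 * (real k + 1)) \<and> 2 \<le> \<eta> * (real k + 1)\<^sup>2" for k
  have "\<forall>\<^sub>F k in sequentially. P k"
  proof -
    have a1: "\<forall>\<^sub>F k in sequentially. real n0 \<le> 2 ^ k" by real_asymp
    have a2: "\<forall>\<^sub>F k in sequentially. (16 / \<epsilon>)\<^sup>2 \<le> 2 * ln (real k * ln 2)" by real_asymp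
    have a3: "\<forall>\<^sub>F k in sequentially. (1 - \<epsilon> / 8) * ln (2 * (real k + 1) * ln (real k + 1)) \<le> ln (real k + 1)"
      using eps by real_asymp
    have a4: "\<forall>\<^sub>F k in sequentially. R * 2 powr (- (real k * \<delta> / 2)) \<le> 1 / (36 * (real k + 1))"
      using R \<delta> by real_asymp
    have a5: "\<forall>\<^sub>F k in sequentially. 2 \<le> \<eta> * (real k + 1)\<^sup>2" using \<eta> by real_asymp
    from a1 a2 a3 a4 a5 eventually_ge_at_top[of 2] show ?thesis
    proof eventually_elim
      case (elim k)
      have n2: "2 ^ k \<le> real (n k)" unfolding n_def by (rule f_ge)
      have npos: "0 < real (n k)" by (rule less_le_trans[OF _ n2]) simp
      have "n0 \<le> n k" using elim(1) n2 by (metis of_nat_le_iff order_trans)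
      then have "regular_at A c \<delta> \<sigma> \<eta> H L (n k)" by (rule n0)
      moreover have kln: "1 < real k * ln 2"
      proof -
        have "(0::real) < (16 / \<epsilon>)\<^sup>2" using eps by simp
        then have "0 < ln (real k * ln 2)" using elim(2) by linarith
        moreover have "0 < real k * ln 2" using elim by simp
        ultimately show ?thesis by simp
      qed
      have lnn: "real k * ln 2 \<le> ln (real (n k))"
      proof -
        have "ln (2 ^ k) \<le> ln (real (n k))" using n2 npos by (subst ln_le_cancel_iff) simp_all
        then show ?thesis by (simp add: ln_realpow)
      qed
      have LLge: "ln (real k * ln 2) \<le> ln (ln (real (n k)))" using kln lnn by (subst ln_le_cancel_iff) auto
      have "16 / \<epsilon> \<le> \<theta> k" unfolding \<theta>_def by (rule real_le_rsqrt) (use LLge elim(2) in linarith)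
      moreover have "(1 - \<epsilon> / 8) * ln (ln (real (n k))) \<le> ln (real k + 1)"
      proof -
        have "real (n k) \<le> ((real k + 1) ^ Suc k)\<^sup>2"
        proof -
          have "(fact (Suc k) :: real) \<le> real (Suc k ^ Suc k)" by (rule fact_le_power)
          then have "(fact (Suc k) :: real)\<^sup>2 \<le> (real (Suc k) ^ Suc k)\<^sup>2" by (intro power_mono) (simp_all only: of_nat_power fact_ge_zero)
          moreover have "real (n k) = (fact (Suc k))\<^sup>2" by (simp only: n_def f_def of_nat_power of_nat_fact)
          moreover have "real (Suc k) = real k + 1" by simp
          ultimately show ?thesis by (simp only:)
        qed
        then have "ln (real (n k)) \<le> ln (((real k + 1) ^ Suc k)\<^sup>2)"
          using n2 npos by (subst ln_le_cancel_iff) simp_all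
        also have "\<dots> = 2 * (real k + 1) * ln (real k + 1)"
          by (simp add: ln_realpow algebra_simps del: power_Suc)
        finally have "ln (ln (real (n k))) \<le> ln (2 * (real k + 1) * ln (real k + 1))"
          using kln lnn by (subst ln_le_cancel_iff) auto
        then have "(1 - \<epsilon> / 8) * ln (ln (real (n k))) \<le> (1 - \<epsilon> / 8) * ln (2 * (real k + 1) * ln (real k + 1))"
          using eps by (intro mult_left_mono) auto
        then show ?thesis using elim(3) by linarith
      qed
      ultimately show ?case unfolding P_def using elim by auto
    qed
  qed
  then obtain K where K: "\<And>k. K \<le> k \<Longrightarrow> P k" by (auto simp: eventually_sequentially)
  define T where "T k = (1 - \<epsilon> / 4) * \<theta> k" for k
  define s where "s k = sqrt (2 * real (m k) * (real (m k) - 1) * kernel_var D (H (n k)))" for k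
  define I where "I k = {a k..<n k}" for k
  define Q where "Q k x \<longleftrightarrow> K \<le> k \<longrightarrow> s k * T k \<le> ustat (H (n k)) (m k) (\<lambda>i. x (a k + i))" for k and x :: "nat \<Rightarrow> real"
  have Q_restrict: "Q k (restrict (\<lambda>i. X i \<omega>) (I k)) \<longleftrightarrow> Q k (\<lambda>i. X i \<omega>)" for k \<omega>
  proof -
    have "ustat (H (n k)) (m k) (\<lambda>i. restrict (\<lambda>i. X i \<omega>) (I k) (a k + i)) = ustat (H (n k)) (m k) (\<lambda>i. X (a k + i) \<omega>)"
      by (rule ustat_cong) (simp add: I_def nma)
    then show ?thesis unfolding Q_def by simp
  qed
  define F where "F k = {\<omega>\<in>space M. \<not> Q k (restrict (\<lambda>i. X i \<omega>) (I k))}" for k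
  have indF: "indep_events F UNIV"
    unfolding F_def
  proof (rule indep_eventsI_indep_vars[where N="\<lambda>k. PiM (I k) (\<lambda>_. borel)" and X="\<lambda>k \<omega>. restrict (\<lambda>i. X i \<omega>) (I k)" and P="\<lambda>k x. \<not> Q k x"])
    have "I k \<inter> I k' = {}" if "k < k'" for k k'
      unfolding I_def n_def a_def using f_mono[of "Suc k" k'] that by auto
    then have "disjoint_family_on I UNIV" unfolding disjoint_family_on_def by (metis Int_commute linorder_neqE_nat)
    then show "indep_vars (\<lambda>k. PiM (I k) (\<lambda>_. borel)) (\<lambda>k \<omega>. restrict (\<lambda>i. X i \<omega>) (I k)) UNIV"
      by (intro indep_vars_restrict[OF indep]) auto
    fix k
    show "{x \<in> space (PiM (I k) (\<lambda>_. borel)). \<not> Q k x} \<in> sets (PiM (I k) (\<lambda>_. borel))"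
    proof (cases "K \<le> k")
      case True
      then have dk: "deg_kernel D A (L (n k)) (H (n k))" using K by (auto simp: P_def regular_at_def)
      have [measurable]: "(\<lambda>x. ustat (H (n k)) (m k) (\<lambda>i. x (a k + i))) \<in> borel_measurable (PiM (I k) (\<lambda>_. borel))"
        unfolding ustat_wsum
        by (rule wsum_measurable[OF deg_kernelD(1)[OF dk]], rule measurable_component_singleton) (auto simp: I_def nma)
      have "{x \<in> space (PiM (I k) (\<lambda>_. borel)). \<not> s k * T k \<le> ustat (H (n k)) (m k) (\<lambda>i. x (a k + i))} \<in> sets (PiM (I k) (\<lambda>_. borel))"
        by measurable
      then show ?thesis unfolding Q_def using True by simp
    qed (simp add: Q_def)
  qed
  have facts: "2 \<le> m k" "L (n k) \<le> real (m k)" "0 < L (n k)" "b * L (n k) \<le> kernel_var D (H (n k))"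
    "(1 - \<eta>) * real (n k) \<le> real (m k) - 1" "deg_kernel D A (L (n k)) (H (n k))"
    "c * real (n k) powr \<delta> \<le> L (n k)" "\<sigma>\<^sup>2 / 2 * (1 - \<eta>) * L (n k) \<le> kernel_var D (H (n k))"
    "kernel_var D (H (n k)) \<le> \<sigma>\<^sup>2 / 2 * (1 + \<eta>) * L (n k)" if kK: "K \<le> k" for k
  proof -
    note Pk = K[OF kK, unfolded P_def]
    then show L0: "0 < L (n k)" and "deg_kernel D A (L (n k)) (H (n k))"
    "c * real (n k) powr \<delta> \<le> L (n k)" and w1: "\<sigma>\<^sup>2 / 2 * (1 - \<eta>) * L (n k) \<le> kernel_var D (H (n k))"
    "kernel_var D (H (n k)) \<le> \<sigma>\<^sup>2 / 2 * (1 + \<eta>) * L (n k)"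
      by (auto simp: regular_at_def)
    have a1: "1 \<le> real (a k)" using f1[of k] by (simp add: a_def)
    have "2 * real (a k) \<le> \<eta> * (real k + 1)\<^sup>2 * real (a k)" using Pk a1 by (intro mult_right_mono) auto
    also have "\<dots> = \<eta> * real (n k)" by (simp add: na)
    finally have 2: "2 * real (a k) \<le> \<eta> * real (n k)" .
    then show 1: "(1 - \<eta>) * real (n k) \<le> real (m k) - 1" using a1 nma[of k] by (simp add: left_diff_distrib)
    have "9 \<le> (real k + 1)\<^sup>2" using power_mono[of 3 "real k + 1" 2] Pk by simp
    then have "9 * 1 \<le> real (n k)" unfolding na using a1 by (intro mult_mono) auto
    then have n9: "9 \<le> real (n k)" by simp
    have "(7 / 8) * real (n k) \<le> (1 - \<eta>) * real (n k)" using \<eta> by (intro mult_right_mono) auto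
    then have m78: "(7 / 8) * real (n k) \<le> real (m k) - 1" using 1 by linarith
    then show "2 \<le> m k" using n9 by linarith
    have "2 * L (n k) \<le> real (n k)" using Pk by (auto simp: regular_at_def)
    then show "L (n k) \<le> real (m k)" using m78 n9 by linarith
    have "\<sigma>\<^sup>2 / 2 * (1 / 2) * L (n k) \<le> \<sigma>\<^sup>2 / 2 * (1 - \<eta>) * L (n k)" using \<eta> L0 by (intro mult_right_mono mult_left_mono) auto
    moreover have "b * L (n k) = \<sigma>\<^sup>2 / 2 * (1 / 2) * L (n k)" by (simp add: b_def)
    ultimately show "b * L (n k) \<le> kernel_var D (H (n k))" using w1 by (simp only:)
  qed
  have \<theta>: "16 / \<epsilon> \<le> \<theta> k" "1 \<le> \<theta> k" "2 \<le> \<epsilon> / 8 * \<theta> k" "(\<theta> k)\<^sup>2 = 2 * ln (ln (real (n k)))" "0 \<le> ln (ln (real (n k)))" if kK: "K \<le> k" for k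
  proof -
    show 1: "16 / \<epsilon> \<le> \<theta> k" using K[OF kK] by (simp add: P_def)
    have "16 \<le> 16 / \<epsilon>" using eps by (simp add: field_simps)
    then show 2: "1 \<le> \<theta> k" using 1 by linarith
    show "2 \<le> \<epsilon> / 8 * \<theta> k" using 1 eps by (simp add: pos_divide_le_eq mult.commute)
    have "0 < \<theta> k" using 2 by linarith
    then show "0 \<le> ln (ln (real (n k)))" unfolding \<theta>_def by simp
    then show "(\<theta> k)\<^sup>2 = 2 * ln (ln (real (n k)))" unfolding \<theta>_def by simp
  qed
  have pF: "1 / (36 * (real k + 1)) \<le> 1 - prob (F k)" if kK: "K \<le> k" for k
  proof -
    interpret S: iid_sample M "\<lambda>i. X (a k + i)" D by (rule iid_sample_shift)
    note Pk = K[OF kK, unfolded P_def]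
    note fk = facts[OF kK] and tk = \<theta>[OF kK]
    let ?E = "{\<omega>\<in>space M. s k * T k \<le> ustat (H (n k)) (m k) (\<lambda>i. X (a k + i) \<omega>)}"
    have FE: "F k = space M - ?E" unfolding F_def Q_restrict by (auto simp: Q_def kK)
    have [measurable]: "(\<lambda>\<omega>. ustat (H (n k)) (m k) (\<lambda>i. X (a k + i) \<omega>)) \<in> borel_measurable M"
      by (rule S.ustat_measurable[OF fk(6)])
    have "?E \<in> sets M" by measurable
    then have eE: "1 - prob (F k) = prob ?E" unfolding FE by (simp add: prob_compl)
    have A1: "exp (- (T k + 2)\<^sup>2 / 2) / (6 * sqrt (2 * pi)) - 3 * clt_const A b * (1 / sqrt (m k) + 1 / sqrt (L (n k))) \<le> prob ?E"
      unfolding s_def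
    proof (rule S.ustat_lower_tail[OF fk(6,1) b fk(3,2,4)])
      show "0 \<le> T k" unfolding T_def using tk eps by simp
    qed
    have A2: "1 / (18 * (real k + 1)) \<le> exp (- (T k + 2)\<^sup>2 / 2) / (6 * sqrt (2 * pi))"
    proof -
      have "T k + 2 \<le> (1 - \<epsilon> / 8) * \<theta> k" unfolding T_def using tk by (simp add: algebra_simps)
      moreover have "0 \<le> T k + 2" unfolding T_def using tk eps by simp
      ultimately have "(T k + 2)\<^sup>2 \<le> ((1 - \<epsilon> / 8) * \<theta> k)\<^sup>2" by (intro power_mono)
      also have "\<dots> = 2 * ((1 - \<epsilon> / 8) * ((1 - \<epsilon> / 8) * ln (ln (real (n k)))))"
        unfolding power_mult_distrib tk(4) by (simp add: power2_eq_square)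
      also have "\<dots> \<le> 2 * (1 * ((1 - \<epsilon> / 8) * ln (ln (real (n k)))))"
        using eps tk by (intro mult_left_mono mult_right_mono) auto
      also have "\<dots> \<le> 2 * ln (real k + 1)" using Pk by simp
      finally have "- ln (real k + 1) \<le> - (T k + 2)\<^sup>2 / 2" by simp
      then have "exp (- ln (real k + 1)) \<le> exp (- (T k + 2)\<^sup>2 / 2)" by simp
      then have e: "1 / (real k + 1) \<le> exp (- (T k + 2)\<^sup>2 / 2)" by (simp add: exp_minus inverse_eq_divide add.commute)
      have "sqrt (2 * pi) \<le> 3" by (rule real_le_lsqrt) (use pi_less_4 in auto)
      then have "6 * sqrt (2 * pi) \<le> 18" by simp
      with e have "(1 / (real k + 1)) / 18 \<le> exp (- (T k + 2)\<^sup>2 / 2) / (6 * sqrt (2 * pi))"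
        by (intro frac_le) auto
      then show ?thesis by (simp add: field_simps)
    qed
    have A3: "3 * clt_const A b * (1 / sqrt (m k) + 1 / sqrt (L (n k))) \<le> 1 / (36 * (real k + 1))"
    proof -
      have nk: "2 powr real k \<le> real (n k)" using f_ge[of k] by (simp add: n_def powr_realpow)
      have "(2 powr (real k * \<delta> / 2))\<^sup>2 = (2 powr real k) powr \<delta>"
        by (simp add: powr_powr power2_eq_square powr_add[symmetric] mult.commute)
      then have "sqrt c * 2 powr (real k * \<delta> / 2) = sqrt (c * (2 powr real k) powr \<delta>)"
        by (metis real_sqrt_mult real_sqrt_unique powr_ge_zero)
      also have "\<dots> \<le> sqrt (L (n k))"
      proof (rule real_sqrt_le_mono)
        have "c * (2 powr real k) powr \<delta> \<le> c * real (n k) powr \<delta>" using c \<delta> nk by (intro mult_left_mono powr_mono2) auto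
        then show "c * (2 powr real k) powr \<delta> \<le> L (n k)" using fk(7) by linarith
      qed
      finally have sL: "sqrt c * 2 powr (real k * \<delta> / 2) \<le> sqrt (L (n k))" .
      have "1 / sqrt (m k) \<le> 1 / sqrt (L (n k))" using fk by (intro divide_left_mono real_sqrt_le_mono) auto
      then have "1 / sqrt (m k) + 1 / sqrt (L (n k)) \<le> 2 / sqrt (L (n k))" by simp
      also have "\<dots> \<le> 2 / (sqrt c * 2 powr (real k * \<delta> / 2))" using sL c fk by (intro divide_left_mono) auto
      finally have "3 * clt_const A b * (1 / sqrt (m k) + 1 / sqrt (L (n k))) \<le> 3 * clt_const A b * (2 / (sqrt c * 2 powr (real k * \<delta> / 2)))"
        using clt0 by (intro mult_left_mono) auto
      also have "\<dots> = (6 * clt_const A b / sqrt c) * 2 powr (- (real k * \<delta> / 2))" by (simp add: powr_minus field_simps)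
      also have "\<dots> \<le> R * 2 powr (- (real k * \<delta> / 2))" unfolding R_def by (intro mult_right_mono) auto
      finally show ?thesis using Pk by linarith
    qed
    have "1 / (36 * (real k + 1)) = 1 / (18 * (real k + 1)) - 1 / (36 * (real k + 1))" by (simp add: field_simps)
    also have "\<dots> \<le> prob ?E" by (rule order_trans[OF diff_mono[OF A2 A3] A1])
    finally show ?thesis unfolding eE .
  qed
  have "\<not> summable (\<lambda>k. 1 - prob (F k))"
  proof
    assume "summable (\<lambda>k. 1 - prob (F k))"
    then have "summable (\<lambda>k. 1 / (36 * (real k + 1)))"
      by (rule summable_comparison_test'[where N=K]) (use pF in auto)
    then have "summable (\<lambda>k. 36 * (1 / (36 * (real k + 1))))" by (rule summable_mult)
    moreover have "36 * (1 / (36 * (real k + 1))) = real (Suc k) powr (- 1)" for k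
      by (simp add: powr_minus field_simps)
    ultimately have "summable (\<lambda>k. real (Suc k) powr (- 1))" by (simp only:)
    then have "summable (\<lambda>k. real k powr (- 1))" by (subst (asm) summable_Suc_iff)
    then show False unfolding summable_real_powr_iff by simp
  qed
  from indep_borel_cantelli[OF indF this]
  have often: "AE \<omega> in M. \<exists>\<^sub>F k in sequentially. \<omega> \<notin> F k" .
  define rest where "rest k \<omega> = wsum (\<lambda>i l. if i < a k then 2 else 0) (H (n k)) (n k) (\<lambda>i. X i \<omega>)" for k \<omega>
  define t where "t k = \<epsilon> / 2 * (\<sigma> * real (n k) * sqrt (L (n k)) * \<theta> k)" for k
  define G where "G k = (if K \<le> k then {\<omega>\<in>space M. t k \<le> \<bar>rest k \<omega>\<bar>} else {})" for k
  have restm: "rest k \<in> borel_measurable M" if "K \<le> k" for k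
    unfolding rest_def by (rule wsum_measurable[OF deg_kernelD(1)[OF facts(6)[OF that]]]) simp
  have Gs: "G k \<in> sets M" for k
  proof (cases "K \<le> k")
    case True
    note [measurable] = restm[OF True]
    have "{\<omega>\<in>space M. t k \<le> \<bar>rest k \<omega>\<bar>} \<in> sets M" by measurable
    then show ?thesis using True by (simp add: G_def)
  qed (simp add: G_def)
  have probG: "prob (G k) \<le> 16 / \<epsilon>\<^sup>2 * (1 / (real (Suc k))\<^sup>2)" if kK: "K \<le> k" for k
  proof -
    note fk = facts[OF kK] and tk = \<theta>[OF kK]
    have a1: "1 \<le> real (a k)" using f1[of k] by (simp add: a_def)
    have npos: "0 < real (n k)" unfolding na using a1 by simp
    have tpos: "0 < t k" unfolding t_def using eps \<sigma> npos fk(3) tk(2) by simp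
    have rb: "\<bar>rest k \<omega>\<bar> \<le> (\<Sum>l<n k. \<Sum>i<l. \<bar>if i < a k then 2 else 0\<bar> * (A * L (n k)))" for \<omega>
      unfolding rest_def by (rule wsum_bound[OF deg_kernelD(4)[OF fk(6)]])
    have "prob (G k) \<le> expectation (\<lambda>\<omega>. (rest k \<omega>)\<^sup>2) / (t k)\<^sup>2"
      unfolding G_def using kK second_moment_tail[OF restm[OF kK] rb tpos] by simp
    also have "\<dots> \<le> (4 * real (a k) * real (n k) * (\<sigma>\<^sup>2 * L (n k))) / (\<epsilon>\<^sup>2 / 4 * \<sigma>\<^sup>2 * (real (n k))\<^sup>2 * L (n k))"
    proof (rule frac_le)
      have "expectation (\<lambda>\<omega>. (rest k \<omega>)\<^sup>2) \<le> 4 * real (a k) * real (n k) * kernel_var D (H (n k))"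
        unfolding rest_def by (rule early_pairs_second_moment[OF fk(6)])
      also have "\<dots> \<le> 4 * real (a k) * real (n k) * (\<sigma>\<^sup>2 * L (n k))"
      proof (rule mult_left_mono)
        have "\<sigma>\<^sup>2 / 2 * (1 + \<eta>) * L (n k) \<le> \<sigma>\<^sup>2 / 2 * 2 * L (n k)" using \<eta> fk(3) by (intro mult_right_mono mult_left_mono) auto
        then show "kernel_var D (H (n k)) \<le> \<sigma>\<^sup>2 * L (n k)" using fk(9) by simp
      qed simp
      finally show "expectation (\<lambda>\<omega>. (rest k \<omega>)\<^sup>2) \<le> 4 * real (a k) * real (n k) * (\<sigma>\<^sup>2 * L (n k))" .
      have "\<epsilon>\<^sup>2 / 4 * \<sigma>\<^sup>2 * (real (n k))\<^sup>2 * L (n k) * 1 \<le> \<epsilon>\<^sup>2 / 4 * \<sigma>\<^sup>2 * (real (n k))\<^sup>2 * L (n k) * (\<theta> k)\<^sup>2"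
        using tk(2) fk(3) by (intro mult_left_mono) auto
      also have "\<dots> = (t k)\<^sup>2" unfolding t_def using fk(3) by (simp add: power_mult_distrib power_divide)
      finally show "\<epsilon>\<^sup>2 / 4 * \<sigma>\<^sup>2 * (real (n k))\<^sup>2 * L (n k) \<le> (t k)\<^sup>2" by simp
    qed (use eps \<sigma> npos fk(3) in auto)
    also have "\<dots> = 16 / \<epsilon>\<^sup>2 * (real (a k) / real (n k))"
      using eps \<sigma> npos fk(3) by (simp add: field_simps power2_eq_square)
    also have "\<dots> = 16 / \<epsilon>\<^sup>2 * (1 / (real (Suc k))\<^sup>2)" unfolding na using a1 by (simp add: add.commute)
    finally show ?thesis .
  qed
  have rare: "AE \<omega> in M. \<forall>\<^sub>F k in sequentially. \<omega> \<in> space M - G k"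
  proof (rule borel_cantelli_AE1[OF Gs])
    show "emeasure M (G k) < \<infinity>" for k by (simp add: emeasure_eq_measure)
    show "summable (\<lambda>k. measure M (G k))"
    proof (rule summable_comparison_test'[where N=K])
      have "summable (\<lambda>k. 1 / (real (Suc k))\<^sup>2)"
        using inverse_power_summable[of 2, where ?'a=real] by (subst summable_Suc_iff) (simp add: inverse_eq_divide)
      then show "summable (\<lambda>k. 16 / \<epsilon>\<^sup>2 * (1 / (real (Suc k))\<^sup>2))" by (rule summable_mult)
    qed (use probG in auto)
  qed
  from often rare show ?thesis
  proof eventually_elim
    case (elim \<omega>)
    have "\<exists>\<^sub>F k in sequentially. \<omega> \<notin> F k \<and> \<omega> \<in> space M - G k \<and> K \<le> k"
      using elim by (intro frequently_eventually_frequently eventually_conj eventually_ge_at_top) auto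
    then have fr: "\<exists>\<^sub>F k in sequentially. (1 - \<epsilon>) * (\<sigma> * real (n k) * sqrt (L (n k)) * sqrt (2 * ln (ln (real (n k))))) \<le> ustat (H (n k)) (n k) (\<lambda>i. X i \<omega>)"
    proof (rule frequently_elim1)
      fix k assume *: "\<omega> \<notin> F k \<and> \<omega> \<in> space M - G k \<and> K \<le> k"
      then have kK: "K \<le> k" by simp
      note fk = facts[OF kK] and tk = \<theta>[OF kK]
      have "Q k (\<lambda>i. X i \<omega>)" using * unfolding F_def Q_restrict by auto
      then have blk: "s k * T k \<le> ustat (H (n k)) (m k) (\<lambda>i. X (a k + i) \<omega>)" using kK by (simp add: Q_def)
      have r: "\<bar>rest k \<omega>\<bar> < t k" using * kK by (auto simp: G_def)
      have split: "ustat (H (n k)) (n k) (\<lambda>i. X i \<omega>) = ustat (H (n k)) (m k) (\<lambda>i. X (a k + i) \<omega>) + rest k \<omega>"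
        unfolding rest_def ustat_split[where a="a k"] nma ustat_block ..
      define Z where "Z = \<sigma> * real (n k) * sqrt (L (n k)) * \<theta> k"
      have Z0: "0 \<le> Z" unfolding Z_def using \<sigma> fk(3) tk(2) by simp
      have "(1 - \<epsilon> / 2) * Z \<le> s k * T k"
      proof -
        have m1: "0 \<le> real (m k) - 1" using fk(1) by simp
        have "(1 - \<eta>) * real (n k) * (\<sigma> * (1 - \<eta>) * sqrt (L (n k))) \<le> (real (m k) - 1) * (\<sigma> * (1 - \<eta>) * sqrt (L (n k)))"
          using fk(5,3) \<sigma> \<eta> by (intro mult_right_mono) auto
        also have "\<dots> = sqrt ((real (m k) - 1)\<^sup>2 * (\<sigma>\<^sup>2 * (1 - \<eta>)\<^sup>2 * L (n k)))"
          using m1 \<sigma> \<eta> by (simp add: real_sqrt_mult)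
        also have "\<dots> \<le> s k" unfolding s_def
        proof (rule real_sqrt_le_mono)
          have "(real (m k) - 1)\<^sup>2 * (\<sigma>\<^sup>2 * (1 - \<eta>)\<^sup>2 * L (n k)) \<le> (real (m k) * (real (m k) - 1)) * (\<sigma>\<^sup>2 * (1 - \<eta>) * L (n k))"
            using m1 \<eta> fk(3) unfolding power2_eq_square
            by (intro mult_mono mult_right_mono mult_left_mono) (auto intro: mult_left_le)
          also have "\<dots> = 2 * real (m k) * (real (m k) - 1) * (\<sigma>\<^sup>2 / 2 * (1 - \<eta>) * L (n k))" by simp
          also have "\<dots> \<le> 2 * real (m k) * (real (m k) - 1) * kernel_var D (H (n k))"
            using m1 by (intro mult_left_mono fk(8)) auto
          finally show "(real (m k) - 1)\<^sup>2 * (\<sigma>\<^sup>2 * (1 - \<eta>)\<^sup>2 * L (n k)) \<le> 2 * real (m k) * (real (m k) - 1) * kernel_var D (H (n k))" .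
        qed
        finally have "(1 - \<eta>) * real (n k) * (\<sigma> * (1 - \<eta>) * sqrt (L (n k))) * T k \<le> s k * T k"
          by (rule mult_right_mono) (use tk eps in \<open>simp add: T_def\<close>)
        moreover have "(1 - \<eta>) * real (n k) * (\<sigma> * (1 - \<eta>) * sqrt (L (n k))) * T k = ((1 - \<eta>)\<^sup>2 * (1 - \<epsilon> / 4)) * Z"
          unfolding T_def Z_def by (simp add: power2_eq_square)
        moreover have "1 - \<epsilon> / 2 \<le> (1 - \<eta>)\<^sup>2 * (1 - \<epsilon> / 4)"
        proof -
          have "1 - \<epsilon> / 4 \<le> (1 - \<eta>)\<^sup>2" unfolding \<eta>_def by (simp add: power2_eq_square field_simps)
          then have "(1 - \<epsilon> / 4) * (1 - \<epsilon> / 4) \<le> (1 - \<eta>)\<^sup>2 * (1 - \<epsilon> / 4)" using eps by (intro mult_right_mono) auto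
          moreover have "1 - \<epsilon> / 2 \<le> (1 - \<epsilon> / 4) * (1 - \<epsilon> / 4)" by (simp add: field_simps)
          ultimately show ?thesis by linarith
        qed
        ultimately show ?thesis using mult_right_mono[OF _ Z0, of "1 - \<epsilon> / 2" "(1 - \<eta>)\<^sup>2 * (1 - \<epsilon> / 4)"] by linarith
      qed
      moreover have "t k = \<epsilon> / 2 * Z" by (simp add: t_def Z_def)
      moreover have "(1 - \<epsilon>) * Z = (1 - \<epsilon> / 2) * Z - \<epsilon> / 2 * Z" by (simp add: left_diff_distrib)
      ultimately have "(1 - \<epsilon>) * Z \<le> ustat (H (n k)) (n k) (\<lambda>i. X i \<omega>)" using blk r split by linarith
      then show "(1 - \<epsilon>) * (\<sigma> * real (n k) * sqrt (L (n k)) * sqrt (2 * ln (ln (real (n k))))) \<le> ustat (H (n k)) (n k) (\<lambda>i. X i \<omega>)"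
        unfolding Z_def \<theta>_def .
    qed
    have n_top: "filterlim n sequentially sequentially"
    proof (rule filterlim_subseq)
      have "f (Suc k) < f (Suc (Suc k))" for k
        unfolding fSuc[of "Suc k"] using f1[of "Suc k"] by (simp add: power2_eq_square)
      then show "strict_mono n" unfolding n_def by (intro strict_mono_Suc_iff[THEN iffD2]) auto
    qed
    show ?case
    proof (rule ccontr)
      assume "\<not> ?case"
      then have "\<forall>\<^sub>F n in sequentially. \<not> (1 - \<epsilon>) * (\<sigma> * real n * sqrt (L n) * sqrt (2 * ln (ln (real n)))) \<le> ustat (H n) n (\<lambda>i. X i \<omega>)"
        by (simp add: frequently_def)
      from filterlim_iff[THEN iffD1, OF n_top, rule_format, OF this] fr show False by (simp add: frequently_def)
    qed
  qed
qed

end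

section \<open>Parseval identities for wavelet bases\<close>

lemma L2_measurable: "g \<in> L2 \<Longrightarrow> g \<in> borel_measurable borel"
  by (simp add: L2_def)

lemma L2_square_integrable: "g \<in> L2 \<Longrightarrow> integrable lborel (\<lambda>x. (g x)\<^sup>2)"
  by (simp add: L2_def)

lemma L2_mult_integrable:
  assumes "g \<in> L2" "h \<in> L2" shows "integrable lborel (\<lambda>x. g x * h x)"
proof (rule Bochner_Integration.integrable_bound)
  note [measurable] = L2_measurable[OF assms(1)] L2_measurable[OF assms(2)]
  show "integrable lborel (\<lambda>x. (g x)\<^sup>2 + (h x)\<^sup>2)" using assms by (simp add: L2_def)
  show "(\<lambda>x. g x * h x) \<in> borel_measurable lborel" by measurable
  have "\<bar>a * b\<bar> \<le> a\<^sup>2 + b\<^sup>2" for a b :: real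
  proof -
    have "0 \<le> (\<bar>a\<bar> - \<bar>b\<bar>)\<^sup>2" by simp
    then have "2 * (\<bar>a\<bar> * \<bar>b\<bar>) \<le> a\<^sup>2 + b\<^sup>2" by (simp add: power2_diff)
    moreover have "0 \<le> \<bar>a\<bar> * \<bar>b\<bar>" by simp
    ultimately show ?thesis unfolding abs_mult by linarith
  qed
  then show "AE x in lborel. norm (g x * h x) \<le> norm ((g x)\<^sup>2 + (h x)\<^sup>2)" by simp
qed

lemma L2_comb:
  assumes "g \<in> L2" "h \<in> L2" shows "(\<lambda>x. a * g x + b * h x) \<in> L2"
proof -
  note [measurable] = L2_measurable[OF assms(1)] L2_measurable[OF assms(2)]
  have "(\<lambda>x. (a * g x + b * h x)\<^sup>2) = (\<lambda>x. a\<^sup>2 * (g x)\<^sup>2 + 2 * a * b * (g x * h x) + b\<^sup>2 * (h x)\<^sup>2)"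
    by (simp add: fun_eq_iff power2_eq_square algebra_simps)
  then show ?thesis
    using L2_mult_integrable[OF assms] L2_square_integrable[OF assms(1)] L2_square_integrable[OF assms(2)]
    by (simp add: L2_def)
qed

lemma L2_add: "g \<in> L2 \<Longrightarrow> h \<in> L2 \<Longrightarrow> (\<lambda>x. g x + h x) \<in> L2"
  using L2_comb[of g h 1 1] by simp

lemma L2_diff: "g \<in> L2 \<Longrightarrow> h \<in> L2 \<Longrightarrow> (\<lambda>x. g x - h x) \<in> L2"
  using L2_comb[of g h 1 "-1"] by simp

lemma L2_sum: "(\<And>i. i \<in> I \<Longrightarrow> u i \<in> L2) \<Longrightarrow> (\<lambda>x. \<Sum>i\<in>I. c i * u i x) \<in> L2"
proof (induction I rule: infinite_finite_induct)
  case (insert i I)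
  have "(\<lambda>x. c i * u i x + 1 * (\<Sum>i\<in>I. c i * u i x)) \<in> L2" by (rule L2_comb) (use insert in auto)
  then show ?case using insert by simp
qed (auto simp: L2_def)

lemma L2_inner_add: "g \<in> L2 \<Longrightarrow> h \<in> L2 \<Longrightarrow> w \<in> L2 \<Longrightarrow> L2_inner (\<lambda>x. g x + h x) w = L2_inner g w + L2_inner h w"
  unfolding L2_inner_def by (simp add: distrib_right L2_mult_integrable)

lemma L2_inner_diff: "g \<in> L2 \<Longrightarrow> h \<in> L2 \<Longrightarrow> w \<in> L2 \<Longrightarrow> L2_inner (\<lambda>x. g x - h x) w = L2_inner g w - L2_inner h w"
  unfolding L2_inner_def by (simp add: left_diff_distrib L2_mult_integrable)

lemma L2_inner_commute: "L2_inner g h = L2_inner h g"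
  by (simp add: L2_inner_def mult.commute)

lemma L2_inner_sum:
  assumes "\<And>i. i \<in> I \<Longrightarrow> u i \<in> L2" "w \<in> L2"
  shows "L2_inner (\<lambda>x. \<Sum>i\<in>I. c i * u i x) w = (\<Sum>i\<in>I. c i * L2_inner (u i) w)"
proof -
  have "L2_inner (\<lambda>x. \<Sum>i\<in>I. c i * u i x) w = (\<integral>x. (\<Sum>i\<in>I. c i * (u i x * w x)) \<partial>lborel)"
    unfolding L2_inner_def by (simp add: sum_distrib_right mult.assoc)
  also have "\<dots> = (\<Sum>i\<in>I. \<integral>x. c i * (u i x * w x) \<partial>lborel)"
    by (rule Bochner_Integration.integral_sum) (intro integrable_mult_right L2_mult_integrable assms)
  finally show ?thesis by (simp add: L2_inner_def)
qed

lemma L2_norm_sq: "(L2_norm g)\<^sup>2 = L2_inner g g"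
  unfolding L2_norm_def L2_inner_def by (simp add: power2_eq_square)

text \<open>
  Pythagoras for the approximation of \<open>g\<close> by an arbitrary finite combination; it gives Bessel's inequality and the optimality
  of the Fourier coefficients at once.
\<close>

lemma bessel_identity:
  assumes g: "g \<in> L2" and u: "\<And>i. u i \<in> L2"
    and on: "\<And>i i'. L2_inner (u i) (u i') = (if i = i' then 1 else 0)" and I: "finite I"
  shows "(L2_norm (\<lambda>x. g x - (\<Sum>i\<in>I. d i * u i x)))\<^sup>2 =
     L2_inner g g - (\<Sum>i\<in>I. (L2_inner g (u i))\<^sup>2) + (\<Sum>i\<in>I. (L2_inner g (u i) - d i)\<^sup>2)"
proof -
  let ?s = "\<lambda>x. \<Sum>i\<in>I. d i * u i x"
  have s: "?s \<in> L2" by (rule L2_sum) (rule u)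
  have sg: "L2_inner ?s g = (\<Sum>i\<in>I. d i * L2_inner g (u i))"
    by (subst L2_inner_sum) (auto simp: u g L2_inner_commute)
  have "L2_inner ?s ?s = (\<Sum>i\<in>I. d i * L2_inner ?s (u i))"
    by (subst L2_inner_sum) (auto simp: u s L2_inner_commute)
  also have "\<dots> = (\<Sum>i\<in>I. d i * d i)"
  proof (rule sum.cong[OF refl])
    fix i assume i: "i \<in> I"
    have "L2_inner ?s (u i) = (\<Sum>i'\<in>I. d i' * L2_inner (u i') (u i))" by (rule L2_inner_sum) (auto simp: u)
    also have "\<dots> = (\<Sum>i'\<in>I. if i' = i then d i else 0)" by (rule sum.cong) (auto simp: on)
    also have "\<dots> = d i" using i I by simp
    finally show "d i * L2_inner ?s (u i) = d i * d i" by simp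
  qed
  finally have ss: "L2_inner ?s ?s = (\<Sum>i\<in>I. d i * d i)" .
  have "L2_inner (\<lambda>x. g x - ?s x) (\<lambda>x. g x - ?s x) = L2_inner g (\<lambda>x. g x - ?s x) - L2_inner ?s (\<lambda>x. g x - ?s x)"
    by (rule L2_inner_diff[OF g s L2_diff[OF g s]])
  also have "\<dots> = L2_inner (\<lambda>x. g x - ?s x) g - L2_inner (\<lambda>x. g x - ?s x) ?s" by (simp only: L2_inner_commute)
  also have "\<dots> = (L2_inner g g - L2_inner ?s g) - (L2_inner g ?s - L2_inner ?s ?s)"
    by (simp only: L2_inner_diff[OF g s g] L2_inner_diff[OF g s s])
  also have "L2_inner g ?s = L2_inner ?s g" by (rule L2_inner_commute)
  also have "(L2_inner g g - L2_inner ?s g) - (L2_inner ?s g - L2_inner ?s ?s)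
     = L2_inner g g - (\<Sum>i\<in>I. (L2_inner g (u i))\<^sup>2) + (\<Sum>i\<in>I. (L2_inner g (u i) - d i)\<^sup>2)"
    unfolding sg ss by (simp add: power2_eq_square algebra_simps sum.distrib sum_subtractf sum_distrib_left)
  finally show ?thesis by (simp only: L2_norm_sq)
qed

lemma parseval_square:
  assumes b: "orthonormal_basis_of u L2" and g: "g \<in> L2"
  shows "((\<lambda>i. (L2_inner g (u i))\<^sup>2) has_sum L2_inner g g) UNIV"
proof -
  have u: "\<And>i. u i \<in> L2" and on: "\<And>i i'. L2_inner (u i) (u i') = (if i = i' then 1 else 0)"
    and dense: "\<And>e. 0 < e \<Longrightarrow> \<exists>I c. finite I \<and> L2_norm (\<lambda>x. g x - (\<Sum>i\<in>I. c i * u i x)) < e"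
    using b g unfolding orthonormal_basis_of_def by blast+
  let ?c = "\<lambda>i. (L2_inner g (u i))\<^sup>2"
  have le: "sum ?c I \<le> L2_inner g g" if "finite I" for I
  proof -
    have "0 \<le> (L2_norm (\<lambda>x. g x - (\<Sum>i\<in>I. L2_inner g (u i) * u i x)))\<^sup>2" by (rule zero_le_power2)
    then show ?thesis unfolding bessel_identity[OF g u on that] by simp
  qed
  show ?thesis
    unfolding has_sum_def
  proof (rule tendstoI)
    fix e :: real assume e: "0 < e"
    obtain I c where I: "finite I" "L2_norm (\<lambda>x. g x - (\<Sum>i\<in>I. c i * u i x)) < sqrt e"
      using dense[of "sqrt e"] e by auto
    have "0 \<le> L2_norm (\<lambda>x. g x - (\<Sum>i\<in>I. c i * u i x))" unfolding L2_norm_def by simp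
    then have "(L2_norm (\<lambda>x. g x - (\<Sum>i\<in>I. c i * u i x)))\<^sup>2 < (sqrt e)\<^sup>2" using I(2) by (intro power_strict_mono) auto
    then have "L2_inner g g - sum ?c I + (\<Sum>i\<in>I. (L2_inner g (u i) - c i)\<^sup>2) < e"
      using bessel_identity[OF g u on I(1), of c] e by simp
    moreover have "0 \<le> (\<Sum>i\<in>I. (L2_inner g (u i) - c i)\<^sup>2)" by (intro sum_nonneg) auto
    ultimately have *: "L2_inner g g - sum ?c I < e" by linarith
    show "\<forall>\<^sub>F F in finite_subsets_at_top UNIV. dist (sum ?c F) (L2_inner g g) < e"
      unfolding eventually_finite_subsets_at_top
    proof (intro exI[of _ I] conjI allI impI)
      fix F assume F: "finite F \<and> I \<subseteq> F \<and> F \<subseteq> UNIV"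
      then have "sum ?c I \<le> sum ?c F" by (intro sum_mono2) auto
      then show "dist (sum ?c F) (L2_inner g g) < e" using le[of F] F * by (simp add: dist_real_def)
    qed (use I in auto)
  qed
qed

text \<open>
  By polarization.
\<close>

lemma parseval:
  assumes b: "orthonormal_basis_of u L2" and g: "g \<in> L2" and h: "h \<in> L2"
  shows "((\<lambda>i. L2_inner g (u i) * L2_inner h (u i)) has_sum L2_inner g h) UNIV"
proof -
  have u: "\<And>i. u i \<in> L2" using b unfolding orthonormal_basis_of_def by blast
  have gh: "(\<lambda>x. g x + h x) \<in> L2" "(\<lambda>x. g x - h x) \<in> L2" using g h by (auto intro: L2_add L2_diff)
  have 1: "((\<lambda>i. (1/4) * ((L2_inner (\<lambda>x. g x + h x) (u i))\<^sup>2 + (-1) * (L2_inner (\<lambda>x. g x - h x) (u i))\<^sup>2))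
     has_sum (1/4) * (L2_inner (\<lambda>x. g x + h x) (\<lambda>x. g x + h x) + (-1) * L2_inner (\<lambda>x. g x - h x) (\<lambda>x. g x - h x))) UNIV"
    by (intro has_sum_cmult_right has_sum_add parseval_square[OF b] gh)
  have 2: "(1/4) * ((L2_inner (\<lambda>x. g x + h x) (u i))\<^sup>2 + (-1) * (L2_inner (\<lambda>x. g x - h x) (u i))\<^sup>2) = L2_inner g (u i) * L2_inner h (u i)" for i
    unfolding L2_inner_add[OF g h u] L2_inner_diff[OF g h u] by (simp add: power2_eq_square algebra_simps)
  have 3: "L2_inner (\<lambda>x. g x + h x) (\<lambda>x. g x + h x) = L2_inner g g + 2 * L2_inner g h + L2_inner h h"
    unfolding L2_inner_add[OF g h gh(1)] unfolding L2_inner_commute[of g "\<lambda>x. g x + h x"] L2_inner_commute[of h "\<lambda>x. g x + h x"]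
      L2_inner_add[OF g h g] L2_inner_add[OF g h h] L2_inner_commute[of h g] by simp
  have 4: "L2_inner (\<lambda>x. g x - h x) (\<lambda>x. g x - h x) = L2_inner g g - 2 * L2_inner g h + L2_inner h h"
    unfolding L2_inner_diff[OF g h gh(2)] unfolding L2_inner_commute[of g "\<lambda>x. g x - h x"] L2_inner_commute[of h "\<lambda>x. g x - h x"]
      L2_inner_diff[OF g h g] L2_inner_diff[OF g h h] L2_inner_commute[of h g] by simp
  have "(1/4) * (L2_inner (\<lambda>x. g x + h x) (\<lambda>x. g x + h x) + (-1) * L2_inner (\<lambda>x. g x - h x) (\<lambda>x. g x - h x)) = L2_inner g h"
    unfolding 3 4 by simp
  then show ?thesis using 1 unfolding 2 by simp
qed

lemma dilate_measurable [measurable]: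
  assumes [measurable]: "\<theta> \<in> borel_measurable borel"
  shows "dilate \<theta> j k \<in> borel_measurable borel"
  unfolding dilate_def[abs_def] by measurable

lemma dilate_Suc: "dilate \<theta> (j + 1) k x = sqrt 2 * dilate \<theta> j k (2 * x)"
proof -
  have "2 powr (real_of_int (j + 1) / 2) = 2 powr (real_of_int j / 2) * sqrt 2"
    by (simp add: add_divide_distrib powr_add powr_half_sqrt)
  moreover have "2 powi (j + 1) * x = 2 powi j * (2 * x)" by (simp add: power_int_add)
  ultimately show ?thesis unfolding dilate_def by (simp only: mult.assoc mult.left_commute mult.commute)
qed

text \<open>
  Halving the argument, with the normalizing factor, is a unitary map; its adjoint is the corresponding doubling.
\<close>

lemma L2_inner_shrink:
  assumes [measurable]: "g \<in> borel_measurable borel" "w \<in> borel_measurable borel"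
  shows "L2_inner (\<lambda>x. g (x / 2) / sqrt 2) w = L2_inner g (\<lambda>x. sqrt 2 * w (2 * x))"
proof -
  have "L2_inner (\<lambda>x. g (x / 2) / sqrt 2) w = \<bar>2\<bar> *\<^sub>R (\<integral>x. (g ((0 + 2 * x) / 2) / sqrt 2) * w (0 + 2 * x) \<partial>lborel)"
    unfolding L2_inner_def by (rule lborel_integral_real_affine) simp
  also have "\<dots> = (\<integral>x. 2 * ((g x / sqrt 2) * w (2 * x)) \<partial>lborel)" by simp
  also have "\<dots> = L2_inner g (\<lambda>x. sqrt 2 * w (2 * x))"
    unfolding L2_inner_def
  proof (rule Bochner_Integration.integral_cong[OF refl])
    fix x
    have "2 / sqrt 2 = sqrt 2" by (simp add: real_div_sqrt)
    then show "2 * ((g x / sqrt 2) * w (2 * x)) = g x * (sqrt 2 * w (2 * x))" by (metis (no_types, lifting) mult.assoc mult.commute times_divide_eq_right)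
  qed
  finally show ?thesis .
qed

lemma L2_shrink:
  assumes g: "g \<in> L2" shows "(\<lambda>x. g (x / 2) / sqrt 2) \<in> L2"
proof -
  note [measurable] = L2_measurable[OF g]
  have "integrable lborel (\<lambda>x. (g (0 + (1/2) * x))\<^sup>2)"
    by (rule lborel_integrable_real_affine[OF L2_square_integrable[OF g]]) simp
  then show ?thesis by (simp add: L2_def power_divide)
qed

text \<open>
  The image of the wavelet family under \<open>J\<close> dilations by two.
\<close>

definition scaled_family :: "nat \<Rightarrow> (real \<Rightarrow> real) \<Rightarrow> (real \<Rightarrow> real) \<Rightarrow> int + nat \<times> int \<Rightarrow> real \<Rightarrow> real" where
  "scaled_family J \<phi> \<psi> i = (case i of Inl k \<Rightarrow> dilate \<phi> (int J) k | Inr (j, k) \<Rightarrow> dilate \<psi> (int (J + j)) k)"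

lemma scaled_family_0: "scaled_family 0 \<phi> \<psi> = wavelet_family \<phi> \<psi>"
  by (rule ext) (auto simp: scaled_family_def split: sum.split)

lemma scaled_family_Suc: "scaled_family (Suc J) \<phi> \<psi> i = (\<lambda>x. sqrt 2 * scaled_family J \<phi> \<psi> i (2 * x))"
proof -
  have "dilate \<theta> (int (Suc n)) k = (\<lambda>x. sqrt 2 * dilate \<theta> (int n) k (2 * x))" for \<theta> n k
    using dilate_Suc[of \<theta> "int n" k] by (simp add: fun_eq_iff add.commute)
  from this[of \<phi> J] this[of \<psi> "J + j" for j] show ?thesis
    by (auto simp: scaled_family_def fun_eq_iff split: sum.split)
qed

lemma wavelet_measurable:
  assumes b: "orthonormal_basis_of (wavelet_family \<phi> \<psi>) L2"
  shows "\<phi> \<in> borel_measurable borel" "\<psi> \<in> borel_measurable borel" "\<phi> \<in> L2" "\<psi> \<in> L2"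
proof -
  have "wavelet_family \<phi> \<psi> i \<in> L2" for i using b unfolding orthonormal_basis_of_def by blast
  from this[of "Inl 0"] this[of "Inr (0, 0)"] show "\<phi> \<in> L2" "\<psi> \<in> L2" by (simp_all add: dilate_def[abs_def])
  then show "\<phi> \<in> borel_measurable borel" "\<psi> \<in> borel_measurable borel" by (auto intro: L2_measurable)
qed

text \<open>
  The dilation is unitary, so the dilated family inherits the Parseval identity of the original one.
\<close>

lemma scaled_parseval:
  assumes b: "orthonormal_basis_of (wavelet_family \<phi> \<psi>) L2" and "g \<in> L2" "h \<in> L2"
  shows "((\<lambda>i. L2_inner g (scaled_family J \<phi> \<psi> i) * L2_inner h (scaled_family J \<phi> \<psi> i)) has_sum L2_inner g h) UNIV"
  using assms(2,3)
proof (induction J arbitrary: g h)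
  case 0
  then show ?case using parseval[OF b] by (simp add: scaled_family_0)
next
  case (Suc J)
  let ?g = "\<lambda>x. g (x / 2) / sqrt 2" and ?h = "\<lambda>x. h (x / 2) / sqrt 2"
  note m[measurable] = wavelet_measurable(1,2)[OF b] L2_measurable[OF Suc.prems(1)] L2_measurable[OF Suc.prems(2)]
  have fm: "scaled_family J \<phi> \<psi> i \<in> borel_measurable borel" for i
    by (auto simp: scaled_family_def split: sum.split)
  have "L2_inner ?g ?h = L2_inner g (\<lambda>x. sqrt 2 * (h ((2 * x) / 2) / sqrt 2))" by (rule L2_inner_shrink) auto
  then have i: "L2_inner ?g ?h = L2_inner g h" by simp
  have "L2_inner g (scaled_family (Suc J) \<phi> \<psi> i) = L2_inner ?g (scaled_family J \<phi> \<psi> i)"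
    "L2_inner h (scaled_family (Suc J) \<phi> \<psi> i) = L2_inner ?h (scaled_family J \<phi> \<psi> i)" for i
    unfolding scaled_family_Suc by (auto intro!: L2_inner_shrink[symmetric] fm)
  then show ?case using Suc.IH[OF L2_shrink[OF Suc.prems(1)] L2_shrink[OF Suc.prems(2)]] i by simp
qed

text \<open>
  The contribution of one level to the inner product: the bilinear form of the projection onto the span of
  \<open>dilate \<theta> j k\<close> over all \<open>k\<close>.
\<close>

definition level_form :: "(real \<Rightarrow> real) \<Rightarrow> int \<Rightarrow> (real \<Rightarrow> real) \<Rightarrow> (real \<Rightarrow> real) \<Rightarrow> real" where
  "level_form \<theta> j g h = (\<Sum>\<^sub>\<infinity>k. L2_inner g (dilate \<theta> j k) * L2_inner h (dilate \<theta> j k))"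

text \<open>
  Both sides complete the same sum over the wavelets of levels above \<open>J\<close> to the inner product of \<open>g\<close> and \<open>h\<close>, by the Parseval
  identities of two successive dilates.
\<close>

lemma level_form_step:
  assumes b: "orthonormal_basis_of (wavelet_family \<phi> \<psi>) L2" and gh: "g \<in> L2" "h \<in> L2"
  shows "level_form \<phi> (int (Suc J)) g h = level_form \<phi> (int J) g h + level_form \<psi> (int J) g h"
proof -
  define T where "T J i = L2_inner g (scaled_family J \<phi> \<psi> i) * L2_inner h (scaled_family J \<phi> \<psi> i)" for J i
  have T: "(T J has_sum L2_inner g h) UNIV" for J unfolding T_def by (rule scaled_parseval[OF b gh])
  then have su: "T J summable_on A" for J A
    using has_sum_imp_summable summable_on_subset_banach by blast
  have split: "L2_inner g h = level_form \<phi> (int J) g h + infsum (\<lambda>i. T J (Inr i)) UNIV" for J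
  proof -
    have "L2_inner g h = infsum (T J) (range Inl \<union> range Inr)"
      using infsumI[OF T[of J]] by (simp add: UNIV_sum)
    also have "\<dots> = infsum (T J) (range Inl) + infsum (T J) (range Inr)"
      by (rule infsum_Un_disjoint) (auto intro: su)
    also have "infsum (T J) (range Inl) = level_form \<phi> (int J) g h"
      unfolding level_form_def by (subst infsum_reindex) (auto simp: o_def T_def scaled_family_def intro!: inj_onI)
    also have "infsum (T J) (range Inr) = infsum (\<lambda>i. T J (Inr i)) UNIV"
      by (subst infsum_reindex) (auto simp: o_def)
    finally show ?thesis .
  qed
  have suI: "(\<lambda>i. T J (Inr i)) summable_on A" for J A
  proof -
    have "(T J \<circ> Inr) summable_on UNIV" using su[of J "range Inr"] by (subst (asm) summable_on_reindex) auto
    then show ?thesis using summable_on_subset_banach by (fastforce simp: o_def)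
  qed
  have TS: "T (Suc J) (Inr (j, k)) = T J (Inr (Suc j, k))" for j k by (simp add: T_def scaled_family_def add.left_commute)
  have U: "(UNIV :: (nat \<times> int) set) = range (Pair 0) \<union> range (\<lambda>(j, k). (Suc j, k))"
  proof -
    have "p \<in> range (Pair 0) \<union> range (\<lambda>(j, k). (Suc j, k))" for p :: "nat \<times> int"
      by (cases p; cases "fst p") (auto intro: image_eqI[where x="(nat, snd p)" for nat] rev_image_eqI)
    then show ?thesis by auto
  qed
  have "infsum (\<lambda>i. T J (Inr i)) UNIV = infsum (\<lambda>i. T J (Inr i)) (range (Pair 0)) + infsum (\<lambda>i. T J (Inr i)) (range (\<lambda>(j, k). (Suc j, k)))"
    by (subst U, rule infsum_Un_disjoint) (auto intro: suI)
  also have "infsum (\<lambda>i. T J (Inr i)) (range (Pair 0)) = level_form \<psi> (int J) g h"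
    unfolding level_form_def by (subst infsum_reindex) (auto simp: o_def T_def scaled_family_def intro!: inj_onI)
  also have "infsum (\<lambda>i. T J (Inr i)) (range (\<lambda>(j, k). (Suc j, k))) = infsum (\<lambda>i. T (Suc J) (Inr i)) UNIV"
    by (subst infsum_reindex) (auto simp: o_def TS split_beta' inj_on_def intro!: infsum_cong)
  finally show ?thesis using split[of J] split[of "Suc J"] by simp
qed

lemma level_form_telescope:
  assumes b: "orthonormal_basis_of (wavelet_family \<phi> \<psi>) L2" and gh: "g \<in> L2" "h \<in> L2"
  shows "level_form \<phi> (int J) g h = level_form \<phi> 0 g h + (\<Sum>j<J. level_form \<psi> (int j) g h)"
proof (induction J)
  case (Suc J)
  then show ?case using level_form_step[OF b gh, of J] by simp
qed simp

section \<open>Projection kernels and the telescoping identity\<close>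

lemma summable_on_iff_integrable: "f summable_on A \<longleftrightarrow> integrable (count_space A) (f :: 'a \<Rightarrow> real)"
  using summable_on_iff_abs_summable_on_real[of f A] abs_summable_equivalent[of f A]
  unfolding Infinite_Set_Sum.abs_summable_on_def by blast

text \<open>
  Unordered sums as integrals over the counting measure, so that Fubini's theorem is available for sums over shifts.
\<close>

lemma infsum_eq_integral: "infsum f A = integral\<^sup>L (count_space A) (f :: 'a \<Rightarrow> real)"
proof (cases "f summable_on A")
  case True
  then have "Infinite_Set_Sum.abs_summable_on f A"
    unfolding summable_on_iff_integrable Infinite_Set_Sum.abs_summable_on_def .
  from infsetsum_infsum[OF this] show ?thesis by (simp add: infsetsum_def)
next
  case False
  then have "\<not> integrable (count_space A) f" unfolding summable_on_iff_integrable .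
  then show ?thesis using infsum_not_exists[OF False] by (simp add: not_integrable_integral_eq)
qed

lemma borel_measurable_infsum:
  fixes F :: "'k :: countable \<Rightarrow> 'b \<Rightarrow> real"
  assumes [measurable]: "\<And>k. F k \<in> borel_measurable N"
  shows "(\<lambda>p. \<Sum>\<^sub>\<infinity>k. F k p) \<in> borel_measurable N"
proof -
  interpret C: sigma_finite_measure "count_space (UNIV :: 'k set)" by (rule sigma_finite_measure_count_space)
  have "(\<lambda>q. F (snd q) (fst q)) \<in> borel_measurable (N \<Otimes>\<^sub>M count_space UNIV)"
    by (rule measurable_compose_countable'[where f="\<lambda>k q. F k (fst q)" and g=snd and I=UNIV, simplified]) auto
  then show ?thesis unfolding infsum_eq_integral
    by (intro C.borel_measurable_lebesgue_integral) (simp add: split_beta')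
qed

definition ker :: "(real \<Rightarrow> real) \<Rightarrow> int \<Rightarrow> real \<Rightarrow> real \<Rightarrow> real" where
  "ker \<theta> j x y = (\<Sum>\<^sub>\<infinity>k. dilate \<theta> j k x * dilate \<theta> j k y)"

lemma ker_measurable:
  assumes [measurable]: "\<theta> \<in> borel_measurable borel"
  shows "(\<lambda>p. ker \<theta> j (fst p) (snd p)) \<in> borel_measurable (borel \<Otimes>\<^sub>M borel)"
  unfolding ker_def by (rule borel_measurable_infsum) measurable

lemma card_int_window: assumes "0 \<le> C" shows "finite {k::int. \<bar>t + of_int k\<bar> \<le> C}" "real (card {k::int. \<bar>t + of_int k\<bar> \<le> (C::real)}) \<le> 2 * C + 1"
proof -
  have e: "{k::int. \<bar>t + of_int k\<bar> \<le> C} = {\<lceil>- C - t\<rceil>..\<lfloor>C - t\<rfloor>}"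
    by (auto simp: abs_le_iff ceiling_le_iff le_floor_iff)
  show "finite {k::int. \<bar>t + of_int k\<bar> \<le> C}" unfolding e by simp
  show "real (card {k::int. \<bar>t + of_int k\<bar> \<le> C}) \<le> 2 * C + 1"
    unfolding e using assms by (simp; linarith)
qed

text \<open>
  By Fubini: after substitution, each point \<open>t\<close> is seen by the window for at most \<open>2 R 2\<^sup>j + 1\<close> shifts \<open>k\<close>.
\<close>

lemma local_square_sum:
  assumes th: "\<theta> \<in> L2" and R: "0 \<le> R"
  shows "(\<integral>\<^sup>+k. (\<integral>\<^sup>+x. ennreal ((dilate \<theta> j k x)\<^sup>2) * indicator {-R..R} x \<partial>lborel) \<partial>count_space UNIV) < \<infinity>"
proof -
  note [measurable] = L2_measurable[OF th]
  interpret C: sigma_finite_measure "count_space (UNIV :: int set)" by (rule sigma_finite_measure_count_space)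
  interpret P: pair_sigma_finite "count_space (UNIV :: int set)" lborel ..
  let ?a = "2 powi j :: real"
  have a: "0 < ?a" by simp
  have pp: "(2 powr (real_of_int j / 2))\<^sup>2 = ?a"
    by (simp add: power2_eq_square powr_add[symmetric] powr_real_of_int')
  have shift: "(\<integral>\<^sup>+x. ennreal ((dilate \<theta> j k x)\<^sup>2) * indicator {-R..R} x \<partial>lborel)
     = (\<integral>\<^sup>+t. ennreal ((\<theta> t)\<^sup>2) * indicator {k. \<bar>t + of_int k\<bar> \<le> R * ?a} k \<partial>lborel)" for k :: int
  proof -
    have "(\<integral>\<^sup>+x. ennreal ((dilate \<theta> j k x)\<^sup>2) * indicator {-R..R} x \<partial>lborel)
      = \<bar>1 / ?a\<bar> * (\<integral>\<^sup>+t. ennreal ((dilate \<theta> j k (real_of_int k / ?a + (1 / ?a) * t))\<^sup>2) * indicator {-R..R} (real_of_int k / ?a + (1 / ?a) * t) \<partial>lborel)"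
      by (rule nn_integral_real_affine) (use a in auto)
    also have "\<dots> = (\<integral>\<^sup>+t. \<bar>1 / ?a\<bar> * (ennreal ((dilate \<theta> j k (real_of_int k / ?a + (1 / ?a) * t))\<^sup>2) * indicator {-R..R} (real_of_int k / ?a + (1 / ?a) * t)) \<partial>lborel)"
      by (rule nn_integral_cmult[symmetric]) measurable
    also have "\<dots> = (\<integral>\<^sup>+t. ennreal ((\<theta> t)\<^sup>2) * indicator {k. \<bar>t + of_int k\<bar> \<le> R * ?a} k \<partial>lborel)"
    proof (rule nn_integral_cong)
      fix t :: real
      have d: "dilate \<theta> j k (real_of_int k / ?a + (1 / ?a) * t) = 2 powr (real_of_int j / 2) * \<theta> t"
        unfolding dilate_def using a by (simp add: distrib_left)
      have e: "real_of_int k / ?a + (1 / ?a) * t = (t + real_of_int k) / ?a" by (simp add: add_divide_distrib)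
      have i: "real_of_int k / ?a + (1 / ?a) * t \<in> {-R..R} \<longleftrightarrow> k \<in> {k. \<bar>t + of_int k\<bar> \<le> R * ?a}"
        unfolding e using a by (auto simp: abs_le_iff pos_divide_le_eq pos_le_divide_eq)
      have "ennreal \<bar>1 / ?a\<bar> * ennreal ((2 powr (real_of_int j / 2) * \<theta> t)\<^sup>2) = ennreal ((\<theta> t)\<^sup>2)"
        using a by (simp add: ennreal_mult[symmetric] power_mult_distrib pp)
      then show "\<bar>1 / ?a\<bar> * (ennreal ((dilate \<theta> j k (real_of_int k / ?a + (1 / ?a) * t))\<^sup>2) * indicator {-R..R} (real_of_int k / ?a + (1 / ?a) * t))
        = ennreal ((\<theta> t)\<^sup>2) * indicator {k. \<bar>t + of_int k\<bar> \<le> R * ?a} k"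
        unfolding d indicator_def i by (simp add: mult.assoc[symmetric])
    qed
    finally show ?thesis .
  qed
  have "(\<integral>\<^sup>+k. (\<integral>\<^sup>+x. ennreal ((dilate \<theta> j k x)\<^sup>2) * indicator {-R..R} x \<partial>lborel) \<partial>count_space UNIV)
     = (\<integral>\<^sup>+k. (\<integral>\<^sup>+t. ennreal ((\<theta> t)\<^sup>2) * indicator {k. \<bar>t + of_int k\<bar> \<le> R * ?a} k \<partial>lborel) \<partial>count_space UNIV)"
    unfolding shift ..
  also have "\<dots> = (\<integral>\<^sup>+t. (\<integral>\<^sup>+k. ennreal ((\<theta> t)\<^sup>2) * indicator {k. \<bar>t + of_int k\<bar> \<le> R * ?a} k \<partial>count_space UNIV) \<partial>lborel)"
  proof (rule P.Fubini'[symmetric])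
    show "(\<lambda>(k, t). ennreal ((\<theta> t)\<^sup>2) * indicator {k. \<bar>t + of_int k\<bar> \<le> R * ?a} k) \<in> borel_measurable (count_space UNIV \<Otimes>\<^sub>M lborel)"
      by (rule measurable_pair_measure_countable1) (auto simp: indicator_def)
  qed
  also have "\<dots> \<le> (\<integral>\<^sup>+t. ennreal ((\<theta> t)\<^sup>2) * ennreal (2 * (R * ?a) + 1) \<partial>lborel)"
  proof (rule nn_integral_mono)
    fix t :: real
    have "(\<integral>\<^sup>+k. ennreal ((\<theta> t)\<^sup>2) * indicator {k. \<bar>t + of_int k\<bar> \<le> R * ?a} k \<partial>count_space UNIV) = ennreal ((\<theta> t)\<^sup>2) * emeasure (count_space UNIV) {k::int. \<bar>t + of_int k\<bar> \<le> R * ?a}"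
      by (subst nn_integral_cmult_indicator) auto
    also have "emeasure (count_space UNIV) {k::int. \<bar>t + of_int k\<bar> \<le> R * ?a} = ennreal (real (card {k::int. \<bar>t + of_int k\<bar> \<le> R * ?a}))"
      using card_int_window(1)[of "R * ?a" t] R by (subst emeasure_count_space_finite) (auto simp: ennreal_of_nat_eq_real_of_nat)
    also have "ennreal ((\<theta> t)\<^sup>2) * \<dots> \<le> ennreal ((\<theta> t)\<^sup>2) * ennreal (2 * (R * ?a) + 1)"
      using card_int_window(2)[of "R * ?a" t] R by (intro mult_left_mono ennreal_leI) auto
    finally show "(\<integral>\<^sup>+k. ennreal ((\<theta> t)\<^sup>2) * indicator {k. \<bar>t + of_int k\<bar> \<le> R * ?a} k \<partial>count_space UNIV) \<le> ennreal ((\<theta> t)\<^sup>2) * ennreal (2 * (R * ?a) + 1)" .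
  qed
  also have "\<dots> = (\<integral>\<^sup>+t. ennreal ((\<theta> t)\<^sup>2) \<partial>lborel) * ennreal (2 * (R * ?a) + 1)"
    by (rule nn_integral_multc) measurable
  also have "\<dots> < \<infinity>"
    using L2_square_integrable[OF th] by (simp add: ennreal_mult_less_top nn_integral_eq_integral)
  finally show ?thesis .
qed

abbreviation plane :: "(real \<times> real) measure" where "plane \<equiv> lborel \<Otimes>\<^sub>M lborel"

text \<open>
  By \<open>\<bar>a b\<bar> \<le> a\<^sup>2 + b\<^sup>2\<close> and local summability of the squares.
\<close>

lemma box_integrable:
  assumes th: "\<theta> \<in> L2" and R: "0 \<le> R" and AB[measurable]: "A \<in> sets borel" "B \<in> sets borel" and sub: "A \<subseteq> {-R..R}" "B \<subseteq> {-R..R}"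
  shows "integrable (count_space UNIV \<Otimes>\<^sub>M plane) (\<lambda>(k :: int, p). (indicator A (fst p) * dilate \<theta> j k (fst p)) * (indicator B (snd p) * dilate \<theta> j k (snd p)))"
proof (rule integrableI_bounded)
  note [measurable] = L2_measurable[OF th]
  interpret C: sigma_finite_measure "count_space (UNIV :: int set)" by (rule sigma_finite_measure_count_space)
  interpret P: pair_sigma_finite "count_space (UNIV :: int set)" plane ..
  let ?F = "\<lambda>(k :: int, p). (indicator A (fst p) * dilate \<theta> j k (fst p)) * (indicator B (snd p) * dilate \<theta> j k (snd p))"
  have sf: "sigma_finite_measure plane" by (rule sigma_finite_pair_measure) standard
  show m: "?F \<in> borel_measurable (count_space UNIV \<Otimes>\<^sub>M plane)"
    by (rule measurable_pair_measure_countable1) simp_all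
  let ?I = "\<lambda>k. \<integral>\<^sup>+x. ennreal ((dilate \<theta> j k x)\<^sup>2) * indicator {-R..R} x \<partial>lborel"
  have "(\<integral>\<^sup>+z. ennreal (norm (?F z)) \<partial>(count_space UNIV \<Otimes>\<^sub>M plane)) = (\<integral>\<^sup>+k. (\<integral>\<^sup>+p. ennreal (norm (?F (k, p))) \<partial>plane) \<partial>count_space UNIV)"
    by (rule sigma_finite_measure.nn_integral_fst[symmetric, OF sf]) (use m in measurable)
  also have "\<dots> \<le> (\<integral>\<^sup>+k. ennreal (4 * R) * ?I k \<partial>count_space UNIV)"
  proof (rule nn_integral_mono)
    fix k :: int
    have "(\<integral>\<^sup>+p. ennreal (norm (?F (k, p))) \<partial>plane) \<le> (\<integral>\<^sup>+p. ennreal ((dilate \<theta> j k (fst p))\<^sup>2) * indicator {-R..R} (fst p) * indicator {-R..R} (snd p)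
        + ennreal ((dilate \<theta> j k (snd p))\<^sup>2) * indicator {-R..R} (snd p) * indicator {-R..R} (fst p) \<partial>plane)"
    proof (rule nn_integral_mono)
      fix p :: "real \<times> real"
      have *: "\<bar>a * b\<bar> \<le> a\<^sup>2 + b\<^sup>2" for a b :: real
      proof -
        have "0 \<le> (\<bar>a\<bar> - \<bar>b\<bar>)\<^sup>2" by simp
        then have "2 * (\<bar>a\<bar> * \<bar>b\<bar>) \<le> a\<^sup>2 + b\<^sup>2" by (simp add: power2_diff)
        moreover have "0 \<le> \<bar>a\<bar> * \<bar>b\<bar>" by simp
        ultimately show ?thesis unfolding abs_mult by linarith
      qed
      show "ennreal (norm (?F (k, p))) \<le> ennreal ((dilate \<theta> j k (fst p))\<^sup>2) * indicator {-R..R} (fst p) * indicator {-R..R} (snd p)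
        + ennreal ((dilate \<theta> j k (snd p))\<^sup>2) * indicator {-R..R} (snd p) * indicator {-R..R} (fst p)"
      proof (cases "fst p \<in> A \<and> snd p \<in> B")
        case True
        then have "fst p \<in> {-R..R}" "snd p \<in> {-R..R}" using sub by auto
        then show ?thesis using True *[of "dilate \<theta> j k (fst p)" "dilate \<theta> j k (snd p)"]
          by (simp add: ennreal_plus[symmetric] del: ennreal_plus)
      qed auto
    qed
    also have "\<dots> = (\<integral>\<^sup>+p. ennreal ((dilate \<theta> j k (fst p))\<^sup>2) * indicator {-R..R} (fst p) * indicator {-R..R} (snd p) \<partial>plane)
        + (\<integral>\<^sup>+p. ennreal ((dilate \<theta> j k (snd p))\<^sup>2) * indicator {-R..R} (snd p) * indicator {-R..R} (fst p) \<partial>plane)"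
      by (rule nn_integral_add) measurable
    also have "(\<integral>\<^sup>+p. ennreal ((dilate \<theta> j k (fst p))\<^sup>2) * indicator {-R..R} (fst p) * indicator {-R..R} (snd p) \<partial>plane) = ?I k * ennreal (2 * R)"
    proof -
      have "(\<integral>\<^sup>+p. ennreal ((dilate \<theta> j k (fst p))\<^sup>2) * indicator {-R..R} (fst p) * indicator {-R..R} (snd p) \<partial>plane)
        = (\<integral>\<^sup>+x. \<integral>\<^sup>+y. ennreal ((dilate \<theta> j k x)\<^sup>2) * indicator {-R..R} x * indicator {-R..R} y \<partial>lborel \<partial>lborel)"
        by (subst lborel.nn_integral_fst[symmetric]) auto
      also have "\<dots> = (\<integral>\<^sup>+x. ennreal ((dilate \<theta> j k x)\<^sup>2) * indicator {-R..R} x * ennreal (2 * R) \<partial>lborel)"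
        using R by (subst nn_integral_cmult) auto
      finally show ?thesis by (simp add: nn_integral_multc)
    qed
    also have "(\<integral>\<^sup>+p. ennreal ((dilate \<theta> j k (snd p))\<^sup>2) * indicator {-R..R} (snd p) * indicator {-R..R} (fst p) \<partial>plane) = ?I k * ennreal (2 * R)"
    proof -
      have "(\<integral>\<^sup>+p. ennreal ((dilate \<theta> j k (snd p))\<^sup>2) * indicator {-R..R} (snd p) * indicator {-R..R} (fst p) \<partial>plane)
        = (\<integral>\<^sup>+y. \<integral>\<^sup>+x. ennreal ((dilate \<theta> j k y)\<^sup>2) * indicator {-R..R} y * indicator {-R..R} x \<partial>lborel \<partial>lborel)"
        by (subst lborel_pair.nn_integral_snd[symmetric]) auto
      also have "\<dots> = (\<integral>\<^sup>+x. ennreal ((dilate \<theta> j k x)\<^sup>2) * indicator {-R..R} x * ennreal (2 * R) \<partial>lborel)"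
        using R by (subst nn_integral_cmult) auto
      finally show ?thesis by (simp add: nn_integral_multc)
    qed
    also have "?I k * ennreal (2 * R) + ?I k * ennreal (2 * R) = ennreal (4 * R) * ?I k"
    proof -
      have "ennreal (4 * R) = ennreal (2 * R) + ennreal (2 * R)" using R by (simp add: ennreal_plus[symmetric] del: ennreal_plus)
      then show ?thesis by (simp only: distrib_right mult.commute)
    qed
    finally show "(\<integral>\<^sup>+p. ennreal (norm (?F (k, p))) \<partial>plane) \<le> ennreal (4 * R) * ?I k" .
  qed
  also have "\<dots> = ennreal (4 * R) * (\<integral>\<^sup>+k. ?I k \<partial>count_space UNIV)" by (rule nn_integral_cmult) simp
  also have "\<dots> < \<infinity>" using local_square_sum[OF th R, of j] by (simp add: ennreal_mult_less_top)
  finally show "(\<integral>\<^sup>+z. ennreal (norm (?F z)) \<partial>(count_space UNIV \<Otimes>\<^sub>M plane)) < \<infinity>" .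
qed

text \<open>
  Fubini on a bounded rectangle: the kernel is a function almost everywhere, and its integral over the rectangle is
  the bilinear form at the two indicator functions.
\<close>

lemma ker_box:
  assumes th: "\<theta> \<in> L2" and R: "0 \<le> R" and AB[measurable]: "A \<in> sets borel" "B \<in> sets borel" and sub: "A \<subseteq> {-R..R}" "B \<subseteq> {-R..R}"
  shows "integrable plane (\<lambda>p. indicator (A \<times> B) p * ker \<theta> j (fst p) (snd p))"
    and "(\<integral>p. indicator (A \<times> B) p * ker \<theta> j (fst p) (snd p) \<partial>plane) = level_form \<theta> j (indicator A) (indicator B)"
    and "AE p in plane. p \<in> A \<times> B \<longrightarrow> (\<lambda>k. dilate \<theta> j k (fst p) * dilate \<theta> j k (snd p)) summable_on UNIV"
proof -
  note [measurable] = L2_measurable[OF th]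
  interpret C: sigma_finite_measure "count_space (UNIV :: int set)" by (rule sigma_finite_measure_count_space)
  interpret P: pair_sigma_finite "count_space (UNIV :: int set)" plane ..
  let ?F = "\<lambda>(k :: int) p. (indicator A (fst p) * dilate \<theta> j k (fst p)) * (indicator B (snd p) * dilate \<theta> j k (snd p))"
  note I = box_integrable[OF th R AB sub, of j]
  have F: "?F k p = indicator (A \<times> B) p * (dilate \<theta> j k (fst p) * dilate \<theta> j k (snd p))" for k p
    by (cases p) (auto simp: indicator_def)
  have inner: "(\<integral>k. ?F k p \<partial>count_space UNIV) = indicator (A \<times> B) p * ker \<theta> j (fst p) (snd p)" for p
    unfolding F ker_def infsum_eq_integral by simp
  show "integrable plane (\<lambda>p. indicator (A \<times> B) p * ker \<theta> j (fst p) (snd p))"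
    using P.integrable_snd[OF I] unfolding inner by simp
  have "(\<integral>p. indicator (A \<times> B) p * ker \<theta> j (fst p) (snd p) \<partial>plane) = (\<integral>p. (\<integral>k. ?F k p \<partial>count_space UNIV) \<partial>plane)"
    unfolding inner ..
  also have "\<dots> = (\<integral>k. (\<integral>p. ?F k p \<partial>plane) \<partial>count_space UNIV)"
    by (rule P.Fubini_integral[OF I])
  also have "(\<lambda>k. \<integral>p. ?F k p \<partial>plane) = (\<lambda>k. L2_inner (indicator A) (dilate \<theta> j k) * L2_inner (indicator B) (dilate \<theta> j k))"
  proof
    fix k
    have "AE k in count_space UNIV. integrable plane (?F k)" using P.AE_integrable_fst[OF I] by simp
    then have "integrable plane (?F k)" by (simp add: AE_count_space)
    then have "(\<integral>p. ?F k p \<partial>plane) = (\<integral>x. (\<integral>y. (indicator A x * dilate \<theta> j k x) * (indicator B y * dilate \<theta> j k y) \<partial>lborel) \<partial>lborel)"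
      by (subst lborel_pair.integral_fst'[symmetric]) auto
    then show "(\<integral>p. ?F k p \<partial>plane) = L2_inner (indicator A) (dilate \<theta> j k) * L2_inner (indicator B) (dilate \<theta> j k)"
      by (simp add: L2_inner_def)
  qed
  finally show "(\<integral>p. indicator (A \<times> B) p * ker \<theta> j (fst p) (snd p) \<partial>plane) = level_form \<theta> j (indicator A) (indicator B)"
    unfolding level_form_def infsum_eq_integral .
  have "AE p in plane. integrable (count_space UNIV) (\<lambda>k. ?F k p)"
    using P.AE_integrable_snd[OF I] by simp
  then show "AE p in plane. p \<in> A \<times> B \<longrightarrow> (\<lambda>k. dilate \<theta> j k (fst p) * dilate \<theta> j k (snd p)) summable_on UNIV"
    unfolding F summable_on_iff_integrable by eventually_elim auto
qed

lemma ker_summable: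
  assumes th: "\<theta> \<in> L2"
  shows "AE p in plane. (\<lambda>k. dilate \<theta> j k (fst p) * dilate \<theta> j k (snd p)) summable_on UNIV"
proof -
  have "AE p in plane. \<forall>n::nat. p \<in> {-real n..real n} \<times> {-real n..real n} \<longrightarrow> (\<lambda>k. dilate \<theta> j k (fst p) * dilate \<theta> j k (snd p)) summable_on UNIV"
    unfolding AE_all_countable by (intro allI ker_box(3)[OF th, where R="real _"]) auto
  then show ?thesis
  proof eventually_elim
    case (elim p)
    obtain n :: nat where "max \<bar>fst p\<bar> \<bar>snd p\<bar> \<le> real n" using real_arch_simple by blast
    then have "p \<in> {-real n..real n} \<times> {-real n..real n}" by (cases p) auto
    with elim show ?case by blast
  qed
qed

text \<open>
  The positive and the negative part of \<open>F\<close> are densities of finite measures which agree on the rectangles, a generator of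
  the product algebra stable under intersection.
\<close>

lemma AE_zero_of_rectangles:
  fixes F :: "real \<times> real \<Rightarrow> real"
  assumes I: "integrable plane F" and Z: "\<And>A B. A \<in> sets borel \<Longrightarrow> B \<in> sets borel \<Longrightarrow> (\<integral>p. indicator (A \<times> B) p * F p \<partial>plane) = 0"
  shows "AE p in plane. F p = 0"
proof -
  have [measurable]: "F \<in> borel_measurable plane" using I by simp
  let ?E = "{A \<times> B | A B. A \<in> sets lborel \<and> B \<in> sets (lborel :: real measure)}"
  have eq: "emeasure (density plane (\<lambda>p. ennreal (F p))) (A \<times> B) = emeasure (density plane (\<lambda>p. ennreal (- F p))) (A \<times> B)"
    and fin: "emeasure (density plane (\<lambda>p. ennreal (F p))) (A \<times> B) < \<infinity>"
    if [measurable]: "A \<in> sets borel" "B \<in> sets borel" for A B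
  proof -
    let ?G = "\<lambda>p. indicator (A \<times> B) p * F p"
    have AB[measurable]: "A \<times> B \<in> sets plane" by simp
    have IG: "integrable plane ?G" using integrable_mult_indicator[OF AB I] by simp
    have e: "emeasure (density plane (\<lambda>p. ennreal (F p))) (A \<times> B) = (\<integral>\<^sup>+p. ennreal (?G p) \<partial>plane)"
      by (subst emeasure_density) (auto intro!: nn_integral_cong split: split_indicator)
    have e': "emeasure (density plane (\<lambda>p. ennreal (- F p))) (A \<times> B) = (\<integral>\<^sup>+p. ennreal (- ?G p) \<partial>plane)"
      by (subst emeasure_density) (auto intro!: nn_integral_cong split: split_indicator)
    have f: "(\<integral>\<^sup>+p. ennreal (?G p) \<partial>plane) < \<infinity>" "(\<integral>\<^sup>+p. ennreal (- ?G p) \<partial>plane) < \<infinity>"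
      using IG unfolding real_integrable_def by (auto simp: less_top)
    have "enn2real (\<integral>\<^sup>+p. ennreal (?G p) \<partial>plane) = enn2real (\<integral>\<^sup>+p. ennreal (- ?G p) \<partial>plane)"
      using Z[OF that] real_lebesgue_integral_def[OF IG] by simp
    then show "emeasure (density plane (\<lambda>p. ennreal (F p))) (A \<times> B) = emeasure (density plane (\<lambda>p. ennreal (- F p))) (A \<times> B)"
      unfolding e e' using f by (metis ennreal_enn2real infinity_ennreal_def)
    show "emeasure (density plane (\<lambda>p. ennreal (F p))) (A \<times> B) < \<infinity>" unfolding e using f by simp
  qed
  have "density plane (\<lambda>p. ennreal (F p)) = density plane (\<lambda>p. ennreal (- F p))"
  proof (rule measure_eqI_generator_eq[where E="?E" and \<Omega>=UNIV and A="\<lambda>_. UNIV \<times> UNIV"])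
    show "Int_stable ?E" using Int_stable_pair_measure_generator[of lborel lborel] by simp
    show "emeasure (density plane (\<lambda>p. ennreal (F p))) X = emeasure (density plane (\<lambda>p. ennreal (- F p))) X" if "X \<in> ?E" for X
      using that eq by auto
    show "sets (density plane (\<lambda>p. ennreal (F p))) = sigma_sets UNIV ?E" "sets (density plane (\<lambda>p. ennreal (- F p))) = sigma_sets UNIV ?E"
      by (simp_all add: sets_pair_measure)
    show "range (\<lambda>_::nat. UNIV \<times> UNIV) \<subseteq> ?E" by (auto intro!: exI[of _ UNIV])
    show "emeasure (density plane (\<lambda>p. ennreal (F p))) (UNIV \<times> UNIV) \<noteq> \<infinity>" using fin[of UNIV UNIV] by auto
  qed auto
  then have "AE p in plane. ennreal (F p) = ennreal (- F p)"
    by (subst (asm) sigma_finite_measure.density_unique_iff[OF sigma_finite_pair_measure]) (auto intro: lborel.sigma_finite_measure_axioms)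
  then show ?thesis
  proof eventually_elim
    case (elim p)
    then show ?case by (cases "0 \<le> F p") (auto simp: ennreal_neg ennreal_eq_0_iff)
  qed
qed

text \<open>
  Both sides have the same integral over every bounded rectangle, by the telescoped identity for the bilinear forms. Since \<open>\<psi>\<close>
  is an arbitrary element of \<open>L2\<close>, an identity almost everywhere is the most that can hold.
\<close>

theorem kernel_identity:
  assumes b: "orthonormal_basis_of (wavelet_family \<phi> \<psi>) L2"
  shows "AE p in plane. ker \<phi> (int J) (fst p) (snd p) = ker \<phi> 0 (fst p) (snd p) + (\<Sum>j<J. ker \<psi> (int j) (fst p) (snd p))"
proof -
  note th = wavelet_measurable(3,4)[OF b]
  let ?D = "\<lambda>p. ker \<phi> (int J) (fst p) (snd p) - ker \<phi> 0 (fst p) (snd p) - (\<Sum>j<J. ker \<psi> (int j) (fst p) (snd p))"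
  have "AE p in plane. indicator ({-real n..real n} \<times> {-real n..real n}) p * ?D p = 0" for n :: nat
  proof (rule AE_zero_of_rectangles)
    let ?R = "{-real n..real n}"
    have Deq: "indicator S p * ?D p = indicator S p * ker \<phi> (int J) (fst p) (snd p) - indicator S p * ker \<phi> 0 (fst p) (snd p)
       - (\<Sum>j<J. indicator S p * ker \<psi> (int j) (fst p) (snd p))" for S p
      by (simp add: right_diff_distrib sum_distrib_left)
    show "integrable plane (\<lambda>p. indicator (?R \<times> ?R) p * ?D p)"
      unfolding Deq by (intro Bochner_Integration.integrable_diff Bochner_Integration.integrable_sum ker_box(1)[where R="real n"] th) auto
    fix A B :: "real set" assume [measurable]: "A \<in> sets borel" "B \<in> sets borel"
    let ?A = "A \<inter> ?R" and ?B = "B \<inter> ?R"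
    have "indicator (A \<times> B) p * (indicator (?R \<times> ?R) p * ?D p) = indicator (?A \<times> ?B) p * ?D p" for p
      by (cases p) (auto simp: indicator_def)
    then have "(\<integral>p. indicator (A \<times> B) p * (indicator (?R \<times> ?R) p * ?D p) \<partial>plane) = (\<integral>p. indicator (?A \<times> ?B) p * ?D p \<partial>plane)"
      by (simp only:)
    also have "\<dots> = level_form \<phi> (int J) (indicator ?A) (indicator ?B) - level_form \<phi> 0 (indicator ?A) (indicator ?B)
       - (\<Sum>j<J. level_form \<psi> (int j) (indicator ?A) (indicator ?B))"
    proof -
      define f where "f \<theta> j p = indicator (?A \<times> ?B) p * ker \<theta> j (fst p) (snd p)" for \<theta> j p
      have I: "integrable plane (f \<theta> j)" "(\<integral>p. f \<theta> j p \<partial>plane) = level_form \<theta> j (indicator ?A) (indicator ?B)"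
        if "\<theta> \<in> L2" for \<theta> j unfolding f_def by (rule ker_box[OF that, where R="real n"]; auto)+
      show ?thesis unfolding Deq f_def[symmetric]
        by (simp add: I th Bochner_Integration.integral_diff Bochner_Integration.integral_sum Bochner_Integration.integrable_sum Bochner_Integration.integrable_diff)
    qed
    also have "\<dots> = 0"
    proof -
      have ind: "indicator S \<in> L2" if "S \<in> sets borel" "S \<subseteq> ?R" for S
      proof -
        have "integrable lborel (\<lambda>x. indicator ?R x :: real)" by simp
        then have "integrable lborel (\<lambda>x. indicator S x :: real)"
          by (rule Bochner_Integration.integrable_bound, use that in simp, intro AE_I2) (use that in \<open>auto simp: indicator_def\<close>)
        moreover have "(indicator S x :: real)\<^sup>2 = indicator S x" for x by (simp add: indicator_def)
        ultimately show ?thesis using that by (simp add: L2_def)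
      qed
      show ?thesis using level_form_telescope[OF b ind ind, of ?A ?B J] by simp
    qed
    finally show "(\<integral>p. indicator (A \<times> B) p * (indicator (?R \<times> ?R) p * ?D p) \<partial>plane) = 0" .
  qed
  then have "AE p in plane. \<forall>n::nat. indicator ({-real n..real n} \<times> {-real n..real n}) p * ?D p = 0"
    unfolding AE_all_countable by blast
  then show ?thesis
  proof eventually_elim
    case (elim p)
    obtain n :: nat where "max \<bar>fst p\<bar> \<bar>snd p\<bar> \<le> real n" using real_arch_simple by blast
    then have "p \<in> {-real n..real n} \<times> {-real n..real n}" by (cases p) auto
    then show ?case using elim[rule_format, of n] by simp
  qed
qed

section \<open>Weak convergence tested on intervals\<close>

text \<open>
  Integrability is part of the notion so that the closure properties below can be iterated.
\<close>

definition null_against :: "(nat \<Rightarrow> real \<Rightarrow> real) \<Rightarrow> (real \<Rightarrow> real) \<Rightarrow> bool" where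
  "null_against d h \<longleftrightarrow> integrable lborel h \<and> (\<lambda>n. \<integral>x. h x * d n x \<partial>lborel) \<longlonglongrightarrow> 0"

lemma bounded_mult_integrable:
  assumes "integrable lborel h" "d \<in> borel_measurable borel" "\<And>x. \<bar>d x :: real\<bar> \<le> C"
  shows "integrable lborel (\<lambda>x. h x * d x :: real)"
proof (rule Bochner_Integration.integrable_bound[where f="\<lambda>x. C * h x"])
  have "0 \<le> C" using assms(3)[of 0] by linarith
  then show "AE x in lborel. norm (h x * d x) \<le> norm (C * h x)"
    using assms(3) by (intro AE_I2) (simp add: abs_mult mult.commute mult_right_mono)
qed (use assms in auto)

lemma null_against_add:
  assumes d: "\<And>n. d n \<in> borel_measurable borel" "\<And>n x. \<bar>d n x\<bar> \<le> C" and "null_against d g" "null_against d h"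
  shows "null_against d (\<lambda>x. a * g x + b * h x)"
proof -
  have I: "integrable lborel g" "integrable lborel h" and lim: "(\<lambda>n. \<integral>x. g x * d n x \<partial>lborel) \<longlonglongrightarrow> 0" "(\<lambda>n. \<integral>x. h x * d n x \<partial>lborel) \<longlonglongrightarrow> 0"
    using assms(3,4) by (auto simp: null_against_def)
  have "(\<integral>x. (a * g x + b * h x) * d n x \<partial>lborel) = a * (\<integral>x. g x * d n x \<partial>lborel) + b * (\<integral>x. h x * d n x \<partial>lborel)" for n
  proof -
    have "(\<integral>x. (a * g x + b * h x) * d n x \<partial>lborel) = (\<integral>x. a * (g x * d n x) + b * (h x * d n x) \<partial>lborel)"
      by (simp add: distrib_right mult.assoc)
    then show ?thesis using bounded_mult_integrable[OF I(1) d(1,2)] bounded_mult_integrable[OF I(2) d(1,2)] by simp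
  qed
  moreover have "(\<lambda>n. a * (\<integral>x. g x * d n x \<partial>lborel) + b * (\<integral>x. h x * d n x \<partial>lborel)) \<longlonglongrightarrow> a * 0 + b * 0"
    by (intro tendsto_intros lim)
  ultimately show ?thesis using I by (simp add: null_against_def)
qed

text \<open>
  Uniform boundedness of \<open>d n\<close> makes the pairing continuous in \<open>h\<close> for the \<open>L\<^sub>1\<close> norm, and dominated convergence gives
  convergence in that norm.
\<close>

lemma null_against_lim:
  assumes d: "\<And>n. d n \<in> borel_measurable borel" "\<And>n x. \<bar>d n x\<bar> \<le> C"
    and s: "\<And>i. null_against d (s i)" and lim: "\<And>x. (\<lambda>i. s i x) \<longlonglongrightarrow> h x" and w: "integrable lborel w" "\<And>i x. \<bar>s i x\<bar> \<le> w x"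
  shows "null_against d h"
proof -
  have sI: "integrable lborel (s i)" for i using s by (simp add: null_against_def)
  have hm: "h \<in> borel_measurable borel"
    by (rule borel_measurable_LIMSEQ_real[OF lim]) (use sI in auto)
  have hI: "integrable lborel h"
    by (rule integrable_dominated_convergence[where s=s, OF _ _ w(1)]) (use hm sI lim w(2) in auto)
  have L1: "(\<lambda>i. \<integral>x. \<bar>h x - s i x\<bar> \<partial>lborel) \<longlonglongrightarrow> (\<integral>x. 0 \<partial>(lborel :: real measure))"
  proof (rule integral_dominated_convergence[where w="\<lambda>x. \<bar>h x\<bar> + w x"])
    show "AE x in lborel. (\<lambda>i. \<bar>h x - s i x\<bar>) \<longlonglongrightarrow> 0"
    proof (rule AE_I2)
      fix x
      have "(\<lambda>i. \<bar>h x - s i x\<bar>) \<longlonglongrightarrow> \<bar>h x - h x\<bar>" by (intro tendsto_intros lim)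
      then show "(\<lambda>i. \<bar>h x - s i x\<bar>) \<longlonglongrightarrow> 0" by simp
    qed
    show "AE x in lborel. norm \<bar>h x - s i x\<bar> \<le> \<bar>h x\<bar> + w x" for i
    proof (rule AE_I2)
      fix x show "norm \<bar>h x - s i x\<bar> \<le> \<bar>h x\<bar> + w x" using w(2)[of i x] by (simp; linarith)
    qed
    show "integrable lborel (\<lambda>x. \<bar>h x\<bar> + w x)" using hI w(1) by simp
    show "(\<lambda>x. \<bar>h x - s i x\<bar>) \<in> borel_measurable lborel" for i using hm sI[of i] by auto
  qed auto
  have C0: "0 \<le> C" using d(2)[of 0 0] by linarith
  have "(\<lambda>n. \<integral>x. h x * d n x \<partial>lborel) \<longlonglongrightarrow> 0"
  proof (rule LIMSEQ_I)
    fix e :: real assume e: "0 < e"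
    then have e': "0 < e / 2 / (C + 1)" using C0 by simp
    from L1 have "\<forall>\<^sub>F i in sequentially. (\<integral>x. \<bar>h x - s i x\<bar> \<partial>lborel) < e / 2 / (C + 1)"
      using e' by (intro order_tendstoD(2)) auto
    then obtain i where i: "(\<integral>x. \<bar>h x - s i x\<bar> \<partial>lborel) < e / 2 / (C + 1)" by (auto simp: eventually_sequentially)
    have sl: "(\<lambda>n. \<integral>x. s i x * d n x \<partial>lborel) \<longlonglongrightarrow> 0" using s by (simp add: null_against_def)
    have e2: "0 < e / 2" using e by simp
    obtain N where N: "\<And>n. N \<le> n \<Longrightarrow> norm ((\<integral>x. s i x * d n x \<partial>lborel) - 0) < e / 2"
      using LIMSEQ_D[OF sl e2] by blast
    have diff: "\<bar>(\<integral>x. h x * d n x \<partial>lborel) - (\<integral>x. s i x * d n x \<partial>lborel)\<bar> \<le> e / 2" for n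
    proof -
      have I1: "integrable lborel (\<lambda>x. (h x - s i x) * d n x)"
        by (rule bounded_mult_integrable[OF _ d(1,2)]) (use hI sI in auto)
      have "\<bar>(\<integral>x. h x * d n x \<partial>lborel) - (\<integral>x. s i x * d n x \<partial>lborel)\<bar> = \<bar>\<integral>x. (h x - s i x) * d n x \<partial>lborel\<bar>"
        using bounded_mult_integrable[OF hI d(1,2)[of n]] bounded_mult_integrable[OF sI d(1,2)[of n], of i]
        by (simp add: left_diff_distrib)
      also have "\<dots> \<le> (\<integral>x. \<bar>(h x - s i x) * d n x\<bar> \<partial>lborel)" by (rule integral_abs_bound)
      also have "\<dots> \<le> (\<integral>x. \<bar>h x - s i x\<bar> * (C + 1) \<partial>lborel)"
      proof (rule integral_mono)
        show "\<bar>(h x - s i x) * d n x\<bar> \<le> \<bar>h x - s i x\<bar> * (C + 1)" for x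
          unfolding abs_mult using d(2)[of n x] by (intro mult_left_mono) auto
      qed (use I1 hI sI in auto)
      also have "\<dots> = (\<integral>x. \<bar>h x - s i x\<bar> \<partial>lborel) * (C + 1)" by simp
      also have "\<dots> \<le> e / 2 / (C + 1) * (C + 1)" using i C0 by (intro mult_right_mono) auto
      also have "\<dots> = e / 2"
      proof -
        have "C + 1 \<noteq> 0" using C0 by simp
        then show ?thesis by (metis times_divide_eq_left nonzero_mult_div_cancel_right)
      qed
      finally show ?thesis .
    qed
    show "\<exists>N. \<forall>n\<ge>N. norm ((\<integral>x. h x * d n x \<partial>lborel) - 0) < e"
    proof (intro exI[of _ N] allI impI)
      fix n assume "N \<le> n"
      then show "norm ((\<integral>x. h x * d n x \<partial>lborel) - 0) < e" using N[of n] diff[of n] unfolding real_norm_def by linarith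
    qed
  qed
  then show ?thesis using hI by (simp add: null_against_def)
qed

text \<open>
  The functions null against \<open>d\<close> form a space closed under dominated limits. From intervals it
  extends to Borel sets by the monotone class argument for disjoint unions, inside a bounded window to have finite
  measure, and then to integrable functions.
\<close>

lemma weak_star_null:
  assumes d: "\<And>n. d n \<in> borel_measurable borel" "\<And>n x. \<bar>d n x\<bar> \<le> C"
    and int: "\<And>s t. s \<le> t \<Longrightarrow> (\<lambda>n. \<integral>x. indicator {s..t} x * d n x \<partial>lborel) \<longlonglongrightarrow> 0"
    and h: "integrable lborel h"
  shows "null_against d h"
proof -
  note lin = null_against_add[OF d] and lim = null_against_lim[OF d]
  have zero: "null_against d (\<lambda>x. 0)" by (simp add: null_against_def)
  have interval: "null_against d (indicator {s..t})" for s t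
  proof (cases "s \<le> t")
    case True then show ?thesis using int by (simp add: null_against_def)
  next
    case False
    then have "indicator {s..t} = (\<lambda>x. 0 :: real)" by (auto simp: fun_eq_iff indicator_def)
    then show ?thesis using zero by simp
  qed
  have sets: "null_against d (indicator (A \<inter> {-real m..real m}))" if A: "A \<in> sets borel" for A m
  proof -
    let ?R = "{-real m..real m}"
    have "Int_stable (range (\<lambda>(a, b). {a..b::real}))"
      by (auto simp: Int_stable_def)
    moreover have "range (\<lambda>(a, b). {a..b::real}) \<subseteq> Pow UNIV" by simp
    moreover have "A \<in> sigma_sets UNIV (range (\<lambda>(a, b). {a..b::real}))"
      using A unfolding borel_eq_atLeastAtMost by simp
    ultimately show ?thesis
    proof (induction rule: sigma_sets_induct_disjoint)
      case (basic A)
      then obtain a b where "A = {a..b}" by auto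
      then have "A \<inter> ?R = {max a (- real m)..min b (real m)}" by auto
      then show ?case using interval by simp
    next
      case empty
      have "indicator ({} \<inter> ?R) = (\<lambda>x. 0 :: real)" by auto
      then show ?case using zero by simp
    next
      case (compl A)
      have "indicator ((UNIV - A) \<inter> ?R) = (\<lambda>x. 1 * indicator ?R x + (-1) * indicator (A \<inter> ?R) x :: real)"
        by (auto simp: fun_eq_iff indicator_def)
      then show ?case using lin[OF interval[of "-real m" "real m"] compl.IH, of 1 "-1"] by simp
    next
      case (union A)
      define s where "s N x = (\<Sum>i<N. indicator (A i \<inter> ?R) x :: real)" for N :: nat and x
      have sP: "null_against d (s N)" for N
      proof (induction N)
        case 0 then show ?case using zero by (simp add: s_def[abs_def])
      next
        case (Suc N)
        have "s (Suc N) = (\<lambda>x. 1 * s N x + 1 * indicator (A N \<inter> ?R) x)" by (simp add: s_def fun_eq_iff)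
        then show ?case using lin[OF Suc union.IH[of N], of 1 1] by simp
      qed
      have dj: "disjoint_family (\<lambda>i. A i \<inter> ?R)" using union.hyps(1) by (auto simp: disjoint_family_on_def)
      show ?case
      proof (rule lim[where s=s and w="indicator ?R"])
        fix x
        have "(\<lambda>i. indicator (A i \<inter> ?R) x :: real) sums indicator (\<Union>i. A i \<inter> ?R) x"
          by (rule indicator_sums) (use dj in \<open>auto simp: disjoint_family_on_def\<close>)
        then show "(\<lambda>N. s N x) \<longlonglongrightarrow> indicator ((\<Union>i. A i) \<inter> ?R) x" unfolding sums_def s_def by (simp add: UN_simps)
        fix N
        have "s N x = indicator (\<Union>i<N. A i \<inter> ?R) x" unfolding s_def
          by (rule indicator_UN_disjoint[symmetric]) (use dj in \<open>auto simp: disjoint_family_on_def\<close>)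
        then show "\<bar>s N x\<bar> \<le> indicator ?R x" by (auto simp: indicator_def)
      qed (use sP in auto)
    qed
  qed
  have sets': "null_against d (indicator A)" if A: "A \<in> sets borel" "emeasure lborel A < \<infinity>" for A
  proof (rule lim[where s="\<lambda>m. indicator (A \<inter> {-real m..real m})" and w="indicator A"])
    show "integrable lborel (indicator A :: real \<Rightarrow> real)" using A by simp
    fix x :: real
    obtain m0 :: nat where m0: "\<bar>x\<bar> \<le> real m0" using real_arch_simple by blast
    have "\<forall>\<^sub>F m in sequentially. indicator (A \<inter> {-real m..real m}) x = (indicator A x :: real)"
      using eventually_ge_at_top[of m0]
    proof eventually_elim
      case (elim m)
      then have "\<bar>x\<bar> \<le> real m" using m0 by linarith
      then show ?case by (auto simp: indicator_def)
    qed
    then show "(\<lambda>m. indicator (A \<inter> {-real m..real m}) x) \<longlonglongrightarrow> (indicator A x :: real)" by (rule tendsto_eventually)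
  qed (use sets A in \<open>auto simp: indicator_def\<close>)
  show ?thesis using h
  proof (induction rule: integrable_induct)
    case (base A c)
    have "(\<lambda>x. indicator A x *\<^sub>R c) = (\<lambda>x. c * indicator A x + 0 * 0)" by auto
    then show ?case using lin[OF sets'[of A] zero, of c 0] base by simp
  next
    case (add f g)
    then show ?case using lin[OF add.IH, of 1 1] by simp
  next
    case (lim f s)
    show ?case
      by (rule null_against_lim[OF d, where s=s and w="\<lambda>x. 2 * norm (f x)"]) (use lim in auto)
  qed
qed

lemma weak_star_limit:
  fixes u :: "nat \<Rightarrow> real \<Rightarrow> real" and v h :: "real \<Rightarrow> real"
  assumes u: "\<And>n. u n \<in> borel_measurable borel" "\<And>n x. \<bar>u n x\<bar> \<le> C" and v: "v \<in> borel_measurable borel" "\<And>x. \<bar>v x\<bar> \<le> C"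
    and int: "\<And>s t. s \<le> t \<Longrightarrow> (\<lambda>n. \<integral>x. indicator {s..t} x * u n x \<partial>lborel) \<longlonglongrightarrow> (\<integral>x. indicator {s..t} x * v x \<partial>lborel)"
    and h: "integrable lborel h"
  shows "(\<lambda>n. \<integral>x. h x * u n x \<partial>lborel) \<longlonglongrightarrow> (\<integral>x. h x * v x \<partial>lborel)"
proof -
  let ?d = "\<lambda>n x. u n x - v x"
  have db: "\<bar>?d n x\<bar> \<le> 2 * C" for n x using u(2)[of n x] v(2)[of x] by linarith
  have split: "(\<integral>x. g x * ?d n x \<partial>lborel) = (\<integral>x. g x * u n x \<partial>lborel) - (\<integral>x. g x * v x \<partial>lborel)" if "integrable lborel g" for g n
    using bounded_mult_integrable[OF that u] bounded_mult_integrable[OF that v] by (simp add: right_diff_distrib)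
  have "null_against ?d h"
  proof (rule weak_star_null[OF _ db _ h])
    fix s t :: real assume st: "s \<le> t"
    have I: "integrable lborel (\<lambda>x. indicator {s..t} x :: real)"
      using st by (intro integrable_real_indicator) auto
    show "(\<lambda>n. \<integral>x. indicator {s..t} x * ?d n x \<partial>lborel) \<longlonglongrightarrow> 0"
      unfolding split[OF I] using int[OF st] by (rule LIM_zero)
  qed (use u v in auto)
  then have "(\<lambda>n. (\<integral>x. h x * u n x \<partial>lborel) - (\<integral>x. h x * v x \<partial>lborel)) \<longlonglongrightarrow> 0"
    unfolding null_against_def split[OF h] by simp
  then show ?thesis by (rule LIM_zero_cancel)
qed

section \<open>The projection kernel of a compactly supported scaling function\<close>

text \<open>
  The bounds on \<open>\<phi>\<close> are parameters; \<open>R \<ge> 1\<close> is no restriction, since a support radius may be enlarged.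
\<close>

locale scaling_kernel =
  fixes \<phi> :: "real \<Rightarrow> real" and R B :: real
  assumes phi_L2: "\<phi> \<in> L2" and phi_bound: "\<And>x. \<bar>\<phi> x\<bar> \<le> B" and R: "1 \<le> R" and supp: "\<And>x. R < \<bar>x\<bar> \<Longrightarrow> \<phi> x = 0"
    and orth: "\<And>k k'. L2_inner (dilate \<phi> 0 k) (dilate \<phi> 0 k') = (if k = k' then 1 else 0)"
begin

lemma phi_measurable [measurable]: "\<phi> \<in> borel_measurable borel"
  by (rule L2_measurable[OF phi_L2])

lemma dilate0: "dilate \<phi> 0 k x = \<phi> (x - real_of_int k)"
  by (simp add: dilate_def)

text \<open>
  The shifts for which \<open>\<phi> (x - k)\<close> can be nonzero, written to match the window counted above.
\<close>

definition near :: "real \<Rightarrow> int set" where "near x = {k. \<bar>- x + of_int k\<bar> \<le> R}"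

lemma near_shifts: "finite (near x)" "real (card (near x)) \<le> 2 * R + 1" "k \<notin> near x \<Longrightarrow> \<phi> (x - of_int k) = 0"
  using card_int_window[of R "-x"] R supp[of "x - of_int k"] by (auto simp: near_def abs_minus_commute)

abbreviation "K \<equiv> ker \<phi> 0"

lemma K_sum: "K x y = (\<Sum>k\<in>near x. \<phi> (x - of_int k) * \<phi> (y - of_int k))"
proof -
  have "K x y = (\<Sum>\<^sub>\<infinity>k\<in>near x. \<phi> (x - of_int k) * \<phi> (y - of_int k))"
    unfolding ker_def dilate0 by (rule infsum_cong_neutral) (auto simp: near_shifts(3))
  then show ?thesis using near_shifts(1) by simp
qed

lemma K_summable: "(\<lambda>k. \<phi> (x - of_int k) * \<phi> (y - of_int k)) summable_on UNIV"
  by (rule summable_on_cong_neutral[THEN iffD1, OF _ _ _ summable_on_finite[OF near_shifts(1)[of x]]]) (auto simp: near_shifts(3))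

lemma K_sym: "K x y = K y x"
  by (simp add: ker_def mult.commute)

definition C0 :: real where "C0 = (2 * R + 1) * B\<^sup>2"

lemma B_nonneg: "0 \<le> B" using phi_bound[of 0] by linarith

lemma C0_nonneg: "0 \<le> C0" unfolding C0_def using R by simp

lemma K_bound: "\<bar>K x y\<bar> \<le> C0"
proof -
  have "\<bar>K x y\<bar> \<le> (\<Sum>k\<in>near x. \<bar>\<phi> (x - of_int k) * \<phi> (y - of_int k)\<bar>)" unfolding K_sum by (rule sum_abs)
  also have "\<dots> \<le> (\<Sum>k\<in>near x. B * B)" unfolding abs_mult by (intro sum_mono mult_mono phi_bound B_nonneg) auto
  also have "\<dots> = real (card (near x)) * B\<^sup>2" by (simp add: power2_eq_square)
  also have "\<dots> \<le> C0" unfolding C0_def using near_shifts(2) by (intro mult_right_mono) auto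
  finally show ?thesis .
qed

lemma K_zero: "2 * R < \<bar>x - y\<bar> \<Longrightarrow> K x y = 0"
  unfolding K_sum
proof (intro sum.neutral ballI)
  fix k assume "2 * R < \<bar>x - y\<bar>" "k \<in> near x"
  then have "R < \<bar>y - of_int k\<bar>" unfolding near_def by auto
  then show "\<phi> (x - of_int k) * \<phi> (y - of_int k) = 0" using supp by simp
qed

lemma K_measurable: "(\<lambda>p. K (fst p) (snd p)) \<in> borel_measurable (borel \<Otimes>\<^sub>M borel)"
  by (rule ker_measurable) simp

lemma K_measurable_comp:
  assumes "u \<in> borel_measurable N" "v \<in> borel_measurable N" shows "(\<lambda>z. K (u z) (v z)) \<in> borel_measurable N"
  using measurable_compose[OF measurable_Pair[OF assms] K_measurable] by simp

text \<open>
  For fixed \<open>x\<close> and \<open>y\<close> both kernels are finite combinations of orthonormal translates.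
\<close>

lemma K_reproducing: "integrable lborel (\<lambda>z. K x z * K z y)" "(\<integral>z. K x z * K z y \<partial>lborel) = K x y"
proof -
  have dL: "dilate \<phi> 0 k \<in> L2" for k
  proof -
    have "integrable lborel (\<lambda>x. (\<phi> (- of_int k + 1 * x))\<^sup>2)"
      by (rule lborel_integrable_real_affine[OF L2_square_integrable[OF phi_L2]]) simp
    then show ?thesis by (simp add: L2_def dilate0[abs_def])
  qed
  have e: "K x z * K z y = (\<Sum>k\<in>near x. \<Sum>k'\<in>near y. (\<phi> (x - of_int k) * \<phi> (y - of_int k')) * (dilate \<phi> 0 k z * dilate \<phi> 0 k' z))" for z
    unfolding K_sym[of z y] unfolding K_sum sum_product dilate0 by (intro sum.cong refl) (simp add: mult_ac)
  show "integrable lborel (\<lambda>z. K x z * K z y)"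
    unfolding e by (intro Bochner_Integration.integrable_sum integrable_mult_right L2_mult_integrable dL)
  have "(\<integral>z. K x z * K z y \<partial>lborel) = (\<Sum>k\<in>near x. \<Sum>k'\<in>near y. (\<phi> (x - of_int k) * \<phi> (y - of_int k')) * L2_inner (dilate \<phi> 0 k) (dilate \<phi> 0 k'))"
    unfolding e L2_inner_def
    by (simp add: Bochner_Integration.integral_sum Bochner_Integration.integrable_sum L2_mult_integrable dL)
  also have "\<dots> = (\<Sum>k\<in>near x. \<Sum>k'\<in>near y. if k' = k then \<phi> (x - of_int k) * \<phi> (y - of_int k) else 0)"
    unfolding orth by (intro sum.cong refl) auto
  also have "\<dots> = (\<Sum>k\<in>near x. if k \<in> near y then \<phi> (x - of_int k) * \<phi> (y - of_int k) else 0)"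
    using near_shifts(1) by (intro sum.cong refl) simp
  also have "\<dots> = K x y" unfolding K_sum by (intro sum.cong refl) (auto simp: near_shifts(3))
  finally show "(\<integral>z. K x z * K z y \<partial>lborel) = K x y" .
qed

lemma K_diag_sum: "ennreal (K x x) = (\<integral>\<^sup>+k. ennreal ((\<phi> (x - of_int k))\<^sup>2) \<partial>count_space UNIV)"
proof -
  have I: "integrable (count_space UNIV) (\<lambda>k :: int. (\<phi> (x - of_int k))\<^sup>2)"
    using K_summable[of x x] unfolding summable_on_iff_integrable by (simp add: power2_eq_square)
  show ?thesis
    unfolding ker_def infsum_eq_integral dilate0 using nn_integral_eq_integral[OF I] by (simp add: power2_eq_square)
qed

lemma K_diag_nonneg: "0 \<le> K x x"
  unfolding K_sum by (intro sum_nonneg) auto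

lemma phi_norm: "(\<integral>\<^sup>+t. ennreal ((\<phi> t)\<^sup>2) \<partial>lborel) = 1"
proof -
  have "L2_inner (dilate \<phi> 0 0) (dilate \<phi> 0 0) = 1" using orth[of 0 0] by simp
  then have "(\<integral>t. (\<phi> t)\<^sup>2 \<partial>lborel) = 1" by (simp add: L2_inner_def dilate0 power2_eq_square)
  then show ?thesis using L2_square_integrable[OF phi_L2] by (simp add: nn_integral_eq_integral)
qed

text \<open>
  The integral of \<open>\<Sum>\<^sub>k \<phi> (x - k)\<^sup>2\<close> over \<open>[s, t]\<close> is the average, with weight \<open>\<phi>\<^sup>2\<close> of total mass one, of the number of
  integers \<open>k\<close> with \<open>v + k\<close> in \<open>[s, t]\<close>; this number differs from \<open>t - s\<close> by at most one.
\<close>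

lemma K_diag_interval:
  assumes st: "s \<le> t"
  shows "\<bar>(\<integral>x. indicator {s..t} x * K x x \<partial>lborel) - (t - s)\<bar> \<le> 1"
proof -
  interpret C: sigma_finite_measure "count_space (UNIV :: int set)" by (rule sigma_finite_measure_count_space)
  interpret P: pair_sigma_finite "count_space (UNIV :: int set)" lborel ..
  let ?c = "\<lambda>v. card {k::int. s \<le> v + of_int k \<and> v + of_int k \<le> t}"
  have cnt: "{k::int. s \<le> v + of_int k \<and> v + of_int k \<le> t} = {\<lceil>s - v\<rceil>..\<lfloor>t - v\<rfloor>}" for v
    by (auto simp: ceiling_le_iff le_floor_iff)
  have c: "t - s - 1 \<le> real (?c v)" "real (?c v) \<le> t - s + 1" for v
    unfolding cnt using st by (simp; linarith)+
  have fin: "finite {k::int. s \<le> v + of_int k \<and> v + of_int k \<le> t}" for v unfolding cnt by simp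
  have eq: "(\<integral>\<^sup>+x. ennreal (indicator {s..t} x * K x x) \<partial>lborel) = (\<integral>\<^sup>+v. ennreal ((\<phi> v)\<^sup>2) * ennreal (real (?c v)) \<partial>lborel)"
  proof -
    have "(\<integral>\<^sup>+x. ennreal (indicator {s..t} x * K x x) \<partial>lborel) = (\<integral>\<^sup>+x. (\<integral>\<^sup>+k. ennreal ((\<phi> (x - of_int k))\<^sup>2) * indicator {s..t} x \<partial>count_space UNIV) \<partial>lborel)"
      by (intro nn_integral_cong) (auto simp: K_diag_sum[symmetric] split: split_indicator)
    also have "\<dots> = (\<integral>\<^sup>+k. (\<integral>\<^sup>+x. ennreal ((\<phi> (x - of_int k))\<^sup>2) * indicator {s..t} x \<partial>lborel) \<partial>count_space UNIV)"
      by (rule P.Fubini') (rule measurable_pair_measure_countable1; simp)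
    also have "\<dots> = (\<integral>\<^sup>+k. (\<integral>\<^sup>+v. ennreal ((\<phi> v)\<^sup>2) * indicator {k. s \<le> v + of_int k \<and> v + of_int k \<le> t} k \<partial>lborel) \<partial>count_space UNIV)"
    proof (rule nn_integral_cong)
      fix k :: int
      have "(\<integral>\<^sup>+x. ennreal ((\<phi> (x - of_int k))\<^sup>2) * indicator {s..t} x \<partial>lborel)
        = ennreal \<bar>1\<bar> * (\<integral>\<^sup>+v. ennreal ((\<phi> (of_int k + 1 * v - of_int k))\<^sup>2) * indicator {s..t} (of_int k + 1 * v) \<partial>lborel)"
        by (rule nn_integral_real_affine) auto
      also have "\<dots> = (\<integral>\<^sup>+v. ennreal ((\<phi> v)\<^sup>2) * indicator {k. s \<le> v + of_int k \<and> v + of_int k \<le> t} k \<partial>lborel)"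
        by (simp, intro nn_integral_cong) (auto simp: indicator_def add.commute)
      finally show "(\<integral>\<^sup>+x. ennreal ((\<phi> (x - of_int k))\<^sup>2) * indicator {s..t} x \<partial>lborel) = \<dots>" .
    qed
    also have "\<dots> = (\<integral>\<^sup>+v. (\<integral>\<^sup>+k. ennreal ((\<phi> v)\<^sup>2) * indicator {k. s \<le> v + of_int k \<and> v + of_int k \<le> t} k \<partial>count_space UNIV) \<partial>lborel)"
      by (rule P.Fubini'[symmetric]) (rule measurable_pair_measure_countable1; simp add: indicator_def)
    also have "\<dots> = (\<integral>\<^sup>+v. ennreal ((\<phi> v)\<^sup>2) * ennreal (real (?c v)) \<partial>lborel)"
      using fin by (intro nn_integral_cong) (simp add: nn_integral_cmult_indicator emeasure_count_space_finite ennreal_of_nat_eq_real_of_nat)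
    finally show ?thesis .
  qed
  have nonneg: "0 \<le> (\<integral>x. indicator {s..t} x * K x x \<partial>lborel)" using K_diag_nonneg by (intro integral_nonneg_AE AE_I2) auto
  have I0: "integrable lborel (\<lambda>x. indicator {s..t} x :: real)"
    using st by (intro integrable_real_indicator) auto
  have I: "integrable lborel (\<lambda>x. indicator {s..t} x * K x x)"
    by (rule bounded_mult_integrable[OF I0, where C=C0]) (auto intro!: K_measurable_comp K_bound)
  have J: "ennreal (\<integral>x. indicator {s..t} x * K x x \<partial>lborel) = (\<integral>\<^sup>+v. ennreal ((\<phi> v)\<^sup>2) * ennreal (real (?c v)) \<partial>lborel)"
    unfolding eq[symmetric] using K_diag_nonneg by (intro nn_integral_eq_integral[symmetric] I AE_I2) auto
  have "\<dots> \<le> (\<integral>\<^sup>+v. ennreal ((\<phi> v)\<^sup>2) * ennreal (t - s + 1) \<partial>lborel)"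
    by (intro nn_integral_mono mult_left_mono ennreal_leI c) auto
  also have "\<dots> = ennreal (t - s + 1)" by (simp add: nn_integral_multc phi_norm)
  finally have up: "(\<integral>x. indicator {s..t} x * K x x \<partial>lborel) \<le> t - s + 1" unfolding J[symmetric] using st by (subst (asm) ennreal_le_iff) auto
  have "ennreal (t - s - 1) = (\<integral>\<^sup>+v. ennreal ((\<phi> v)\<^sup>2) * ennreal (t - s - 1) \<partial>lborel)" by (simp add: nn_integral_multc phi_norm)
  also have "\<dots> \<le> (\<integral>\<^sup>+v. ennreal ((\<phi> v)\<^sup>2) * ennreal (real (?c v)) \<partial>lborel)"
    by (intro nn_integral_mono mult_left_mono ennreal_leI c) auto
  finally have "t - s - 1 \<le> (\<integral>x. indicator {s..t} x * K x x \<partial>lborel)" unfolding J[symmetric] using nonneg by (auto simp: ennreal_le_iff2)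
  with up show ?thesis by linarith
qed

end

section \<open>The limiting variance of the kernel\<close>

context scaling_kernel
begin

lemma ker_scale: "ker \<phi> j x y = 2 powi j * K (2 powi j * x) (2 powi j * y)"
proof -
  have "(2 powr (real_of_int j / 2)) * 2 powr (real_of_int j / 2) = (2 powi j :: real)"
    by (simp add: powr_add[symmetric] powr_real_of_int')
  then have "dilate \<phi> j k x * dilate \<phi> j k y = 2 powi j * (dilate \<phi> 0 k (2 powi j * x) * dilate \<phi> 0 k (2 powi j * y))" for k
    unfolding dilate0 by (simp add: dilate_def mult.assoc mult.left_commute)
  then show ?thesis unfolding ker_def by (simp add: infsum_cmult_right')
qed

lemma K_window:
  assumes a: "0 < a" shows "\<bar>K (a * x) (a * z)\<bar> \<le> C0 * indicator {x - 2 * R / a..x + 2 * R / a} z"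
proof (cases "z \<in> {x - 2 * R / a..x + 2 * R / a}")
  case False
  then have "2 * R / a < \<bar>x - z\<bar>" by auto
  then have "2 * R < a * \<bar>x - z\<bar>" using a by (simp add: pos_divide_less_eq mult.commute)
  also have "\<dots> = \<bar>a * x - a * z\<bar>" using a by (simp add: right_diff_distrib[symmetric] abs_mult)
  finally show ?thesis using K_zero False by simp
qed (use K_bound in auto)

lemma window_integral:
  assumes "0 < a"
  shows "integrable lborel (\<lambda>z. c * indicator {x - 2 * R / a..x + 2 * R / a} z :: real)"
    "(\<integral>z. c * indicator {x - 2 * R / a..x + 2 * R / a} z \<partial>lborel) = c * (4 * R / a)"
  using R assms by (auto simp: field_simps)

lemma K_L1:
  assumes a: "0 < a"
  shows "integrable lborel (\<lambda>z. K (a * x) (a * z))" "(\<integral>z. \<bar>K (a * x) (a * z)\<bar> \<partial>lborel) \<le> C0 * (4 * R / a)"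
proof -
  show I: "integrable lborel (\<lambda>z. K (a * x) (a * z))"
    by (rule Bochner_Integration.integrable_bound[OF window_integral(1)[OF a, of C0 x]])
       (use K_window[OF a] in \<open>auto intro!: K_measurable_comp AE_I2 intro: order_trans[OF _ abs_ge_self]\<close>)
  have "(\<integral>z. \<bar>K (a * x) (a * z)\<bar> \<partial>lborel) \<le> (\<integral>z. C0 * indicator {x - 2 * R / a..x + 2 * R / a} z \<partial>lborel)"
    by (intro integral_mono integrable_abs I window_integral[OF a] K_window[OF a])
  then show "(\<integral>z. \<bar>K (a * x) (a * z)\<bar> \<partial>lborel) \<le> C0 * (4 * R / a)" unfolding window_integral(2)[OF a] .
qed

text \<open>
  The square of the kernel at scale \<open>a\<close>, normalized to have row mass \<open>K (a x) (a x)\<close>, which is bounded and equal to one on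
  average.
\<close>

definition Msq :: "real \<Rightarrow> real \<Rightarrow> real \<Rightarrow> real" where "Msq a x y = a * (K (a * x) (a * y))\<^sup>2"

lemma Msq_sym: "Msq a x y = Msq a y x" by (simp add: Msq_def K_sym)

lemma Msq_measurable: "u \<in> borel_measurable N \<Longrightarrow> v \<in> borel_measurable N \<Longrightarrow> (\<lambda>z. Msq a (u z) (v z)) \<in> borel_measurable N"
  unfolding Msq_def by (intro borel_measurable_times borel_measurable_const borel_measurable_power K_measurable_comp) auto

lemma Msq_nonneg: "0 < a \<Longrightarrow> 0 \<le> Msq a x y" by (simp add: Msq_def)

text \<open>
  The reproducing property after the substitution \<open>z = a y\<close>.
\<close>

lemma Msq_integral:
  assumes a: "0 < a" shows "integrable lborel (\<lambda>y. Msq a x y)" "(\<integral>y. Msq a x y \<partial>lborel) = K (a * x) (a * x)"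
proof -
  have e: "K (a * x) z * K z (a * x) = (K (a * x) z)\<^sup>2" for z by (simp add: K_sym[of z] power2_eq_square)
  have I: "integrable lborel (\<lambda>z. (K (a * x) z)\<^sup>2)" and J: "(\<integral>z. (K (a * x) z)\<^sup>2 \<partial>lborel) = K (a * x) (a * x)"
    using K_reproducing[of "a * x" "a * x"] unfolding e by auto
  have "integrable lborel (\<lambda>y. (K (a * x) (0 + a * y))\<^sup>2)" by (rule lborel_integrable_real_affine[OF I]) (use a in simp)
  then show "integrable lborel (\<lambda>y. Msq a x y)" unfolding Msq_def by simp
  have "(\<integral>z. (K (a * x) z)\<^sup>2 \<partial>lborel) = \<bar>a\<bar> *\<^sub>R (\<integral>y. (K (a * x) (0 + a * y))\<^sup>2 \<partial>lborel)"
    by (rule lborel_integral_real_affine) (use a in simp)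
  then show "(\<integral>y. Msq a x y \<partial>lborel) = K (a * x) (a * x)" using J a by (simp add: Msq_def)
qed

lemma Msq_bound: "0 < a \<Longrightarrow> Msq a x y \<le> a * C0\<^sup>2"
  unfolding Msq_def using norm_sq_le[OF K_bound] by (auto intro!: mult_left_mono)

lemma Msq_zero: "0 < a \<Longrightarrow> 2 * R / a < \<bar>x - y\<bar> \<Longrightarrow> Msq a x y = 0"
proof -
  assume a: "0 < a" and far: "2 * R / a < \<bar>x - y\<bar>"
  have "y \<notin> {x - 2 * R / a..x + 2 * R / a}" using far by auto
  then show "Msq a x y = 0" using K_window[OF a, of x y] by (simp add: Msq_def)
qed

text \<open>
  After rescaling, the error \<open>1\<close> in the integral over an interval becomes \<open>1 / a n\<close>.
\<close>

lemma diag_weak_limit: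
  assumes a: "filterlim a at_top sequentially" "\<And>n. 0 < a n" and h: "integrable lborel h"
  shows "(\<lambda>n. \<integral>x. h x * K (a n * x) (a n * x) \<partial>lborel) \<longlonglongrightarrow> (\<integral>x. h x \<partial>lborel)"
proof -
  have "(\<lambda>n. \<integral>x. h x * K (a n * x) (a n * x) \<partial>lborel) \<longlonglongrightarrow> (\<integral>x. h x * 1 \<partial>lborel)"
  proof (rule weak_star_limit[where C="max C0 1", OF _ _ _ _ _ h])
    show "(\<lambda>x. K (a n * x) (a n * x)) \<in> borel_measurable borel" for n by (intro K_measurable_comp) auto
    show "\<bar>K (a n * x) (a n * x)\<bar> \<le> max C0 1" for n x using K_bound[of "a n * x" "a n * x"] by simp
    fix s t :: real assume st: "s \<le> t"
    have bd: "\<bar>(\<integral>x. indicator {s..t} x * K (a n * x) (a n * x) \<partial>lborel) - (t - s)\<bar> \<le> 1 / a n" for n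
    proof -
      have an: "0 < a n" by (rule a(2))
      have "(\<integral>u. indicator {a n * s..a n * t} u * K u u \<partial>lborel) = \<bar>a n\<bar> *\<^sub>R (\<integral>x. indicator {a n * s..a n * t} (0 + a n * x) * K (0 + a n * x) (0 + a n * x) \<partial>lborel)"
        by (rule lborel_integral_real_affine) (use an in simp)
      moreover have "indicator {a n * s..a n * t} (0 + a n * x) = (indicator {s..t} x :: real)" for x
        using an by (auto simp: indicator_def)
      ultimately have e: "(\<integral>u. indicator {a n * s..a n * t} u * K u u \<partial>lborel) = a n * (\<integral>x. indicator {s..t} x * K (a n * x) (a n * x) \<partial>lborel)"
        using an by simp
      have "\<bar>a n * (\<integral>x. indicator {s..t} x * K (a n * x) (a n * x) \<partial>lborel) - (a n * t - a n * s)\<bar> \<le> 1"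
        using K_diag_interval[of "a n * s" "a n * t"] st an unfolding e by simp
      then have "a n * \<bar>(\<integral>x. indicator {s..t} x * K (a n * x) (a n * x) \<partial>lborel) - (t - s)\<bar> \<le> 1"
        using an by (simp add: abs_mult_pos' right_diff_distrib)
      then show ?thesis using an by (simp add: pos_le_divide_eq mult.commute)
    qed
    have lim0: "(\<lambda>n. 1 / a n) \<longlonglongrightarrow> 0" using a(1) by (intro tendsto_divide_0[OF tendsto_const] filterlim_at_top_imp_at_infinity)
    have "(\<lambda>n. (\<integral>x. indicator {s..t} x * K (a n * x) (a n * x) \<partial>lborel) - (t - s)) \<longlonglongrightarrow> 0"
      by (rule Lim_null_comparison[OF _ lim0]) (intro always_eventually allI, unfold real_norm_def, rule bd)
    then have "(\<lambda>n. \<integral>x. indicator {s..t} x * K (a n * x) (a n * x) \<partial>lborel) \<longlonglongrightarrow> t - s" by (rule LIM_zero_cancel)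
    then show "(\<lambda>n. \<integral>x. indicator {s..t} x * K (a n * x) (a n * x) \<partial>lborel) \<longlonglongrightarrow> (\<integral>x. indicator {s..t} x * 1 \<partial>lborel)"
      using st by simp
  qed auto
  then show ?thesis by simp
qed

end

locale density_kernel = scaling_kernel \<phi> R B for \<phi> R B +
  fixes f :: "real \<Rightarrow> real" and F :: real
  assumes f_measurable [measurable]: "f \<in> borel_measurable borel" and f_nonneg: "\<And>x. 0 \<le> f x" and f_bound: "\<And>x. f x \<le> F"
    and f_int: "integrable lborel f" "(\<integral>x. f x \<partial>lborel) = 1"
begin

definition D :: "real measure" where "D = density lborel f"

lemma sets_D [simp, measurable_cong]: "sets D = sets borel" and space_D [simp]: "space D = UNIV" by (simp_all add: D_def)

lemma integral_D: "g \<in> borel_measurable borel \<Longrightarrow> (\<integral>x. g x \<partial>D) = (\<integral>x. f x * g x \<partial>lborel :: real)"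
  unfolding D_def using f_nonneg by (subst integral_density) auto

lemma prob_D: "prob_space D"
proof
  have "emeasure D (space D) = (\<integral>\<^sup>+x. ennreal (f x) \<partial>lborel)" unfolding D_def by (simp add: emeasure_density)
  also have "\<dots> = 1" using f_int f_nonneg by (simp add: nn_integral_eq_integral)
  finally show "emeasure D (space D) = 1" .
qed

sublocale D: prob_space D by (rule prob_D)

lemma prob_UNIV_D [simp]: "measure D UNIV = 1" using D.prob_space by simp

lemma F_nonneg: "0 \<le> F" using f_nonneg[of 0] f_bound[of 0] by linarith

lemma f_sq: "integrable lborel (\<lambda>x. f x * f x)"
  by (rule bounded_mult_integrable[OF f_int(1) f_measurable, of F]) (use f_nonneg f_bound in auto)

text \<open>
  The second moment of the kernel in one variable, in units of \<open>a\<close>; an approximation to \<open>f\<close> in the weak sense.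
\<close>

definition smoothed :: "real \<Rightarrow> real \<Rightarrow> real" where "smoothed a y = (\<integral>x. Msq a x y \<partial>D)"

lemma smoothed_eq: "smoothed a y = (\<integral>x. f x * Msq a x y \<partial>lborel)"
  unfolding smoothed_def by (rule integral_D) (intro Msq_measurable; simp)

lemma f_Msq_integrable: assumes a: "0 < a" shows "integrable lborel (\<lambda>x. f x * Msq a x y)"
  by (rule bounded_mult_integrable[OF f_int(1), where C="a * C0\<^sup>2"])
     (use Msq_nonneg[OF a] Msq_bound[OF a] in \<open>auto intro!: Msq_measurable\<close>)

lemma smoothed_measurable: "smoothed a \<in> borel_measurable borel"
  unfolding smoothed_eq[abs_def]
  by (intro lborel.borel_measurable_lebesgue_integral) (simp add: split_beta', intro borel_measurable_times Msq_measurable; simp)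

lemma smoothed_bound: assumes a: "0 < a" shows "\<bar>smoothed a y\<bar> \<le> F * C0"
proof -
  have "0 \<le> smoothed a y" unfolding smoothed_eq using f_nonneg Msq_nonneg[OF a] by (intro integral_nonneg_AE AE_I2) auto
  moreover have "smoothed a y \<le> (\<integral>x. F * Msq a y x \<partial>lborel)" unfolding smoothed_eq Msq_sym[of a _ y]
    by (intro integral_mono f_Msq_integrable[OF a, of y, unfolded Msq_sym[of a _ y]] integrable_mult_right Msq_integral(1)[OF a] mult_right_mono f_bound Msq_nonneg[OF a])
  moreover have "(\<integral>x. F * Msq a y x \<partial>lborel) \<le> F * C0"
    using Msq_integral(2)[OF a, of y] K_bound[of "a * y" "a * y"] F_nonneg by (simp add: mult_left_mono)
  ultimately show ?thesis by linarith
qed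

text \<open>
  By Fubini the first integral is \<open>\<integral> f v\<close> with \<open>v x\<close> the mass that \<open>Msq a x\<close> puts on \<open>[s, t]\<close>. As \<open>Msq a x\<close> lives within
  \<open>2 R / a\<close> of \<open>x\<close>, this is all or nothing of the row mass unless \<open>x\<close> is that close to an endpoint.
\<close>

lemma smoothed_interval:
  assumes a: "0 < a" and st: "s \<le> t"
  shows "\<bar>(\<integral>y. indicator {s..t} y * smoothed a y \<partial>lborel) - (\<integral>x. (f x * indicator {s..t} x) * K (a * x) (a * x) \<partial>lborel)\<bar> \<le> F * (C0 * (4 * R / a) + C0 * (4 * R / a))"
proof -
  let ?I = "\<lambda>y. indicator {s..t} y :: real"
  have Iint: "integrable lborel ?I" using st by (intro integrable_real_indicator) auto
  define v where "v x = (\<integral>y. ?I y * Msq a x y \<partial>lborel)" for x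
  have secI: "integrable lborel (\<lambda>y. ?I y * Msq a x y)" for x
    by (rule Bochner_Integration.integrable_bound[OF Msq_integral(1)[OF a, of x]])
       (use Msq_nonneg[OF a] in \<open>auto simp: indicator_def intro!: Msq_measurable borel_measurable_times borel_measurable_indicator\<close>)
  have vm: "v \<in> borel_measurable borel" unfolding v_def[abs_def]
    by (intro lborel.borel_measurable_lebesgue_integral) (simp add: split_beta', intro borel_measurable_times Msq_measurable; simp)
  have v0: "0 \<le> v x" for x unfolding v_def using Msq_nonneg[OF a] by (intro integral_nonneg_AE AE_I2) auto
  have vb: "v x \<le> C0" for x
  proof -
    have "v x \<le> (\<integral>y. Msq a x y \<partial>lborel)" unfolding v_def
      by (intro integral_mono secI Msq_integral(1)[OF a]) (use Msq_nonneg[OF a] in \<open>auto simp: indicator_def\<close>)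
    then show ?thesis using Msq_integral(2)[OF a, of x] K_bound[of "a * x" "a * x"] by linarith
  qed
  have fv: "integrable lborel (\<lambda>x. f x * v x)" by (rule bounded_mult_integrable[OF f_int(1) vm, of C0]) (use v0 vb in auto)
  have fub: "integrable (lborel \<Otimes>\<^sub>M lborel) (\<lambda>(x, y). f x * (?I y * Msq a x y))"
  proof (rule lborel_pair.Fubini_integrable)
    show "(\<lambda>(x, y). f x * (?I y * Msq a x y)) \<in> borel_measurable (lborel \<Otimes>\<^sub>M lborel)"
      unfolding split_beta' by (intro borel_measurable_times Msq_measurable; simp)
    have "norm (f x * (?I y * Msq a x y)) = f x * (?I y * Msq a x y)" for x y
      using f_nonneg[of x] Msq_nonneg[OF a, of x y] by simp
    then show "integrable lborel (\<lambda>x. \<integral>y. norm (case (x, y) of (x, y) \<Rightarrow> f x * (?I y * Msq a x y)) \<partial>lborel)"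
      using fv unfolding v_def by simp
    show "AE x in lborel. integrable lborel (\<lambda>y. case (x, y) of (x, y) \<Rightarrow> f x * (?I y * Msq a x y))"
      using secI by simp
  qed
  have "(\<integral>y. ?I y * smoothed a y \<partial>lborel) = (\<integral>y. (\<integral>x. f x * (?I y * Msq a x y) \<partial>lborel) \<partial>lborel)"
    unfolding smoothed_eq by (subst integral_mult_right_zero[symmetric]) (simp add: mult.left_commute)
  also have "\<dots> = (\<integral>x. (\<integral>y. f x * (?I y * Msq a x y) \<partial>lborel) \<partial>lborel)"
    by (rule lborel_pair.Fubini_integral[OF fub])
  also have "\<dots> = (\<integral>x. f x * v x \<partial>lborel)" unfolding v_def by simp
  finally have e: "(\<integral>y. ?I y * smoothed a y \<partial>lborel) = (\<integral>x. f x * v x \<partial>lborel)" .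
  let ?w = "\<lambda>x0 x. C0 * indicator {x0 - 2 * R / a..x0 + 2 * R / a} x :: real"
  \<comment> \<open>The windows \<open>?w s\<close> and \<open>?w t\<close> are the neighbourhoods of the endpoints, of total length \<open>O(1 / a)\<close>.\<close>
  have close: "\<bar>v x - ?I x * K (a * x) (a * x)\<bar> \<le> ?w s x + ?w t x" for x
  proof -
    have J: "integrable lborel (\<lambda>y. ?I y * Msq a x y - ?I x * Msq a x y)" by (intro Bochner_Integration.integrable_diff secI integrable_mult_right Msq_integral(1)[OF a])
    have e1: "v x - ?I x * K (a * x) (a * x) = (\<integral>y. ?I y * Msq a x y - ?I x * Msq a x y \<partial>lborel)"
      unfolding v_def Msq_integral(2)[OF a, symmetric]
      using secI Msq_integral(1)[OF a, of x] by (simp add: Bochner_Integration.integral_diff)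
    have w0: "0 \<le> ?w s x" "0 \<le> ?w t x" using C0_nonneg by auto
    show ?thesis
    proof (cases "x \<in> {s - 2 * R / a..s + 2 * R / a} \<or> x \<in> {t - 2 * R / a..t + 2 * R / a}")
      case True
      then have "C0 \<le> ?w s x + ?w t x" using C0_nonneg by (auto simp: indicator_def)
      moreover have "\<bar>v x - ?I x * K (a * x) (a * x)\<bar> \<le> C0"
        using v0[of x] vb[of x] K_diag_nonneg[of "a * x"] K_bound[of "a * x" "a * x"] by (auto simp: indicator_def abs_le_iff)
      ultimately show ?thesis by linarith
    next
      case False
      have "?I y * Msq a x y - ?I x * Msq a x y = 0" for y
      proof (cases "2 * R / a < \<bar>x - y\<bar>")
        case True then show ?thesis using Msq_zero[OF a] by simp
      next
        case f: False
        then have "?I y = ?I x" using False st by (auto simp: indicator_def)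
        then show ?thesis by simp
      qed
      then have "(\<lambda>y. ?I y * Msq a x y - ?I x * Msq a x y) = (\<lambda>y. 0)" by (rule ext)
      then have "(\<integral>y. ?I y * Msq a x y - ?I x * Msq a x y \<partial>lborel) = 0" by (simp only: integral_zero)
      then show ?thesis unfolding e1 using w0 by (simp only: abs_zero add_nonneg_nonneg)
    qed
  qed
  have kI: "integrable lborel (\<lambda>x. f x * (?I x * K (a * x) (a * x)))"
    by (rule bounded_mult_integrable[OF f_int(1), where C=C0])
       (use K_bound C0_nonneg in \<open>auto simp: indicator_def intro!: borel_measurable_times K_measurable_comp\<close>)
  have "\<bar>(\<integral>x. f x * v x \<partial>lborel) - (\<integral>x. f x * (?I x * K (a * x) (a * x)) \<partial>lborel)\<bar> = \<bar>\<integral>x. f x * (v x - ?I x * K (a * x) (a * x)) \<partial>lborel\<bar>"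
    using fv kI by (simp add: right_diff_distrib)
  also have "\<dots> \<le> (\<integral>x. \<bar>f x * (v x - ?I x * K (a * x) (a * x))\<bar> \<partial>lborel)" by (rule integral_abs_bound)
  also have "\<dots> \<le> (\<integral>x. F * (?w s x + ?w t x) \<partial>lborel)"
  proof (rule integral_mono)
    show "integrable lborel (\<lambda>x. \<bar>f x * (v x - ?I x * K (a * x) (a * x))\<bar>)" using fv kI by (simp add: right_diff_distrib)
    show "integrable lborel (\<lambda>x. F * (?w s x + ?w t x))" by (intro integrable_mult_right Bochner_Integration.integrable_add window_integral(1)[OF a])
    show "\<bar>f x * (v x - ?I x * K (a * x) (a * x))\<bar> \<le> F * (?w s x + ?w t x)" for x
      unfolding abs_mult using f_nonneg[of x] f_bound[of x] F_nonneg by (intro mult_mono close) auto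
  qed
  also have "\<dots> = F * (C0 * (4 * R / a) + C0 * (4 * R / a))"
    using window_integral[OF a] by (simp only: integral_mult_right_zero Bochner_Integration.integral_add)
  finally show ?thesis unfolding e by (simp add: mult.assoc)
qed

text \<open>
  The functions \<open>smoothed (a n)\<close> converge to \<open>f\<close> weakly, and the test function here is \<open>f\<close> itself.
\<close>

theorem variance_limit:
  assumes a: "filterlim a at_top sequentially" "\<And>n. 0 < a n"
  shows "(\<lambda>n. \<integral>y. smoothed (a n) y \<partial>D) \<longlonglongrightarrow> (\<integral>x. (f x)\<^sup>2 \<partial>lborel)"
proof -
  have "(\<lambda>n. \<integral>y. f y * smoothed (a n) y \<partial>lborel) \<longlonglongrightarrow> (\<integral>y. f y * f y \<partial>lborel)"
  proof (rule weak_star_limit[where C="max (F * C0) F", OF _ _ _ _ _ f_int(1)])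
    \<comment> \<open>Convergence on intervals: \<open>smoothed\<close> may be replaced by \<open>f\<close> times the diagonal of the kernel, whose weak limit is known.\<close>
    show "\<bar>smoothed (a n) x\<bar> \<le> max (F * C0) F" for n x using smoothed_bound[OF a(2), of n x] by simp
    show "\<bar>f x\<bar> \<le> max (F * C0) F" for x using f_nonneg[of x] f_bound[of x] by simp
    fix s t :: real assume st: "s \<le> t"
    let ?I = "\<lambda>y. indicator {s..t} y :: real"
    have Iint: "integrable lborel ?I" using st by (intro integrable_real_indicator) auto
    have fI: "integrable lborel (\<lambda>x. f x * ?I x)"
      by (rule bounded_mult_integrable[OF f_int(1), where C=1]) (auto simp: indicator_def)
    have "(\<lambda>n. \<integral>x. (f x * ?I x) * K (a n * x) (a n * x) \<partial>lborel) \<longlonglongrightarrow> (\<integral>x. f x * ?I x \<partial>lborel)"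
      by (rule diag_weak_limit[OF a fI])
    moreover have "(\<lambda>n. (\<integral>y. ?I y * smoothed (a n) y \<partial>lborel) - (\<integral>x. (f x * ?I x) * K (a n * x) (a n * x) \<partial>lborel)) \<longlonglongrightarrow> 0"
    proof (rule Lim_null_comparison)
      show "\<forall>\<^sub>F n in sequentially. norm ((\<integral>y. ?I y * smoothed (a n) y \<partial>lborel) - (\<integral>x. (f x * ?I x) * K (a n * x) (a n * x) \<partial>lborel)) \<le> F * (C0 * (4 * R / a n) + C0 * (4 * R / a n))"
        using smoothed_interval[OF a(2) st] by simp
      have "(\<lambda>n. 4 * R / a n) \<longlonglongrightarrow> 0" using a(1) by (intro tendsto_divide_0[OF tendsto_const] filterlim_at_top_imp_at_infinity)
      then have "(\<lambda>n. F * (C0 * (4 * R / a n) + C0 * (4 * R / a n))) \<longlonglongrightarrow> F * (C0 * 0 + C0 * 0)" by (intro tendsto_intros)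
      then show "(\<lambda>n. F * (C0 * (4 * R / a n) + C0 * (4 * R / a n))) \<longlonglongrightarrow> 0" by simp
    qed
    ultimately have "(\<lambda>n. ((\<integral>y. ?I y * smoothed (a n) y \<partial>lborel) - (\<integral>x. (f x * ?I x) * K (a n * x) (a n * x) \<partial>lborel)) + (\<integral>x. (f x * ?I x) * K (a n * x) (a n * x) \<partial>lborel)) \<longlonglongrightarrow> 0 + (\<integral>x. f x * ?I x \<partial>lborel)"
      by (intro tendsto_add)
    then show "(\<lambda>n. \<integral>x. ?I x * smoothed (a n) x \<partial>lborel) \<longlonglongrightarrow> (\<integral>x. ?I x * f x \<partial>lborel)" by (simp add: mult.commute)
  qed (auto intro: smoothed_measurable)
  then show ?thesis by (simp add: integral_D smoothed_measurable power2_eq_square)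
qed

end

section \<open>Hoeffding decomposition of the squared error\<close>

context density_kernel
begin

text \<open>
  A bound for the integrals of \<open>\<bar>ker \<phi> j x\<bar>\<close> under the law of the observations which is uniform in the scale.
\<close>

definition Q :: real where "Q = F * (4 * R * C0)"
definition proj :: "int \<Rightarrow> real \<Rightarrow> real" where "proj j x = (\<integral>z. ker \<phi> j x z \<partial>D)"
definition cmean :: "int \<Rightarrow> real" where "cmean j = (\<integral>x. proj j x \<partial>D)"
text \<open>
  The canonical part of \<open>ker \<phi> j\<close> in the Hoeffding decomposition with respect to the law of the observations.
\<close>

definition centered_ker :: "int \<Rightarrow> real \<Rightarrow> real \<Rightarrow> real" where "centered_ker j x y = ker \<phi> j x y - proj j x - proj j y + cmean j"

lemma Q_nonneg: "0 \<le> Q" unfolding Q_def using F_nonneg R C0_nonneg by (intro mult_nonneg_nonneg) auto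

lemma ker_measurable_comp: "u \<in> borel_measurable N \<Longrightarrow> v \<in> borel_measurable N \<Longrightarrow> (\<lambda>z. ker \<phi> j (u z) (v z)) \<in> borel_measurable N"
  using measurable_compose[OF measurable_Pair ker_measurable[OF phi_measurable]] by simp

lemma ker_sym: "ker \<phi> j x y = ker \<phi> j y x" by (simp add: ker_def mult.commute)

lemma ker_bound: "\<bar>ker \<phi> j x y\<bar> \<le> C0 * 2 powi j"
  unfolding ker_scale[of j] using K_bound[of "2 powi j * x" "2 powi j * y"] by (simp add: abs_mult mult.commute mult_left_mono)

lemma ker_integrable_D: "integrable D (\<lambda>z. ker \<phi> j x z)"
  by (rule D.integrable_const_bound[where B="C0 * 2 powi j"]) (use ker_bound in \<open>auto intro!: ker_measurable_comp\<close>)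

lemma ker_integrable: "integrable lborel (\<lambda>z. ker \<phi> j x z)"
  unfolding ker_scale[of j] by (intro integrable_mult_right K_L1(1)) simp

lemma ker_L1_D: "(\<integral>z. \<bar>ker \<phi> j x z\<bar> \<partial>D) \<le> Q"
proof -
  let ?a = "2 powi j :: real"
  have a: "0 < ?a" by simp
  have "(\<integral>z. \<bar>ker \<phi> j x z\<bar> \<partial>D) = (\<integral>z. f z * \<bar>ker \<phi> j x z\<bar> \<partial>lborel)"
    by (rule integral_D) (intro borel_measurable_abs ker_measurable_comp; simp)
  also have "\<dots> \<le> (\<integral>z. F * \<bar>ker \<phi> j x z\<bar> \<partial>lborel)"
  proof (rule integral_mono)
    show "integrable lborel (\<lambda>z. f z * \<bar>ker \<phi> j x z\<bar>)"
      by (rule bounded_mult_integrable[OF f_int(1), where C="C0 * ?a"]) (use ker_bound in \<open>auto intro!: ker_measurable_comp borel_measurable_abs\<close>)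
  qed (auto intro!: ker_integrable integrable_mult_right integrable_abs mult_right_mono f_bound)
  also have "\<dots> = F * (?a * (\<integral>z. \<bar>K (?a * x) (?a * z)\<bar> \<partial>lborel))"
    unfolding ker_scale[of j] using a by (simp add: abs_mult)
  also have "\<dots> \<le> F * (?a * (C0 * (4 * R / ?a)))" using K_L1(2)[OF a, of x] a F_nonneg by (intro mult_left_mono) auto
  also have "\<dots> = Q" unfolding Q_def using a by simp
  finally show ?thesis .
qed

lemma proj_measurable: "proj j \<in> borel_measurable borel"
  unfolding proj_def[abs_def] by (intro D.borel_measurable_lebesgue_integral) (simp add: split_beta', intro ker_measurable_comp; simp)

lemma proj_bound: "\<bar>proj j x\<bar> \<le> Q"
  unfolding proj_def using integral_abs_bound[of D "\<lambda>z. ker \<phi> j x z"] ker_L1_D[of j x] by linarith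

lemma proj_integrable: "integrable D (proj j)"
  by (rule D.integrable_const_bound[where B=Q]) (use proj_bound proj_measurable in auto)

lemma cmean_bound: "\<bar>cmean j\<bar> \<le> Q"
proof -
  have "\<bar>cmean j\<bar> \<le> (\<integral>x. \<bar>proj j x\<bar> \<partial>D)" unfolding cmean_def by (rule integral_abs_bound)
  also have "\<dots> \<le> (\<integral>x. Q \<partial>D)" by (intro integral_mono integrable_abs proj_integrable D.integrable_const proj_bound)
  finally show ?thesis by simp
qed

lemma centered_ker_close: "\<bar>centered_ker j x y - ker \<phi> j x y\<bar> \<le> 3 * Q"
  unfolding centered_ker_def using proj_bound[of j x] proj_bound[of j y] cmean_bound[of j] by linarith

lemma deg_kernel_centered_ker:
  assumes j: "0 \<le> j"
  shows "deg_kernel D (C0 + 4 * Q) (2 powi j) (centered_ker j)"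
  unfolding deg_kernel_def
proof (intro conjI allI)
  let ?a = "2 powi j :: real"
  have a1: "1 \<le> ?a" using j by (simp add: power_int_def)
  show m: "(\<lambda>p. centered_ker j (fst p) (snd p)) \<in> borel_measurable (borel \<Otimes>\<^sub>M borel)"
    unfolding centered_ker_def by (intro borel_measurable_add borel_measurable_diff borel_measurable_const ker_measurable_comp measurable_compose[OF _ proj_measurable]) auto
  fix x y
  show "centered_ker j x y = centered_ker j y x" by (simp add: centered_ker_def ker_sym[of j x y])
  show "(\<integral>y. centered_ker j x y \<partial>D) = 0"
    unfolding centered_ker_def using ker_integrable_D[of j x] proj_integrable[of j] by (simp add: proj_def[symmetric] cmean_def[symmetric])
  show "\<bar>centered_ker j x y\<bar> \<le> (C0 + 4 * Q) * ?a"
  proof -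
    have "\<bar>centered_ker j x y\<bar> \<le> C0 * ?a + 4 * Q" using centered_ker_close[of j x y] ker_bound[of j x y] Q_nonneg by linarith
    also have "4 * Q \<le> 4 * Q * ?a" using Q_nonneg a1 by (simp add: mult_le_cancel_left1)
    finally show ?thesis by (simp add: distrib_right)
  qed
  show "(\<integral>y. \<bar>centered_ker j x y\<bar> \<partial>D) \<le> C0 + 4 * Q"
  proof -
    have "(\<integral>y. \<bar>centered_ker j x y\<bar> \<partial>D) \<le> (\<integral>y. \<bar>ker \<phi> j x y\<bar> + 3 * Q \<partial>D)"
    proof (rule integral_mono')
      show "\<bar>centered_ker j x y\<bar> \<le> \<bar>ker \<phi> j x y\<bar> + 3 * Q" for y using centered_ker_close[of j x y] by linarith
    qed (use ker_integrable_D[of j x] Q_nonneg in auto)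
    also have "\<dots> = (\<integral>y. \<bar>ker \<phi> j x y\<bar> \<partial>D) + 3 * Q" using ker_integrable_D[of j x] by simp
    finally show ?thesis using ker_L1_D[of j x] C0_nonneg Q_nonneg by linarith
  qed
qed

text \<open>
  Centering changes the kernel by a bounded amount and hence, the rows having bounded mass, the second moment by a bounded
  amount, while the second moment itself is of order \<open>2 powi j\<close>.
\<close>

lemma kernel_var_centered_ker:
  assumes j: "0 \<le> j"
  shows "\<bar>kernel_var D (centered_ker j) - 2 powi j * (\<integral>y. smoothed (2 powi j) y \<partial>D)\<bar> \<le> 15 * Q\<^sup>2"
proof -
  let ?a = "2 powi j :: real"
  have a: "0 < ?a" by simp
  note dk = deg_kernel_centered_ker[OF j]
  have Km: "(\<lambda>x. ker \<phi> j x y) \<in> borel_measurable borel" for y by (intro ker_measurable_comp) auto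
  have Kxy: "integrable D (\<lambda>x. ker \<phi> j x y)" for y using ker_integrable_D[of j y] by (simp add: ker_sym[of j _ y])
  have Hm: "(\<lambda>x. centered_ker j x y) \<in> borel_measurable borel" for y
    by (rule kernel_measurable_comp[OF deg_kernelD(1)[OF dk]]) auto
  have KI: "integrable D (\<lambda>x. (ker \<phi> j x y)\<^sup>2)" for y
    by (rule D.integrable_const_bound[where B="(C0 * ?a)\<^sup>2"]) (use norm_sq_le[OF ker_bound] Km in auto)
  have HI: "integrable D (\<lambda>x. (centered_ker j x y)\<^sup>2)" for y
    by (rule D.integrable_const_bound[where B="((C0 + 4 * Q) * ?a)\<^sup>2"]) (use norm_sq_le[OF deg_kernelD(4)[OF dk]] Hm in auto)
  have K2: "(\<integral>x. (ker \<phi> j x y)\<^sup>2 \<partial>D) = ?a * smoothed ?a y" for y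
    unfolding smoothed_def ker_scale[of j] Msq_def by (simp add: power_mult_distrib power2_eq_square[of ?a] mult.assoc)
  have diff: "\<bar>(\<integral>x. (centered_ker j x y)\<^sup>2 \<partial>D) - ?a * smoothed ?a y\<bar> \<le> 15 * Q\<^sup>2" for y
  proof -
    have "\<bar>(\<integral>x. (centered_ker j x y)\<^sup>2 \<partial>D) - ?a * smoothed ?a y\<bar> = \<bar>\<integral>x. (centered_ker j x y)\<^sup>2 - (ker \<phi> j x y)\<^sup>2 \<partial>D\<bar>"
      unfolding K2[symmetric] using HI KI by simp
    also have "\<dots> \<le> (\<integral>x. \<bar>(centered_ker j x y)\<^sup>2 - (ker \<phi> j x y)\<^sup>2\<bar> \<partial>D)" by (rule integral_abs_bound)
    also have "\<dots> \<le> (\<integral>x. 3 * Q * (2 * \<bar>ker \<phi> j x y\<bar> + 3 * Q) \<partial>D)"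
    proof (rule integral_mono)
      fix x
      have "\<bar>centered_ker j x y + ker \<phi> j x y\<bar> \<le> 2 * \<bar>ker \<phi> j x y\<bar> + 3 * Q" using centered_ker_close[of j x y] by linarith
      then have "\<bar>centered_ker j x y - ker \<phi> j x y\<bar> * \<bar>centered_ker j x y + ker \<phi> j x y\<bar> \<le> 3 * Q * (2 * \<bar>ker \<phi> j x y\<bar> + 3 * Q)"
        using centered_ker_close[of j x y] Q_nonneg by (intro mult_mono) auto
      moreover have "(centered_ker j x y)\<^sup>2 - (ker \<phi> j x y)\<^sup>2 = (centered_ker j x y - ker \<phi> j x y) * (centered_ker j x y + ker \<phi> j x y)"
        by (simp add: power2_eq_square algebra_simps)
      ultimately show "\<bar>(centered_ker j x y)\<^sup>2 - (ker \<phi> j x y)\<^sup>2\<bar> \<le> 3 * Q * (2 * \<bar>ker \<phi> j x y\<bar> + 3 * Q)" by (simp only: abs_mult)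
    next
      show "integrable D (\<lambda>x. \<bar>(centered_ker j x y)\<^sup>2 - (ker \<phi> j x y)\<^sup>2\<bar>)" by (intro integrable_abs Bochner_Integration.integrable_diff HI KI)
      show "integrable D (\<lambda>x. 3 * Q * (2 * \<bar>ker \<phi> j x y\<bar> + 3 * Q))"
        by (intro integrable_mult_right Bochner_Integration.integrable_add integrable_abs Kxy D.integrable_const)
    qed
    also have "\<dots> = 3 * Q * (2 * (\<integral>x. \<bar>ker \<phi> j x y\<bar> \<partial>D) + 3 * Q)" using Kxy[of y] by simp
    also have "\<dots> \<le> 3 * Q * (2 * Q + 3 * Q)"
    proof -
      have "(\<integral>x. \<bar>ker \<phi> j x y\<bar> \<partial>D) \<le> Q" using ker_L1_D[of j y] by (simp add: ker_sym[of j _ y])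
      then show ?thesis using Q_nonneg by (intro mult_left_mono) auto
    qed
    also have "\<dots> = 15 * Q\<^sup>2" by (simp add: power2_eq_square)
    finally show ?thesis .
  qed
  have sI: "integrable D (smoothed ?a)"
    by (rule D.integrable_const_bound[where B="F * C0"]) (use smoothed_bound[OF a] smoothed_measurable in auto)
  have hm: "(\<lambda>y. \<integral>x. (centered_ker j x y)\<^sup>2 \<partial>D) \<in> borel_measurable borel"
    by (intro D.borel_measurable_lebesgue_integral) (simp add: split_beta', intro borel_measurable_power kernel_measurable_comp[OF deg_kernelD(1)[OF dk]]; simp)
  have hI: "integrable D (\<lambda>y. \<integral>x. (centered_ker j x y)\<^sup>2 \<partial>D)"
  proof (rule D.integrable_const_bound[where B="?a * (F * C0) + 15 * Q\<^sup>2"])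
    show "AE y in D. norm (\<integral>x. (centered_ker j x y)\<^sup>2 \<partial>D) \<le> ?a * (F * C0) + 15 * Q\<^sup>2"
    proof (rule AE_I2)
      fix y
      have "\<bar>?a * smoothed ?a y\<bar> \<le> ?a * (F * C0)" unfolding abs_mult using smoothed_bound[OF a, of y] by simp
      then show "norm (\<integral>x. (centered_ker j x y)\<^sup>2 \<partial>D) \<le> ?a * (F * C0) + 15 * Q\<^sup>2" using diff[of y] unfolding real_norm_def by linarith
    qed
  qed (use hm in simp)
  have "\<bar>kernel_var D (centered_ker j) - ?a * (\<integral>y. smoothed ?a y \<partial>D)\<bar> = \<bar>\<integral>y. (\<integral>x. (centered_ker j x y)\<^sup>2 \<partial>D) - ?a * smoothed ?a y \<partial>D\<bar>"
    unfolding kernel_var_def using hI sI by simp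
  also have "\<dots> \<le> (\<integral>y. \<bar>(\<integral>x. (centered_ker j x y)\<^sup>2 \<partial>D) - ?a * smoothed ?a y\<bar> \<partial>D)" by (rule integral_abs_bound)
  also have "\<dots> \<le> (\<integral>y. 15 * Q\<^sup>2 \<partial>D)"
    by (intro integral_mono integrable_abs Bochner_Integration.integrable_diff hI integrable_mult_right sI D.integrable_const diff)
  finally show ?thesis by simp
qed

lemma kernel_var_limit:
  assumes j: "filterlim j at_top sequentially"
  shows "(\<lambda>n. kernel_var D (centered_ker (j n)) / 2 powi (j n)) \<longlonglongrightarrow> (\<integral>x. (f x)\<^sup>2 \<partial>lborel)"
proof -
  have j0: "\<forall>\<^sub>F n in sequentially. 0 \<le> j n" using j by (simp add: filterlim_at_top)
  have "filterlim (\<lambda>n. real_of_int (j n)) at_top sequentially"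
    by (rule filterlim_compose[OF filterlim_real_of_int_at_top j])
  moreover have "filterlim (\<lambda>x::real. 2 powr x) at_top at_top" by real_asymp
  ultimately have "filterlim (\<lambda>n. 2 powr real_of_int (j n)) at_top sequentially" by (rule filterlim_compose[rotated])
  then have a: "filterlim (\<lambda>n. 2 powi (j n) :: real) at_top sequentially" by (simp add: powr_real_of_int')
  have 1: "(\<lambda>n. \<integral>y. smoothed (2 powi (j n)) y \<partial>D) \<longlonglongrightarrow> (\<integral>x. (f x)\<^sup>2 \<partial>lborel)" by (rule variance_limit[OF a]) simp
  have 2: "(\<lambda>n. kernel_var D (centered_ker (j n)) / 2 powi (j n) - (\<integral>y. smoothed (2 powi (j n)) y \<partial>D)) \<longlonglongrightarrow> 0"
  proof (rule Lim_null_comparison)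
    show "\<forall>\<^sub>F n in sequentially. norm (kernel_var D (centered_ker (j n)) / 2 powi (j n) - (\<integral>y. smoothed (2 powi (j n)) y \<partial>D)) \<le> 15 * Q\<^sup>2 / 2 powi (j n)"
      using j0
    proof eventually_elim
      case (elim n)
      let ?a = "2 powi (j n) :: real"
      have "kernel_var D (centered_ker (j n)) / ?a - (\<integral>y. smoothed ?a y \<partial>D) = (kernel_var D (centered_ker (j n)) - ?a * (\<integral>y. smoothed ?a y \<partial>D)) / ?a"
        by (simp add: diff_divide_distrib)
      then show ?case using kernel_var_centered_ker[OF elim] by (simp add: divide_right_mono)
    qed
    show "(\<lambda>n. 15 * Q\<^sup>2 / 2 powi (j n)) \<longlonglongrightarrow> 0" using a by (intro tendsto_divide_0[OF tendsto_const] filterlim_at_top_imp_at_infinity)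
  qed
  from tendsto_add[OF 2 1] show ?thesis by simp
qed

lemma ker_reproducing: "integrable lborel (\<lambda>z. ker \<phi> j x z * ker \<phi> j y z)" "(\<integral>z. ker \<phi> j x z * ker \<phi> j y z \<partial>lborel) = ker \<phi> j x y"
proof -
  let ?a = "2 powi j :: real"
  have a: "0 < ?a" by simp
  have I: "integrable lborel (\<lambda>u. K (?a * x) u * K u (?a * y))" by (rule K_reproducing(1))
  have e: "ker \<phi> j x z * ker \<phi> j y z = ?a * ?a * (K (?a * x) (0 + ?a * z) * K (0 + ?a * z) (?a * y))" for z
    unfolding ker_scale[of j] by (simp add: K_sym[of "?a * z" "?a * y"])
  show "integrable lborel (\<lambda>z. ker \<phi> j x z * ker \<phi> j y z)"
    unfolding e by (intro integrable_mult_right lborel_integrable_real_affine[OF I]) simp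
  have "(\<integral>u. K (?a * x) u * K u (?a * y) \<partial>lborel) = \<bar>?a\<bar> *\<^sub>R (\<integral>z. K (?a * x) (0 + ?a * z) * K (0 + ?a * z) (?a * y) \<partial>lborel)"
    by (rule lborel_integral_real_affine) simp
  then have "K (?a * x) (?a * y) = ?a * (\<integral>z. K (?a * x) (0 + ?a * z) * K (0 + ?a * z) (?a * y) \<partial>lborel)"
    unfolding K_reproducing(2) by simp
  then show "(\<integral>z. ker \<phi> j x z * ker \<phi> j y z \<partial>lborel) = ker \<phi> j x y"
    unfolding e by (subst integral_mult_right_zero) (simp add: ker_scale[of j x y] mult.assoc)
qed

text \<open>
  What is left of the pairs of equal indices and of the linear terms. The linear part of the U-statistic carries the factor
  \<open>2 (n - 1)\<close>, that of the cross term with \<open>f\<close> the factor \<open>-2 n\<close>; hence the difference \<open>-2\<close>.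
\<close>

definition diag :: "int \<Rightarrow> real \<Rightarrow> real" where "diag j x = ker \<phi> j x x - 2 * proj j x"

lemma ustat_centered_ker: "ustat (centered_ker j) n y = ustat (ker \<phi> j) n y - 2 * (real n - 1) * (\<Sum>i<n. proj j (y i)) + real n * (real n - 1) * cmean j"
proof (induction n)
  case (Suc n)
  have "(\<Sum>i<n. centered_ker j (y i) (y n)) = (\<Sum>i<n. ker \<phi> j (y i) (y n)) - (\<Sum>i<n. proj j (y i)) - real n * proj j (y n) + real n * cmean j"
    unfolding centered_ker_def by (simp add: sum.distrib sum_subtractf)
  then show ?case using Suc by (simp add: ustat_def algebra_simps)
qed (simp add: ustat_def)

text \<open>
  A deterministic identity. Integrating the square of the kernel mean gives the double sum of the kernel by the reproducing
  property, and the cross term with \<open>f\<close> gives the projection of \<open>f\<close>.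
\<close>

lemma squared_error_expansion:
  assumes n: "1 \<le> n"
  shows "(\<integral>x. ((\<Sum>i<n. ker \<phi> j (y i) x) / real n - f x)\<^sup>2 \<partial>lborel)
    = (ustat (centered_ker j) n y + (\<Sum>i<n. diag j (y i))) / (real n)\<^sup>2 + ((\<integral>x. f x * f x \<partial>lborel) - (real n - 1) / real n * cmean j)"
proof -
  have e: "((\<Sum>i<n. ker \<phi> j (y i) x) / real n - f x)\<^sup>2 = (1 / (real n)\<^sup>2) * (\<Sum>i<n. \<Sum>l<n. ker \<phi> j (y i) x * ker \<phi> j (y l) x)
     - (2 / real n) * (\<Sum>i<n. f x * ker \<phi> j (y i) x) + f x * f x" for x
  proof -
    have "(\<Sum>i<n. \<Sum>l<n. ker \<phi> j (y i) x * ker \<phi> j (y l) x) = (\<Sum>i<n. ker \<phi> j (y i) x)\<^sup>2"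
      unfolding power2_eq_square sum_product ..
    moreover have "(\<Sum>i<n. f x * ker \<phi> j (y i) x) = f x * (\<Sum>i<n. ker \<phi> j (y i) x)" by (simp add: sum_distrib_left)
    ultimately show ?thesis by (simp add: power2_diff power_divide) (simp add: power2_eq_square)
  qed
  have fk: "integrable lborel (\<lambda>x. f x * ker \<phi> j (y i) x)" for i
    by (rule bounded_mult_integrable[OF f_int(1), where C="C0 * 2 powi j"]) (auto intro!: ker_measurable_comp ker_bound)
  have fkP: "(\<integral>x. f x * ker \<phi> j (y i) x \<partial>lborel) = proj j (y i)" for i
    unfolding proj_def by (rule integral_D[symmetric]) (intro ker_measurable_comp; simp)
  have "(\<integral>x. ((\<Sum>i<n. ker \<phi> j (y i) x) / real n - f x)\<^sup>2 \<partial>lborel)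
     = (1 / (real n)\<^sup>2) * (\<Sum>i<n. \<Sum>l<n. ker \<phi> j (y i) (y l)) - (2 / real n) * (\<Sum>i<n. proj j (y i)) + (\<integral>x. f x * f x \<partial>lborel)"
  proof -
    let ?A = "\<lambda>x. \<Sum>i<n. \<Sum>l<n. ker \<phi> j (y i) x * ker \<phi> j (y l) x" and ?B = "\<lambda>x. \<Sum>i<n. f x * ker \<phi> j (y i) x"
    have A: "integrable lborel ?A" "(\<integral>x. ?A x \<partial>lborel) = (\<Sum>i<n. \<Sum>l<n. ker \<phi> j (y i) (y l))"
      by (auto simp: Bochner_Integration.integral_sum Bochner_Integration.integrable_sum ker_reproducing)
    have B: "integrable lborel ?B" "(\<integral>x. ?B x \<partial>lborel) = (\<Sum>i<n. proj j (y i))"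
      by (auto simp: Bochner_Integration.integral_sum Bochner_Integration.integrable_sum fk fkP)
    show ?thesis unfolding e
      by (subst Bochner_Integration.integral_add, intro Bochner_Integration.integrable_diff integrable_mult_right A B, rule f_sq,
          subst Bochner_Integration.integral_diff, intro integrable_mult_right A, intro integrable_mult_right B)
         (simp only: integral_mult_right_zero A B)
  qed
  also have "(\<Sum>i<n. \<Sum>l<n. ker \<phi> j (y i) (y l)) = (\<Sum>i<n. ker \<phi> j (y i) (y i)) + ustat (ker \<phi> j) n y"
    by (rule double_sum_ustat) (rule ker_sym)
  also have "ustat (ker \<phi> j) n y = ustat (centered_ker j) n y + 2 * (real n - 1) * (\<Sum>i<n. proj j (y i)) - real n * (real n - 1) * cmean j"
    unfolding ustat_centered_ker by simp
  finally have E: "(\<integral>x. ((\<Sum>i<n. ker \<phi> j (y i) x) / real n - f x)\<^sup>2 \<partial>lborel) = (1 / (real n)\<^sup>2) * ((\<Sum>i<n. ker \<phi> j (y i) (y i)) +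
      (ustat (centered_ker j) n y + 2 * (real n - 1) * (\<Sum>i<n. proj j (y i)) - real n * (real n - 1) * cmean j)) - (2 / real n) * (\<Sum>i<n. proj j (y i)) + (\<integral>x. f x * f x \<partial>lborel)" .
  have dg: "(\<Sum>i<n. diag j (y i)) = (\<Sum>i<n. ker \<phi> j (y i) (y i)) - 2 * (\<Sum>i<n. proj j (y i))"
    unfolding diag_def by (simp add: sum_subtractf sum_distrib_left)
  have alg: "(1 / N\<^sup>2) * (k + (u + 2 * (N - 1) * p - N * (N - 1) * c)) - (2 / N) * p + f2 = (u + (k - 2 * p)) / N\<^sup>2 + (f2 - (N - 1) / N * c)"
    if "N \<noteq> 0" for N k u p c f2 :: real
    using that by (simp add: field_simps power2_eq_square)
  show ?thesis unfolding E dg by (rule alg) (use n in simp)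
qed

lemma diag_bound: assumes "0 \<le> j" shows "\<bar>diag j x\<bar> \<le> (C0 + 2 * Q) * 2 powi j"
proof -
  have a1: "1 \<le> (2 powi j :: real)" using assms by (simp add: power_int_def)
  have "\<bar>diag j x\<bar> \<le> C0 * 2 powi j + 2 * Q" unfolding diag_def using ker_bound[of j x x] proj_bound[of j x] by linarith
  also have "2 * Q \<le> 2 * Q * 2 powi j" using Q_nonneg a1 by (simp add: mult_le_cancel_left1)
  finally show ?thesis by (simp add: distrib_right)
qed

lemma diag_measurable: "diag j \<in> borel_measurable borel"
  unfolding diag_def[abs_def] by (intro borel_measurable_diff borel_measurable_times borel_measurable_const ker_measurable_comp proj_measurable) auto

end

section \<open>The diagonal term and the centered squared error\<close>

context iid_sample
begin

text \<open>
  The fourth moment of the sum is of order \<open>n\<^sup>2 L\<^sup>4\<close>, so Chebyshev's inequality for the squares gives probabilities of order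
  \<open>L\<^sup>2 / n\<^sup>2 \<le> n\<^sup>2\<^sup>\<delta>\<^sup>-\<^sup>2\<close>, which are summable. The second moment would give only \<open>L / n\<close>, which is not.
\<close>

lemma diag_negligible:
  fixes q :: "nat \<Rightarrow> real \<Rightarrow> real" and L :: "nat \<Rightarrow> real"
  assumes ev: "\<forall>\<^sub>F n in sequentially. q n \<in> borel_measurable borel \<and> (\<forall>y. \<bar>q n y\<bar> \<le> A * L n) \<and> (\<integral>y. q n y \<partial>D) = 0 \<and> 0 < L n \<and> L n \<le> C * real n powr \<delta>"
    and \<delta>: "\<delta> < 1 / 2"
  shows "AE \<omega> in M. (\<lambda>n. (\<Sum>i<n. q n (X i \<omega>)) / (real n * sqrt (L n))) \<longlonglongrightarrow> 0"
proof -
  obtain n0 where n0: "\<And>n. n0 \<le> n \<Longrightarrow> q n \<in> borel_measurable borel \<and> (\<forall>y. \<bar>q n y\<bar> \<le> A * L n) \<and> (\<integral>y. q n y \<partial>D) = 0 \<and> 0 < L n \<and> L n \<le> C * real n powr \<delta>"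
    using ev unfolding eventually_sequentially by blast
  define S where "S n \<omega> = (\<Sum>i<n. q n (X i \<omega>))" for n \<omega>
  have "AE \<omega> in M. \<forall>\<^sub>F n in sequentially. \<bar>S n \<omega>\<bar> < 1 / real (Suc m) * (real n * sqrt (L n))" for m :: nat
  proof -
    define e where "e = 1 / real (Suc m)"
    have e: "0 < e" by (simp add: e_def)
    \<comment> \<open>Before \<open>n0\<close> nothing is known about \<open>q n\<close>, not even measurability, so the event is set to be empty there.\<close>
    define G where "G n = (if Suc n0 \<le> n then {\<omega>\<in>space M. e\<^sup>2 * (real n)\<^sup>2 * L n \<le> \<bar>(S n \<omega>)\<^sup>2\<bar>} else {})" for n
    have Sm: "S n \<in> borel_measurable M" if "n0 \<le> n" for n
      unfolding S_def by (intro borel_measurable_sum measurable_compose[OF X_measurable]) (use n0[OF that] in auto)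
    have Gs: "G n \<in> sets M" for n
    proof (cases "Suc n0 \<le> n")
      case True
      have [measurable]: "S n \<in> borel_measurable M" using Sm True by simp
      have "{\<omega>\<in>space M. e\<^sup>2 * (real n)\<^sup>2 * L n \<le> \<bar>(S n \<omega>)\<^sup>2\<bar>} \<in> sets M" by measurable
      then show ?thesis unfolding G_def by (simp only: if_P[OF True])
    qed (simp add: G_def)
    have pG: "prob (G n) \<le> 4 * A^4 * C\<^sup>2 / e^4 * real n powr (2 * \<delta> - 2)" if n: "Suc n0 \<le> n" for n
    proof -
      have nn: "n0 \<le> n" "0 < real n" using n by auto
      note qn = n0[OF nn(1)]
      then have qm: "q n \<in> borel_measurable borel" and qb: "\<And>y. \<bar>q n y\<bar> \<le> A * L n" and qz: "(\<integral>y. q n y \<partial>D) = 0" and L0: "0 < L n" and LC: "L n \<le> C * real n powr \<delta>" by auto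
      let ?t = "e\<^sup>2 * (real n)\<^sup>2 * L n"
      have t0: "0 < ?t" using e nn L0 by simp
      have Sb: "\<bar>(S n \<omega>)\<^sup>2\<bar> \<le> (real n * (A * L n))\<^sup>2" for \<omega>
      proof -
        have "\<bar>S n \<omega>\<bar> \<le> (\<Sum>i<n. \<bar>q n (X i \<omega>)\<bar>)" unfolding S_def by (rule sum_abs)
        also have "\<dots> \<le> (\<Sum>i<n. A * L n)" by (intro sum_mono qb)
        finally show ?thesis using norm_sq_le[of "S n \<omega>" "real n * (A * L n)"] by simp
      qed
      have S2m: "(\<lambda>\<omega>. (S n \<omega>)\<^sup>2) \<in> borel_measurable M" using Sm[OF nn(1)] by measurable
      have "prob (G n) \<le> expectation (\<lambda>\<omega>. ((S n \<omega>)\<^sup>2)\<^sup>2) / ?t\<^sup>2"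
        unfolding G_def using n second_moment_tail[OF S2m Sb t0] by simp
      also have "\<dots> \<le> (4 * (real n)\<^sup>2 * (A * L n)^4) / ?t\<^sup>2"
      proof (rule divide_right_mono)
        have q4I: "integrable D (\<lambda>y. (q n y)^k)" for k
          by (rule D.integrable_const_bound[where B="(A * L n)^k"]) (use qm in \<open>auto simp: power_abs intro!: power_mono qb\<close>)
        have q4: "(\<integral>y. (q n y)^4 \<partial>D) \<le> (\<integral>y. (A * L n)^4 \<partial>D)"
        proof (rule integral_mono[OF q4I])
          show "(q n y)^4 \<le> (A * L n)^4" for y using power_mono[OF qb[of y], of 4] by (simp add: power_even_abs)
        qed simp
        have q2: "(\<integral>y. (q n y)\<^sup>2 \<partial>D) \<le> (\<integral>y. (A * L n)\<^sup>2 \<partial>D)"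
          by (rule integral_mono[OF q4I]) (use norm_sq_le[OF qb] in auto)
        have "0 \<le> (\<integral>y. (q n y)\<^sup>2 \<partial>D)" by (intro integral_nonneg_AE AE_I2) auto
        with q2 have q22: "(\<integral>y. (q n y)\<^sup>2 \<partial>D)\<^sup>2 \<le> ((A * L n)\<^sup>2)\<^sup>2" by (intro power_mono) auto
        have "expectation (\<lambda>\<omega>. ((S n \<omega>)\<^sup>2)\<^sup>2) = expectation (\<lambda>\<omega>. (\<Sum>i<n. q n (X i \<omega>))^4)"
          unfolding S_def by (simp add: power_mult[symmetric])
        also have "\<dots> \<le> real n * (\<integral>y. (q n y)^4 \<partial>D) + 3 * (real n)\<^sup>2 * (\<integral>y. (q n y)\<^sup>2 \<partial>D)\<^sup>2"
          by (rule sum_fourth_moment[OF qm qb qz])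
        also have "\<dots> \<le> (real n)\<^sup>2 * (A * L n)^4 + 3 * (real n)\<^sup>2 * ((A * L n)\<^sup>2)\<^sup>2"
        proof (intro add_mono mult_left_mono q22)
          have "real n * 1 \<le> real n * real n" using n by (intro mult_left_mono) auto
          then have n2: "real n \<le> (real n)\<^sup>2" by (simp add: power2_eq_square)
          have "real n * (\<integral>y. (q n y)^4 \<partial>D) \<le> real n * (A * L n)^4" using q4 by (intro mult_left_mono) auto
          also have "\<dots> \<le> (real n)\<^sup>2 * (A * L n)^4" using n2 by (intro mult_right_mono) auto
          finally show "real n * (\<integral>y. (q n y)^4 \<partial>D) \<le> (real n)\<^sup>2 * (A * L n)^4" .
        qed simp
        also have "\<dots> = 4 * (real n)\<^sup>2 * (A * L n)^4" by (simp add: power_mult[symmetric])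
        finally show "expectation (\<lambda>\<omega>. ((S n \<omega>)\<^sup>2)\<^sup>2) \<le> 4 * (real n)\<^sup>2 * (A * L n)^4" .
      qed simp
      also have "\<dots> = 4 * A^4 / e^4 * ((L n)\<^sup>2 / (real n)\<^sup>2)"
        using e nn L0 by (simp add: power_mult_distrib field_simps)
      also have "\<dots> \<le> 4 * A^4 / e^4 * ((C * real n powr \<delta>)\<^sup>2 / (real n)\<^sup>2)"
        using L0 LC e by (intro mult_left_mono divide_right_mono power_mono) auto
      also have "\<dots> = 4 * A^4 * C\<^sup>2 / e^4 * ((real n powr \<delta>)\<^sup>2 / (real n)\<^sup>2)" by (simp add: power_mult_distrib)
      also have "(real n powr \<delta>)\<^sup>2 / (real n)\<^sup>2 = real n powr (2 * \<delta> - 2)"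
        using nn by (simp add: powr_diff powr_powr[symmetric] power2_eq_square powr_add[symmetric])
      finally show ?thesis .
    qed
    have "AE \<omega> in M. \<forall>\<^sub>F n in sequentially. \<omega> \<in> space M - G n"
    proof (rule borel_cantelli_AE1[OF Gs])
      show "emeasure M (G n) < \<infinity>" for n by (simp add: emeasure_eq_measure)
      show "summable (\<lambda>n. measure M (G n))"
      proof (rule summable_comparison_test'[where N="Suc n0"])
        show "summable (\<lambda>n. 4 * A^4 * C\<^sup>2 / e^4 * real n powr (2 * \<delta> - 2))"
          by (rule summable_mult) (use \<delta> in \<open>simp add: summable_real_powr_iff\<close>)
      qed (use pG in auto)
    qed
    then show ?thesis
    proof eventually_elim
      case (elim \<omega>)
      from elim eventually_ge_at_top[of "Suc n0"] show ?case
      proof eventually_elim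
        case (elim n)
        have L0: "0 < L n" using n0[of n] elim(2) by auto
        have "\<not> e\<^sup>2 * (real n)\<^sup>2 * L n \<le> \<bar>(S n \<omega>)\<^sup>2\<bar>" using elim by (simp add: G_def)
        then have "\<bar>S n \<omega>\<bar>\<^sup>2 < (e * (real n * sqrt (L n)))\<^sup>2" using L0 by (simp add: power_mult_distrib mult.assoc)
        then have "\<bar>S n \<omega>\<bar> < e * (real n * sqrt (L n))" by (rule power_less_imp_less_base) (use e L0 in simp)
        then show ?case by (simp add: e_def)
      qed
    qed
  qed
  then have "AE \<omega> in M. \<forall>m. \<forall>\<^sub>F n in sequentially. \<bar>S n \<omega>\<bar> < 1 / real (Suc m) * (real n * sqrt (L n))"
    unfolding AE_all_countable by blast
  then show ?thesis
  proof eventually_elim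
    case (elim \<omega>)
    show ?case
    proof (rule tendstoI)
      fix r :: real assume "0 < r"
      then obtain m where m: "1 / real (Suc m) < r" using reals_Archimedean[of r] by (auto simp: inverse_eq_divide)
      from elim[rule_format, of m] eventually_ge_at_top[of "Suc n0"]
      show "\<forall>\<^sub>F n in sequentially. dist ((\<Sum>i<n. q n (X i \<omega>)) / (real n * sqrt (L n))) 0 < r"
      proof eventually_elim
        case (elim n)
        have p: "0 < real n * sqrt (L n)" using n0[of n] elim(2) by auto
        have "\<bar>S n \<omega> / (real n * sqrt (L n))\<bar> = \<bar>S n \<omega>\<bar> / (real n * sqrt (L n))" using p by (simp only: abs_divide abs_of_pos)
        also have "\<dots> < 1 / real (Suc m)" using elim(1) p by (simp add: pos_divide_less_eq)
        finally show ?case using m unfolding S_def dist_real_def by simp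
      qed
    qed
  qed
qed

end

lemma estimator_level:
  assumes "\<And>i. i \<in> {1..n} \<Longrightarrow> (\<lambda>k. dilate \<theta> j k (X i \<omega>) * dilate \<theta> j k x) summable_on UNIV"
  shows "(\<Sum>\<^sub>\<infinity>k. empirical_coeff (dilate \<theta> j k) X n \<omega> * dilate \<theta> j k x) = (\<Sum>i=1..n. ker \<theta> j (X i \<omega>) x) / real n"
proof -
  have "(\<Sum>\<^sub>\<infinity>k. empirical_coeff (dilate \<theta> j k) X n \<omega> * dilate \<theta> j k x) = (\<integral>k. (1 / real n) * (\<Sum>i=1..n. dilate \<theta> j k (X i \<omega>) * dilate \<theta> j k x) \<partial>count_space UNIV)"
    unfolding infsum_eq_integral empirical_coeff_def by (intro Bochner_Integration.integral_cong refl) (simp add: sum_distrib_right)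
  also have "\<dots> = (1 / real n) * (\<Sum>i=1..n. \<integral>k. dilate \<theta> j k (X i \<omega>) * dilate \<theta> j k x \<partial>count_space UNIV)"
    unfolding integral_mult_right_zero
    by (subst Bochner_Integration.integral_sum) (use assms in \<open>auto simp: summable_on_iff_integrable\<close>)
  finally show ?thesis unfolding ker_def infsum_eq_integral by simp
qed

text \<open>
  The summability assumptions hold for almost all values of the observations and of \<open>x\<close>; under them sums over shifts and
  over observations may be interchanged.
\<close>

lemma estimator_eq_kernel_mean:
  assumes s0: "\<And>i. i \<in> {1..n} \<Longrightarrow> (\<lambda>k. dilate \<phi> 0 k (X i \<omega>) * dilate \<phi> 0 k x) summable_on UNIV"
    and s: "\<And>i j. i \<in> {1..n} \<Longrightarrow> j < J \<Longrightarrow> (\<lambda>k. dilate \<psi> (int j) k (X i \<omega>) * dilate \<psi> (int j) k x) summable_on UNIV"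
    and id: "\<And>i. i \<in> {1..n} \<Longrightarrow> ker \<phi> (int J) (X i \<omega>) x = ker \<phi> 0 (X i \<omega>) x + (\<Sum>j<J. ker \<psi> (int j) (X i \<omega>) x)"
  shows "wavelet_density_estimator \<phi> \<psi> (int J) X n \<omega> x = (\<Sum>i<n. ker \<phi> (int J) (X (Suc i) \<omega>) x) / real n"
proof -
  have J: "{0..<int J} = int ` {..<J}" by (simp add: image_int_atLeastLessThan atLeast0LessThan[symmetric] del: atLeast0LessThan)
  have "wavelet_density_estimator \<phi> \<psi> (int J) X n \<omega> x = (\<Sum>i=1..n. ker \<phi> 0 (X i \<omega>) x) / real n + (\<Sum>j<J. (\<Sum>i=1..n. ker \<psi> (int j) (X i \<omega>) x) / real n)"
  proof -
    have "(\<Sum>l\<in>{0..<int J}. \<Sum>\<^sub>\<infinity>k. empirical_coeff (dilate \<psi> l k) X n \<omega> * dilate \<psi> l k x) = (\<Sum>j<J. (\<Sum>i=1..n. ker \<psi> (int j) (X i \<omega>) x) / real n)"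
      unfolding J sum.reindex[OF inj_on_of_nat] o_def by (intro sum.cong refl estimator_level s) auto
    moreover have "(\<Sum>\<^sub>\<infinity>k. empirical_coeff (dilate \<phi> 0 k) X n \<omega> * dilate \<phi> 0 k x) = (\<Sum>i=1..n. ker \<phi> 0 (X i \<omega>) x) / real n"
      by (rule estimator_level) (rule s0)
    ultimately show ?thesis unfolding wavelet_density_estimator_def by (simp only:)
  qed
  also have "\<dots> = (\<Sum>i=1..n. ker \<phi> 0 (X i \<omega>) x + (\<Sum>j<J. ker \<psi> (int j) (X i \<omega>) x)) / real n"
    by (simp add: sum.distrib add_divide_distrib sum_divide_distrib[symmetric] sum.swap[of _ "{..<J}"])
  also have "\<dots> = (\<Sum>i=1..n. ker \<phi> (int J) (X i \<omega>) x) / real n" using id by simp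
  also have "(\<Sum>i=1..n. ker \<phi> (int J) (X i \<omega>) x) = (\<Sum>i<n. ker \<phi> (int J) (X (Suc i) \<omega>) x)"
    by (rule sum.reindex_bij_witness[where i=Suc and j="\<lambda>i. i - 1"]) auto
  finally show ?thesis .
qed

context density_kernel
begin

text \<open>
  The law of the observations has a density, so exceptional null sets of the plane are avoided almost surely; the
  expansion of the squared error then applies. In the centered error the constants cancel and the U-statistic has mean zero.
\<close>

theorem centered_ISE_eq:
  fixes X :: "nat \<Rightarrow> 'a \<Rightarrow> real"
  assumes iid: "iid_sample M (\<lambda>i. X (Suc i)) D" and b: "orthonormal_basis_of (wavelet_family \<phi> \<psi>) L2"
    and n: "1 \<le> n" and j: "0 \<le> j n"
  shows "AE \<omega> in M. centered_ISE M \<phi> \<psi> j X f n \<omega>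
    = (ustat (centered_ker (j n)) n (\<lambda>i. X (Suc i) \<omega>) + (\<Sum>i<n. diag (j n) (X (Suc i) \<omega>) - (\<integral>y. diag (j n) y \<partial>D))) / (real n)\<^sup>2"
proof -
  interpret S: iid_sample M "\<lambda>i. X (Suc i)" D by (rule iid)
  obtain J where J: "j n = int J" using j zero_le_imp_eq_int by blast
  note th = wavelet_measurable[OF b]
  note [measurable] = th(1,2)
  define good where "good y x \<longleftrightarrow> (\<lambda>k. dilate \<phi> 0 k y * dilate \<phi> 0 k x) summable_on UNIV \<and>
     (\<forall>j<J. (\<lambda>k. dilate \<psi> (int j) k y * dilate \<psi> (int j) k x) summable_on UNIV) \<and>
     ker \<phi> (int J) y x = ker \<phi> 0 y x + (\<Sum>j<J. ker \<psi> (int j) y x)" for y x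
  have "AE p in plane. good (fst p) (snd p)"
  proof -
    have "AE p in plane. \<forall>j. (\<lambda>k. dilate \<psi> (int j) k (fst p) * dilate \<psi> (int j) k (snd p)) summable_on UNIV"
      unfolding AE_all_countable using ker_summable[OF th(4)] by blast
    with ker_summable[OF th(3), of 0] kernel_identity[OF b, of J] show ?thesis
      by eventually_elim (simp add: good_def)
  qed
  then have "AE y in lborel. AE x in lborel. good y x" using lborel_pair.AE_pair by fastforce
  then have "AE y in D. AE x in lborel. good y x" unfolding D_def by (subst AE_density) auto
  then have "AE \<omega> in M. AE x in lborel. good (X (Suc i) \<omega>) x" for i
    using AE_distrD[OF S.X_measurable[of i], of "\<lambda>y. AE x in lborel. good y x"] unfolding S.law by blast
  then have AEg: "AE \<omega> in M. \<forall>i. AE x in lborel. good (X (Suc i) \<omega>) x" unfolding AE_all_countable by blast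
  define cst where "cst = (\<integral>x. f x * f x \<partial>lborel) - (real n - 1) / real n * cmean (j n)"
  define Z where "Z \<omega> = (ustat (centered_ker (j n)) n (\<lambda>i. X (Suc i) \<omega>) + (\<Sum>i<n. diag (j n) (X (Suc i) \<omega>))) / (real n)\<^sup>2 + cst" for \<omega>
  have Xm: "X i \<in> borel_measurable M" if "i \<in> {1..n}" for i using S.X_measurable[of "i - 1"] that by (cases i) auto
  have coeffm: "(\<lambda>p. empirical_coeff (dilate \<theta> l k) X n (fst p) * dilate \<theta> l k (snd p)) \<in> borel_measurable (M \<Otimes>\<^sub>M lborel)"
    if [measurable]: "\<theta> \<in> borel_measurable borel" for \<theta> l k
    unfolding empirical_coeff_def
  proof (intro borel_measurable_times borel_measurable_divide borel_measurable_const borel_measurable_sum)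
    fix i assume i: "i \<in> {1..n}"
    have "(\<lambda>p. X i (fst p)) \<in> borel_measurable (M \<Otimes>\<^sub>M lborel)" by (rule measurable_compose[OF measurable_fst Xm[OF i]])
    then show "(\<lambda>p. dilate \<theta> l k (X i (fst p))) \<in> borel_measurable (M \<Otimes>\<^sub>M lborel)" unfolding dilate_def by measurable
  next
    have "(\<lambda>p. snd p) \<in> measurable (M \<Otimes>\<^sub>M lborel) borel" using measurable_snd[of M lborel] by simp
    then show "(\<lambda>p. dilate \<theta> l k (snd p)) \<in> borel_measurable (M \<Otimes>\<^sub>M lborel)" by simp
  qed
  have estm: "(\<lambda>p. wavelet_density_estimator \<phi> \<psi> (j n) X n (fst p) (snd p)) \<in> borel_measurable (M \<Otimes>\<^sub>M lborel)"
    unfolding wavelet_density_estimator_def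
    by (intro borel_measurable_add borel_measurable_sum borel_measurable_infsum coeffm th)
  have ise_int: "integrated_squared_error \<phi> \<psi> j X f n \<omega> = (\<integral>x. (wavelet_density_estimator \<phi> \<psi> (j n) X n \<omega> x - f x)\<^sup>2 \<partial>lborel)" for \<omega>
    unfolding integrated_squared_error_def L2_norm_sq L2_inner_def by (simp add: power2_eq_square)
  have isem: "integrated_squared_error \<phi> \<psi> j X f n \<in> borel_measurable M"
    unfolding ise_int[abs_def]
    by (intro lborel.borel_measurable_lebesgue_integral)
       (simp add: split_beta', intro borel_measurable_power borel_measurable_diff estm measurable_compose[OF measurable_snd]; simp)
  have ISE: "AE \<omega> in M. integrated_squared_error \<phi> \<psi> j X f n \<omega> = Z \<omega>"
    using AEg
  proof eventually_elim
    case (elim \<omega>)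
    have "AE x in lborel. \<forall>i. good (X (Suc i) \<omega>) x" using elim unfolding AE_all_countable by blast
    then have est: "AE x in lborel. wavelet_density_estimator \<phi> \<psi> (j n) X n \<omega> x = (\<Sum>i<n. ker \<phi> (j n) (X (Suc i) \<omega>) x) / real n"
    proof eventually_elim
      case (elim x)
      have g: "good (X i \<omega>) x" if "i \<in> {1..n}" for i using elim[rule_format, of "i - 1"] that by simp
      show ?case unfolding J by (rule estimator_eq_kernel_mean) (use g in \<open>auto simp: good_def\<close>)
    qed
    have coeffm': "(\<lambda>x. \<Sum>\<^sub>\<infinity>k. empirical_coeff (dilate \<theta> l k) X n \<omega> * dilate \<theta> l k x) \<in> borel_measurable borel"
      if [measurable]: "\<theta> \<in> borel_measurable borel" for \<theta> l
    proof (rule borel_measurable_infsum)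
      show "(\<lambda>x. empirical_coeff (dilate \<theta> l k) X n \<omega> * dilate \<theta> l k x) \<in> borel_measurable borel" for k
        unfolding dilate_def by measurable
    qed
    have em: "(\<lambda>x. wavelet_density_estimator \<phi> \<psi> (j n) X n \<omega> x) \<in> borel_measurable borel"
      unfolding wavelet_density_estimator_def by (intro borel_measurable_add borel_measurable_sum coeffm' th)
    have "integrated_squared_error \<phi> \<psi> j X f n \<omega> = (\<integral>x. ((\<Sum>i<n. ker \<phi> (j n) (X (Suc i) \<omega>) x) / real n - f x)\<^sup>2 \<partial>lborel)"
      unfolding ise_int
    proof (rule integral_cong_AE)
      show "(\<lambda>x. (wavelet_density_estimator \<phi> \<psi> (j n) X n \<omega> x - f x)\<^sup>2) \<in> borel_measurable lborel"
        using em f_measurable by simp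
      show "(\<lambda>x. ((\<Sum>i<n. ker \<phi> (j n) (X (Suc i) \<omega>) x) / real n - f x)\<^sup>2) \<in> borel_measurable lborel"
        by (intro borel_measurable_power borel_measurable_diff borel_measurable_divide borel_measurable_sum ker_measurable_comp) auto
    qed (use est in eventually_elim, simp)
    then show ?case using squared_error_expansion[OF n, of "j n" "\<lambda>i. X (Suc i) \<omega>"] by (simp add: Z_def cst_def)
  qed
  note dk = deg_kernel_centered_ker[OF j]
  let ?U = "\<lambda>\<omega>. ustat (centered_ker (j n)) n (\<lambda>i. X (Suc i) \<omega>)"
  have Um: "?U \<in> borel_measurable M" by (rule S.ustat_measurable[OF dk])
  have dm: "(\<lambda>\<omega>. diag (j n) (X (Suc i) \<omega>)) \<in> borel_measurable M" for i
    by (rule measurable_compose[OF S.X_measurable diag_measurable])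
  have UI: "integrable M ?U"
    by (rule S.integrable_const_bound[where B="\<Sum>l<n. \<Sum>i<l. \<bar>2\<bar> * ((C0 + 4 * Q) * 2 powi (j n))"])
       (use wsum_bound[OF deg_kernelD(4)[OF dk], where a="\<lambda>_ _. 2"] Um in \<open>auto simp: ustat_wsum\<close>)
  have dI: "integrable M (\<lambda>\<omega>. diag (j n) (X (Suc i) \<omega>))" for i
    by (rule S.integrable_const_bound[where B="(C0 + 2 * Q) * 2 powi (j n)"]) (use diag_bound[OF j] dm in auto)
  have U0: "S.expectation ?U = 0"
    using S.ustat_orthogonal[OF dk le0[of n], where z="\<lambda>_. 1" and b=1] by (simp add: ustat_def)
  have "S.expectation (integrated_squared_error \<phi> \<psi> j X f n) = S.expectation Z"
    by (rule integral_cong_AE[OF isem _ ISE]) (unfold Z_def, intro borel_measurable_add borel_measurable_divide borel_measurable_sum Um dm borel_measurable_const)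
  also have "\<dots> = (\<Sum>i<n. \<integral>y. diag (j n) y \<partial>D) / (real n)\<^sup>2 + cst"
    unfolding Z_def using UI dI by (simp add: U0 S.expectation_X[OF diag_measurable] S.prob_space)
  finally have E: "S.expectation (integrated_squared_error \<phi> \<psi> j X f n) = (\<Sum>i<n. \<integral>y. diag (j n) y \<partial>D) / (real n)\<^sup>2 + cst" .
  show ?thesis
    using ISE
  proof eventually_elim
    case (elim \<omega>)
    show ?case unfolding centered_ISE_def elim E Z_def sum_subtractf by (simp add: add_divide_distrib diff_divide_distrib)
  qed
qed

end

text \<open>
  The two halves of the iterated logarithm law, with errors \<open>1 / (m + 1)\<close> and an additive null sequence, in terms of an
  extended real upper limit.
\<close>

lemma limsup_eq_1_of_ratio:
  fixes T U N r :: "nat \<Rightarrow> real"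
  assumes T: "\<forall>\<^sub>F n in sequentially. T n = U n / N n + r n" and N: "\<forall>\<^sub>F n in sequentially. 0 < N n"
    and r: "r \<longlonglongrightarrow> 0"
    and up: "\<And>m. \<forall>\<^sub>F n in sequentially. U n \<le> (1 + 1 / real (Suc m)) * N n"
    and lo: "\<And>m. \<exists>\<^sub>F n in sequentially. (1 - 1 / real (Suc m)) * N n \<le> U n"
  shows "limsup (\<lambda>n. ereal (T n)) = 1"
proof (rule antisym)
  have rs: "\<forall>\<^sub>F n in sequentially. \<bar>r n\<bar> < e" if "0 < e" for e
    using tendstoD[OF r that] by (simp add: dist_real_def)
  have pick: "\<exists>m. 1 / real (Suc m) < e" if "0 < e" for e :: real
    using reals_Archimedean[OF that] by (auto simp: inverse_eq_divide)
  show "limsup (\<lambda>n. ereal (T n)) \<le> 1"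
  proof (rule ereal_le_epsilon2)
    fix e :: real assume e: "0 < e"
    obtain m where m: "1 / real (Suc m) < e / 2" using pick[of "e / 2"] e by auto
    show "limsup (\<lambda>n. ereal (T n)) \<le> 1 + ereal e"
    proof (rule Limsup_bounded)
      have "\<forall>\<^sub>F n in sequentially. T n \<le> 1 + e"
        using T N rs[of "e / 2", OF half_gt_zero[OF e]] up[of m]
      proof eventually_elim
        case (elim n)
        have "U n / N n \<le> 1 + 1 / real (Suc m)" using elim by (simp only: pos_divide_le_eq)
        then show ?case using elim m by linarith
      qed
      then show "\<forall>\<^sub>F n in sequentially. ereal (T n) \<le> 1 + ereal e"
        by eventually_elim (simp add: one_ereal_def)
    qed
  qed
  show "1 \<le> limsup (\<lambda>n. ereal (T n))"
  proof (rule ccontr)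
    assume "\<not> 1 \<le> limsup (\<lambda>n. ereal (T n))"
    then have "limsup (\<lambda>n. ereal (T n)) < ereal 1" by (simp add: one_ereal_def not_le)
    then obtain t where t: "limsup (\<lambda>n. ereal (T n)) < ereal t" "ereal t < ereal 1" using ereal_dense2 by blast
    define e where "e = 1 - t"
    have e: "0 < e" using t by (simp add: e_def)
    obtain m where m: "1 / real (Suc m) < e / 2" using pick[of "e / 2"] e by auto
    have ev: "\<forall>\<^sub>F n in sequentially. \<not> (1 - 1 / real (Suc m)) * N n \<le> U n"
      using Limsup_lessD[OF t(1)] T N rs[of "e / 2", OF half_gt_zero[OF e]]
    proof eventually_elim
      case (elim n)
      have "U n / N n < 1 - 1 / real (Suc m)" using elim m unfolding e_def by simp
      then show ?case using elim(3) by (simp only: pos_divide_less_eq not_le)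
    qed
    then show False using lo[of m] by (simp add: frequently_def)
  qed
qed

section \<open>The law of the iterated logarithm for the squared error\<close>

text \<open>
  The total mass is one because the law of \<open>X\<close> is a probability measure, and a nonnegative function is recovered from its
  extended real version.
\<close>

lemma distributed_lborel_real:
  assumes "prob_space M" and X: "distributed M lborel X (\<lambda>x. ennreal (f x))" and f0: "\<And>x. 0 \<le> f x"
  shows "f \<in> borel_measurable borel" "integrable lborel f" "(\<integral>x. f x \<partial>lborel) = (1::real)"
    "distr M borel X = density lborel f"
proof -
  interpret prob_space M by fact
  have fm: "(\<lambda>x. ennreal (f x)) \<in> borel_measurable lborel" and Xm: "X \<in> measurable M lborel" and d: "distr M lborel X = density lborel (\<lambda>x. ennreal (f x))"
    using X by (auto simp: distributed_def)
  have "(\<lambda>x. enn2real (ennreal (f x))) \<in> borel_measurable borel" using fm by simp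
  then show m: "f \<in> borel_measurable borel" using f0 by simp
  have "distr M borel X = distr M lborel X" by (rule distr_cong) auto
  with d show "distr M borel X = density lborel f" by simp
  interpret P: prob_space "distr M lborel X" by (rule prob_space_distr[OF Xm])
  have "emeasure (density lborel (\<lambda>x. ennreal (f x))) UNIV = 1" using P.emeasure_space_1 unfolding d by simp
  then have nn: "(\<integral>\<^sup>+x. ennreal (f x) \<partial>lborel) = 1" using fm by (simp add: emeasure_density)
  show "integrable lborel f" by (rule integrableI_nonneg) (use m f0 nn in auto)
  show "(\<integral>x. f x \<partial>lborel) = 1" using integral_eq_nn_integral[of f lborel] m f0 nn by simp
qed

lemma same_order_growth:
  assumes o: "same_order (\<lambda>n. 2 powi (- j n)) (\<lambda>n. real n powr (- \<delta>))"
  obtains c C where "0 < c" "0 < C" "\<forall>\<^sub>F n in sequentially. c * real n powr \<delta> \<le> 2 powi j n \<and> 2 powi j n \<le> C * real n powr \<delta>"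
proof -
  let ?q = "\<lambda>n. (2::real) powi (- j n) / real n powr (- \<delta>)"
  have lo: "ereal 0 < liminf (\<lambda>n. ereal (?q n))" and up: "limsup (\<lambda>n. ereal (?q n)) < \<infinity>"
    using o by (auto simp: same_order_def zero_ereal_def)
  obtain a where a: "ereal 0 < ereal a" "ereal a < liminf (\<lambda>n. ereal (?q n))" using ereal_dense2[OF lo] by blast
  obtain b where b: "limsup (\<lambda>n. ereal (?q n)) < ereal b" using ereal_dense2[OF up] by blast
  have ev: "\<forall>\<^sub>F n in sequentially. 1 \<le> n \<and> a < ?q n \<and> ?q n < b"
    using less_LiminfD[OF a(2)] Limsup_lessD[OF b] eventually_ge_at_top[of "1::nat"] by eventually_elim simp
  have a0: "0 < a" using a by simp
  obtain n where "a < ?q n" "?q n < b" using eventually_happens'[OF _ ev] by auto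
  then have b0: "0 < b" using a0 by linarith
  have q: "?q n = real n powr \<delta> / 2 powi j n" if "1 \<le> n" for n
    using that by (simp add: power_int_minus powr_minus divide_simps)
  show ?thesis
  proof (rule that[of "1 / b" "1 / a"])
    show "\<forall>\<^sub>F n in sequentially. 1 / b * real n powr \<delta> \<le> 2 powi j n \<and> 2 powi j n \<le> 1 / a * real n powr \<delta>"
      using ev
    proof eventually_elim
      case (elim n)
      then have "a < real n powr \<delta> / 2 powi j n" "real n powr \<delta> / 2 powi j n < b" using q[of n] by auto
      then show ?case using a0 b0 by (simp add: pos_less_divide_eq pos_divide_less_eq pos_divide_le_eq pos_le_divide_eq mult.commute less_imp_le)
    qed
  qed (use a0 b0 in auto)
qed

lemma deg_kernel_sign:
  assumes "deg_kernel D A L H" "s = 1 \<or> s = -1" shows "deg_kernel D A L (\<lambda>x y. s * H x y)"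
  using assms unfolding deg_kernel_def by auto

theorem theorem1p1:
  fixes M :: "'a measure"
    and X :: "nat \<Rightarrow> 'a \<Rightarrow> real"
    and f \<phi> \<psi> :: "real \<Rightarrow> real"
    and j :: "nat \<Rightarrow> int"
    and \<delta> \<sigma> :: real
    and lam :: "nat \<Rightarrow> real"
  assumes "prob_space M"
    and "prob_space.indep_vars M (\<lambda>_. borel) X UNIV"
    and "\<And>x. 0 \<le> f x"
    and "\<And>i. distributed M lborel (X i) (\<lambda>x. ennreal (f x))"
    and "bounded (range f)"
    and "scaling_function_with_wavelet \<phi> \<psi>"
    and "bounded (range \<phi>)"
    and "compact (closure {x. \<phi> x \<noteq> 0})"
    and "total_variation \<phi> < \<infinity>"
    and "filterlim j at_top sequentially"
    and "0 < \<delta>" and "\<delta> < 1 / 3"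
    and "same_order (\<lambda>n. 2 powi (- j n)) (\<lambda>n. real n powr (- \<delta>))"
    and "mono_on {1..} lam"
    and "\<And>k. 1 \<le> k \<Longrightarrow> 0 < lam k"
    and "(\<lambda>k. lam (Suc k) / lam k) \<longlonglongrightarrow> 1"
    and "(\<lambda>k. ln (ln (lam k)) / ln (real k)) \<longlonglongrightarrow> 1"
    and "filterlim (\<lambda>k. lam (Suc k) - lam k) at_top sequentially"
    and "\<And>k. 1 \<le> k \<Longrightarrow>
           (\<lambda>n. (2::real) powi (- j n)) constant_on {n. lam k \<le> real n \<and> real n < lam (Suc k)}"
    and "\<sigma>\<^sup>2 = 2 * (\<integral>x. (f x)\<^sup>2 \<partial>lborel)"
    and "0 < \<sigma>"
  shows "\<forall>s\<in>{1, -1 :: real}. AE \<omega> in M.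
           limsup (\<lambda>n. ereal (s * (real n * 2 powr (- real_of_int (j n) / 2) /
             (\<sigma> * sqrt (2 * ln (ln (real n))))) * centered_ISE M \<phi> \<psi> j X f n \<omega>)) = 1"
proof
  fix s :: real assume s: "s \<in> {1, -1}"
  interpret prob_space M by (rule assms(1))
  have basis: "orthonormal_basis_of (wavelet_family \<phi> \<psi>) L2" using assms(6) by (simp add: scaling_function_with_wavelet_def)
  note dens = distributed_lborel_real[OF assms(1) assms(4) assms(3)]
  obtain F where F: "\<And>x. f x \<le> F" using assms(5) unfolding bounded_iff by (metis abs_le_D1 rangeI real_norm_def)
  obtain B where B: "\<And>x. \<bar>\<phi> x\<bar> \<le> B" using assms(7) unfolding bounded_iff by (metis rangeI real_norm_def)
  obtain R0 where R0: "\<And>x. x \<in> closure {x. \<phi> x \<noteq> 0} \<Longrightarrow> \<bar>x\<bar> \<le> R0"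
    using compact_imp_bounded[OF assms(8)] unfolding bounded_iff by (metis real_norm_def)
  define R where "R = max 1 R0"
  interpret DK: density_kernel \<phi> R B f F
  proof
    show "\<phi> \<in> L2" by (rule wavelet_measurable[OF basis])
    show "\<phi> x = 0" if "R < \<bar>x\<bar>" for x
    proof (rule ccontr)
      assume "\<phi> x \<noteq> 0"
      then have "\<bar>x\<bar> \<le> R0" by (intro R0 subsetD[OF closure_subset]) simp
      then show False using that by (simp add: R_def)
    qed
    show "L2_inner (dilate \<phi> 0 k) (dilate \<phi> 0 k') = (if k = k' then 1 else 0)" for k k'
    proof -
      have "L2_inner (wavelet_family \<phi> \<psi> (Inl k)) (wavelet_family \<phi> \<psi> (Inl k')) = (if Inl k = (Inl k' :: int + nat \<times> int) then 1 else 0)"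
        using basis unfolding orthonormal_basis_of_def by blast
      then show ?thesis by simp
    qed
  qed (use B F dens assms(3) in \<open>auto simp: R_def\<close>)
  interpret S0: iid_sample M X DK.D
    by unfold_locales (use assms(2) dens(4) in \<open>auto simp: DK.D_def\<close>)
  \<comment> \<open>The estimator averages over \<open>X 1, \<dots>, X n\<close>, whereas U-statistics number the observations from zero.\<close>
  have iid: "iid_sample M (\<lambda>i. X (Suc i)) DK.D" using S0.iid_sample_shift[of 1] by simp
  interpret S: iid_sample M "\<lambda>i. X (Suc i)" DK.D by (rule iid)
  define L :: "nat \<Rightarrow> real" where "L n = 2 powi j n" for n
  have L0: "0 < L n" for n by (simp add: L_def)
  \<comment> \<open>The lower limit is the upper limit for the negated kernel, which has the same size and variance.\<close>
  define H where "H n = (\<lambda>x y. s * DK.centered_ker (j n) x y)" for n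
  define A where "A = DK.C0 + 4 * DK.Q"
  have j0: "\<forall>\<^sub>F n in sequentially. 0 \<le> j n" using assms(10) by (simp add: filterlim_at_top)
  have k: "\<forall>\<^sub>F n in sequentially. deg_kernel DK.D A (L n) (H n)"
    using j0 by eventually_elim (use s in \<open>auto simp: H_def L_def A_def intro!: deg_kernel_sign DK.deg_kernel_centered_ker\<close>)
  obtain c C where c: "0 < c" and C: "0 < C"
    and growth: "\<forall>\<^sub>F n in sequentially. c * real n powr \<delta> \<le> L n \<and> L n \<le> C * real n powr \<delta>"
    unfolding L_def by (rule same_order_growth[OF assms(13)])
  have "(\<lambda>n. 2 * C * real n powr (\<delta> - 1)) \<longlonglongrightarrow> 0" using assms(12) by real_asymp
  then have small: "\<forall>\<^sub>F n in sequentially. 2 * C * real n powr (\<delta> - 1) < 1" by (rule order_tendstoD) simp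
  have Lg: "\<forall>\<^sub>F n in sequentially. c * real n powr \<delta> \<le> L n \<and> 2 * L n \<le> real n"
    using growth small eventually_gt_at_top[of "0::nat"]
  proof eventually_elim
    case (elim n)
    have "2 * C * real n powr \<delta> = 2 * C * real n powr (\<delta> - 1) * real n" using elim by (simp add: powr_diff)
    also have "\<dots> \<le> 1 * real n" using elim by (intro mult_right_mono) auto
    finally show ?case using elim by simp
  qed
  have var: "(\<lambda>n. kernel_var DK.D (H n) / L n) \<longlonglongrightarrow> \<sigma>\<^sup>2 / 2"
  proof -
    have "s\<^sup>2 = 1" using s by auto
    then have "kernel_var DK.D (H n) = kernel_var DK.D (DK.centered_ker (j n))" for n
      by (simp add: kernel_var_def H_def power_mult_distrib)
    then show ?thesis using DK.kernel_var_limit[OF assms(10)] by (simp add: L_def assms(20))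
  qed
  have blocks: "H n = H m \<and> L n = L m"
    if "1 \<le> k" "lam k \<le> real n" "real n < lam (Suc k)" "lam k \<le> real m" "real m < lam (Suc k)" for k n m
  proof -
    have "(2::real) powi (- j n) = 2 powi (- j m)" using assms(19)[OF that(1)] that unfolding constant_on_def by auto
    moreover have "(2::real) powr real_of_int i = 2 powi i" for i by (rule powr_real_of_int') auto
    ultimately have "(2::real) powr real_of_int (- j n) = 2 powr real_of_int (- j m)" by (simp only:)
    then have "j n = j m" by (simp add: powr_inj)
    then show ?thesis by (simp add: H_def L_def)
  qed
  let ?U = "\<lambda>n \<omega>. ustat (H n) n (\<lambda>i. X (Suc i) \<omega>)"
  define N where "N n = \<sigma> * real n * sqrt (L n) * sqrt (2 * ln (ln (real n)))" for n
  have "AE \<omega> in M. \<forall>\<^sub>F n in sequentially. ?U n \<omega> \<le> (1 + 1 / real (Suc m)) * N n" for m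
    unfolding N_def
    by (rule S.ustat_lil_upper[OF k Lg c assms(11) var assms(21,14,17,16,18) blocks]) auto
  then have up: "AE \<omega> in M. \<forall>m. \<forall>\<^sub>F n in sequentially. ?U n \<omega> \<le> (1 + 1 / real (Suc m)) * N n"
    unfolding AE_all_countable by blast
  have "AE \<omega> in M. \<exists>\<^sub>F n in sequentially. (1 - 1 / real (Suc m)) * N n \<le> ?U n \<omega>" for m
    unfolding N_def by (rule S.ustat_lil_lower[OF k Lg c assms(11) var assms(21)]) auto
  then have lo: "AE \<omega> in M. \<forall>m. \<exists>\<^sub>F n in sequentially. (1 - 1 / real (Suc m)) * N n \<le> ?U n \<omega>"
    unfolding AE_all_countable by blast
  define q where "q n y = DK.diag (j n) y - (\<integral>y. DK.diag (j n) y \<partial>DK.D)" for n y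
  define E where "E n \<omega> = (\<Sum>i<n. q n (X (Suc i) \<omega>))" for n \<omega>
  have neg: "AE \<omega> in M. (\<lambda>n. E n \<omega> / (real n * sqrt (L n))) \<longlonglongrightarrow> 0"
    unfolding E_def
  proof (rule S.diag_negligible[where A="2 * (DK.C0 + 2 * DK.Q)" and C=C and \<delta>=\<delta>])
    show "\<forall>\<^sub>F n in sequentially. q n \<in> borel_measurable borel \<and> (\<forall>y. \<bar>q n y\<bar> \<le> 2 * (DK.C0 + 2 * DK.Q) * L n)
        \<and> (\<integral>y. q n y \<partial>DK.D) = 0 \<and> 0 < L n \<and> L n \<le> C * real n powr \<delta>"
      using j0 growth
    proof eventually_elim
      case (elim n)
      note db = DK.diag_bound[OF elim(1), folded L_def]
      have I: "integrable DK.D (DK.diag (j n))"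
        by (rule DK.D.integrable_const_bound[where B="(DK.C0 + 2 * DK.Q) * L n"]) (use db DK.diag_measurable in auto)
      have "\<bar>\<integral>y. DK.diag (j n) y \<partial>DK.D\<bar> \<le> (\<integral>y. \<bar>DK.diag (j n) y\<bar> \<partial>DK.D)" by (rule integral_abs_bound)
      also have "\<dots> \<le> (\<integral>y. (DK.C0 + 2 * DK.Q) * L n \<partial>DK.D)"
        by (intro integral_mono integrable_abs I DK.D.integrable_const db)
      finally have mb: "\<bar>\<integral>y. DK.diag (j n) y \<partial>DK.D\<bar> \<le> (DK.C0 + 2 * DK.Q) * L n" by simp
      have "\<bar>q n y\<bar> \<le> 2 * (DK.C0 + 2 * DK.Q) * L n" for y
        unfolding q_def using db[of y] mb by linarith
      moreover have "q n \<in> borel_measurable borel" unfolding q_def[abs_def] using DK.diag_measurable by measurable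
      moreover have "(\<integral>y. q n y \<partial>DK.D) = 0" unfolding q_def using I by simp
      ultimately show ?case using elim L0 by blast
    qed
  qed (use assms(12) in simp)
  have "AE \<omega> in M. 1 \<le> n \<and> 0 \<le> j n \<longrightarrow> centered_ISE M \<phi> \<psi> j X f n \<omega>
      = (ustat (DK.centered_ker (j n)) n (\<lambda>i. X (Suc i) \<omega>) + E n \<omega>) / (real n)\<^sup>2" for n
    using DK.centered_ISE_eq[OF iid basis, of n j] unfolding E_def q_def by (cases "1 \<le> n \<and> 0 \<le> j n") auto
  then have repr: "AE \<omega> in M. \<forall>n. 1 \<le> n \<and> 0 \<le> j n \<longrightarrow> centered_ISE M \<phi> \<psi> j X f n \<omega>
      = (ustat (DK.centered_ker (j n)) n (\<lambda>i. X (Suc i) \<omega>) + E n \<omega>) / (real n)\<^sup>2"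
    unfolding AE_all_countable by blast
  have lnln: "\<forall>\<^sub>F n in sequentially. 0 < ln (ln (real n))" by real_asymp
  have Npos: "\<forall>\<^sub>F n in sequentially. 0 < N n"
    using lnln eventually_gt_at_top[of "0::nat"] by eventually_elim (use assms(21) L0 in \<open>simp add: N_def\<close>)
  \<comment> \<open>The diagonal term vanishes relative to \<open>n \<surd>L\<close>, and a fortiori after dividing by the iterated logarithm.\<close>
  have "(\<lambda>n. 1 / (\<sigma> * sqrt (2 * ln (ln (real n))))) \<longlonglongrightarrow> 0" using assms(21) by real_asymp
  note van = this
  from up lo neg repr show "AE \<omega> in M. limsup (\<lambda>n. ereal (s * (real n * 2 powr (- real_of_int (j n) / 2) /
             (\<sigma> * sqrt (2 * ln (ln (real n))))) * centered_ISE M \<phi> \<psi> j X f n \<omega>)) = 1"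
  proof eventually_elim
    case (elim \<omega>)
    show ?case
    proof (rule limsup_eq_1_of_ratio[where U="\<lambda>n. ?U n \<omega>" and N=N])
      let ?r = "\<lambda>n. s * (E n \<omega> / (real n * sqrt (L n)) * (1 / (\<sigma> * sqrt (2 * ln (ln (real n))))))"
      show "?r \<longlonglongrightarrow> 0" using tendsto_mult_left[OF tendsto_mult[OF elim(3) van], of s] by simp
      show "\<forall>\<^sub>F n in sequentially. s * (real n * 2 powr (- real_of_int (j n) / 2) /
             (\<sigma> * sqrt (2 * ln (ln (real n))))) * centered_ISE M \<phi> \<psi> j X f n \<omega> = ?U n \<omega> / N n + ?r n"
        using lnln j0 eventually_ge_at_top[of "1::nat"]
      proof eventually_elim
        case (elim n)
        have c: "centered_ISE M \<phi> \<psi> j X f n \<omega> = (ustat (DK.centered_ker (j n)) n (\<lambda>i. X (Suc i) \<omega>) + E n \<omega>) / (real n)\<^sup>2"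
          using \<open>\<forall>n. 1 \<le> n \<and> 0 \<le> j n \<longrightarrow> _ n\<close> elim by blast
        have u: "?U n \<omega> = s * ustat (DK.centered_ker (j n)) n (\<lambda>i. X (Suc i) \<omega>)"
          unfolding ustat_def H_def sum_distrib_left by (simp add: mult.left_commute)
        have p: "2 powr (- real_of_int (j n) / 2) = 1 / sqrt (L n)"
          by (simp add: L_def powr_real_of_int'[symmetric] powr_half_sqrt[symmetric] powr_powr powr_minus divide_simps)
        have alg: "s * (n * (1 / l) / (\<sigma> * t)) * ((u + e) / n\<^sup>2) = s * u / (\<sigma> * n * l * t) + s * (e / (n * l) * (1 / (\<sigma> * t)))"
          if "n \<noteq> 0" "l \<noteq> 0" "t \<noteq> 0" for n l t u e :: real
          using that assms(21) by (simp add: field_simps power2_eq_square)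
        show ?case unfolding c u p N_def
          by (rule alg) (use elim L0[of n] in auto)
      qed
    qed (use elim Npos in auto)
  qed
qed

end
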